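(* Let $\{X_j\}$ be a fourth-order stationary sequence with $\mu=EX_j$, autocovariances $\gamma_j=\mathrm{Cov}(X_0,X_j)$ and fourth-order cumulants $\kappa(h,r,s)$, such that for some $\frac12<H<1$: (a) $n^{-H}\sum_{1\le j\le nt}(X_j-\mu)\xrightarrow{d}c_HW_H(t)$ in $D[0,1]$ for some $c_H>0$; (b) $\gamma_j\sim c_0j^{2H-2}$ as $j\to\infty$ for some $c_0>0$; (c) $\sup_h\sum_{-n\le r,s\le n}|\kappa(h,r,s)|=O(n^{2H-1})$. Suppose $q(n)$ is nondecreasing, $\sup_{k\ge0}q(2^{k+1})/q(2^k)<\infty$, $q(n)\to\infty$ and $q(n)=O(n(\log n)^{-7/(4-4H)})$. Then the random vectors $$\Big[\Big(\frac{q(\hat k)}n\Big)^{H-1/2}T_{n,1},\ \Big(\frac{q(n-\hat k)}n\Big)^{H-1/2}T_{n,2}\Big]$$ converge in distribution to $$\Big[\frac1{\sqrt\xi}\sup_{0\le t\le\xi}\Big|W_H(t)-\frac t\xi W_H(\xi)\Big|,\ \frac1{\sqrt{1-\xi}}\sup_{\xi\le t\le1}\Big|(W_H(t)-W_H(\xi))-\frac{t-\xi}{1-\xi}(W_H(1)-W_H(\xi))\Big|\Big],$$ where $\xi=\inf\{t\ge0:|B_H(t)|=\sup_{0\le s\le1}|B_H(s)|\}$ and $B_H(t)=W_H(t)-tW_H(1)$.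
   Context: $W_H$ denotes fractional Brownian motion: a mean-zero Gaussian process with $E[W_H(t)W_H(s)]=(t^{2H}+s^{2H}-|t-s|^{2H})/2$. A sequence is fourth-order stationary if it has finite fourth moments and its joint moments of order at most four are shift invariant; its fourth-order cumulant is $\kappa(h,r,s)=E[\tilde X_k\tilde X_{k+h}\tilde X_{k+r}\tilde X_{k+s}]-(\gamma_h\gamma_{r-s}+\gamma_r\gamma_{h-s}+\gamma_s\gamma_{h-r})$ with $\tilde X_k=X_k-\mu$. $a_j\sim b_j$ means $a_j/b_j\to1$. $q(n)$ is a sequence of positive integers, $\omega_j(q)=1-j/(q+1)$. $\hat k=\min\{k:\max_{1\le i\le n}|\sum_{j\le i}X_j-\frac in\sum_{j\le n}X_j|=|\sum_{j\le k}X_j-\frac kn\sum_{j\le n}X_j|\}$. With $\bar X_k=\frac1k\sum_{i\le k}X_i$, $\tilde X^{(n)}_k=\frac1{n-k}\sum_{k<i\le n}X_i$: $s_{n,1}^2=\frac1{\hat k}\sum_{1\le i\le\hat k}(X_i-\bar X_{\hat k})^2+2\sum_{1\le j\le q(\hat k)}\omega_j(q(\hat k))\frac1{\hat k}\sum_{1\le i\le\hat k-j}(X_i-\bar X_{\hat k})(X_{i+j}-\bar X_{\hat k})$, $s_{n,2}^2=\frac1{n-\hat k}\sum_{\hat k<i\le n}(X_i-\tilde X^{(n)}_{\hat k})^2+2\sum_{1\le j\le q(n-\hat k)}\omega_j(q(n-\hat k))\frac1{n-\hat k}\sum_{\hat k<i\le n-j}(X_i-\tilde X^{(n)}_{\hat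 k})(X_{i+j}-\tilde X^{(n)}_{\hat k})$, $T_{n,1}=\frac1{s_{n,1}}\hat k^{-1/2}\max_{1\le k\le\hat k}|\sum_{i\le k}X_i-\frac k{\hat k}\sum_{i\le\hat k}X_i|$, $T_{n,2}=\frac1{s_{n,2}}(n-\hat k)^{-1/2}\max_{\hat k<k\le n}|\sum_{\hat k<i\le k}X_i-\frac{k-\hat k}{n-\hat k}\sum_{\hat k<i\le n}X_i|$. *)

theory Defs
  imports "HOL-Probability.Probability"
begin

text \<open>Paths are real functions; only their values on [0,1] matter.\<close>

definition cadlag01 :: "(real \<Rightarrow> real) \<Rightarrow> bool" where
  "cadlag01 x \<longleftrightarrow>
     (\<forall>t\<in>{0..<1}. (x \<longlongrightarrow> x t) (at_right t)) \<and>
     (\<forall>t\<in>{0<..1}. \<exists>l. (x \<longlongrightarrow> l) (at_left t))"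

definition time_changes :: "(real \<Rightarrow> real) set" where
  "time_changes = {l. strict_mono_on {0..1} l \<and> bij_betw l {0..1} {0..1}}"

definition skorokhod_dist :: "(real \<Rightarrow> real) \<Rightarrow> (real \<Rightarrow> real) \<Rightarrow> real" where
  "skorokhod_dist x y = Inf {e. 0 < e \<and> (\<exists>l\<in>time_changes.
       (\<forall>t\<in>{0..1}. \<bar>l t - t\<bar> \<le> e) \<and> (\<forall>t\<in>{0..1}. \<bar>x t - y (l t)\<bar> \<le> e))}"

definition bdd_sk_continuous :: "((real \<Rightarrow> real) \<Rightarrow> real) \<Rightarrow> bool" where
  "bdd_sk_continuous f \<longleftrightarrow>
     (\<exists>B. \<forall>x. cadlag01 x \<longrightarrow> \<bar>f x\<bar> \<le> B) \<and>
     (\<forall>x. cadlag01 x \<longrightarrow> (\<forall>e>0. \<exists>d>0. \<forall>y. cadlag01 y \<longrightarrow>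
         skorokhod_dist x y < d \<longrightarrow> \<bar>f y - f x\<bar> < e))"

definition conv_distr_D ::
  "'a measure \<Rightarrow> (nat \<Rightarrow> 'a \<Rightarrow> real \<Rightarrow> real) \<Rightarrow> 'b measure \<Rightarrow> ('b \<Rightarrow> real \<Rightarrow> real) \<Rightarrow> bool" where
  "conv_distr_D M Y N Z \<longleftrightarrow>
     (\<forall>f. bdd_sk_continuous f \<longrightarrow>
        (\<lambda>n. \<integral>\<omega>. f (Y n \<omega>) \<partial>M) \<longlonglongrightarrow> (\<integral>\<omega>. f (Z \<omega>) \<partial>N))"

definition conv_distr_R2 ::
  "'a measure \<Rightarrow> (nat \<Rightarrow> 'a \<Rightarrow> real \<times> real) \<Rightarrow> 'b measure \<Rightarrow> ('b \<Rightarrow> real \<times> real) \<Rightarrow> bool" where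
  "conv_distr_R2 M V N U \<longleftrightarrow>
     (\<forall>g :: real \<times> real \<Rightarrow> real. continuous_on UNIV g \<and> bounded (range g) \<longrightarrow>
        (\<lambda>n. \<integral>\<omega>. g (V n \<omega>) \<partial>M) \<longlonglongrightarrow> (\<integral>\<omega>. g (U \<omega>) \<partial>N))"

definition centered_normal_rv :: "'b measure \<Rightarrow> ('b \<Rightarrow> real) \<Rightarrow> bool" where
  "centered_normal_rv N Y \<longleftrightarrow> Y \<in> borel_measurable N \<and>
     ((AE \<omega> in N. Y \<omega> = 0) \<or> (\<exists>\<sigma>>0. distributed N lborel Y (normal_density 0 \<sigma>)))"

definition fBm :: "'b measure \<Rightarrow> real \<Rightarrow> (real \<Rightarrow> 'b \<Rightarrow> real) \<Rightarrow> bool" where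
  "fBm N H W \<longleftrightarrow> prob_space N \<and>
     (\<forall>t\<ge>0. W t \<in> borel_measurable N) \<and>
     (\<forall>(ts :: real list) (as :: real list). length as = length ts \<longrightarrow> (\<forall>t\<in>set ts. 0 \<le> t) \<longrightarrow>
        centered_normal_rv N (\<lambda>\<omega>. \<Sum>i<length ts. as ! i * W (ts ! i) \<omega>)) \<and>
     (\<forall>t s. 0 \<le> t \<longrightarrow> 0 \<le> s \<longrightarrow>
        (\<integral>\<omega>. W t \<omega> * W s \<omega> \<partial>N) = (t powr (2*H) + s powr (2*H) - \<bar>t - s\<bar> powr (2*H)) / 2) \<and>
     (\<forall>\<omega>\<in>space N. continuous_on {0..} (\<lambda>t. W t \<omega>))"

definition fourth_order_stationary :: "'a measure \<Rightarrow> (int \<Rightarrow> 'a \<Rightarrow> real) \<Rightarrow> bool" where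
  "fourth_order_stationary M X \<longleftrightarrow>
     (\<forall>k. X k \<in> borel_measurable M \<and> integrable M (\<lambda>\<omega>. X k \<omega> ^ 4)) \<and>
     (\<forall>(idx :: int list) m. length idx \<le> 4 \<longrightarrow>
        (\<integral>\<omega>. prod_list (map (\<lambda>i. X i \<omega>) idx) \<partial>M) =
        (\<integral>\<omega>. prod_list (map (\<lambda>i. X (i + m) \<omega>) idx) \<partial>M))"

definition mean_seq :: "'a measure \<Rightarrow> (int \<Rightarrow> 'a \<Rightarrow> real) \<Rightarrow> real" where
  "mean_seq M X = (\<integral>\<omega>. X 0 \<omega> \<partial>M)"

definition autocov :: "'a measure \<Rightarrow> (int \<Rightarrow> 'a \<Rightarrow> real) \<Rightarrow> int \<Rightarrow> real" where
  "autocov M X j = (\<integral>\<omega>. (X 0 \<omega> - mean_seq M X) * (X j \<omega> - mean_seq M X) \<partial>M)"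

text \<open>Fourth-order cumulant (with k = 0; independent of k by stationarity).\<close>
definition cum4 :: "'a measure \<Rightarrow> (int \<Rightarrow> 'a \<Rightarrow> real) \<Rightarrow> int \<Rightarrow> int \<Rightarrow> int \<Rightarrow> real" where
  "cum4 M X h r s =
     (\<integral>\<omega>. (X 0 \<omega> - mean_seq M X) * (X h \<omega> - mean_seq M X) *
           (X r \<omega> - mean_seq M X) * (X s \<omega> - mean_seq M X) \<partial>M)
     - (autocov M X h * autocov M X (r - s) + autocov M X r * autocov M X (h - s)
        + autocov M X s * autocov M X (h - r))"

definition psum :: "(int \<Rightarrow> 'a \<Rightarrow> real) \<Rightarrow> 'a \<Rightarrow> nat \<Rightarrow> nat \<Rightarrow> real" where
  "psum X \<omega> a b = (\<Sum>i\<in>{a<..b}. X (int i) \<omega>)"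

definition khat :: "(int \<Rightarrow> 'a \<Rightarrow> real) \<Rightarrow> nat \<Rightarrow> 'a \<Rightarrow> nat" where
  "khat X n \<omega> = (LEAST k. 1 \<le> k \<and> k \<le> n \<and>
      \<bar>psum X \<omega> 0 k - real k / real n * psum X \<omega> 0 n\<bar> =
      Max ((\<lambda>i. \<bar>psum X \<omega> 0 i - real i / real n * psum X \<omega> 0 n\<bar>) ` {1..n}))"

definition bartlett :: "nat \<Rightarrow> nat \<Rightarrow> real" where
  "bartlett q j = 1 - real j / (real q + 1)"

definition lrv_est :: "(int \<Rightarrow> 'a \<Rightarrow> real) \<Rightarrow> (nat \<Rightarrow> nat) \<Rightarrow> nat \<Rightarrow> nat \<Rightarrow> 'a \<Rightarrow> real" where
  "lrv_est X q a b \<omega> =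
     (let L = b - a; m = psum X \<omega> a b / real L in
       (1 / real L) * (\<Sum>i\<in>{a<..b}. (X (int i) \<omega> - m)\<^sup>2)
       + 2 * (\<Sum>j\<in>{1..q L}. bartlett (q L) j * (1 / real L) *
            (\<Sum>i\<in>{a<..b - j}. (X (int i) \<omega> - m) * (X (int (i + j)) \<omega> - m))))"

definition cusum_T :: "(int \<Rightarrow> 'a \<Rightarrow> real) \<Rightarrow> (nat \<Rightarrow> nat) \<Rightarrow> nat \<Rightarrow> nat \<Rightarrow> 'a \<Rightarrow> real" where
  "cusum_T X q a b \<omega> =
     1 / sqrt (lrv_est X q a b \<omega>) * (1 / sqrt (real (b - a))) *
     Max ((\<lambda>k. \<bar>psum X \<omega> a k - real (k - a) / real (b - a) * psum X \<omega> a b\<bar>) ` {a<..b})"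

definition stat_vec :: "(int \<Rightarrow> 'a \<Rightarrow> real) \<Rightarrow> (nat \<Rightarrow> nat) \<Rightarrow> real \<Rightarrow> nat \<Rightarrow> 'a \<Rightarrow> real \<times> real" where
  "stat_vec X q H n \<omega> =
     (let k = khat X n \<omega> in
       ((real (q k) / real n) powr (H - 1/2) * cusum_T X q 0 k \<omega>,
        (real (q (n - k)) / real n) powr (H - 1/2) * cusum_T X q k n \<omega>))"

definition xi_arg :: "(real \<Rightarrow> 'b \<Rightarrow> real) \<Rightarrow> 'b \<Rightarrow> real" where
  "xi_arg W \<omega> = Inf {t. 0 \<le> t \<and> \<bar>W t \<omega> - t * W 1 \<omega>\<bar> =
       Sup ((\<lambda>s. \<bar>W s \<omega> - s * W 1 \<omega>\<bar>) ` {0..1})}"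

definition limit_vec :: "(real \<Rightarrow> 'b \<Rightarrow> real) \<Rightarrow> 'b \<Rightarrow> real \<times> real" where
  "limit_vec W \<omega> =
     (let \<xi> = xi_arg W \<omega> in
       (1 / sqrt \<xi> * Sup ((\<lambda>t. \<bar>W t \<omega> - t / \<xi> * W \<xi> \<omega>\<bar>) ` {0..\<xi>}),
        1 / sqrt (1 - \<xi>) * Sup ((\<lambda>t. \<bar>(W t \<omega> - W \<xi> \<omega>) - (t - \<xi>) / (1 - \<xi>) * (W 1 \<omega> - W \<xi> \<omega>)\<bar>)
                                 ` {\<xi>..1})))"

end

theory Submission
  imports Defs
begin

text \<open>
  The Bartlett estimator of a segment is a normalised sum of squares of sums over windows of length
  \<open>q + 1\<close>. Hence the triangle inequality in \<open>l\<^sup>2\<close>, monotonicity in the endpoints of the segment,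
  and fourth-moment bounds drawn from the cumulant condition show that \<open>s\<^sup>2 / (q + 1)\<^sup>2\<^sup>H\<^sup>-\<^sup>1\<close>
  converges to the square of \<open>c\<^sub>H\<close> in probability, uniformly over all segments of length at least
  \<open>\<delta> n\<close>; the constant is the limiting variance of the normalised partial sums, by uniform
  integrability. The remaining factors are functionals of the partial-sum path that are continuous
  at almost every path of \<open>W\<close>, because the modulus of the fractional bridge has almost surely
  exactly one maximiser. Continuity is exploited through Lipschitz envelopes with respect to the
  Skorokhod distance.

  The maximiser is unique because, for suitable \<open>T \<ge> 1\<close>, the bridge splits into an independent
  part and a deterministic function times \<open>W T\<close>; conditionally on the former, the maxima over two
  disjoint intervals coincide for at most countably many values of \<open>W T\<close>.
\<close>

section \<open>Continuous mapping in the Skorokhod space\<close>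

text \<open>The break is random and depends on the whole sample, so bounds for a fixed segment are
  not enough: the variance estimator has to be controlled for all long segments at once. The window
  length varies with the segment as well. The doubling condition keeps it comparable with
  \<open>q n + 1\<close>, so it can be rounded to one of finitely many lengths whose number is fixed
  before \<open>n\<close> grows. For one length the sums of squares increase with the endpoint while
  their limit is linear, so finitely many endpoints suffice too.

  Convergence in the path space is given only through integrals of bounded continuous functionals,
  with no sigma-algebra on paths. Lipschitz envelopes supply such functionals, and their Lipschitz
  bound also makes them measurable along both processes.

  For the maximiser a single \<open>T\<close> would not do: the covariance of the bridge with
  \<open>W 1\<close> is antisymmetric about 1/2, hence blind to ties of opposite sign at
  \<open>t\<close> and \<open>1 - t\<close>. Letting \<open>T\<close> vary separates all pairs of
  points.\<close>

definition sk_close :: "real \<Rightarrow> (real \<Rightarrow> real) \<Rightarrow> (real \<Rightarrow> real) \<Rightarrow> bool" where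
  "sk_close e x y \<longleftrightarrow> (\<exists>l\<in>time_changes. (\<forall>t\<in>{0..1}. \<bar>l t - t\<bar> \<le> e) \<and> (\<forall>t\<in>{0..1}. \<bar>x t - y (l t)\<bar> \<le> e))"

lemma sk_close_uniform:
  assumes "0 \<le> e" "\<And>t. t \<in> {0..1} \<Longrightarrow> \<bar>x t - y t\<bar> \<le> e"
  shows "sk_close e x y"
proof -
  have "(\<lambda>t. t) \<in> time_changes"
    by (auto simp: time_changes_def bij_betw_def strict_mono_on_def)
  then show ?thesis unfolding sk_close_def using assms by (intro bexI[of _ "\<lambda>t. t"]) auto
qed

lemma sk_close_trans:
  assumes "sk_close d x y" "sk_close e y z"
  shows "sk_close (d + e) x z"
proof -
  obtain l where l: "l \<in> time_changes" "\<And>t. t\<in>{0..1} \<Longrightarrow> \<bar>l t - t\<bar> \<le> d"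
     "\<And>t. t\<in>{0..1} \<Longrightarrow> \<bar>x t - y (l t)\<bar> \<le> d"
    using assms(1) unfolding sk_close_def by blast
  obtain k where k: "k \<in> time_changes" "\<And>t. t\<in>{0..1} \<Longrightarrow> \<bar>k t - t\<bar> \<le> e"
     "\<And>t. t\<in>{0..1} \<Longrightarrow> \<bar>y t - z (k t)\<bar> \<le> e"
    using assms(2) unfolding sk_close_def by blast
  have l01: "l t \<in> {0..1}" if "t \<in> {0..1}" for t
    using l(1) that unfolding time_changes_def bij_betw_def by blast
  have "bij_betw (k \<circ> l) {0..1} {0..1}"
    using l(1) k(1) unfolding time_changes_def by (auto intro: bij_betw_trans)
  moreover have "strict_mono_on {0..1} (k \<circ> l)"
    using l(1) k(1) l01 unfolding time_changes_def strict_mono_on_def by auto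
  ultimately have "k \<circ> l \<in> time_changes" unfolding time_changes_def by simp
  moreover have "\<bar>(k \<circ> l) t - t\<bar> \<le> d + e" "\<bar>x t - z ((k \<circ> l) t)\<bar> \<le> d + e" if "t \<in> {0..1}" for t
    using l(2,3)[OF that] k(2,3)[OF l01[OF that]] by auto
  ultimately show ?thesis unfolding sk_close_def by blast
qed

lemma sk_close_sym:
  assumes "sk_close e x y"
  shows "sk_close e y x"
proof -
  obtain l where l: "l \<in> time_changes" "\<And>t. t\<in>{0..1} \<Longrightarrow> \<bar>l t - t\<bar> \<le> e"
     "\<And>t. t\<in>{0..1} \<Longrightarrow> \<bar>x t - y (l t)\<bar> \<le> e"
    using assms(1) unfolding sk_close_def by blast
  define k where "k = inv_into {0..1} l"
  have bl: "bij_betw l {0..1} {0..1}" and ml: "strict_mono_on {0..1} l"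
    using l(1) by (auto simp: time_changes_def)
  have bk: "bij_betw k {0..1} {0..1}" unfolding k_def using bl by (rule bij_betw_inv_into)
  have k01: "k t \<in> {0..1}" if "t \<in> {0..1}" for t
    using bk that unfolding bij_betw_def by blast
  have lk: "l (k t) = t" if "t \<in> {0..1}" for t
    unfolding k_def using bl that by (simp add: bij_betw_inv_into_right)
  have "strict_mono_on {0..1} k"
  proof (rule strict_mono_onI)
    fix r s :: real assume rs: "r \<in> {0..1}" "s \<in> {0..1}" "r < s"
    have "\<not> k s \<le> k r"
      using strict_mono_on_leD[OF ml k01[OF rs(2)] k01[OF rs(1)]] lk rs by auto
    then show "k r < k s" by simp
  qed
  then have "k \<in> time_changes" using bk by (simp add: time_changes_def)
  moreover have "\<bar>k t - t\<bar> \<le> e" "\<bar>y t - x (k t)\<bar> \<le> e" if "t \<in> {0..1}" for t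
    using l(2,3)[OF k01[OF that]] lk[OF that] by auto
  ultimately show ?thesis unfolding sk_close_def by blast
qed

text \<open>Near a continuous path the Skorokhod and the uniform topology agree: uniform continuity
  absorbs the time change. Hence later limits need checking only under uniform perturbations of the
  path.\<close>

lemma sk_close_continuous:
  assumes x: "continuous_on {0..1} x" and "0 < (\<epsilon>::real)"
  obtains d where "0 < d" "\<And>e y t. sk_close e x y \<Longrightarrow> e < d \<Longrightarrow> t \<in> {0..1} \<Longrightarrow> \<bar>y t - x t\<bar> < \<epsilon>"
proof -
  have "uniformly_continuous_on {0..1} x" using x by (simp add: compact_uniformly_continuous)
  then obtain d where d: "d > 0" "\<And>s t. s\<in>{0..1} \<Longrightarrow> t\<in>{0..1} \<Longrightarrow> \<bar>s - t\<bar> < d \<Longrightarrow> \<bar>x s - x t\<bar> < \<epsilon>/2"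
    unfolding uniformly_continuous_on_def dist_real_def using \<open>0 < \<epsilon>\<close> by (metis half_gt_zero)
  show ?thesis
  proof (rule that[of "min d (\<epsilon>/2)"])
    show "0 < min d (\<epsilon>/2)" using d assms by auto
  next
    fix e y t assume "sk_close e x y" and e: "e < min d (\<epsilon>/2)" and t: "t \<in> {0..1::real}"
    then obtain k where k: "k \<in> time_changes" "\<bar>k t - t\<bar> \<le> e" "\<bar>y t - x (k t)\<bar> \<le> e"
      using sk_close_sym unfolding sk_close_def by blast
    have "k t \<in> {0..1}" using k(1) t unfolding time_changes_def bij_betw_def by blast
    then have "\<bar>x (k t) - x t\<bar> < \<epsilon>/2" using d(2) t k(2) e by auto
    moreover have "e < \<epsilon>/2" using e by simp
    ultimately show "\<bar>y t - x t\<bar> < \<epsilon>" using k by linarith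
  qed
qed

text \<open>One-sided limits bound the path on a neighbourhood of each point, and compactness of the
  interval leaves finitely many neighbourhoods. Boundedness is what makes the infimum in
  \<open>skorokhod_dist\<close> range over a nonempty set.\<close>

lemma cadlag01_bounded:
  assumes "cadlag01 x"
  obtains B where "\<And>t. t \<in> {0..1} \<Longrightarrow> \<bar>x t\<bar> \<le> B"
proof -
  have loc: "\<exists>U B. open U \<and> t \<in> U \<and> (\<forall>s\<in>U \<inter> {0..1}. \<bar>x s\<bar> \<le> B)" if t: "t \<in> {0..1}" for t
  proof -
    have "\<exists>b B. t < b \<and> (\<forall>s\<in>{t<..<b} \<inter> {0..1}. \<bar>x s\<bar> \<le> B)"
    proof (cases "t < 1")
      case True
      then have "(x \<longlongrightarrow> x t) (at_right t)" using assms t unfolding cadlag01_def by auto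
      then have "eventually (\<lambda>s. dist (x s) (x t) < 1) (at_right t)" by (rule tendstoD) simp
      then obtain b where "b > t" "\<And>s. s > t \<Longrightarrow> s < b \<Longrightarrow> dist (x s) (x t) < 1"
        unfolding eventually_at_right_field by blast
      then show ?thesis by (intro exI[of _ b] exI[of _ "\<bar>x t\<bar> + 1"]) (force simp: dist_real_def)
    next
      case False then show ?thesis by (intro exI[of _ "t+1"]) auto
    qed
    then obtain b B1 where b: "t < b" "\<And>s. s\<in>{t<..<b} \<inter> {0..1} \<Longrightarrow> \<bar>x s\<bar> \<le> B1" by blast
    have "\<exists>a B. a < t \<and> (\<forall>s\<in>{a<..<t} \<inter> {0..1}. \<bar>x s\<bar> \<le> B)"
    proof (cases "0 < t")
      case True
      then obtain l where "(x \<longlongrightarrow> l) (at_left t)"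
        using assms t unfolding cadlag01_def by (metis atLeastAtMost_iff greaterThanAtMost_iff)
      then have "eventually (\<lambda>s. dist (x s) l < 1) (at_left t)" by (rule tendstoD) simp
      then obtain b where "b < t" "\<And>s. s > b \<Longrightarrow> s < t \<Longrightarrow> dist (x s) l < 1"
        unfolding eventually_at_left_field by blast
      then show ?thesis by (intro exI[of _ b] exI[of _ "\<bar>l\<bar> + 1"]) (force simp: dist_real_def)
    next
      case False then show ?thesis by (intro exI[of _ "t-1"]) auto
    qed
    then obtain a B2 where a: "a < t" "\<And>s. s\<in>{a<..<t} \<inter> {0..1} \<Longrightarrow> \<bar>x s\<bar> \<le> B2" by blast
    show ?thesis
    proof (intro exI[of _ "{a<..<b}"] exI[of _ "max \<bar>x t\<bar> (max B1 B2)"] conjI ballI)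
      fix s assume s: "s \<in> {a<..<b} \<inter> {0..1}"
      show "\<bar>x s\<bar> \<le> max \<bar>x t\<bar> (max B1 B2)"
        using a(2)[of s] b(2)[of s] s by (cases s t rule: linorder_cases) auto
    qed (use a b in auto)
  qed
  then obtain U B where UB: "\<And>t. t \<in> {0..1} \<Longrightarrow> open (U t)" "\<And>t. t \<in> {0..1} \<Longrightarrow> t \<in> U t"
    "\<And>t s. t \<in> {0..1} \<Longrightarrow> s \<in> U t \<inter> {0..1} \<Longrightarrow> \<bar>x s\<bar> \<le> B t"
    by metis
  obtain F where F: "F \<subseteq> {0..1}" "finite F" "{0..1} \<subseteq> (\<Union>t\<in>F. U t)"
    using compactE_image[of "{0..1::real}" "{0..1}" U] UB by (metis UN_I compact_Icc subsetI)
  show ?thesis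
  proof (rule that)
    fix s :: real assume s: "s \<in> {0..1}"
    then obtain t where "t \<in> F" "s \<in> U t" using F by blast
    then have "\<bar>x s\<bar> \<le> B t" using UB(3) F s by blast
    also have "\<dots> \<le> Max (B ` F)" using F \<open>t \<in> F\<close> by simp
    finally show "\<bar>x s\<bar> \<le> Max (B ` F)" .
  qed
qed

text \<open>Passes from the infimum to an actual time change. An infimum over the empty set would
  carry no information, so the bounds on both paths first provide some admissible, possibly large,
  \<open>e\<close>.\<close>

lemma skorokhod_dist_sk_close:
  assumes "cadlag01 x" "cadlag01 y" "skorokhod_dist x y < d"
  obtains e where "0 \<le> e" "e < d" "sk_close e x y"
proof -
  obtain B where B: "\<And>t. t \<in> {0..1} \<Longrightarrow> \<bar>x t\<bar> \<le> B" using cadlag01_bounded assms by blast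
  obtain C where C: "\<And>t. t \<in> {0..1} \<Longrightarrow> \<bar>y t\<bar> \<le> C" using cadlag01_bounded assms by blast
  let ?S = "{e. 0 < e \<and> sk_close e x y}"
  have eq: "skorokhod_dist x y = Inf ?S" unfolding skorokhod_dist_def sk_close_def by simp
  have "sk_close (\<bar>B\<bar> + \<bar>C\<bar> + 1) x y"
  proof (rule sk_close_uniform)
    fix t :: real assume "t \<in> {0..1}"
    with B[of t] C[of t] show "\<bar>x t - y t\<bar> \<le> \<bar>B\<bar> + \<bar>C\<bar> + 1" by auto
  qed auto
  then have "?S \<noteq> {}" by (auto intro!: exI[of _ "\<bar>B\<bar> + \<bar>C\<bar> + 1"])
  then have "\<exists>e\<in>?S. e < d" using assms(3) eq by (metis cInf_lessD)
  then show ?thesis using that by (metis (mono_tags, lifting) less_imp_le mem_Collect_eq)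
qed

text \<open>The sup-convolution (Pasch-Hausdorff envelope) of \<open>g\<close>: a Lipschitz majorant
  with constant \<open>k\<close>. The penalty is put on an admissible \<open>e\<close> and
  \<open>y\<close> ranges over all functions, so the infimum in \<open>skorokhod_dist\<close> and
  the cadlag property stay out of the calculations.\<close>

definition lip_env :: "real \<Rightarrow> ((real \<Rightarrow> real) \<Rightarrow> real) \<Rightarrow> (real \<Rightarrow> real) \<Rightarrow> real" where
  "lip_env k g x = Sup {g y - k * e | y e. 0 \<le> e \<and> sk_close e x y}"

context
  fixes k B :: real and g :: "(real \<Rightarrow> real) \<Rightarrow> real"
  assumes k: "0 \<le> k" and g: "\<And>y. \<bar>g y\<bar> \<le> B"
begin

lemma lip_env_bdd: "bdd_above {g y - k * e | y e. 0 \<le> e \<and> sk_close e x y}"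
proof (rule bdd_aboveI[of _ B], clarify)
  fix y and e :: real assume "0 \<le> e"
  then have "0 \<le> k * e" using k by simp
  then show "g y - k * e \<le> B" using g[of y] by linarith
qed

lemma lip_env_upper: "0 \<le> e \<Longrightarrow> sk_close e x y \<Longrightarrow> g y - k * e \<le> lip_env k g x"
  unfolding lip_env_def by (rule cSup_upper[OF _ lip_env_bdd]) blast

lemma lip_env_ge: "g x \<le> lip_env k g x"
  using lip_env_upper[of 0 x x] sk_close_uniform[of 0 x x] by simp

lemma lip_env_least:
  assumes "\<And>y e. 0 \<le> e \<Longrightarrow> sk_close e x y \<Longrightarrow> g y - k * e \<le> c"
  shows "lip_env k g x \<le> c"
  unfolding lip_env_def
proof (rule cSup_least)
  have "sk_close 0 x x" by (rule sk_close_uniform) auto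
  then show "{g y - k * e | y e. 0 \<le> e \<and> sk_close e x y} \<noteq> {}" by blast
qed (use assms in blast)

lemma lip_env_abs: "\<bar>lip_env k g x\<bar> \<le> B"
proof -
  have "lip_env k g x \<le> B"
  proof (rule lip_env_least)
    fix y e assume "0 \<le> (e::real)"
    then have "0 \<le> k * e" using k by simp
    then show "g y - k * e \<le> B" using g[of y] by linarith
  qed
  then show ?thesis using lip_env_ge[of x] g[of x] by linarith
qed

text \<open>A competitor for \<open>y\<close> at cost \<open>d\<close> is by the triangle inequality
  a competitor for \<open>x\<close> at cost \<open>e + d\<close>; symmetry of
  \<open>sk_close\<close> gives the other direction.\<close>

lemma lip_env_lipschitz:
  assumes "0 \<le> e" "sk_close e x y"
  shows "\<bar>lip_env k g x - lip_env k g y\<bar> \<le> k * e"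
proof -
  have *: "lip_env k g y \<le> lip_env k g x + k * e" if "sk_close e x y" for x y
  proof (rule lip_env_least)
    fix z d assume d: "0 \<le> d" "sk_close d y z"
    have "g z - k * (e + d) \<le> lip_env k g x"
      using lip_env_upper[OF _ sk_close_trans[OF that d(2)]] assms(1) d(1) by simp
    then show "g z - k * d \<le> lip_env k g x + k * e" by (simp add: algebra_simps)
  qed
  from *[OF assms(2)] *[OF sk_close_sym[OF assms(2)]] show ?thesis by linarith
qed

lemma bdd_sk_continuous_lip_env: "bdd_sk_continuous (lip_env k g)"
  unfolding bdd_sk_continuous_def
proof (rule conjI[OF exI[of _ B]]; intro allI impI)
  fix x and \<epsilon> :: real assume x: "cadlag01 x" and \<epsilon>: "0 < \<epsilon>"
  show "\<exists>d>0. \<forall>y. cadlag01 y \<longrightarrow> skorokhod_dist x y < d \<longrightarrow> \<bar>lip_env k g y - lip_env k g x\<bar> < \<epsilon>"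
  \<comment> \<open>The constant \<open>k\<close> may be 0, hence \<open>k + 1\<close> in the
    denominator.\<close>
  proof (intro exI[of _ "\<epsilon> / (k + 1)"] conjI allI impI)
    fix y assume "cadlag01 y" "skorokhod_dist x y < \<epsilon> / (k + 1)"
    then obtain e where e: "0 \<le> e" "e < \<epsilon> / (k + 1)" "sk_close e x y"
      using skorokhod_dist_sk_close[OF x] by blast
    have "k * e \<le> (k + 1) * e" using e by (simp add: algebra_simps)
    also have "\<dots> < \<epsilon>" using e k by (simp add: field_simps)
    finally show "\<bar>lip_env k g y - lip_env k g x\<bar> < \<epsilon>"
      using lip_env_lipschitz[OF e(1,3)] by linarith
  qed (use \<epsilon> k in auto)
qed (rule lip_env_abs)

end

text \<open>The functional itself is measurable in no given sense. Rounding the finitely many values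
  of the step path to multiples of \<open>1 / Suc p\<close> makes it a function of a list of
  integers, which takes countably many values; the Lipschitz bound makes the rounded versions
  converge.\<close>

lemma measurable_step_functional:
  fixes f :: "(real \<Rightarrow> real) \<Rightarrow> real" and c :: "nat \<Rightarrow> 'a \<Rightarrow> real"
  assumes lip: "\<And>x y e. 0 \<le> e \<Longrightarrow> (\<And>t. t \<in> {0..1} \<Longrightarrow> \<bar>x t - y t\<bar> \<le> e) \<Longrightarrow> \<bar>f x - f y\<bar> \<le> K * e"
    and c[measurable]: "\<And>i. i \<le> m \<Longrightarrow> c i \<in> borel_measurable M"
  shows "(\<lambda>\<omega>. f (\<lambda>t. c (nat \<lfloor>real m * t\<rfloor>) \<omega>)) \<in> borel_measurable M"
proof (rule borel_measurable_LIMSEQ_real)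
  define L where "L p \<omega> = map (\<lambda>j. \<lfloor>real (Suc p) * c j \<omega>\<rfloor>) [0..<Suc m]" for p \<omega>
  define F where "F p l = f (\<lambda>t. of_int (l ! nat \<lfloor>real m * t\<rfloor>) / real (Suc p))" for p l
  have idx: "nat \<lfloor>real m * t\<rfloor> \<le> m" if "t \<in> {0..1}" for t :: real
  proof -
    have "real m * t \<le> real m" using that by (simp add: mult_left_le)
    then show ?thesis by linarith
  qed
  show "(\<lambda>p. F p (L p \<omega>)) \<longlonglongrightarrow> f (\<lambda>t. c (nat \<lfloor>real m * t\<rfloor>) \<omega>)" for \<omega>
  proof (rule LIMSEQ_I)
    fix r :: real assume "0 < r"
    define C where "C = f (\<lambda>t. c (nat \<lfloor>real m * t\<rfloor>) \<omega>)"
    have b: "\<bar>F p (L p \<omega>) - C\<bar> \<le> K * (1 / real (Suc p))" for p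
      unfolding F_def C_def
    proof (rule lip)
      fix t :: real assume t: "t \<in> {0..1}"
      define j where "j = nat \<lfloor>real m * t\<rfloor>"
      have "L p \<omega> ! j = \<lfloor>real (Suc p) * c j \<omega>\<rfloor>" using idx[OF t] unfolding L_def j_def
        by (auto simp: nth_append simp del: upt_Suc)
      moreover have "\<bar>of_int \<lfloor>real (Suc p) * c j \<omega>\<rfloor> - real (Suc p) * c j \<omega>\<bar> \<le> 1" by linarith
      ultimately have "\<bar>of_int (L p \<omega> ! j) - real (Suc p) * c j \<omega>\<bar> / real (Suc p) \<le> 1 / real (Suc p)"
        by (simp add: divide_right_mono)
      then show "\<bar>of_int (L p \<omega> ! nat \<lfloor>real m * t\<rfloor>) / real (Suc p) - c (nat \<lfloor>real m * t\<rfloor>) \<omega>\<bar> \<le> 1 / real (Suc p)"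
        unfolding j_def[symmetric]
        by (subst (asm) abs_of_pos[of "real (Suc p)", symmetric], simp, subst (asm) abs_divide[symmetric])
           (simp add: diff_divide_distrib)
    qed auto
    have "(\<lambda>p. K * (1 / real (Suc p))) \<longlonglongrightarrow> K * 0"
      by (intro tendsto_mult tendsto_const) (rule LIMSEQ_Suc[OF lim_const_over_n[of 1]])
    then obtain no where "\<And>p. p \<ge> no \<Longrightarrow> \<bar>K * (1 / real (Suc p))\<bar> < r"
      using LIMSEQ_D[OF _ \<open>0 < r\<close>] by (metis diff_zero mult_zero_right real_norm_def)
    then show "\<exists>no. \<forall>n\<ge>no. norm (F n (L n \<omega>) - f (\<lambda>t. c (nat \<lfloor>real m * t\<rfloor>) \<omega>)) < r"
      unfolding C_def[symmetric] real_norm_def using b by (intro exI[of _ no]) (meson abs_ge_self le_less_trans order_trans)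
  qed
  show "(\<lambda>\<omega>. F p (L p \<omega>)) \<in> borel_measurable M" for p
  proof (rule measurable_compose[of "L p" M "count_space UNIV"])
    show "L p \<in> M \<rightarrow>\<^sub>M count_space UNIV"
    proof (rule measurable_count_space_eq2_countable[THEN iffD2], intro conjI ballI)
      fix a :: "int list"
      show "L p -` {a} \<inter> space M \<in> sets M"
      proof (cases "length a = Suc m")
        case True
        have "L p \<omega> = a \<longleftrightarrow> (\<forall>j\<in>{..m}. \<lfloor>real (Suc p) * c j \<omega>\<rfloor> = a ! j)" for \<omega>
          unfolding L_def list_eq_iff_nth_eq using True by (auto simp: less_Suc_eq_le simp del: upt_Suc)
        then have "L p -` {a} \<inter> space M = {\<omega>\<in>space M. \<forall>j\<in>{..m}. \<lfloor>real (Suc p) * c j \<omega>\<rfloor> = a ! j}" by auto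
        also have "\<dots> = (\<Inter>j\<in>{..m}. {\<omega>\<in>space M. \<lfloor>real (Suc p) * c j \<omega>\<rfloor> = a ! j})" by auto
        also have "\<dots> \<in> sets M"
        proof (rule sets.finite_INT)
          fix j assume "j \<in> {..m}"
          then have [measurable]: "c j \<in> borel_measurable M" using c by simp
          show "{\<omega>\<in>space M. \<lfloor>real (Suc p) * c j \<omega>\<rfloor> = a ! j} \<in> sets M" by measurable
        qed auto
        finally show ?thesis .
      next
        case False
        then have "L p -` {a} \<inter> space M = {}" unfolding L_def by auto
        then show ?thesis by simp
      qed
    qed auto
  qed auto
qed

text \<open>Sampling a continuous path on the grid of mesh \<open>1 / Suc m\<close> gives step paths
  that converge uniformly, so the previous lemma passes to the limit.\<close>

lemma measurable_continuous_functional: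
  fixes f :: "(real \<Rightarrow> real) \<Rightarrow> real" and Z :: "'a \<Rightarrow> real \<Rightarrow> real"
  assumes lip: "\<And>x y e. 0 \<le> e \<Longrightarrow> (\<And>t. t \<in> {0..1} \<Longrightarrow> \<bar>x t - y t\<bar> \<le> e) \<Longrightarrow> \<bar>f x - f y\<bar> \<le> K * e"
    and Z: "\<And>t. t \<in> {0..1} \<Longrightarrow> (\<lambda>\<omega>. Z \<omega> t) \<in> borel_measurable M"
    and cont: "\<And>\<omega>. \<omega> \<in> space M \<Longrightarrow> continuous_on {0..1} (Z \<omega>)"
  shows "(\<lambda>\<omega>. f (Z \<omega>)) \<in> borel_measurable M"
proof (rule borel_measurable_LIMSEQ_real)
  define F where "F m \<omega> = f (\<lambda>t. Z \<omega> (real (nat \<lfloor>real (Suc m) * t\<rfloor>) / real (Suc m)))" for m \<omega>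
  show "F m \<in> borel_measurable M" for m
    unfolding F_def
    by (rule measurable_step_functional[OF lip, where c = "\<lambda>i \<omega>. Z \<omega> (real i / real (Suc m))" and m = "Suc m"])
       (auto intro!: Z)
  fix \<omega> assume w: "\<omega> \<in> space M"
  show "(\<lambda>m. F m \<omega>) \<longlonglongrightarrow> f (Z \<omega>)"
  proof (rule LIMSEQ_I)
    fix r :: real assume "0 < r"
    define e where "e = r / (2 * (\<bar>K\<bar> + 1))"
    have "0 < e" using \<open>0 < r\<close> by (simp add: e_def add_pos_nonneg)
    have Ke: "K * e < r"
    proof -
      have "K * e \<le> (\<bar>K\<bar> + 1) * e" using \<open>0 < e\<close> by (intro mult_right_mono) auto
      also have "\<dots> = r / 2" by (simp add: e_def field_simps)
      finally show ?thesis using \<open>0 < r\<close> by simp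
    qed
    have "uniformly_continuous_on {0..1} (Z \<omega>)" using cont[OF w] by (simp add: compact_uniformly_continuous)
    then obtain d where d: "d > 0" "\<And>s t. s\<in>{0..1} \<Longrightarrow> t\<in>{0..1} \<Longrightarrow> \<bar>s - t\<bar> < d \<Longrightarrow> \<bar>Z \<omega> s - Z \<omega> t\<bar> < e"
      unfolding uniformly_continuous_on_def dist_real_def using \<open>0 < e\<close> by metis
    obtain no where no: "1 / real (Suc no) < d" using d(1) by (metis nat_approx_posE)
    show "\<exists>no. \<forall>m\<ge>no. norm (F m \<omega> - f (Z \<omega>)) < r"
    proof (intro exI[of _ no] allI impI)
      fix m assume "m \<ge> no"
      then have md: "1 / real (Suc m) < d"
        using no by (smt (verit) frac_le of_nat_0_less_iff of_nat_mono zero_less_Suc Suc_le_mono)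
      have "\<bar>F m \<omega> - f (Z \<omega>)\<bar> \<le> K * e"
        unfolding F_def
      proof (rule lip)
        fix t :: real assume t: "t \<in> {0..1}"
        let ?u = "real (nat \<lfloor>real (Suc m) * t\<rfloor>)"
        have "0 \<le> real (Suc m) * t" using t by (intro mult_nonneg_nonneg) auto
        then have u: "?u \<le> real (Suc m) * t" "real (Suc m) * t < ?u + 1" by linarith+
        have "real (Suc m) * t \<le> real (Suc m) * 1" using t by (intro mult_left_mono) auto
        then have "?u \<le> real (Suc m)" using u(1) by (metis mult.right_neutral order_trans)
        then have "?u / real (Suc m) \<in> {0..1}" by (simp add: divide_le_eq_1)
        moreover have "\<bar>?u / real (Suc m) - t\<bar> \<le> 1 / real (Suc m)"
        proof -
          have "?u / real (Suc m) - t = (?u - real (Suc m) * t) / real (Suc m)" by (simp add: diff_divide_distrib)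
          moreover have "\<bar>?u - real (Suc m) * t\<bar> \<le> 1" using u by linarith
          ultimately show ?thesis by (simp add: abs_divide divide_right_mono)
        qed
        ultimately show "\<bar>Z \<omega> (?u / real (Suc m)) - Z \<omega> t\<bar> \<le> e" using d(2)[of "?u / real (Suc m)" t] t md by auto
      qed (use \<open>0 < e\<close> in auto)
      then show "norm (F m \<omega> - f (Z \<omega>)) < r" using Ke by simp
    qed
  qed
qed

text \<open>\<open>h n\<close> is dominated by a tail supremum, and that by its Lipschitz envelope,
  to which the assumed convergence applies. The same index \<open>k\<close> is the start of the tail
  and the Lipschitz constant, so both approximations sharpen together.\<close>

lemma extended_continuous_mapping_upper:
  fixes h :: "nat \<Rightarrow> (real \<Rightarrow> real) \<Rightarrow> real" and c :: "nat \<Rightarrow> nat \<Rightarrow> 'a \<Rightarrow> real"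
  assumes M: "prob_space M" and N: "prob_space N"
    and conv: "conv_distr_D M (\<lambda>n \<omega> t. c n (nat \<lfloor>real n * t\<rfloor>) \<omega>) N Z"
    and c: "\<And>n i. c n i \<in> borel_measurable M"
    and Z: "\<And>t. t \<in> {0..1} \<Longrightarrow> (\<lambda>\<omega>. Z \<omega> t) \<in> borel_measurable N"
    and cont: "\<And>\<omega>. \<omega> \<in> space N \<Longrightarrow> continuous_on {0..1} (Z \<omega>)"
    and hB: "\<And>n y. \<bar>h n y\<bar> \<le> B"
    and hm: "\<And>n. 1 \<le> n \<Longrightarrow> (\<lambda>\<omega>. h n (\<lambda>t. c n (nat \<lfloor>real n * t\<rfloor>) \<omega>)) \<in> borel_measurable M"
    and hl: "hl \<in> borel_measurable N" "\<And>\<omega>. \<bar>hl \<omega>\<bar> \<le> B"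
    and lim: "AE \<omega> in N. \<forall>e>0. \<exists>d>0. \<exists>m. \<forall>n\<ge>m. \<forall>y. (\<forall>t\<in>{0..1}. \<bar>y t - Z \<omega> t\<bar> < d) \<longrightarrow> \<bar>h n y - hl \<omega>\<bar> < e"
    and r: "0 < r"
  shows "eventually (\<lambda>n. (\<integral>\<omega>. h n (\<lambda>t. c n (nat \<lfloor>real n * t\<rfloor>) \<omega>) \<partial>M) < (\<integral>\<omega>. hl \<omega> \<partial>N) + r) sequentially"
proof -
  interpret M: prob_space M by fact
  interpret N: prob_space N by fact
  have B0: "0 \<le> B" using hB[of 0 undefined] by linarith
  \<comment> \<open>Taking the supremum over the tail leaves a single functional that bounds all
    \<open>h n\<close> with \<open>n \<ge> m\<close>.\<close>
  define g where "g m y = (SUP n\<in>{m..}. h n y)" for m :: nat and y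
  have bdd: "bdd_above ((\<lambda>n. h n y) ` {m..})" for m y
    using hB by (intro bdd_aboveI[of _ B]) (auto simp: abs_le_iff)
  have gh: "h n y \<le> g m y" if "n \<ge> m" for n m y
    unfolding g_def using that bdd by (intro cSUP_upper) auto
  have gle: "g m y \<le> b" if "\<And>n. n \<ge> m \<Longrightarrow> h n y \<le> b" for m y b
    unfolding g_def using that by (intro cSUP_least) auto
  have gB: "\<bar>g m y\<bar> \<le> B" for m y
    using gh[of m m y] hB[of m y] gle[of m y B] hB by (fastforce simp: abs_le_iff)
  define E where "E k = lip_env (real k) (g k)" for k
  have EB: "\<bar>E k x\<bar> \<le> B" for k x unfolding E_def using lip_env_abs[OF _ gB] by simp
  have Elip: "\<bar>E k x - E k y\<bar> \<le> real k * e" if "0 \<le> e" "\<And>t. t \<in> {0..1} \<Longrightarrow> \<bar>x t - y t\<bar> \<le> e" for k x y e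
    unfolding E_def using lip_env_lipschitz[OF _ gB that(1) sk_close_uniform[OF that]] by simp
  have Econt: "bdd_sk_continuous (E k)" for k
    unfolding E_def using bdd_sk_continuous_lip_env[OF _ gB] by simp
  have EZ[measurable]: "(\<lambda>\<omega>. E k (Z \<omega>)) \<in> borel_measurable N" for k
    by (rule measurable_continuous_functional[OF Elip Z cont])
  have EY[measurable]: "(\<lambda>\<omega>. E k (\<lambda>t. c n (nat \<lfloor>real n * t\<rfloor>) \<omega>)) \<in> borel_measurable M" for k n
    by (rule measurable_step_functional[OF Elip c])
  \<comment> \<open>Only an upper bound for \<open>E k (Z \<omega>)\<close> is available in the
    limit. The maximum with \<open>hl\<close> turns it into genuine convergence, as dominated
    convergence requires.\<close>
  have "(\<lambda>k. \<integral>\<omega>. max (E k (Z \<omega>)) (hl \<omega>) \<partial>N) \<longlonglongrightarrow> (\<integral>\<omega>. hl \<omega> \<partial>N)"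
  proof (rule integral_dominated_convergence[where w = "\<lambda>_. B"])
    show "AE \<omega> in N. (\<lambda>k. max (E k (Z \<omega>)) (hl \<omega>)) \<longlonglongrightarrow> hl \<omega>"
      using lim AE_space
    proof eventually_elim
      case (elim \<omega>)
      show ?case
      proof (rule LIMSEQ_I)
        fix \<epsilon> :: real assume "0 < \<epsilon>"
        then obtain d m where d: "0 < d" "\<And>n y. n \<ge> m \<Longrightarrow> (\<forall>t\<in>{0..1}. \<bar>y t - Z \<omega> t\<bar> < d) \<Longrightarrow> \<bar>h n y - hl \<omega>\<bar> < \<epsilon>/2"
          using elim(1)[rule_format, of "\<epsilon>/2"] half_gt_zero by blast
        obtain d' where d': "0 < d'" "\<And>e y t. sk_close e (Z \<omega>) y \<Longrightarrow> e < d' \<Longrightarrow> t \<in> {0..1} \<Longrightarrow> \<bar>y t - Z \<omega> t\<bar> < d"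
          using sk_close_continuous[OF cont[OF elim(2)] d(1)] by metis
        obtain k0 :: nat where k0: "2 * B / d' < real k0" using reals_Archimedean2 by blast
        have "E k (Z \<omega>) \<le> hl \<omega> + \<epsilon>/2" if k: "k \<ge> max m k0" for k
          unfolding E_def
        proof (rule lip_env_least[OF _ gB])
          fix y e assume e: "0 \<le> e" "sk_close e (Z \<omega>) y"
          show "g k y - real k * e \<le> hl \<omega> + \<epsilon>/2"
          proof (cases "e < d'")
            case True
            then have cl: "\<forall>t\<in>{0..1}. \<bar>y t - Z \<omega> t\<bar> < d" using d'(2)[OF e(2)] by blast
            have "g k y \<le> hl \<omega> + \<epsilon>/2"
            proof (rule gle)
              fix n assume "n \<ge> k"
              then have "\<bar>h n y - hl \<omega>\<bar> < \<epsilon>/2" using k by (intro d(2) cl) auto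
              then show "h n y \<le> hl \<omega> + \<epsilon>/2" by linarith
            qed
            then show ?thesis using e by (smt (verit) mult_nonneg_nonneg of_nat_0_le_iff)
          next
            case False
            \<comment> \<open>Far from the limit path the penalty exceeds \<open>2 * B\<close>, more
              than any value of \<open>g k\<close> can gain over \<open>hl\<close>.\<close>
            have "2 * B < real k * d'" using k0 k d'(1) by (simp add: divide_less_eq) (smt (verit) mult_right_mono of_nat_mono)
            also have "\<dots> \<le> real k * e" using False by (intro mult_left_mono) auto
            finally show ?thesis using gB[of k y] hl(2)[of \<omega>] \<open>0 < \<epsilon>\<close> by linarith
          qed
        qed simp
        then show "\<exists>no. \<forall>n\<ge>no. norm (max (E n (Z \<omega>)) (hl \<omega>) - hl \<omega>) < \<epsilon>"
          using \<open>0 < \<epsilon>\<close> by (intro exI[of _ "max m k0"]) fastforce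
      qed
    qed
    show "AE \<omega> in N. norm (max (E k (Z \<omega>)) (hl \<omega>)) \<le> B" for k
      using EB[of k] hl(2) by (intro AE_I2) (auto simp: max_def)
  qed (use hl in auto)
  then have "eventually (\<lambda>k. (\<integral>\<omega>. max (E k (Z \<omega>)) (hl \<omega>) \<partial>N) < (\<integral>\<omega>. hl \<omega> \<partial>N) + r/2) sequentially"
    using r by (intro order_tendstoD(2)) auto
  then obtain k where k: "(\<integral>\<omega>. max (E k (Z \<omega>)) (hl \<omega>) \<partial>N) < (\<integral>\<omega>. hl \<omega> \<partial>N) + r/2"
    using eventually_happens'[OF sequentially_bot] by blast
  have iE: "integrable N (\<lambda>\<omega>. E k (Z \<omega>))" by (rule N.integrable_const_bound[of _ B]) (use EB in auto)
  have ihl: "integrable N hl" by (rule N.integrable_const_bound[of _ B]) (use hl in auto)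
  have "(\<integral>\<omega>. E k (Z \<omega>) \<partial>N) \<le> (\<integral>\<omega>. max (E k (Z \<omega>)) (hl \<omega>) \<partial>N)"
    using iE ihl by (intro integral_mono integrable_max) auto
  then have lt: "(\<integral>\<omega>. E k (Z \<omega>) \<partial>N) < (\<integral>\<omega>. hl \<omega> \<partial>N) + r/2" using k by linarith
  have "(\<lambda>n. \<integral>\<omega>. E k (\<lambda>t. c n (nat \<lfloor>real n * t\<rfloor>) \<omega>) \<partial>M) \<longlonglongrightarrow> (\<integral>\<omega>. E k (Z \<omega>) \<partial>N)"
    using conv Econt[of k] unfolding conv_distr_D_def by blast
  then have "eventually (\<lambda>n. (\<integral>\<omega>. E k (\<lambda>t. c n (nat \<lfloor>real n * t\<rfloor>) \<omega>) \<partial>M) < (\<integral>\<omega>. hl \<omega> \<partial>N) + r) sequentially"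
    using lt r by (intro order_tendstoD(2)) auto
  then show ?thesis
    using eventually_ge_at_top[of "max 1 k"]
  proof eventually_elim
    case (elim n)
    have "(\<integral>\<omega>. h n (\<lambda>t. c n (nat \<lfloor>real n * t\<rfloor>) \<omega>) \<partial>M) \<le> (\<integral>\<omega>. E k (\<lambda>t. c n (nat \<lfloor>real n * t\<rfloor>) \<omega>) \<partial>M)"
    proof (rule integral_mono)
      show "integrable M (\<lambda>\<omega>. h n (\<lambda>t. c n (nat \<lfloor>real n * t\<rfloor>) \<omega>))"
        using elim by (intro M.integrable_const_bound[of _ B] hm) (use hB in auto)
      show "integrable M (\<lambda>\<omega>. E k (\<lambda>t. c n (nat \<lfloor>real n * t\<rfloor>) \<omega>))"
        by (intro M.integrable_const_bound[of _ B] EY) (use EB in auto)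
      fix \<omega>
      have "h n y \<le> E k y" for y
      proof -
        have "g k y \<le> lip_env (real k) (g k) y" by (rule lip_env_ge[OF _ gB]) simp
        then show ?thesis using gh[of k n y] elim unfolding E_def by simp
      qed
      then show "h n (\<lambda>t. c n (nat \<lfloor>real n * t\<rfloor>) \<omega>) \<le> E k (\<lambda>t. c n (nat \<lfloor>real n * t\<rfloor>) \<omega>)" .
    qed
    then show ?case using elim by linarith
  qed
qed

text \<open>The functional may change with \<open>n\<close>, as the argmax over a grid of mesh
  \<open>1 / n\<close> does, and the limit \<open>hl\<close> need only be a random variable, not a
  functional on path space. The lower bound is the upper bound for the negated functionals.\<close>

theorem extended_continuous_mapping:
  fixes h :: "nat \<Rightarrow> (real \<Rightarrow> real) \<Rightarrow> real" and c :: "nat \<Rightarrow> nat \<Rightarrow> 'a \<Rightarrow> real"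
  assumes M: "prob_space M" and N: "prob_space N"
    and conv: "conv_distr_D M (\<lambda>n \<omega> t. c n (nat \<lfloor>real n * t\<rfloor>) \<omega>) N Z"
    and c: "\<And>n i. c n i \<in> borel_measurable M"
    and Z: "\<And>t. t \<in> {0..1} \<Longrightarrow> (\<lambda>\<omega>. Z \<omega> t) \<in> borel_measurable N"
    and cont: "\<And>\<omega>. \<omega> \<in> space N \<Longrightarrow> continuous_on {0..1} (Z \<omega>)"
    and hB: "\<And>n y. \<bar>h n y\<bar> \<le> B"
    and hm: "\<And>n. 1 \<le> n \<Longrightarrow> (\<lambda>\<omega>. h n (\<lambda>t. c n (nat \<lfloor>real n * t\<rfloor>) \<omega>)) \<in> borel_measurable M"
    and hl: "hl \<in> borel_measurable N" "\<And>\<omega>. \<bar>hl \<omega>\<bar> \<le> B"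
    and lim: "AE \<omega> in N. \<forall>e>0. \<exists>d>0. \<exists>m. \<forall>n\<ge>m. \<forall>y. (\<forall>t\<in>{0..1}. \<bar>y t - Z \<omega> t\<bar> < d) \<longrightarrow> \<bar>h n y - hl \<omega>\<bar> < e"
  shows "(\<lambda>n. \<integral>\<omega>. h n (\<lambda>t. c n (nat \<lfloor>real n * t\<rfloor>) \<omega>) \<partial>M) \<longlonglongrightarrow> (\<integral>\<omega>. hl \<omega> \<partial>N)"
proof (rule order_tendstoI)
  fix a assume a: "(\<integral>\<omega>. hl \<omega> \<partial>N) < a"
  show "eventually (\<lambda>n. (\<integral>\<omega>. h n (\<lambda>t. c n (nat \<lfloor>real n * t\<rfloor>) \<omega>) \<partial>M) < a) sequentially"
    using extended_continuous_mapping_upper[OF M N conv c Z cont hB hm hl lim, of "a - (\<integral>\<omega>. hl \<omega> \<partial>N)"] a by simp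
next
  fix a assume a: "a < (\<integral>\<omega>. hl \<omega> \<partial>N)"
  have lim': "AE \<omega> in N. \<forall>e>0. \<exists>d>0. \<exists>m. \<forall>n\<ge>m. \<forall>y. (\<forall>t\<in>{0..1}. \<bar>y t - Z \<omega> t\<bar> < d) \<longrightarrow> \<bar>- h n y - (- hl \<omega>)\<bar> < e"
    using lim by eventually_elim (simp add: abs_minus_commute)
  have "eventually (\<lambda>n. (\<integral>\<omega>. - h n (\<lambda>t. c n (nat \<lfloor>real n * t\<rfloor>) \<omega>) \<partial>M) < (\<integral>\<omega>. - hl \<omega> \<partial>N) + ((\<integral>\<omega>. hl \<omega> \<partial>N) - a)) sequentially"
    by (rule extended_continuous_mapping_upper[OF M N conv c Z cont _ _ _ _ lim', where B = B]) (use hB hl a hm in auto)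
  then show "eventually (\<lambda>n. (\<integral>\<omega>. h n (\<lambda>t. c n (nat \<lfloor>real n * t\<rfloor>) \<omega>) \<partial>M) > a) sequentially"
    by eventually_elim simp
qed

section \<open>Uniqueness of the maximiser of the fractional bridge\<close>

text \<open>Writing the exponent through the second moment covers the degenerate and the
  nondegenerate law by one formula; the variance never has to be known.\<close>

lemma centered_normal_rv_char:
  assumes "prob_space N" and V: "centered_normal_rv N V"
  shows "integrable N (\<lambda>\<omega>. (V \<omega>)\<^sup>2)"
    and "(CLINT \<omega>|N. iexp (V \<omega>)) = complex_of_real (exp (- (\<integral>\<omega>. (V \<omega>)\<^sup>2 \<partial>N) / 2))"
proof -
  interpret prob_space N by fact
  have Vm[measurable]: "V \<in> borel_measurable N" using V by (simp add: centered_normal_rv_def)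
  have "integrable N (\<lambda>\<omega>. (V \<omega>)\<^sup>2) \<and>
    (CLINT \<omega>|N. iexp (V \<omega>)) = complex_of_real (exp (- (\<integral>\<omega>. (V \<omega>)\<^sup>2 \<partial>N) / 2))"
  proof (cases "AE \<omega> in N. V \<omega> = 0")
    case True
    have "integrable N (\<lambda>\<omega>. (V \<omega>)\<^sup>2)"
      by (rule integrable_cong_AE_imp[OF integrable_zero]) (use True in auto)
    moreover have "(\<integral>\<omega>. (V \<omega>)\<^sup>2 \<partial>N) = (\<integral>\<omega>. 0 \<partial>N)"
      by (rule integral_cong_AE) (use True in auto)
    moreover have "(CLINT \<omega>|N. iexp (V \<omega>)) = (CLINT \<omega>|N. 1)"
      by (rule integral_cong_AE) (use True in auto)
    ultimately show ?thesis by (simp add: prob_space)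
  next
    case False
    then obtain \<sigma> where \<sigma>: "\<sigma> > 0" and D: "distributed N lborel V (normal_density 0 \<sigma>)"
      using V unfolding centered_normal_rv_def by auto
    have "integrable lborel (\<lambda>x. normal_density 0 \<sigma> x * (x - 0)^2)" using \<sigma> by (rule integrable_normal_moment)
    then have i: "integrable N (\<lambda>\<omega>. (V \<omega>)\<^sup>2)"
      by (subst distributed_integrable[OF D, symmetric]) auto
    have "expectation V = 0" using normal_distributed_expectation[OF \<sigma> D] .
    then have v: "(\<integral>\<omega>. (V \<omega>)\<^sup>2 \<partial>N) = \<sigma>\<^sup>2" using normal_distributed_variance[OF \<sigma> D] by simp
    have D1: "distributed N lborel (\<lambda>\<omega>. V \<omega> / \<sigma>) std_normal_density"
      using D normal_standard_normal_convert[OF \<sigma>, of V 0] by simp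
    have eq: "distr N borel (\<lambda>\<omega>. V \<omega> / \<sigma>) = std_normal_distribution"
      using distributed_distr_eq_density[OF D1] by (metis (no_types, lifting) distr_cong sets_lborel)
    have "(CLINT \<omega>|N. iexp (V \<omega>)) = (CLINT \<omega>|N. iexp (\<sigma> * (V \<omega> / \<sigma>)))" using \<sigma> by simp
    also have "\<dots> = char (distr N borel (\<lambda>\<omega>. V \<omega> / \<sigma>)) \<sigma>"
      unfolding char_def by (subst integral_distr) auto
    also have "\<dots> = complex_of_real (exp (- \<sigma>\<^sup>2 / 2))" unfolding eq by (simp add: char_std_normal_distribution)
    finally show ?thesis using i v by simp
  qed
  then show "integrable N (\<lambda>\<omega>. (V \<omega>)\<^sup>2)"
    "(CLINT \<omega>|N. iexp (V \<omega>)) = complex_of_real (exp (- (\<integral>\<omega>. (V \<omega>)\<^sup>2 \<partial>N) / 2))" by auto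
qed

text \<open>Levy uniqueness for the signed measure with density \<open>G\<close>. The positive and
  negative parts of \<open>G\<close>, divided by their common mass, are probability densities under
  which \<open>Y\<close> has the same characteristic function, hence the same law.\<close>

lemma real_char_zero_imp:
  fixes G Y :: "'b \<Rightarrow> real"
  assumes "prob_space N" and [measurable]: "Y \<in> borel_measurable N" "G \<in> borel_measurable N"
    and GB: "\<And>\<omega>. \<bar>G \<omega>\<bar> \<le> K"
    and zero: "\<And>v. (CLINT \<omega>|N. complex_of_real (G \<omega>) * iexp (v * Y \<omega>)) = 0"
    and A[measurable]: "A \<in> sets borel"
  shows "(\<integral>\<omega>. G \<omega> * indicator A (Y \<omega>) \<partial>N) = 0"
proof -
  interpret prob_space N by fact
  define P where "P \<omega> = max 0 (G \<omega>)" for \<omega>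
  define Q where "Q \<omega> = max 0 (- G \<omega>)" for \<omega>
  have [measurable]: "P \<in> borel_measurable N" "Q \<in> borel_measurable N" unfolding P_def Q_def by auto
  have PQ: "P \<omega> - Q \<omega> = G \<omega>" "0 \<le> P \<omega>" "0 \<le> Q \<omega>" "\<bar>P \<omega>\<bar> \<le> \<bar>K\<bar>" "\<bar>Q \<omega>\<bar> \<le> \<bar>K\<bar>" for \<omega>
    using GB[of \<omega>] by (auto simp: P_def Q_def)
  have iP: "integrable N (\<lambda>\<omega>. complex_of_real (P \<omega>) * f \<omega>)" and iQ: "integrable N (\<lambda>\<omega>. complex_of_real (Q \<omega>) * f \<omega>)"
    if [measurable]: "f \<in> borel_measurable N" and "\<And>\<omega>. norm (f \<omega>) \<le> 1" for f
  proof -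
    have "P \<omega> * norm (f \<omega>) \<le> \<bar>K\<bar>" "Q \<omega> * norm (f \<omega>) \<le> \<bar>K\<bar>" for \<omega>
      using PQ[of \<omega>] that(2)[of \<omega>] mult_mono[of "P \<omega>" "\<bar>K\<bar>" "norm (f \<omega>)" 1] mult_mono[of "Q \<omega>" "\<bar>K\<bar>" "norm (f \<omega>)" 1]
      by auto
    then show "integrable N (\<lambda>\<omega>. complex_of_real (P \<omega>) * f \<omega>)" "integrable N (\<lambda>\<omega>. complex_of_real (Q \<omega>) * f \<omega>)"
      using PQ by (auto intro!: integrable_const_bound[where B="\<bar>K\<bar>"] simp: norm_mult)
  qed
  have eqPQ: "(CLINT \<omega>|N. complex_of_real (P \<omega>) * iexp (v * Y \<omega>)) = (CLINT \<omega>|N. complex_of_real (Q \<omega>) * iexp (v * Y \<omega>))" for v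
  proof -
    have "(CLINT \<omega>|N. complex_of_real (P \<omega>) * iexp (v * Y \<omega>)) - (CLINT \<omega>|N. complex_of_real (Q \<omega>) * iexp (v * Y \<omega>))
      = (CLINT \<omega>|N. complex_of_real (P \<omega>) * iexp (v * Y \<omega>) - complex_of_real (Q \<omega>) * iexp (v * Y \<omega>))"
      by (rule Bochner_Integration.integral_diff[symmetric]) (auto intro!: iP iQ)
    also have "\<dots> = (CLINT \<omega>|N. complex_of_real (G \<omega>) * iexp (v * Y \<omega>))"
      by (intro Bochner_Integration.integral_cong refl) (simp add: PQ(1)[symmetric] algebra_simps)
    finally show ?thesis using zero by simp
  qed
  have iPr: "integrable N P" "integrable N Q"
    using PQ by (auto intro!: integrable_const_bound[where B="\<bar>K\<bar>"])
  define m where "m = (\<integral>\<omega>. P \<omega> \<partial>N)"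
  \<comment> \<open>The characteristic functions at 0 show that both parts have the same mass, so
    one normalising constant serves both.\<close>
  have "complex_of_real (\<integral>\<omega>. P \<omega> \<partial>N) = complex_of_real (\<integral>\<omega>. Q \<omega> \<partial>N)"
    using eqPQ[of 0] by (simp flip: integral_complex_of_real)
  then have mQ: "m = (\<integral>\<omega>. Q \<omega> \<partial>N)" unfolding m_def using of_real_eq_iff by blast
  have m0: "0 \<le> m" unfolding m_def using PQ by simp
  show ?thesis
  proof (cases "m = 0")
    case True
    have "AE \<omega> in N. P \<omega> = 0" using True iPr PQ unfolding m_def
      by (subst (asm) integral_nonneg_eq_0_iff_AE) auto
    moreover have "AE \<omega> in N. Q \<omega> = 0" using True iPr PQ unfolding mQ
      by (subst (asm) integral_nonneg_eq_0_iff_AE) auto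
    ultimately have "AE \<omega> in N. G \<omega> * indicator A (Y \<omega>) = 0"
      by eventually_elim (simp add: PQ(1)[symmetric])
    then show ?thesis by (rule integral_eq_zero_AE)
  next
    case False
    then have m: "0 < m" using m0 by simp
    define D where "D F = distr (density N (\<lambda>\<omega>. ennreal (F \<omega> / m))) borel Y" for F
    have Dp: "real_distribution (D F)"
      if F[measurable]: "F \<in> borel_measurable N" and "\<And>\<omega>. 0 \<le> F \<omega>" "integrable N F" "(\<integral>\<omega>. F \<omega> \<partial>N) = m" for F
    proof -
      have "(\<integral>\<^sup>+\<omega>. ennreal (F \<omega> / m) \<partial>N) = ennreal (\<integral>\<omega>. F \<omega> / m \<partial>N)"
        using that m by (intro nn_integral_eq_integral) auto
      also have "\<dots> = 1" using that m by simp
      finally have "emeasure (density N (\<lambda>\<omega>. ennreal (F \<omega> / m))) (space N) = 1"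
        by (subst emeasure_density) (auto simp: nn_integral_set_ennreal cong: nn_integral_cong)
      then have "prob_space (density N (\<lambda>\<omega>. ennreal (F \<omega> / m)))" by (intro prob_spaceI) simp
      then show ?thesis unfolding D_def real_distribution_def real_distribution_axioms_def
        by (intro conjI prob_space.prob_space_distr) auto
    qed
    have Dint: "(CLINT x|D F. f x) = (CLINT \<omega>|N. complex_of_real (F \<omega>) * f (Y \<omega>)) / m"
      if F[measurable]: "F \<in> borel_measurable N" and F0: "\<And>\<omega>. 0 \<le> F \<omega>" and [measurable]: "f \<in> borel_measurable borel" for F f
    proof -
      have "(CLINT x|D F. f x) = (CLINT \<omega>|density N (\<lambda>\<omega>. ennreal (F \<omega> / m)). f (Y \<omega>))"
        unfolding D_def by (rule integral_distr) auto
      also have "\<dots> = (CLINT \<omega>|N. (F \<omega> / m) *\<^sub>R f (Y \<omega>))"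
        using F0 m by (intro integral_density) auto
      also have "\<dots> = (CLINT \<omega>|N. complex_of_real (F \<omega>) * f (Y \<omega>) / m)"
        by (simp add: scaleR_conv_of_real)
      finally show ?thesis by simp
    qed
    have "D P = D Q"
    proof (rule Levy_uniqueness)
      show "real_distribution (D P)" using PQ iPr m_def by (intro Dp) auto
      show "real_distribution (D Q)" using PQ iPr mQ by (intro Dp) auto
      show "char (D P) = char (D Q)"
        unfolding char_def by (rule ext) (subst (1 2) Dint; use PQ eqPQ in auto)
    qed
    then have "(CLINT x|D P. indicator A x) = (CLINT x|D Q. indicator A x)" by simp
    then have e: "(CLINT \<omega>|N. complex_of_real (P \<omega>) * indicator A (Y \<omega>)) = (CLINT \<omega>|N. complex_of_real (Q \<omega>) * indicator A (Y \<omega>))"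
      using m PQ by (subst (asm) (1 2) Dint) auto
    have conv: "(CLINT \<omega>|N. complex_of_real (F \<omega>) * indicator A (Y \<omega>)) = complex_of_real (\<integral>\<omega>. F \<omega> * indicator A (Y \<omega>) \<partial>N)" for F
      by (subst integral_complex_of_real[symmetric]) (auto intro!: Bochner_Integration.integral_cong simp: indicator_def)
    have e': "(\<integral>\<omega>. P \<omega> * indicator A (Y \<omega>) \<partial>N) = (\<integral>\<omega>. Q \<omega> * indicator A (Y \<omega>) \<partial>N)"
      using e unfolding conv using of_real_eq_iff by blast
    have "(\<integral>\<omega>. G \<omega> * indicator A (Y \<omega>) \<partial>N) = (\<integral>\<omega>. P \<omega> * indicator A (Y \<omega>) - Q \<omega> * indicator A (Y \<omega>) \<partial>N)"
      by (simp add: PQ(1)[symmetric] algebra_simps)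
    also have "\<dots> = (\<integral>\<omega>. P \<omega> * indicator A (Y \<omega>) \<partial>N) - (\<integral>\<omega>. Q \<omega> * indicator A (Y \<omega>) \<partial>N)"
      using PQ by (intro Bochner_Integration.integral_diff integrable_const_bound[where B="\<bar>K\<bar>"])
        (auto simp: abs_mult indicator_def)
    finally show ?thesis using e' by simp
  qed
qed

text \<open>Reduces to real densities: \<open>Re (G \<omega>) * iexp (v * Y \<omega>)\<close> is the
  mean of \<open>G \<omega> * iexp (v * Y \<omega>)\<close> and the conjugate of the same product at
  \<open>-v\<close>. The imaginary part of \<open>G\<close> is the real part of
  \<open>-\<i> * G\<close>.\<close>

lemma char_zero_imp:
  fixes G :: "'b \<Rightarrow> complex" and Y :: "'b \<Rightarrow> real"
  assumes N: "prob_space N" and Y[measurable]: "Y \<in> borel_measurable N" and G[measurable]: "G \<in> borel_measurable N"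
    and GB: "\<And>\<omega>. norm (G \<omega>) \<le> K"
    and zero: "\<And>v. (CLINT \<omega>|N. G \<omega> * iexp (v * Y \<omega>)) = 0"
    and A[measurable]: "A \<in> sets borel"
  shows "(CLINT \<omega>|N. G \<omega> * indicator A (Y \<omega>)) = 0"
proof -
  interpret prob_space N by fact
  have int: "integrable N (\<lambda>\<omega>. F \<omega> * iexp (v * Y \<omega>))"
    if [measurable]: "F \<in> borel_measurable N" and "\<And>\<omega>. norm (F \<omega>) \<le> K" for F v
    using that(2) by (intro integrable_const_bound[where B=K]) (auto simp: norm_mult)
  have *: "(\<integral>\<omega>. Re (F \<omega>) * indicator A (Y \<omega>) \<partial>N) = 0"
    if F[measurable]: "F \<in> borel_measurable N" and FB: "\<And>\<omega>. norm (F \<omega>) \<le> K"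
      and z: "\<And>v. (CLINT \<omega>|N. F \<omega> * iexp (v * Y \<omega>)) = 0" for F
  proof (rule real_char_zero_imp[OF N Y _ _ _ A])
    show "\<bar>Re (F \<omega>)\<bar> \<le> K" for \<omega> using FB[of \<omega>] abs_Re_le_cmod[of "F \<omega>"] by linarith
    fix v
    have "(CLINT \<omega>|N. complex_of_real (Re (F \<omega>)) * iexp (v * Y \<omega>))
      = (CLINT \<omega>|N. (F \<omega> * iexp (v * Y \<omega>) + cnj (F \<omega> * iexp ((-v) * Y \<omega>))) / 2)"
    proof (intro Bochner_Integration.integral_cong refl)
      fix \<omega>
      have "cnj (iexp ((-v) * Y \<omega>)) = iexp (v * Y \<omega>)" by (simp add: exp_cnj)
      moreover have "complex_of_real (Re (F \<omega>)) = (F \<omega> + cnj (F \<omega>)) / 2" by (simp add: complex_add_cnj)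
      ultimately show "complex_of_real (Re (F \<omega>)) * iexp (v * Y \<omega>) = (F \<omega> * iexp (v * Y \<omega>) + cnj (F \<omega> * iexp ((-v) * Y \<omega>))) / 2"
        by (simp only: complex_cnj_mult) (simp add: algebra_simps)
    qed
    also have "\<dots> = ((CLINT \<omega>|N. F \<omega> * iexp (v * Y \<omega>)) + cnj (CLINT \<omega>|N. F \<omega> * iexp ((-v) * Y \<omega>))) / 2"
      using int[OF F FB, of v] int[OF F FB, of "-v"]
      by (subst Bochner_Integration.integral_divide_zero, subst Bochner_Integration.integral_add)
         (auto simp: integral_cnj simp del: complex_cnj_mult)
    also have "\<dots> = 0" by (simp only: z) simp
    finally show "(CLINT \<omega>|N. complex_of_real (Re (F \<omega>)) * iexp (v * Y \<omega>)) = 0" .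
  qed measurable
  have re: "(\<integral>\<omega>. Re (G \<omega>) * indicator A (Y \<omega>) \<partial>N) = 0" using GB zero by (intro *) auto
  have im: "(\<integral>\<omega>. Re (-\<i> * G \<omega>) * indicator A (Y \<omega>) \<partial>N) = 0"
  proof (intro *)
    fix v
    have "(CLINT \<omega>|N. -\<i> * G \<omega> * iexp (v * Y \<omega>)) = -\<i> * (CLINT \<omega>|N. G \<omega> * iexp (v * Y \<omega>))"
      by (subst integral_mult_right_zero[symmetric]) (simp only: mult.assoc)
    then show "(CLINT \<omega>|N. -\<i> * G \<omega> * iexp (v * Y \<omega>)) = 0" using zero by simp
  qed (use GB in \<open>auto simp: norm_mult\<close>)
  have i: "integrable N (\<lambda>\<omega>. G \<omega> * indicator A (Y \<omega>))"
    using GB by (intro integrable_const_bound[where B=K]) (auto simp: norm_mult indicator_def order_trans[OF norm_ge_zero GB])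
  show ?thesis
  proof (rule complex_eqI)
    show "Re (CLINT \<omega>|N. G \<omega> * indicator A (Y \<omega>)) = Re 0"
    proof -
      have "(\<integral>\<omega>. Re (G \<omega> * indicator A (Y \<omega>)) \<partial>N) = (\<integral>\<omega>. Re (G \<omega>) * indicator A (Y \<omega>) \<partial>N)"
        by (intro Bochner_Integration.integral_cong refl) (auto split: split_indicator)
      then show ?thesis using re by (subst integral_Re[OF i, symmetric]) simp
    qed
    show "Im (CLINT \<omega>|N. G \<omega> * indicator A (Y \<omega>)) = Im 0"
    proof -
      have "(\<integral>\<omega>. Im (G \<omega> * indicator A (Y \<omega>)) \<partial>N) = (\<integral>\<omega>. Re (-\<i> * G \<omega>) * indicator A (Y \<omega>) \<partial>N)"
        by (intro Bochner_Integration.integral_cong refl) (auto split: split_indicator)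
      then show ?thesis using im by (subst integral_Im[OF i, symmetric]) simp
    qed
  qed
qed

text \<open>The family \<open>L\<close> plays the role of the linear span of the \<open>Y k\<close>. Indicators of the \<open>Y k\<close> are
  introduced one at a time by the one-dimensional uniqueness theorem, so that no
  multivariate characteristic functions are needed.\<close>

lemma indep_by_characteristic:
  fixes \<xi> :: "'b \<Rightarrow> real" and Y :: "'i \<Rightarrow> 'b \<Rightarrow> real" and L :: "('b \<Rightarrow> real) set"
  assumes N: "prob_space N" and \<xi>[measurable]: "\<xi> \<in> borel_measurable N"
    and Y: "\<And>k. k \<in> I \<Longrightarrow> Y k \<in> borel_measurable N"
    and L0: "(\<lambda>\<omega>. 0) \<in> L" and Lm: "\<And>V. V \<in> L \<Longrightarrow> V \<in> borel_measurable N"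
    and Ladd: "\<And>V k v. V \<in> L \<Longrightarrow> k \<in> I \<Longrightarrow> (\<lambda>\<omega>. V \<omega> + v * Y k \<omega>) \<in> L"
    and fact: "\<And>V u. V \<in> L \<Longrightarrow> (CLINT \<omega>|N. iexp (u * \<xi> \<omega>) * iexp (V \<omega>)) = (CLINT \<omega>|N. iexp (u * \<xi> \<omega>)) * (CLINT \<omega>|N. iexp (V \<omega>))"
    and S: "S \<in> sigma_sets (space N) {space N \<inter> (\<Inter>k\<in>K. Y k -` A k) | K A. finite K \<and> K \<subseteq> I \<and> (\<forall>k\<in>K. A k \<in> sets borel)}"
    and B: "B \<in> sets borel"
  shows "measure N (S \<inter> (\<xi> -` B \<inter> space N)) = measure N S * measure N (\<xi> -` B \<inter> space N)"
proof -
  interpret prob_space N by fact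
  define \<phi> where "\<phi> u = (CLINT \<omega>|N. iexp (u * \<xi> \<omega>))" for u
  have \<phi>1: "norm (\<phi> u) \<le> 1" for u
  proof -
    have "norm (\<phi> u) \<le> (\<integral>\<omega>. norm (iexp (u * \<xi> \<omega>)) \<partial>N)" unfolding \<phi>_def by (rule integral_norm_bound)
    then show ?thesis by (simp add: prob_space)
  qed
  \<comment> \<open>Subtracting \<open>\<phi> u\<close> centres the factor in \<open>\<xi>\<close>.
    Independence becomes the vanishing of these integrals, a property that survives when further
    indicators are multiplied in.\<close>
  define G where "G u K A V \<omega> = (iexp (u * \<xi> \<omega>) - \<phi> u) * (\<Prod>k\<in>K. indicator (A k) (Y k \<omega>)) * iexp (V \<omega>)" for u K A V \<omega>
  have Gm: "G u K A V \<in> borel_measurable N" if "finite K" "K \<subseteq> I" "\<And>k. k \<in> K \<Longrightarrow> A k \<in> sets borel" "V \<in> L" for u K A V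
  proof -
    have [measurable]: "V \<in> borel_measurable N" using Lm that by simp
    have [measurable]: "(\<lambda>\<omega>. \<Prod>k\<in>K. indicator (A k) (Y k \<omega>) :: complex) \<in> borel_measurable N"
    proof (rule borel_measurable_prod)
      fix k assume "k \<in> K"
      then have [measurable]: "Y k \<in> borel_measurable N" "A k \<in> sets borel" using Y that by auto
      show "(\<lambda>\<omega>. indicator (A k) (Y k \<omega>) :: complex) \<in> borel_measurable N" by measurable
    qed
    show ?thesis unfolding G_def by measurable
  qed
  have GB: "norm (G u K A V \<omega>) \<le> 2" for u K A V \<omega>
  proof -
    have "norm (iexp (u * \<xi> \<omega>) - \<phi> u) \<le> 2"
      using norm_triangle_ineq4[of "iexp (u * \<xi> \<omega>)" "\<phi> u"] \<phi>1[of u] by simp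
    moreover have "norm (\<Prod>k\<in>K. indicator (A k) (Y k \<omega>) :: complex) \<le> 1"
      by (rule norm_prod_le[THEN order_trans]) (auto intro!: prod_le_1 simp: indicator_def)
    ultimately show ?thesis unfolding G_def
      by (simp add: norm_mult) (metis mult_mono mult.right_neutral norm_ge_zero zero_le_numeral)
  qed
  have key: "(CLINT \<omega>|N. G u K A V \<omega>) = 0"
    if "finite K" "K \<subseteq> I" "\<And>k. k \<in> K \<Longrightarrow> A k \<in> sets borel" "V \<in> L" for u K A V
    using that
  proof (induction K arbitrary: V rule: finite_induct)
    case empty
    then have [measurable]: "V \<in> borel_measurable N" using Lm by simp
    have "(CLINT \<omega>|N. G u {} A V \<omega>) = (CLINT \<omega>|N. iexp (u * \<xi> \<omega>) * iexp (V \<omega>) - \<phi> u * iexp (V \<omega>))"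
      unfolding G_def by (simp add: algebra_simps)
    also have "\<dots> = (CLINT \<omega>|N. iexp (u * \<xi> \<omega>) * iexp (V \<omega>)) - (CLINT \<omega>|N. \<phi> u * iexp (V \<omega>))"
      by (intro Bochner_Integration.integral_diff integrable_mult_right integrable_const_bound[where B=1])
         (auto simp: norm_mult)
    also have "\<dots> = 0" using fact[OF empty(3)] by (simp add: \<phi>_def)
    finally show ?case .
  next
    case (insert k K)
    have kI: "k \<in> I" using insert by simp
    have "(CLINT \<omega>|N. G u K A V \<omega> * indicator (A k) (Y k \<omega>)) = 0"
    proof (rule char_zero_imp[OF N Y[OF kI] Gm GB])
      fix v
      \<comment> \<open>The new exponential is absorbed into \<open>V\<close>, which stays in
        \<open>L\<close>; this is why the induction keeps \<open>V\<close> arbitrary.\<close>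
      have "(CLINT \<omega>|N. G u K A V \<omega> * iexp (v * Y k \<omega>)) = (CLINT \<omega>|N. G u K A (\<lambda>\<omega>. V \<omega> + v * Y k \<omega>) \<omega>)"
        unfolding G_def by (simp add: exp_add algebra_simps)
      also have "\<dots> = 0" using insert.prems by (intro insert.IH Ladd kI) auto
      finally show "(CLINT \<omega>|N. G u K A V \<omega> * iexp (v * Y k \<omega>)) = 0" .
    qed (use insert in auto)
    also have "(\<lambda>\<omega>. G u K A V \<omega> * indicator (A k) (Y k \<omega>)) = G u (insert k K) A V"
      unfolding G_def using insert(1,2) by (auto simp: fun_eq_iff mult_ac)
    finally show ?case by simp
  qed
  define \<E> where "\<E> = {space N \<inter> (\<Inter>k\<in>K. Y k -` A k) | K A. finite K \<and> K \<subseteq> I \<and> (\<forall>k\<in>K. A k \<in> sets borel)}"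
  define \<X> where "\<X> = {\<xi> -` B \<inter> space N | B. B \<in> sets borel}"
  have Eev: "space N \<inter> (\<Inter>k\<in>K. Y k -` A k) \<in> events"
    if "finite K" "K \<subseteq> I" "\<And>k. k \<in> K \<Longrightarrow> A k \<in> sets borel" for K A
  proof (cases "K = {}")
    case False
    have "space N \<inter> (\<Inter>k\<in>K. Y k -` A k) = (\<Inter>k\<in>K. Y k -` A k \<inter> space N)" using False by auto
    also have "\<dots> \<in> events"
    proof (rule sets.finite_INT[OF \<open>finite K\<close> False])
      fix k assume "k \<in> K"
      then show "Y k -` A k \<inter> space N \<in> events" using Y that by (intro measurable_sets[of _ _ borel]) auto
    qed
    finally show ?thesis .
  qed simp
  have ind: "prob (e \<inter> x) = prob e * prob x" if e: "e \<in> \<E>" and x: "x \<in> \<X>" for e x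
  proof -
    obtain K A where KA: "finite K" "K \<subseteq> I" "\<And>k. k \<in> K \<Longrightarrow> A k \<in> sets borel" "e = space N \<inter> (\<Inter>k\<in>K. Y k -` A k)"
      using e unfolding \<E>_def by (elim CollectE exE conjE) (rule that, simp_all)
    obtain C where C[measurable]: "C \<in> sets borel" "x = \<xi> -` C \<inter> space N" using x unfolding \<X>_def by blast
    have ev[measurable]: "e \<in> events" using Eev KA by simp
    have pr: "(\<Prod>k\<in>K. indicator (A k) (Y k \<omega>) :: complex) = indicator e \<omega>" if "\<omega> \<in> space N" for \<omega>
      using KA(1,4) that by (induction K) (auto simp: indicator_def prod_zero_iff)
    \<comment> \<open>Once all indicators of the \<open>Y k\<close> are in place, the same
      uniqueness argument is applied to \<open>\<xi>\<close> itself and replaces its exponentials by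
      an indicator.\<close>
    have "(\<integral>\<omega>. (indicator e \<omega> - prob e) * indicator C (\<xi> \<omega>) \<partial>N) = 0"
    proof (rule real_char_zero_imp[OF N \<xi>])
      show "\<bar>indicator e \<omega> - prob e\<bar> \<le> 2" for \<omega> :: 'b
        using prob_le_1[of e] measure_nonneg[of N e] by (cases "\<omega> \<in> e") (simp_all add: abs_if del: measure_nonneg prob_le_1)
      fix v
      have "0 = (CLINT \<omega>|N. G v K A (\<lambda>_. 0) \<omega>)" using key[OF KA(1-3) L0] by simp
      also have "\<dots> = (CLINT \<omega>|N. iexp (v * \<xi> \<omega>) * indicator e \<omega> - \<phi> v * indicator e \<omega>)"
        unfolding G_def by (intro Bochner_Integration.integral_cong refl) (simp add: pr algebra_simps)
      also have "\<dots> = (CLINT \<omega>|N. iexp (v * \<xi> \<omega>) * indicator e \<omega>) - (CLINT \<omega>|N. \<phi> v * indicator e \<omega>)"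
        by (intro Bochner_Integration.integral_diff integrable_const_bound[where B=1])
           (use \<phi>1 in \<open>auto simp: norm_mult indicator_def\<close>)
      also have "(CLINT \<omega>|N. \<phi> v * indicator e \<omega>) = \<phi> v * prob e"
      proof -
        have ind: "(indicator e \<omega> :: complex) = complex_of_real (indicator e \<omega>)" for \<omega>
          by (simp split: split_indicator)
        show ?thesis unfolding ind using ev by (simp add: sets.Int_space_eq2)
      qed
      finally have 1: "(CLINT \<omega>|N. iexp (v * \<xi> \<omega>) * indicator e \<omega>) = \<phi> v * prob e" by simp
      have "(CLINT \<omega>|N. complex_of_real (indicator e \<omega> - prob e) * iexp (v * \<xi> \<omega>))
        = (CLINT \<omega>|N. iexp (v * \<xi> \<omega>) * indicator e \<omega> - complex_of_real (prob e) * iexp (v * \<xi> \<omega>))"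
        by (intro Bochner_Integration.integral_cong refl) (simp add: indicator_def algebra_simps)
      also have "\<dots> = (CLINT \<omega>|N. iexp (v * \<xi> \<omega>) * indicator e \<omega>) - (CLINT \<omega>|N. complex_of_real (prob e) * iexp (v * \<xi> \<omega>))"
        by (intro Bochner_Integration.integral_diff integrable_const_bound[where B=1])
           (auto simp: norm_mult indicator_def)
      also have "\<dots> = 0" using 1 by (simp add: \<phi>_def)
      finally show "(CLINT \<omega>|N. complex_of_real (indicator e \<omega> - prob e) * iexp (v * \<xi> \<omega>)) = 0" .
    qed auto
    also have "(\<integral>\<omega>. (indicator e \<omega> - prob e) * indicator C (\<xi> \<omega>) \<partial>N)
      = (\<integral>\<omega>. indicator (e \<inter> x) \<omega> - prob e * indicator x \<omega> \<partial>N)"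
      using C by (intro Bochner_Integration.integral_cong refl) (auto simp: indicator_def)
    also have "\<dots> = prob (e \<inter> x) - prob e * prob x"
      using C by (subst Bochner_Integration.integral_diff) (auto simp: emeasure_eq_measure)
    finally show ?thesis by simp
  qed
  have "indep_set \<E> \<X>"
  proof (rule indep_setI)
    show "\<E> \<subseteq> events"
    proof
      fix e assume "e \<in> \<E>"
      then obtain K A where "finite K" "K \<subseteq> I" "\<forall>k\<in>K. A k \<in> sets borel" "e = space N \<inter> (\<Inter>k\<in>K. Y k -` A k)"
        unfolding \<E>_def by (elim CollectE exE conjE) (rule that)
      then show "e \<in> events" using Eev by simp
    qed
    show "\<X> \<subseteq> events"
    proof
      fix x assume "x \<in> \<X>"
      then obtain C where "C \<in> sets borel" "x = \<xi> -` C \<inter> space N" unfolding \<X>_def by (elim CollectE exE conjE) (rule that)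
      then show "x \<in> events" using measurable_sets[OF \<xi>] by simp
    qed
  qed (rule ind)
  moreover have "Int_stable \<E>"
  proof (rule Int_stableI)
    fix a b assume "a \<in> \<E>" "b \<in> \<E>"
    obtain K A where KA1: "finite K" "K \<subseteq> I" "\<forall>k\<in>K. A k \<in> sets borel" "a = space N \<inter> (\<Inter>k\<in>K. Y k -` A k)"
      using \<open>a \<in> \<E>\<close> unfolding \<E>_def by (elim CollectE exE conjE) (rule that)
    obtain K' A' where KA2: "finite K'" "K' \<subseteq> I" "\<forall>k\<in>K'. A' k \<in> sets borel" "b = space N \<inter> (\<Inter>k\<in>K'. Y k -` A' k)"
      using \<open>b \<in> \<E>\<close> unfolding \<E>_def by (elim CollectE exE conjE) (rule that)
    let ?A = "\<lambda>k. (if k \<in> K then A k else UNIV) \<inter> (if k \<in> K' then A' k else UNIV)"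
    have "a \<inter> b = space N \<inter> (\<Inter>k\<in>K \<union> K'. Y k -` ?A k)" unfolding KA1(4) KA2(4) by (intro set_eqI) (auto split: if_splits)
    moreover have "\<forall>k\<in>K \<union> K'. ?A k \<in> sets borel" using KA1(3) KA2(3) by simp
    ultimately show "a \<inter> b \<in> \<E>" unfolding \<E>_def using KA1(1,2) KA2(1,2)
      by (intro CollectI exI[of _ "K \<union> K'"] exI[of _ ?A] conjI) simp_all
  qed
  moreover have "Int_stable \<X>"
  proof (rule Int_stableI)
    fix a b assume "a \<in> \<X>" "b \<in> \<X>"
    then obtain A B where "A \<in> sets borel" "B \<in> sets borel" "a = \<xi> -` A \<inter> space N" "b = \<xi> -` B \<inter> space N" unfolding \<X>_def by blast
    then show "a \<inter> b \<in> \<X>" unfolding \<X>_def by (intro CollectI exI[of _ "A \<inter> B"]) auto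
  qed
  ultimately have "indep_set (sigma_sets (space N) \<E>) (sigma_sets (space N) \<X>)" by (rule indep_set_sigma_sets)
  moreover have "\<xi> -` B \<inter> space N \<in> sigma_sets (space N) \<X>" using B unfolding \<X>_def by (intro sigma_sets.Basic) blast
  moreover have "S \<in> sigma_sets (space N) \<E>" using S unfolding \<E>_def .
  ultimately show ?thesis unfolding indep_sets2_eq by blast
qed

section \<open>Gaussian structure of fractional Brownian motion and its bridge\<close>

locale fbm =
  fixes N :: "'b measure" and H :: real and W :: "real \<Rightarrow> 'b \<Rightarrow> real"
  assumes fBm: "fBm N H W" and H: "1/2 < H" "H < 1"
begin

sublocale prob_space N using fBm by (simp add: fBm_def)

lemma W_measurable[measurable]: "0 \<le> t \<Longrightarrow> W t \<in> borel_measurable N"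
  using fBm by (simp add: fBm_def)

lemma W_continuous: "\<omega> \<in> space N \<Longrightarrow> continuous_on {0..} (\<lambda>t. W t \<omega>)"
  using fBm by (simp add: fBm_def)

definition cv :: "real \<Rightarrow> real \<Rightarrow> real" where
  "cv t s = (t powr (2*H) + s powr (2*H) - \<bar>t - s\<bar> powr (2*H)) / 2"

lemma W_cov: "0 \<le> t \<Longrightarrow> 0 \<le> s \<Longrightarrow> (\<integral>\<omega>. W t \<omega> * W s \<omega> \<partial>N) = cv t s"
  using fBm by (simp add: fBm_def cv_def)

text \<open>The linear span of the variables \<open>W t\<close>. It grows by one summand at a time
  so that closure properties follow by induction; \<open>gspace_list\<close> recovers the list form
  in which \<open>fBm\<close> states normality.\<close>

inductive_set gspace :: "('b \<Rightarrow> real) set" where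
  zero: "(\<lambda>\<omega>. 0) \<in> gspace"
| step: "V \<in> gspace \<Longrightarrow> 0 \<le> t \<Longrightarrow> (\<lambda>\<omega>. a * W t \<omega> + V \<omega>) \<in> gspace"

lemma gspace_list:
  assumes "V \<in> gspace"
  shows "\<exists>ts as. length as = length ts \<and> (\<forall>t\<in>set ts. 0 \<le> t) \<and> V = (\<lambda>\<omega>. \<Sum>i<length ts. as ! i * W (ts ! i) \<omega>)"
  using assms
proof induction
  case zero
  show ?case by (intro exI[of _ "[]"]) auto
next
  case (step V t a)
  then obtain ts as where *: "length as = length ts" "\<forall>t\<in>set ts. 0 \<le> t" "V = (\<lambda>\<omega>. \<Sum>i<length ts. as ! i * W (ts ! i) \<omega>)"
    by blast
  show ?case
    by (rule exI[of _ "t # ts"], rule exI[of _ "a # as"])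
       (use * step in \<open>simp add: sum.lessThan_Suc_shift del: sum.lessThan_Suc\<close>)
qed

lemma gspace_normal: "V \<in> gspace \<Longrightarrow> centered_normal_rv N V"
  using gspace_list[of V] fBm unfolding fBm_def by metis

lemma gspace_measurable[measurable_dest]: "V \<in> gspace \<Longrightarrow> V \<in> borel_measurable N"
  using gspace_normal by (auto simp: centered_normal_rv_def)

lemma gspace_add: "U \<in> gspace \<Longrightarrow> V \<in> gspace \<Longrightarrow> (\<lambda>\<omega>. U \<omega> + V \<omega>) \<in> gspace"
proof (induction rule: gspace.induct)
  case zero then show ?case by simp
next
  case (step U t a)
  then have "(\<lambda>\<omega>. a * W t \<omega> + (U \<omega> + V \<omega>)) \<in> gspace" by (intro gspace.step) auto
  then show ?case by (simp add: add.assoc)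
qed

lemma gspace_scale: "V \<in> gspace \<Longrightarrow> (\<lambda>\<omega>. b * V \<omega>) \<in> gspace"
proof (induction rule: gspace.induct)
  case zero then show ?case using gspace.zero by simp
next
  case (step V t a)
  then have "(\<lambda>\<omega>. (b * a) * W t \<omega> + b * V \<omega>) \<in> gspace" by (intro gspace.step) auto
  then show ?case by (simp add: algebra_simps)
qed

lemma gspace_W: "0 \<le> t \<Longrightarrow> W t \<in> gspace"
  using gspace.step[OF gspace.zero, of t 1] by simp

lemma gspace_diff: "U \<in> gspace \<Longrightarrow> V \<in> gspace \<Longrightarrow> (\<lambda>\<omega>. U \<omega> - V \<omega>) \<in> gspace"
  using gspace_add[of U "\<lambda>\<omega>. (-1) * V \<omega>"] gspace_scale[of V "-1"] by simp

lemma gspace_square_integrable: "V \<in> gspace \<Longrightarrow> integrable N (\<lambda>\<omega>. (V \<omega>)\<^sup>2)"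
  using centered_normal_rv_char(1)[OF prob_space_axioms gspace_normal] .

lemma gspace_prod_integrable:
  assumes "U \<in> gspace" "V \<in> gspace"
  shows "integrable N (\<lambda>\<omega>. U \<omega> * V \<omega>)"
proof (rule Bochner_Integration.integrable_bound)
  show "integrable N (\<lambda>\<omega>. (U \<omega>)\<^sup>2 + (V \<omega>)\<^sup>2)" using assms gspace_square_integrable by simp
  show "(\<lambda>\<omega>. U \<omega> * V \<omega>) \<in> borel_measurable N" using assms gspace_measurable by simp
  have "\<bar>u * v\<bar> \<le> u\<^sup>2 + v\<^sup>2" for u v :: real
  proof -
    have "2 * (\<bar>u\<bar> * \<bar>v\<bar>) \<le> u\<^sup>2 + v\<^sup>2" using sum_squares_bound[of "\<bar>u\<bar>" "\<bar>v\<bar>"] by (simp add: mult.assoc)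
    moreover have "0 \<le> \<bar>u\<bar> * \<bar>v\<bar>" by simp
    ultimately show ?thesis unfolding abs_mult by linarith
  qed
  then show "AE \<omega> in N. norm (U \<omega> * V \<omega>) \<le> norm ((U \<omega>)\<^sup>2 + (V \<omega>)\<^sup>2)" by auto
qed

definition br :: "real \<Rightarrow> 'b \<Rightarrow> real" where "br t \<omega> = W t \<omega> - t * W 1 \<omega>"

lemma br_gspace: "0 \<le> t \<Longrightarrow> br t \<in> gspace"
  unfolding br_def[abs_def] by (intro gspace_diff gspace_scale gspace_W) auto

lemma br_measurable[measurable]: "0 \<le> t \<Longrightarrow> br t \<in> borel_measurable N"
  using br_gspace gspace_measurable by blast

lemma br_continuous: "\<omega> \<in> space N \<Longrightarrow> continuous_on {0..1} (\<lambda>t. br t \<omega>)"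
  unfolding br_def by (intro continuous_intros continuous_on_subset[OF W_continuous]) auto

definition bcov :: "real \<Rightarrow> real \<Rightarrow> real" where "bcov T t = cv T t - t * cv T 1"

lemma bcov: "0 \<le> T \<Longrightarrow> 0 \<le> t \<Longrightarrow> (\<integral>\<omega>. W T \<omega> * br t \<omega> \<partial>N) = bcov T t"
proof -
  assume *: "0 \<le> T" "0 \<le> t"
  have "(\<integral>\<omega>. W T \<omega> * br t \<omega> \<partial>N) = (\<integral>\<omega>. W T \<omega> * W t \<omega> - t * (W T \<omega> * W 1 \<omega>) \<partial>N)"
    unfolding br_def by (simp add: algebra_simps)
  also have "\<dots> = bcov T t" unfolding bcov_def using *
    by (subst Bochner_Integration.integral_diff)
       (auto intro!: gspace_prod_integrable gspace_W simp: W_cov)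
  finally show ?thesis .
qed

lemma bcov_continuous: "1 \<le> T \<Longrightarrow> continuous_on {0..1} (bcov T)"
  unfolding bcov_def[abs_def] cv_def using H by (intro continuous_intros continuous_on_powr') auto

text \<open>Subtracting the projection onto \<open>W T\<close> leaves variables uncorrelated with
  \<open>W T\<close>. The family \<open>L\<close> is the orthogonal complement of \<open>W T\<close>
  in the Gaussian span; there variances add, and so characteristic functions factorise.\<close>

lemma indep_residual:
  assumes T: "1 \<le> T"
    and S: "S \<in> sigma_sets (space N) {space N \<inter> (\<Inter>k\<in>K. (\<lambda>\<omega>. br k \<omega> - bcov T k / cv T T * W T \<omega>) -` A k) | K A.
        finite K \<and> K \<subseteq> {0..1} \<and> (\<forall>k\<in>K. A k \<in> sets borel)}"
    and B: "B \<in> sets borel"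
  shows "measure N (S \<inter> (W T -` B \<inter> space N)) = measure N S * measure N (W T -` B \<inter> space N)"
proof (rule indep_by_characteristic[where L = "{V\<in>gspace. (\<integral>\<omega>. W T \<omega> * V \<omega> \<partial>N) = 0}", OF prob_space_axioms _ _ _ _ _ _ S B])
  have T0: "0 \<le> T" using T by simp
  have cT: "cv T T > 0" using T by (simp add: cv_def)
  show WT[measurable]: "W T \<in> borel_measurable N" using T by (intro W_measurable) simp
  show "(\<lambda>\<omega>. br k \<omega> - bcov T k / cv T T * W T \<omega>) \<in> borel_measurable N" if "k \<in> {0..1}" for k
  proof -
    have [measurable]: "br k \<in> borel_measurable N" using that by (intro br_measurable) simp
    show ?thesis by measurable
  qed
  show "(\<lambda>\<omega>. 0) \<in> {V\<in>gspace. (\<integral>\<omega>. W T \<omega> * V \<omega> \<partial>N) = 0}" using gspace.zero by simp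
  show "V \<in> borel_measurable N" if "V \<in> {V\<in>gspace. (\<integral>\<omega>. W T \<omega> * V \<omega> \<partial>N) = 0}" for V using that gspace_measurable[of V] by blast
  show "(\<lambda>\<omega>. V \<omega> + v * (br k \<omega> - bcov T k / cv T T * W T \<omega>)) \<in> {V\<in>gspace. (\<integral>\<omega>. W T \<omega> * V \<omega> \<partial>N) = 0}"
    if V: "V \<in> {V\<in>gspace. (\<integral>\<omega>. W T \<omega> * V \<omega> \<partial>N) = 0}" and k: "k \<in> {0..1}" for V k v
  proof -
    have g: "(\<lambda>\<omega>. V \<omega> + v * (br k \<omega> - bcov T k / cv T T * W T \<omega>)) \<in> gspace"
      using V k T by (intro gspace_add gspace_scale gspace_diff br_gspace gspace_W) auto
    have i: "integrable N (\<lambda>\<omega>. W T \<omega> * V \<omega>)" "integrable N (\<lambda>\<omega>. W T \<omega> * br k \<omega>)" "integrable N (\<lambda>\<omega>. W T \<omega> * W T \<omega>)"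
      using V k T by (auto intro!: gspace_prod_integrable gspace_W br_gspace)
    have "(\<integral>\<omega>. W T \<omega> * (V \<omega> + v * (br k \<omega> - bcov T k / cv T T * W T \<omega>)) \<partial>N)
      = (\<integral>\<omega>. W T \<omega> * V \<omega> + (v * (W T \<omega> * br k \<omega>) - v * bcov T k / cv T T * (W T \<omega> * W T \<omega>)) \<partial>N)"
      by (simp add: algebra_simps)
    also have "\<dots> = (\<integral>\<omega>. W T \<omega> * V \<omega> \<partial>N) + (v * (\<integral>\<omega>. W T \<omega> * br k \<omega> \<partial>N) - v * bcov T k / cv T T * (\<integral>\<omega>. W T \<omega> * W T \<omega> \<partial>N))"
      using i by simp
    also have "\<dots> = 0" using V k T cT by (simp add: bcov W_cov)
    finally show ?thesis using g by simp
  qed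
  show "(CLINT \<omega>|N. iexp (u * W T \<omega>) * iexp (V \<omega>)) = (CLINT \<omega>|N. iexp (u * W T \<omega>)) * (CLINT \<omega>|N. iexp (V \<omega>))"
    if V: "V \<in> {V\<in>gspace. (\<integral>\<omega>. W T \<omega> * V \<omega> \<partial>N) = 0}" for V u
  proof -
    have gW: "(\<lambda>\<omega>. u * W T \<omega>) \<in> gspace" using T by (intro gspace_scale gspace_W) auto
    have gV: "V \<in> gspace" using V by simp
    have gA: "(\<lambda>\<omega>. u * W T \<omega> + V \<omega>) \<in> gspace" using gW gV by (rule gspace_add)
    note ch = centered_normal_rv_char(2)[OF prob_space_axioms gspace_normal]
    have i: "integrable N (\<lambda>\<omega>. (u * W T \<omega>)\<^sup>2)" "integrable N (\<lambda>\<omega>. W T \<omega> * V \<omega>)" "integrable N (\<lambda>\<omega>. (V \<omega>)\<^sup>2)"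
      using gW gV T by (auto intro!: gspace_prod_integrable gspace_W gspace_square_integrable)
    have "(\<integral>\<omega>. (u * W T \<omega> + V \<omega>)\<^sup>2 \<partial>N) = (\<integral>\<omega>. (u * W T \<omega>)\<^sup>2 + (2 * u * (W T \<omega> * V \<omega>) + (V \<omega>)\<^sup>2) \<partial>N)"
      by (simp add: power2_sum algebra_simps)
    also have "\<dots> = (\<integral>\<omega>. (u * W T \<omega>)\<^sup>2 \<partial>N) + (2 * u * (\<integral>\<omega>. W T \<omega> * V \<omega> \<partial>N) + (\<integral>\<omega>. (V \<omega>)\<^sup>2 \<partial>N))"
      using i by (simp add: power_mult_distrib)
    also have "\<dots> = (\<integral>\<omega>. (u * W T \<omega>)\<^sup>2 \<partial>N) + (\<integral>\<omega>. (V \<omega>)\<^sup>2 \<partial>N)" using V by simp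
    finally have sq: "(\<integral>\<omega>. (u * W T \<omega> + V \<omega>)\<^sup>2 \<partial>N) = (\<integral>\<omega>. (u * W T \<omega>)\<^sup>2 \<partial>N) + (\<integral>\<omega>. (V \<omega>)\<^sup>2 \<partial>N)" .
    have "(CLINT \<omega>|N. iexp (u * W T \<omega>) * iexp (V \<omega>)) = (CLINT \<omega>|N. iexp (u * W T \<omega> + V \<omega>))"
      by (simp add: exp_add algebra_simps)
    also have "\<dots> = complex_of_real (exp (- (\<integral>\<omega>. (u * W T \<omega> + V \<omega>)\<^sup>2 \<partial>N) / 2))" by (rule ch[OF gA])
    also have "\<dots> = complex_of_real (exp (- (\<integral>\<omega>. (u * W T \<omega>)\<^sup>2 \<partial>N) / 2)) * complex_of_real (exp (- (\<integral>\<omega>. (V \<omega>)\<^sup>2 \<partial>N) / 2))"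
      unfolding sq by (simp add: add_divide_distrib exp_add[symmetric] flip: of_real_mult)
    finally show ?thesis unfolding ch[OF gW] ch[OF gV] .
  qed
qed

text \<open>For \<open>T \<ge> 1\<close> the variance is at least 1, which bounds the normal density
  by 1.\<close>

lemma W_small_interval:
  assumes T: "1 \<le> T" and ab: "a \<le> b"
  shows "measure N (W T -` {a..<b} \<inter> space N) \<le> b - a"
proof -
  have T0: "0 \<le> T" using T by simp
  have n: "centered_normal_rv N (W T)" using gspace_normal[OF gspace_W[OF T0]] .
  have v: "(\<integral>\<omega>. (W T \<omega>)\<^sup>2 \<partial>N) = T powr (2*H)" using W_cov[OF T0 T0] by (simp add: cv_def power2_eq_square)
  have v1: "1 \<le> T powr (2*H)" using T H by (simp add: ge_one_powr_ge_zero)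
  have "\<not> (AE \<omega> in N. W T \<omega> = 0)"
  proof
    assume "AE \<omega> in N. W T \<omega> = 0"
    then have "(\<integral>\<omega>. (W T \<omega>)\<^sup>2 \<partial>N) = 0" by (intro integral_eq_zero_AE) auto
    then show False using v v1 by simp
  qed
  then obtain \<sigma> where \<sigma>: "\<sigma> > 0" and D: "distributed N lborel (W T) (normal_density 0 \<sigma>)"
    using n unfolding centered_normal_rv_def by auto
  have "expectation (W T) = 0" using normal_distributed_expectation[OF \<sigma> D] .
  then have "\<sigma>\<^sup>2 = T powr (2*H)" using normal_distributed_variance[OF \<sigma> D] v by simp
  then have s1: "1 \<le> \<sigma>\<^sup>2" using v1 by simp
  have "1 \<le> 2 * pi * \<sigma>\<^sup>2" using s1 pi_gt3 mult_mono[of 1 "2*pi" 1 "\<sigma>\<^sup>2"] by simp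
  then have "1 \<le> sqrt (2 * pi * \<sigma>\<^sup>2)" by simp
  then have nd: "normal_density 0 \<sigma> x \<le> 1" for x
    unfolding normal_density_def by (intro mult_le_one) (auto simp: divide_le_eq_1)
  have "emeasure N (W T -` {a..<b} \<inter> space N) = (\<integral>\<^sup>+x. ennreal (normal_density 0 \<sigma> x) * indicator {a..<b} x \<partial>lborel)"
    by (rule distributed_emeasure[OF D]) simp
  also have "\<dots> \<le> (\<integral>\<^sup>+x. indicator {a..<b} x \<partial>lborel)"
    using nd by (intro nn_integral_mono) (auto simp: indicator_def ennreal_le_1)
  also have "\<dots> = ennreal (b - a)" using ab by simp
  finally show ?thesis using ab by (simp add: emeasure_eq_measure)
qed

text \<open>Countable suprema are measurable, so maxima over intervals are taken over rationals. The
  interval must have positive length: a single irrational point contains no rational.\<close>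

lemma cSUP_rational_interval:
  fixes f :: "real \<Rightarrow> real"
  assumes "p < r" and f: "continuous_on {p..r} f" and m: "t \<in> {p..r}" "\<And>s. s \<in> {p..r} \<Longrightarrow> f s \<le> f t"
  shows "(SUP s\<in>{p..r} \<inter> \<rat>. f s) = f t"
proof -
  obtain x where "x \<in> \<rat>" "p < x" "x < r" using Rats_dense_in_real[OF \<open>p < r\<close>] by blast
  then have ne: "{p..r} \<inter> \<rat> \<noteq> {}" by (intro ex_in_conv[THEN iffD1] exI[of _ x]) auto
  show ?thesis
  proof (rule antisym)
    show "(SUP s\<in>{p..r} \<inter> \<rat>. f s) \<le> f t" using ne m by (intro cSUP_least) auto
    show "f t \<le> (SUP s\<in>{p..r} \<inter> \<rat>. f s)"
    proof (rule field_le_epsilon)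
      fix e :: real assume "0 < e"
      then obtain d where d: "0 < d" "\<And>s. s \<in> {p..r} \<Longrightarrow> \<bar>s - t\<bar> < d \<Longrightarrow> \<bar>f s - f t\<bar> < e"
        using f m(1) unfolding continuous_on_iff dist_real_def by metis
      have "max p (t - d) < min r (t + d)" using d(1) m(1) \<open>p < r\<close> by auto
      then obtain s where s: "s \<in> \<rat>" "max p (t - d) < s" "s < min r (t + d)" using Rats_dense_in_real by blast
      then have "\<bar>f s - f t\<bar> < e" by (intro d(2)) auto
      moreover have "f s \<le> (SUP s\<in>{p..r} \<inter> \<rat>. f s)"
        using s m by (intro cSUP_upper) (auto intro!: bdd_aboveI[of _ "f t"])
      ultimately show "f t \<le> (SUP s\<in>{p..r} \<inter> \<rat>. f s) + e" by linarith
    qed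
  qed
qed

text \<open>With \<open>a\<close> and \<open>a'\<close> equal to 1 or -1 this describes a tie of
  \<open>\<bar>br\<bar>\<close> between two intervals. Signs are kept as factors because
  \<open>a * br t\<close> is affine in \<open>W T\<close> once the residual is fixed, whereas the
  absolute value is not.\<close>

definition common_max :: "real \<Rightarrow> real \<Rightarrow> real \<Rightarrow> real \<Rightarrow> real \<Rightarrow> real \<Rightarrow> 'b \<Rightarrow> bool" where
  "common_max p r a p' r' a' \<omega> \<longleftrightarrow> (\<exists>t\<in>{p..r}. \<exists>t'\<in>{p'..r'}. a * br t \<omega> = a' * br t' \<omega> \<and>
     (\<forall>s\<in>{p..r}. a * br s \<omega> \<le> a * br t \<omega>) \<and> (\<forall>s\<in>{p'..r'}. a' * br s \<omega> \<le> a' * br t' \<omega>))"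

text \<open>By the gap, the difference of the two maxima is strictly increasing in the value
  \<open>z\<close> of \<open>W T\<close>, so a given residual allows a tie for at most one
  \<open>z\<close>. Conditioning is replaced by cutting the line into cells of length
  \<open>1 / Suc n\<close>: the cell of the sign change is a function of the residual, and
  \<open>W T\<close>, independent of it, falls into that cell with probability at most
  \<open>1 / Suc n\<close>.\<close>

lemma no_common_max:
  assumes T: "1 \<le> T" and pr: "0 \<le> p" "p < r" "r \<le> 1" and pr': "0 \<le> p'" "p' < r'" "r' \<le> 1"
    and gap: "\<alpha>' < \<alpha>" "\<And>t. t \<in> {p..r} \<Longrightarrow> \<alpha> \<le> a * bcov T t" "\<And>t. t \<in> {p'..r'} \<Longrightarrow> a' * bcov T t \<le> \<alpha>'"
  shows "AE \<omega> in N. \<not> common_max p r a p' r' a' \<omega>"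
proof -
  have T0: "0 \<le> T" using T by simp
  have cT: "cv T T > 0" using T by (simp add: cv_def)
  define b where "b t = bcov T t / cv T T" for t
  define Y where "Y t \<omega> = br t \<omega> - b t * W T \<omega>" for t \<omega>
  define \<E> where "\<E> = {space N \<inter> (\<Inter>k\<in>K. Y k -` A k) | K A. finite K \<and> K \<subseteq> {0..1} \<and> (\<forall>k\<in>K. A k \<in> sets borel)}"
  define F where "F = sigma (space N) \<E>"
  have Esub: "\<E> \<subseteq> Pow (space N)" unfolding \<E>_def by auto
  have sF: "space F = space N" "sets F = sigma_sets (space N) \<E>" unfolding F_def using Esub by auto
  have Ym: "Y t \<in> borel_measurable F" if t: "t \<in> {0..1}" for t
  proof (rule measurableI)
    fix A :: "real set" assume A: "A \<in> sets borel"
    have "Y t -` A \<inter> space F = space N \<inter> (\<Inter>k\<in>{t}. Y k -` A)" unfolding sF by auto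
    also have "\<dots> \<in> \<E>" unfolding \<E>_def using A t by (intro CollectI exI[of _ "{t}"] exI[of _ "\<lambda>_. A"]) auto
    finally show "Y t -` A \<inter> space F \<in> sets F" unfolding sF by (rule sigma_sets.Basic)
  qed auto
  have YmN: "Y t \<in> borel_measurable N" if t: "t \<in> {0..1}" for t
  proof -
    have [measurable]: "br t \<in> borel_measurable N" "W T \<in> borel_measurable N" using t T by (auto intro: br_measurable W_measurable)
    show ?thesis unfolding Y_def by measurable
  qed
  have FN: "sets F \<subseteq> sets N"
  proof -
    have "\<E> \<subseteq> sets N"
    proof
      fix e assume "e \<in> \<E>"
      then obtain K A where K: "e = space N \<inter> (\<Inter>k\<in>K. Y k -` A k)" "finite K" "K \<subseteq> {0..1}" "\<forall>k\<in>K. A k \<in> sets borel"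
        unfolding \<E>_def by blast
      have "{\<omega>\<in>space N. \<forall>k\<in>K. Y k \<omega> \<in> A k} \<in> sets N"
      proof (rule sets.sets_Collect_finite_All[OF _ \<open>finite K\<close>])
        fix k assume "k \<in> K"
        then have "Y k -` A k \<inter> space N \<in> sets N" using YmN K by (intro measurable_sets[of _ _ borel]) auto
        then show "{\<omega>\<in>space N. Y k \<omega> \<in> A k} \<in> sets N" by (simp add: vimage_def Collect_conj_eq Int_commute)
      qed
      also have "{\<omega>\<in>space N. \<forall>k\<in>K. Y k \<omega> \<in> A k} = e" using K by auto
      finally show "e \<in> sets N" .
    qed
    then show ?thesis unfolding sF by (rule sets.sigma_sets_subset)
  qed
  \<comment> \<open>The maxima that would result if \<open>W T\<close> took the value
    \<open>z\<close> while the residual stayed the same.\<close>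
  define D0 where "D0 z \<omega> = (SUP t\<in>{p..r} \<inter> \<rat>. a * (Y t \<omega> + b t * z))" for z \<omega>
  define D1 where "D1 z \<omega> = (SUP t\<in>{p'..r'} \<inter> \<rat>. a' * (Y t \<omega> + b t * z))" for z \<omega>
  have bcont: "continuous_on {0..1} b"
    unfolding b_def[abs_def] using cT by (intro continuous_intros bcov_continuous T) auto
  have cont: "continuous_on {0..1} (\<lambda>t. c * (Y t \<omega> + b t * z))" if "\<omega> \<in> space N" for \<omega> z c
    unfolding Y_def using that by (intro continuous_intros br_continuous bcont)
  have bdd: "bdd_above ((\<lambda>t. c * (Y t \<omega> + b t * z)) ` ({u..v} \<inter> \<rat>))" if "\<omega> \<in> space N" "0 \<le> u" "v \<le> 1" for \<omega> z c u v
  proof -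
    have "compact ((\<lambda>t. c * (Y t \<omega> + b t * z)) ` {0..1})"
      using cont[OF that(1)] by (intro compact_continuous_image) auto
    then have "bdd_above ((\<lambda>t. c * (Y t \<omega> + b t * z)) ` {0..1})" by (intro bounded_imp_bdd_above compact_imp_bounded)
    then show ?thesis by (rule bdd_above_mono) (use that in auto)
  qed
  have ne: "{u..v} \<inter> \<rat> \<noteq> {}" if "u < v" for u v :: real
  proof -
    obtain x where "x \<in> \<rat>" "u < x" "x < v" using Rats_dense_in_real[OF \<open>u < v\<close>] by blast
    then show ?thesis by (intro ex_in_conv[THEN iffD1] exI[of _ x]) auto
  qed
  have Dm[measurable]: "D0 z \<in> borel_measurable F" "D1 z \<in> borel_measurable F" for z
  proof -
    have "countable (\<rat> :: real set)" by (rule countable_rat)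
    then have ct: "countable ({u..v} \<inter> \<rat>)" for u v :: real by auto
    have Ym': "(\<lambda>\<omega>. c * (Y t \<omega> + b t * z)) \<in> borel_measurable F" if "t \<in> {0..1}" for t c
      using Ym[OF that] by simp
    show "D0 z \<in> borel_measurable F" unfolding D0_def[abs_def]
      by (rule borel_measurable_cSUP[OF ct]) (use pr Ym' bdd sF in auto)
    show "D1 z \<in> borel_measurable F" unfolding D1_def[abs_def]
      by (rule borel_measurable_cSUP[OF ct]) (use pr' Ym' bdd sF in auto)
  qed
  have inc0: "D0 z \<omega> + \<alpha> / cv T T * (z' - z) \<le> D0 z' \<omega>" if w: "\<omega> \<in> space N" and "z \<le> z'" for \<omega> z z'
  proof -
    have "D0 z \<omega> \<le> D0 z' \<omega> - \<alpha> / cv T T * (z' - z)"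
      unfolding D0_def
    proof (rule cSUP_least[OF ne[OF pr(2)]])
      fix t assume t: "t \<in> {p..r} \<inter> \<rat>"
      have "\<alpha> / cv T T * (z' - z) \<le> a * b t * (z' - z)"
        using gap(2)[of t] t that cT unfolding b_def by (intro mult_right_mono) (auto simp: divide_right_mono)
      moreover have "a * (Y t \<omega> + b t * z') \<le> (SUP t\<in>{p..r} \<inter> \<rat>. a * (Y t \<omega> + b t * z'))"
        using t pr by (intro cSUP_upper bdd w) auto
      ultimately show "a * (Y t \<omega> + b t * z) \<le> (SUP t\<in>{p..r} \<inter> \<rat>. a * (Y t \<omega> + b t * z')) - \<alpha> / cv T T * (z' - z)"
        by (simp add: algebra_simps)
    qed
    then show ?thesis by linarith
  qed
  have inc1: "D1 z' \<omega> \<le> D1 z \<omega> + \<alpha>' / cv T T * (z' - z)" if w: "\<omega> \<in> space N" and "z \<le> z'" for \<omega> z z'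
    unfolding D1_def
  proof (rule cSUP_least[OF ne[OF pr'(2)]])
    fix t assume t: "t \<in> {p'..r'} \<inter> \<rat>"
    have "a' * b t * (z' - z) \<le> \<alpha>' / cv T T * (z' - z)"
      using gap(3)[of t] t that cT unfolding b_def by (intro mult_right_mono) (auto simp: divide_right_mono)
    moreover have "a' * (Y t \<omega> + b t * z) \<le> (SUP t\<in>{p'..r'} \<inter> \<rat>. a' * (Y t \<omega> + b t * z))"
      using t pr' by (intro cSUP_upper bdd w) auto
    ultimately show "a' * (Y t \<omega> + b t * z') \<le> (SUP t\<in>{p'..r'} \<inter> \<rat>. a' * (Y t \<omega> + b t * z)) + \<alpha>' / cv T T * (z' - z)"
      by (simp add: algebra_simps)
  qed
  define D where "D z \<omega> = D0 z \<omega> - D1 z \<omega>" for z \<omega>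
  have Dm'[measurable]: "D z \<in> borel_measurable F" for z unfolding D_def[abs_def] by measurable
  have inc: "D z \<omega> + (\<alpha> - \<alpha>') / cv T T * (z' - z) \<le> D z' \<omega>" if "\<omega> \<in> space N" "z \<le> z'" for \<omega> z z'
    using inc0[OF that] inc1[OF that] unfolding D_def by (simp add: diff_divide_distrib algebra_simps)
  have mono: "D z \<omega> \<le> D z' \<omega>" if "\<omega> \<in> space N" "z \<le> z'" for \<omega> z z'
  proof -
    have "0 \<le> (\<alpha> - \<alpha>') / cv T T * (z' - z)" using gap(1) cT that by simp
    then show ?thesis using inc[OF that] by linarith
  qed
  have strict: "D z \<omega> < D z' \<omega>" if "\<omega> \<in> space N" "z < z'" for \<omega> z z'
  proof -
    have "0 < (\<alpha> - \<alpha>') / cv T T * (z' - z)" using gap(1) cT that by simp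
    then show ?thesis using inc[of \<omega> z z'] that by linarith
  qed
  have D0: "D (W T \<omega>) \<omega> = 0" if w: "\<omega> \<in> space N" and cm: "common_max p r a p' r' a' \<omega>" for \<omega>
  proof -
    obtain t t' where t: "t \<in> {p..r}" "t' \<in> {p'..r'}" "a * br t \<omega> = a' * br t' \<omega>"
      "\<And>s. s \<in> {p..r} \<Longrightarrow> a * br s \<omega> \<le> a * br t \<omega>" "\<And>s. s \<in> {p'..r'} \<Longrightarrow> a' * br s \<omega> \<le> a' * br t' \<omega>"
      using cm unfolding common_max_def by blast
    have "D0 (W T \<omega>) \<omega> = (SUP s\<in>{p..r} \<inter> \<rat>. a * br s \<omega>)" unfolding D0_def Y_def by simp
    also have "\<dots> = a * br t \<omega>"
      by (rule cSUP_rational_interval) (use pr t in \<open>auto intro!: continuous_intros continuous_on_subset[OF br_continuous[OF w]]\<close>)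
    finally have 1: "D0 (W T \<omega>) \<omega> = a * br t \<omega>" .
    have "D1 (W T \<omega>) \<omega> = (SUP s\<in>{p'..r'} \<inter> \<rat>. a' * br s \<omega>)" unfolding D1_def Y_def by simp
    also have "\<dots> = a' * br t' \<omega>"
      by (rule cSUP_rational_interval) (use pr' t in \<open>auto intro!: continuous_intros continuous_on_subset[OF br_continuous[OF w]]\<close>)
    finally show ?thesis using 1 t(3) unfolding D_def by simp
  qed
  \<comment> \<open>The sign change lies in cell \<open>j\<close>. With one weak and one strict
    inequality a monotone function changes sign in at most one cell, so these events are disjoint in
    \<open>j\<close>.\<close>
  define Sj where "Sj n j = {\<omega>\<in>space N. D (of_int j / real (Suc n)) \<omega> \<le> 0 \<and> 0 < D (of_int (j+1) / real (Suc n)) \<omega>}" for n and j :: int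
  define Ej where "Ej n j = Sj n j \<inter> (W T -` {of_int j / real (Suc n)..<of_int (j+1) / real (Suc n)} \<inter> space N)" for n j
  have SF: "Sj n j \<in> sets F" for n j
  proof -
    have "{\<omega>\<in>space F. D (of_int j / real (Suc n)) \<omega> \<le> 0 \<and> 0 < D (of_int (j+1) / real (Suc n)) \<omega>} \<in> sets F" by measurable
    then show ?thesis unfolding Sj_def sF .
  qed
  have SN[measurable]: "Sj n j \<in> sets N" for n j using SF FN by blast
  have EN[measurable]: "Ej n j \<in> sets N" for n j 
  proof -
    have [measurable]: "W T \<in> borel_measurable N" using T0 by (rule W_measurable)
    show ?thesis unfolding Ej_def by measurable
  qed
  have disjS: "disjoint_family_on (Sj n) UNIV" for n
  proof (unfold disjoint_family_on_def, intro ballI impI)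
    have *: False if "i < j" "\<omega> \<in> Sj n i" "\<omega> \<in> Sj n j" for i j \<omega>
    proof -
      have "D (of_int (i+1) / real (Suc n)) \<omega> \<le> D (of_int j / real (Suc n)) \<omega>"
        using that by (intro mono divide_right_mono) (auto simp: Sj_def)
      then show False using that unfolding Sj_def by auto
    qed
    fix i j :: int assume "i \<noteq> j"
    then show "Sj n i \<inter> Sj n j = {}" using *[of i j] *[of j i] by (cases i j rule: linorder_cases) auto
  qed
  then have disjE: "disjoint_family_on (Ej n) UNIV" for n unfolding disjoint_family_on_def Ej_def by blast
  have PE: "emeasure N (Ej n j) \<le> ennreal (1 / real (Suc n)) * emeasure N (Sj n j)" for n j
  proof -
    have "measure N (Ej n j) = measure N (Sj n j) * measure N (W T -` {of_int j / real (Suc n)..<of_int (j+1) / real (Suc n)} \<inter> space N)"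
      unfolding Ej_def
      by (rule indep_residual[OF T]) (use SF[of n j] in \<open>auto simp: sF \<E>_def Y_def[abs_def] b_def\<close>)
    also have "\<dots> \<le> measure N (Sj n j) * (of_int (j+1) / real (Suc n) - of_int j / real (Suc n))"
      by (intro mult_left_mono W_small_interval T) (auto simp: divide_right_mono)
    also have "of_int (j+1) / real (Suc n) - of_int j / real (Suc n) = 1 / real (Suc n)" by (simp flip: diff_divide_distrib)
    finally show ?thesis unfolding emeasure_eq_measure
      by (subst ennreal_mult[symmetric]) (auto simp: mult.commute intro!: ennreal_leI)
  qed
  have UE[measurable]: "(\<Union>j. Ej n j) \<in> sets N" for n by measurable
  have IE: "(\<Inter>n. \<Union>j. Ej n j) \<in> sets N" by measurable
  have PU: "emeasure N (\<Union>j. Ej n j) \<le> ennreal (1 / real (Suc n))" for n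
  proof -
    have "emeasure N (\<Union>j. Ej n j) = (\<integral>\<^sup>+j. emeasure N (Ej n j) \<partial>count_space UNIV)"
      by (rule emeasure_UN_countable[OF _ _ disjE]) auto
    also have "\<dots> \<le> (\<integral>\<^sup>+j. ennreal (1 / real (Suc n)) * emeasure N (Sj n j) \<partial>count_space UNIV)"
      by (intro nn_integral_mono PE)
    also have "\<dots> = ennreal (1 / real (Suc n)) * (\<integral>\<^sup>+j. emeasure N (Sj n j) \<partial>count_space UNIV)"
      by (rule nn_integral_cmult) auto
    also have "(\<integral>\<^sup>+j. emeasure N (Sj n j) \<partial>count_space UNIV) = emeasure N (\<Union>j. Sj n j)"
      by (rule emeasure_UN_countable[OF _ _ disjS, symmetric]) auto
    also have "ennreal (1 / real (Suc n)) * emeasure N (\<Union>j. Sj n j) \<le> ennreal (1 / real (Suc n)) * 1"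
      by (intro mult_left_mono emeasure_le_1) simp
    finally show ?thesis by simp
  qed
  have sub: "\<omega> \<in> (\<Inter>n. \<Union>j. Ej n j)" if w: "\<omega> \<in> space N" and cm: "common_max p r a p' r' a' \<omega>" for \<omega>
  proof
    fix n
    define j where "j = \<lfloor>W T \<omega> * real (Suc n)\<rfloor>"
    have "of_int j \<le> W T \<omega> * real (Suc n)" "W T \<omega> * real (Suc n) < of_int (j + 1)" unfolding j_def by linarith+
    then have j: "of_int j / real (Suc n) \<le> W T \<omega>" "W T \<omega> < of_int (j + 1) / real (Suc n)"
      by (simp_all only: pos_divide_le_eq pos_less_divide_eq of_nat_0_less_iff zero_less_Suc)
    have "D (of_int j / real (Suc n)) \<omega> \<le> 0" using mono[OF w j(1)] D0[OF w cm] by simp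
    moreover have "0 < D (of_int (j+1) / real (Suc n)) \<omega>" using strict[OF w j(2)] D0[OF w cm] by simp
    ultimately have "\<omega> \<in> Ej n j" unfolding Ej_def Sj_def using w j by auto
    then show "\<omega> \<in> (\<Union>j. Ej n j)" by blast
  qed
  have "emeasure N (\<Inter>n. \<Union>j. Ej n j) = 0"
  proof -
    have le: "emeasure N (\<Inter>n. \<Union>j. Ej n j) \<le> 0 + ennreal e" if "0 < e" for e
    proof -
      obtain n where n: "1 / real (Suc n) < e" using nat_approx_posE[OF \<open>0 < e\<close>] by blast
      have "emeasure N (\<Inter>n. \<Union>j. Ej n j) \<le> emeasure N (\<Union>j. Ej n j)" by (intro emeasure_mono INT_lower UE) simp
      also have "\<dots> \<le> ennreal e" using PU[of n] n by (meson ennreal_leI less_imp_le order_trans)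
      finally show ?thesis by simp
    qed
    have "emeasure N (\<Inter>n. \<Union>j. Ej n j) \<le> 0" by (rule ennreal_le_epsilon) (rule le)
    then show ?thesis by simp
  qed
  then have "(\<Inter>n. \<Union>j. Ej n j) \<in> null_sets N" by (rule null_setsI[OF _ IE])
  then show ?thesis
  proof (rule AE_I', intro subsetI)
    fix \<omega> assume "\<omega> \<in> {\<omega> \<in> space N. \<not> \<not> common_max p r a p' r' a' \<omega>}"
    then show "\<omega> \<in> (\<Inter>n. \<Union>j. Ej n j)" by (intro sub) simp_all
  qed
qed

text \<open>As \<open>T\<close> decreases to 1, the second derivative in \<open>T\<close> of the covariance with \<open>W T\<close> blows up
  through the term \<open>(T - 1) powr (2 * H)\<close>, whose coefficient is \<open>a * t - a' * t'\<close>.\<close>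

lemma bcov_nondegenerate:
  assumes t: "0 < t" "t < 1" "0 < t'" "t' < 1" and ne: "a * t \<noteq> a' * t'"
  obtains T where "1 \<le> T" "a * bcov T t \<noteq> a' * bcov T t'"
proof (rule ccontr)
  assume "\<not> thesis"
  then have eq: "\<And>T. 1 \<le> T \<Longrightarrow> a * bcov T t = a' * bcov T t'" using that by blast
  define d where "d = a * t - a' * t'"
  define be where "be = a - a' - d"
  define A where "A = a * t powr (2*H) - a' * t' powr (2*H) - d"
  \<comment> \<open>For \<open>T > 1\<close>, twice the difference of the two covariances is
    \<open>f T + A\<close>. Up to the factors \<open>2*H\<close> and \<open>2*H - 1\<close>,
    \<open>f1\<close> and \<open>f2\<close> are its first two derivatives.\<close>
  define f where "f T = be * T powr (2*H) - a * (T - t) powr (2*H) + a' * (T - t') powr (2*H) + d * (T - 1) powr (2*H)" for T :: real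
  define f1 where "f1 T = be * T powr (2*H-1) - a * (T - t) powr (2*H-1) + a' * (T - t') powr (2*H-1) + d * (T - 1) powr (2*H-1)" for T :: real
  define f2 where "f2 T = be * T powr (2*H-2) - a * (T - t) powr (2*H-2) + a' * (T - t') powr (2*H-2) + d * (T - 1) powr (2*H-2)" for T :: real
  have f0: "f T = - A" if "1 < T" for T
    using eq[of T] that t unfolding bcov_def cv_def f_def A_def be_def d_def
    by (simp add: field_simps)
  have der: "((\<lambda>T. (T - c) powr s) has_real_derivative s * (T - c) powr (s - 1)) (at T)" if "c < T" for c s T :: real
  proof -
    have "((\<lambda>T. T - c) has_real_derivative 1) (at T)" by (auto intro!: derivative_eq_intros)
    from DERIV_chain2[OF has_real_derivative_powr this, of s] that show ?thesis by simp
  qed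
  have der0: "((\<lambda>T. T powr s) has_real_derivative s * T powr (s - 1)) (at T)" if "0 < T" for s T :: real
    using der[of 0 T s] that by simp
  have df: "(f has_real_derivative 2*H * f1 T) (at T)" if "1 < T" for T
  proof -
    have "(f has_real_derivative be * (2*H * T powr (2*H-1)) - a * (2*H * (T - t) powr (2*H-1))
        + a' * (2*H * (T - t') powr (2*H-1)) + d * (2*H * (T - 1) powr (2*H-1))) (at T)"
      unfolding f_def[abs_def] by (intro DERIV_add DERIV_diff DERIV_cmult der der0) (use that t in auto)
    then show ?thesis by (simp add: f1_def algebra_simps)
  qed
  have f10: "f1 T = 0" if "1 < T" for T
  proof -
    have "(f has_real_derivative 0) (at T)"
      by (rule has_field_derivative_transform_within_open[of "\<lambda>_. - A" 0 T "{1<..}"]) (use that f0 in auto)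
    then have "2*H * f1 T = 0" using DERIV_unique[OF df[OF that]] by blast
    then show ?thesis using H by simp
  qed
  have df1: "(f1 has_real_derivative (2*H-1) * f2 T) (at T)" if "1 < T" for T
  proof -
    have "(f1 has_real_derivative be * ((2*H-1) * T powr (2*H-1-1)) - a * ((2*H-1) * (T - t) powr (2*H-1-1))
        + a' * ((2*H-1) * (T - t') powr (2*H-1-1)) + d * ((2*H-1) * (T - 1) powr (2*H-1-1))) (at T)"
      unfolding f1_def[abs_def] by (intro DERIV_add DERIV_diff DERIV_cmult der der0) (use that t in auto)
    then show ?thesis by (simp add: f2_def algebra_simps)
  qed
  have f20: "f2 T = 0" if "1 < T" for T
  proof -
    have "(f1 has_real_derivative 0) (at T)"
      by (rule has_field_derivative_transform_within_open[of "\<lambda>_. 0" 0 T "{1<..}"]) (use that f10 in auto)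
    then have "(2*H-1) * f2 T = 0" using DERIV_unique[OF df1[OF that]] by blast
    then show ?thesis using H by simp
  qed
  \<comment> \<open>This factor turns the singular term of \<open>f2\<close> into the constant
    \<open>d\<close>, while it sends all other terms to 0 at \<open>T = 1\<close>.\<close>
  define g where "g T = (be * T powr (2*H-2) - a * (T - t) powr (2*H-2) + a' * (T - t') powr (2*H-2)) * (T - 1) powr (2-2*H)" for T :: real
  have gd: "g T = - d" if "1 < T" for T
  proof -
    have "g T = (f2 T - d * (T - 1) powr (2*H-2)) * (T - 1) powr (2-2*H)" unfolding g_def f2_def by simp
    also have "\<dots> = - d * ((T - 1) powr (2*H-2) * (T - 1) powr (2-2*H))" using f20[OF that] by simp
    also have "(T - 1) powr (2*H-2) * (T - 1) powr (2-2*H) = 1" using that by (simp flip: powr_add)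
    finally show ?thesis by simp
  qed
  have "(g \<longlongrightarrow> g 1) (at_right 1)"
    unfolding g_def[abs_def] using t H
    by (intro tendsto_intros tendsto_powr') (auto simp: eventually_at_right_field intro: exI[of _ 2])
  then have "(g \<longlongrightarrow> 0) (at_right 1)" unfolding g_def using H by simp
  moreover have "eventually (\<lambda>T. g T = - d) (at_right 1)"
    unfolding eventually_at_right_field by (intro exI[of _ 2]) (use gd in auto)
  then have "(g \<longlongrightarrow> - d) (at_right 1)" by (rule tendsto_eventually)
  ultimately have "- d = 0" using tendsto_unique trivial_limit_at_right_real by blast
  then show False using ne d_def by simp
qed

lemma W_zero_AE: "AE \<omega> in N. W 0 \<omega> = 0"
proof -
  have "(\<integral>\<omega>. (W 0 \<omega>)\<^sup>2 \<partial>N) = 0" using W_cov[of 0 0] by (simp add: cv_def power2_eq_square)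
  moreover have "integrable N (\<lambda>\<omega>. (W 0 \<omega>)\<^sup>2)" by (rule gspace_square_integrable[OF gspace_W]) simp
  ultimately have "AE \<omega> in N. (W 0 \<omega>)\<^sup>2 = 0" by (subst (asm) integral_nonneg_eq_0_iff_AE) auto
  then show ?thesis by simp
qed

text \<open>Makes the maximum of \<open>\<bar>br\<bar>\<close> positive, so that it is not attained
  at the ends, where the bridge vanishes almost surely.\<close>

lemma br_half_AE: "AE \<omega> in N. br (1/2) \<omega> \<noteq> 0"
proof -
  have m[measurable]: "br (1/2) \<in> borel_measurable N" by (rule br_measurable) simp
  \<comment> \<open>With \<open>a = 1\<close> and \<open>a' = 0\<close> nondegeneracy says that
    \<open>br (1/2)\<close> is correlated with some \<open>W T\<close>, which excludes the
    degenerate law.\<close>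
  obtain T where T: "1 \<le> T" "1 * bcov T (1/2) \<noteq> 0 * bcov T (1/2)"
    by (rule bcov_nondegenerate[of "1/2" "1/2" 1 0]) auto
  have [measurable]: "W T \<in> borel_measurable N" using T by (intro W_measurable) simp
  have "\<not> (AE \<omega> in N. br (1/2) \<omega> = 0)"
  proof
    assume "AE \<omega> in N. br (1/2) \<omega> = 0"
    then have "(\<integral>\<omega>. W T \<omega> * br (1/2) \<omega> \<partial>N) = 0" by (intro integral_eq_zero_AE) auto
    then show False using bcov[of T "1/2"] T by simp
  qed
  then obtain \<sigma> where \<sigma>: "\<sigma> > 0" and D: "distributed N lborel (br (1/2)) (normal_density 0 \<sigma>)"
    using gspace_normal[OF br_gspace[of "1/2"]] unfolding centered_normal_rv_def by auto
  have "emeasure N (br (1/2) -` {0} \<inter> space N) = (\<integral>\<^sup>+x. ennreal (normal_density 0 \<sigma> x) * indicator {0} x \<partial>lborel)"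
    by (rule distributed_emeasure[OF D]) simp
  also have "\<dots> = 0" by simp
  finally have "br (1/2) -` {0} \<inter> space N \<in> null_sets N" by (intro null_setsI) auto
  then show ?thesis by (rule AE_I') auto
qed

text \<open>Countably many pairs of rational intervals and signs are excluded outside one null set.
  Two maximisers at different points would, by continuity of the covariance, lie in an excluded
  pair.\<close>

theorem unique_argmax:
  "AE \<omega> in N. \<exists>\<tau>. 0 < \<tau> \<and> \<tau> < 1 \<and> (\<forall>t\<in>{0..1}. t \<noteq> \<tau> \<longrightarrow> \<bar>br t \<omega>\<bar> < \<bar>br \<tau> \<omega>\<bar>)"
proof -
  define good where "good p r i p' r' i' \<longleftrightarrow> 0 \<le> p \<and> p < r \<and> r \<le> 1 \<and> 0 \<le> p' \<and> p' < r' \<and> r' \<le> 1 \<and>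
    (\<exists>T\<ge>1. \<exists>\<alpha> \<alpha>'. \<alpha>' < \<alpha> \<and> (\<forall>t\<in>{p..r}. \<alpha> \<le> of_int i * bcov T t) \<and> (\<forall>t\<in>{p'..r'}. of_int i' * bcov T t \<le> \<alpha>'))"
    for p r :: real and i :: int and p' r' :: real and i' :: int
  have "AE \<omega> in N. good p r i p' r' i' \<longrightarrow> \<not> common_max p r (of_int i) p' r' (of_int i') \<omega>" for p r i p' r' i'
  proof (cases "good p r i p' r' i'")
    case True
    then show ?thesis unfolding good_def using no_common_max by (auto elim!: eventually_mono)
  qed simp
  then have "AE \<omega> in N. \<forall>(p::rat) (r::rat) (i::int) (p'::rat) (r'::rat) (i'::int).
     good (of_rat p) (of_rat r) i (of_rat p') (of_rat r') i' \<longrightarrow>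
     \<not> common_max (of_rat p) (of_rat r) (of_int i) (of_rat p') (of_rat r') (of_int i') \<omega>"
    by (simp add: AE_all_countable)
  then show ?thesis using W_zero_AE br_half_AE AE_space
  proof eventually_elim
    case (elim \<omega>)
    note no = elim(1)[rule_format]
    have cont: "continuous_on {0..1} (\<lambda>t. \<bar>br t \<omega>\<bar>)" by (intro continuous_intros br_continuous elim(4))
    obtain \<tau> where \<tau>: "\<tau> \<in> {0..1}" "\<And>t. t \<in> {0..1} \<Longrightarrow> \<bar>br t \<omega>\<bar> \<le> \<bar>br \<tau> \<omega>\<bar>"
    proof -
      have "\<exists>x\<in>{0..1}. \<forall>y\<in>{0..1}. \<bar>br y \<omega>\<bar> \<le> \<bar>br x \<omega>\<bar>" by (rule continuous_attains_sup[OF _ _ cont]) auto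
      then show thesis using that by blast
    qed
    define m where "m = \<bar>br \<tau> \<omega>\<bar>"
    have m0: "0 < m" using \<tau>(2)[of "1/2"] elim(3) unfolding m_def by auto
    have b01: "br 0 \<omega> = 0" "br 1 \<omega> = 0" using elim(2) by (auto simp: br_def)
    have in01: "0 < t \<and> t < 1" if "t \<in> {0..1}" "\<bar>br t \<omega>\<bar> = m" for t
      using that b01 m0 by (cases "t = 0"; cases "t = 1") auto
    have clash: False
      if x: "0 < x" "x < 1" "of_int i * br x \<omega> = m" and y: "0 < y" "y < 1" "of_int i' * br y \<omega> = m"
        and ii: "\<bar>i\<bar> = 1" "\<bar>i'\<bar> = 1" and T: "1 \<le> T" "of_int i' * bcov T y < of_int i * bcov T x" for x y i i' T
    proof -
      \<comment> \<open>A third of the gap: each covariance may vary by \<open>g\<close> over its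
        interval and a gap of \<open>g\<close> still remains.\<close>
      define g where "g = (of_int i * bcov T x - of_int i' * bcov T y) / 3"
      have g: "0 < g" "of_int i' * bcov T y + g < of_int i * bcov T x - g" using T unfolding g_def by (auto simp: field_simps)
      have near: "\<exists>p r::rat. 0 \<le> real_of_rat p \<and> of_rat p < z \<and> z < of_rat r \<and> real_of_rat r \<le> 1 \<and>
        (\<forall>t\<in>{of_rat p..of_rat r}. \<bar>of_int j * bcov T t - of_int j * bcov T z\<bar> < g)"
        if z: "0 < z" "z < 1" for z and j :: int
      proof -
        have "continuous_on {0..1} (\<lambda>t. of_int j * bcov T t)" by (intro continuous_intros bcov_continuous T(1))
        then obtain d where d: "0 < d" "\<And>s. s \<in> {0..1} \<Longrightarrow> \<bar>s - z\<bar> < d \<Longrightarrow> \<bar>of_int j * bcov T s - of_int j * bcov T z\<bar> < g"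
          using z g(1) unfolding continuous_on_iff dist_real_def by (metis atLeastAtMost_iff less_imp_le)
        obtain p where p: "max 0 (z - d) < of_rat p" "of_rat p < z" using of_rat_dense[of "max 0 (z - d)" z] z d by auto
        obtain r where r: "z < of_rat r" "of_rat r < min 1 (z + d)" using of_rat_dense[of z "min 1 (z + d)"] z d by auto
        show ?thesis
        proof (rule exI[of _ p], rule exI[of _ r], intro conjI ballI)
          fix t assume "t \<in> {real_of_rat p..real_of_rat r}"
          then have "0 \<le> t" "t \<le> 1" "\<bar>t - z\<bar> < d" using p r unfolding atLeastAtMost_iff by linarith+
          then show "\<bar>of_int j * bcov T t - of_int j * bcov T z\<bar> < g" by (intro d(2)) auto
        qed (use p r in linarith)+
      qed
      obtain p r where pr: "0 \<le> real_of_rat p" "of_rat p < x" "x < of_rat r" "real_of_rat r \<le> 1"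
        "\<And>t. t\<in>{of_rat p..of_rat r} \<Longrightarrow> \<bar>of_int i * bcov T t - of_int i * bcov T x\<bar> < g" using near[OF x(1,2), of i] by blast
      obtain p' r' where pr': "0 \<le> real_of_rat p'" "of_rat p' < y" "y < of_rat r'" "real_of_rat r' \<le> 1"
        "\<And>t. t\<in>{of_rat p'..of_rat r'} \<Longrightarrow> \<bar>of_int i' * bcov T t - of_int i' * bcov T y\<bar> < g" using near[OF y(1,2), of i'] by blast
      have "good (of_rat p) (of_rat r) i (of_rat p') (of_rat r') i'"
        unfolding good_def
      proof (intro conjI, goal_cases)
        case 7
        show ?case
        proof (rule exI[of _ T], rule conjI[OF T(1)], rule exI[of _ "of_int i * bcov T x - g"],
            rule exI[of _ "of_int i' * bcov T y + g"], intro conjI ballI)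
        fix t assume "t \<in> {real_of_rat p..real_of_rat r}"
        from pr(5)[OF this] show "of_int i * bcov T x - g \<le> of_int i * bcov T t" by linarith
      next
        fix t assume "t \<in> {real_of_rat p'..real_of_rat r'}"
        from pr'(5)[OF this] show "of_int i' * bcov T t \<le> of_int i' * bcov T y + g" by linarith
        qed (rule g(2))
      qed (use pr pr' in linarith)+
      moreover have "common_max (of_rat p) (of_rat r) (of_int i) (of_rat p') (of_rat r') (of_int i') \<omega>"
        unfolding common_max_def
      proof (rule bexI[of _ x], rule bexI[of _ y], intro conjI ballI)
        have le: "of_int j * br s \<omega> \<le> m" if "\<bar>j\<bar> = 1" "s \<in> {0..1}" for j :: int and s
        proof -
          have "of_int j * br s \<omega> \<le> \<bar>of_int j * br s \<omega>\<bar>" by simp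
          also have "\<dots> = \<bar>br s \<omega>\<bar>" using that(1) by (simp add: abs_mult flip: of_int_abs)
          finally show ?thesis using \<tau>(2)[OF that(2)] unfolding m_def by linarith
        qed
        show "of_int i * br s \<omega> \<le> of_int i * br x \<omega>" if "s \<in> {real_of_rat p..real_of_rat r}" for s
        proof -
          have "s \<in> {0..1}" using that pr(1,4) unfolding atLeastAtMost_iff by linarith
          then show ?thesis using le[OF ii(1), of s] x(3) by linarith
        qed
        show "of_int i' * br s \<omega> \<le> of_int i' * br y \<omega>" if "s \<in> {real_of_rat p'..real_of_rat r'}" for s
        proof -
          have "s \<in> {0..1}" using that pr'(1,4) unfolding atLeastAtMost_iff by linarith
          then show ?thesis using le[OF ii(2), of s] y(3) by linarith
        qed
      qed (use x(3) y(3) pr(2,3) pr'(2,3) in auto)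
      ultimately show False using no by blast
    qed
    have "\<bar>br t \<omega>\<bar> < \<bar>br \<tau> \<omega>\<bar>" if t: "t \<in> {0..1}" "t \<noteq> \<tau>" for t
    proof (rule ccontr)
      assume "\<not> \<bar>br t \<omega>\<bar> < \<bar>br \<tau> \<omega>\<bar>"
      then have tm: "\<bar>br t \<omega>\<bar> = m" using \<tau>(2)[OF t(1)] unfolding m_def by simp
      have t1: "0 < t" "t < 1" "0 < \<tau>" "\<tau> < 1" using in01[OF t(1) tm] in01[OF \<tau>(1)] m_def by auto
      define i :: int where "i = (if 0 \<le> br \<tau> \<omega> then 1 else -1)"
      define j :: int where "j = (if 0 \<le> br t \<omega> then 1 else -1)"
      have i: "\<bar>i\<bar> = 1" "of_int i * br \<tau> \<omega> = m" unfolding i_def m_def by auto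
      have j: "\<bar>j\<bar> = 1" "of_int j * br t \<omega> = m" using tm unfolding j_def by auto
      \<comment> \<open>Both points are positive: equal signs give different products since the
        points differ, and opposite signs give products of opposite sign.\<close>
      have "of_int i * \<tau> \<noteq> of_int j * t" using t(2) t1 unfolding i_def j_def by auto
      then obtain T where T: "1 \<le> T" "of_int i * bcov T \<tau> \<noteq> of_int j * bcov T t"
        using bcov_nondegenerate[OF t1(3,4,1,2)] by metis
      then show False
        using clash[OF t1(3,4) i(2) t1(1,2) j(2) i(1) j(1) T(1)] clash[OF t1(1,2) j(2) t1(3,4) i(2) j(1) i(1) T(1)] by linarith
    qed
    then show ?case using in01[OF \<tau>(1)] m_def by auto
  qed
qed

end

section \<open>Grid functionals of a path\<close>

lemma abs_scale_diff_le:
  fixes u a b e :: real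
  assumes "u \<in> {0..1}" "\<bar>a - b\<bar> \<le> e"
  shows "\<bar>u * a - u * b\<bar> \<le> e"
proof -
  have "\<bar>u * (a - b)\<bar> \<le> 1 * e" unfolding abs_mult using assms by (intro mult_mono) auto
  then show ?thesis by (simp only: right_diff_distrib mult_1)
qed

lemma abs_diff_diff_le:
  fixes a b c d e f g :: real
  assumes "\<bar>a - b\<bar> \<le> e" "\<bar>c - d\<bar> \<le> f" "e + f \<le> g"
  shows "\<bar>a - c - (b - d)\<bar> \<le> g"
  using assms by linarith

lemma grid_point:
  fixes u :: real and K :: nat
  assumes "0 \<le> u" "u \<le> 1" "1 \<le> K"
  obtains k where "1 \<le> k" "k \<le> K" "\<bar>real k / real K - u\<bar> \<le> 1 / real K"
proof
  \<comment> \<open>The grid starts at 1, so \<open>u = 0\<close> has to be rounded up to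
    \<open>1 / K\<close>.\<close>
  define k where "k = max 1 (nat \<lceil>u * real K\<rceil>)"
  show "1 \<le> k" unfolding k_def by simp
  have "u * real K \<le> real K" using assms by (simp add: mult_left_le_one_le)
  then have "nat \<lceil>u * real K\<rceil> \<le> K" by linarith
  then show "k \<le> K" unfolding k_def using assms by simp
  have "0 \<le> u * real K" using assms by simp
  then have "\<bar>real k - u * real K\<bar> \<le> 1" unfolding k_def by (auto simp: max_def) linarith+
  moreover have "real k / real K - u = (real k - u * real K) / real K" using assms by (simp add: field_simps)
  ultimately show "\<bar>real k / real K - u\<bar> \<le> 1 / real K" using assms by (simp add: abs_divide divide_right_mono)
qed

text \<open>In relative position \<open>u\<close> the segments with moving endpoint all become the
  unit interval, and the endpoint turns into the parameter \<open>s\<close>. Uniform continuity of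
  \<open>\<Psi>\<close> on the square then handles the endpoint and the mesh together.\<close>

lemma grid_max_converges:
  fixes \<Psi> :: "real \<times> real \<Rightarrow> real" and v :: "nat \<Rightarrow> nat \<Rightarrow> real"
  assumes \<Psi>: "continuous_on ({0..1} \<times> {0..1}) \<Psi>"
    and s: "s \<longlonglongrightarrow> s0" "\<And>j. s j \<in> {0..1}" "s0 \<in> {0..1}"
    and K: "filterlim K at_top sequentially" and e: "e \<longlonglongrightarrow> 0"
    and v: "\<And>j k. 1 \<le> k \<Longrightarrow> k \<le> K j \<Longrightarrow> \<bar>v j k - \<Psi> (s j, real k / real (K j))\<bar> \<le> e j"
  shows "(\<lambda>j. Max ((\<lambda>k. \<bar>v j k\<bar>) ` {1..K j})) \<longlonglongrightarrow> Sup ((\<lambda>u. \<bar>\<Psi> (s0, u)\<bar>) ` {0..1})"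
proof (rule LIMSEQ_I)
  fix r :: real assume r: "0 < r"
  define \<epsilon> where "\<epsilon> = r / 3"
  have \<epsilon>: "0 < \<epsilon>" using r by (simp add: \<epsilon>_def)
  have c0: "continuous_on {0..1} (\<lambda>u. \<bar>\<Psi> (s0, u)\<bar>)"
    using s(3) by (intro continuous_intros continuous_on_compose2[OF \<Psi>]) auto
  obtain u0 where u0: "u0 \<in> {0..1}" "\<And>u. u \<in> {0..1} \<Longrightarrow> \<bar>\<Psi> (s0, u)\<bar> \<le> \<bar>\<Psi> (s0, u0)\<bar>"
  proof -
    have "\<exists>x\<in>{0..1}. \<forall>y\<in>{0..1}. \<bar>\<Psi> (s0, y)\<bar> \<le> \<bar>\<Psi> (s0, x)\<bar>" by (rule continuous_attains_sup[OF _ _ c0]) auto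
    then show thesis using that by blast
  qed
  have sup: "Sup ((\<lambda>u. \<bar>\<Psi> (s0, u)\<bar>) ` {0..1}) = \<bar>\<Psi> (s0, u0)\<bar>"
    by (rule cSup_eq_maximum) (use u0 in auto)
  have "uniformly_continuous_on ({0..1} \<times> {0..1}) \<Psi>"
    by (rule compact_uniformly_continuous[OF \<Psi>]) (intro compact_Times compact_Icc)
  then obtain d where d: "0 < d" "\<And>x y. x \<in> {0..1} \<times> {0..1} \<Longrightarrow> y \<in> {0..1} \<times> {0..1} \<Longrightarrow> dist x y < d \<Longrightarrow> dist (\<Psi> x) (\<Psi> y) < \<epsilon>"
    unfolding uniformly_continuous_on_def using \<epsilon> by metis
  have dd: "\<bar>\<Psi> (a, b) - \<Psi> (a', b')\<bar> < \<epsilon>" if "a \<in> {0..1}" "b \<in> {0..1}" "a' \<in> {0..1}" "b' \<in> {0..1}" "\<bar>a - a'\<bar> < d/2" "\<bar>b - b'\<bar> < d/2" for a b a' b'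
  proof -
    have "dist (a, b) (a', b') \<le> dist a a' + dist b b'"
      unfolding dist_prod_def by (simp add: sqrt_sum_squares_le_sum)
    then have "dist (a, b) (a', b') < d" using that by (simp add: dist_real_def)
    then show ?thesis using d(2)[of "(a,b)" "(a',b')"] that by (simp add: dist_real_def)
  qed
  have "eventually (\<lambda>j. \<bar>s j - s0\<bar> < d/2) sequentially"
    using tendstoD[OF s(1), of "d/2"] d(1) by (simp add: dist_real_def)
  moreover have "eventually (\<lambda>j. e j < \<epsilon>) sequentially" using order_tendstoD(2)[OF e \<epsilon>] .
  moreover have "eventually (\<lambda>j. nat \<lceil>2 / d\<rceil> + 1 \<le> K j) sequentially" using K unfolding filterlim_at_top by blast
  ultimately have "eventually (\<lambda>j. norm (Max ((\<lambda>k. \<bar>v j k\<bar>) ` {1..K j}) - Sup ((\<lambda>u. \<bar>\<Psi> (s0, u)\<bar>) ` {0..1})) < r) sequentially"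
  proof eventually_elim
    case (elim j)
    have K1: "1 \<le> K j" using elim by simp
    have "2 / d < real (K j)" using elim(3) by linarith
    then have Kd: "1 / real (K j) < d / 2" using d(1) K1 by (simp add: field_simps)
    have ne: "{1..K j} \<noteq> {}" using K1 by simp
    have up: "Max ((\<lambda>k. \<bar>v j k\<bar>) ` {1..K j}) \<le> \<bar>\<Psi> (s0, u0)\<bar> + 2 * \<epsilon>"
    proof (rule Max.boundedI)
      fix y assume "y \<in> (\<lambda>k. \<bar>v j k\<bar>) ` {1..K j}"
      then obtain k where k: "1 \<le> k" "k \<le> K j" "y = \<bar>v j k\<bar>" by auto
      have k01: "real k / real (K j) \<in> {0..1}" using k K1 by simp
      have "\<bar>\<Psi> (s j, real k / real (K j)) - \<Psi> (s0, real k / real (K j))\<bar> < \<epsilon>"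
        using s elim(1) d(1) k01 by (intro dd) auto
      moreover have "\<bar>\<Psi> (s0, real k / real (K j))\<bar> \<le> \<bar>\<Psi> (s0, u0)\<bar>" by (rule u0(2)[OF k01])
      ultimately show "y \<le> \<bar>\<Psi> (s0, u0)\<bar> + 2 * \<epsilon>" using v[OF k(1,2)] elim(2) k(3) by linarith
    qed (use ne in auto)
    obtain k where k: "1 \<le> k" "k \<le> K j" "\<bar>real k / real (K j) - u0\<bar> \<le> 1 / real (K j)"
      using grid_point[of u0 "K j"] u0(1) K1 by auto
    have k01: "real k / real (K j) \<in> {0..1}" using k K1 by simp
    have "\<bar>\<Psi> (s j, real k / real (K j)) - \<Psi> (s0, u0)\<bar> < \<epsilon>"
    proof (rule dd)
      show "\<bar>real k / real (K j) - u0\<bar> < d/2" using k(3) Kd by linarith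
    qed (use s u0(1) k01 elim(1) in auto)
    then have "\<bar>\<Psi> (s0, u0)\<bar> - 2 * \<epsilon> \<le> \<bar>v j k\<bar>" using v[OF k(1,2)] elim(2) by linarith
    also have "\<dots> \<le> Max ((\<lambda>k. \<bar>v j k\<bar>) ` {1..K j})" using k by (intro Max_ge) auto
    finally have lo: "\<bar>\<Psi> (s0, u0)\<bar> - 2 * \<epsilon> \<le> Max ((\<lambda>k. \<bar>v j k\<bar>) ` {1..K j})" .
    show ?case unfolding sup real_norm_def using up lo r unfolding \<epsilon>_def by linarith
  qed
  then show "\<exists>no. \<forall>n\<ge>no. norm (Max ((\<lambda>k. \<bar>v n k\<bar>) ` {1..K n}) - Sup ((\<lambda>u. \<bar>\<Psi> (s0, u)\<bar>) ` {0..1})) < r"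
    unfolding eventually_sequentially .
qed


text \<open>This and the next two definitions express the break and the two maxima as functionals of
  a path sampled on the grid of mesh \<open>1 / n\<close>, the form required for continuous
  mapping.\<close>

definition grid_argmax :: "nat \<Rightarrow> (real \<Rightarrow> real) \<Rightarrow> nat" where
  "grid_argmax n y = (LEAST k. 1 \<le> k \<and> k \<le> n \<and>
     \<bar>y (real k / real n) - real k / real n * y 1\<bar> = Max ((\<lambda>i. \<bar>y (real i / real n) - real i / real n * y 1\<bar>) ` {1..n}))"

definition grid_left :: "nat \<Rightarrow> (real \<Rightarrow> real) \<Rightarrow> nat \<Rightarrow> real" where
  "grid_left n y m = sqrt (real n / real m) *
     Max ((\<lambda>k. \<bar>y (real k / real n) - real k / real m * y (real m / real n)\<bar>) ` {0<..m})"

definition grid_right :: "nat \<Rightarrow> (real \<Rightarrow> real) \<Rightarrow> nat \<Rightarrow> real" where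
  "grid_right n y m = sqrt (real n / real (n - m)) *
     Max ((\<lambda>k. \<bar>y (real k / real n) - y (real m / real n) -
        real (k - m) / real (n - m) * (y 1 - y (real m / real n))\<bar>) ` {m<..n})"

lemma grid_argmax:
  assumes "1 \<le> n"
  shows "1 \<le> grid_argmax n y" "grid_argmax n y \<le> n"
    "\<And>i. 1 \<le> i \<Longrightarrow> i \<le> n \<Longrightarrow> \<bar>y (real i / real n) - real i / real n * y 1\<bar>
      \<le> \<bar>y (real (grid_argmax n y) / real n) - real (grid_argmax n y) / real n * y 1\<bar>"
proof -
  let ?f = "\<lambda>i. \<bar>y (real i / real n) - real i / real n * y 1\<bar>"
  have "Max (?f ` {1..n}) \<in> ?f ` {1..n}" using assms by (intro Max_in) auto
  then obtain k where "k \<in> {1..n}" "?f k = Max (?f ` {1..n})" by auto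
  then have "\<exists>k. 1 \<le> k \<and> k \<le> n \<and> ?f k = Max (?f ` {1..n})" by auto
  then have *: "1 \<le> grid_argmax n y \<and> grid_argmax n y \<le> n \<and> ?f (grid_argmax n y) = Max (?f ` {1..n})"
    unfolding grid_argmax_def by (rule LeastI_ex)
  then show "1 \<le> grid_argmax n y" "grid_argmax n y \<le> n" by auto
  show "?f i \<le> ?f (grid_argmax n y)" if "1 \<le> i" "i \<le> n" for i
    using * that by (auto intro!: Max_ge)
qed

context
  fixes x :: "real \<Rightarrow> real" and \<tau> :: real
  assumes x: "continuous_on {0..1} x" and \<tau>: "0 < \<tau>" "\<tau> < 1"
    and uniq: "\<And>t. t \<in> {0..1} \<Longrightarrow> t \<noteq> \<tau> \<Longrightarrow> \<bar>x t - t * x 1\<bar> < \<bar>x \<tau> - \<tau> * x 1\<bar>"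
begin

context
  fixes n :: "nat \<Rightarrow> nat" and y :: "nat \<Rightarrow> real \<Rightarrow> real" and e :: "nat \<Rightarrow> real"
  assumes n: "filterlim n at_top sequentially" "\<And>j. 1 \<le> n j"
    and e: "e \<longlonglongrightarrow> 0" and y: "\<And>j t. t \<in> {0..1} \<Longrightarrow> \<bar>y j t - x t\<bar> \<le> e j"
begin

lemma argmax_ratio_in: "real (grid_argmax (n j) (y j)) / real (n j) \<in> {0..1}"
  using grid_argmax(2)[OF n(2), of j "y j"] n(2)[of j] by simp

text \<open>Away from \<open>\<tau>\<close> the modulus of the bridge stays below its maximum by a
  fixed amount, by compactness. Path errors and grid errors smaller than this gap cannot move the
  maximiser out of the neighbourhood.\<close>

lemma argmax_ratio_converges: "(\<lambda>j. real (grid_argmax (n j) (y j)) / real (n j)) \<longlonglongrightarrow> \<tau>"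
proof (rule LIMSEQ_I)
  fix r :: real assume r: "0 < r"
  define b where "b t = \<bar>x t - t * x 1\<bar>" for t
  have bc: "continuous_on {0..1} b" unfolding b_def by (intro continuous_intros x)
  have "\<exists>g>0. \<forall>t\<in>{0..1}. r \<le> \<bar>t - \<tau>\<bar> \<longrightarrow> b t \<le> b \<tau> - g"
  proof (cases "{t\<in>{0..1}. r \<le> \<bar>t - \<tau>\<bar>} = {}")
    case True then show ?thesis by (intro exI[of _ 1]) auto
  next
    case False
    have "{t\<in>{0..1}. r \<le> \<bar>t - \<tau>\<bar>} = {0..1} \<inter> - ball \<tau> r" by (auto simp: dist_real_def abs_minus_commute)
    then have "compact {t\<in>{0..1}. r \<le> \<bar>t - \<tau>\<bar>}" by (simp only:) (intro compact_Int_closed closed_Compl open_ball compact_Icc)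
    moreover have "continuous_on {t\<in>{0..1}. r \<le> \<bar>t - \<tau>\<bar>} b" by (rule continuous_on_subset[OF bc]) blast
    ultimately have "\<exists>t0\<in>{t\<in>{0..1}. r \<le> \<bar>t - \<tau>\<bar>}. \<forall>t\<in>{t\<in>{0..1}. r \<le> \<bar>t - \<tau>\<bar>}. b t \<le> b t0"
      using False by (intro continuous_attains_sup)
    then obtain t0 where t0: "t0 \<in> {0..1}" "r \<le> \<bar>t0 - \<tau>\<bar>" "\<And>t. t \<in> {0..1} \<Longrightarrow> r \<le> \<bar>t - \<tau>\<bar> \<Longrightarrow> b t \<le> b t0"
      by blast
    have "b t0 < b \<tau>" unfolding b_def using t0 r by (intro uniq) auto
    then show ?thesis using t0(3) by (intro exI[of _ "b \<tau> - b t0"]) auto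
  qed
  then obtain g where g: "0 < g" "\<And>t. t \<in> {0..1} \<Longrightarrow> r \<le> \<bar>t - \<tau>\<bar> \<Longrightarrow> b t \<le> b \<tau> - g" by blast
  obtain d where d: "0 < d" "\<And>t. t \<in> {0..1} \<Longrightarrow> \<bar>t - \<tau>\<bar> < d \<Longrightarrow> \<bar>b t - b \<tau>\<bar> < g/2"
    using bc \<tau> g(1) unfolding continuous_on_iff dist_real_def by (metis atLeastAtMost_iff half_gt_zero less_imp_le)
  \<comment> \<open>Passing between \<open>y j\<close> and \<open>x\<close> costs
    \<open>2 * e j\<close> at each of two points, together less than \<open>g/2\<close>; the other
    half of the gap pays for replacing \<open>\<tau>\<close> by a grid point.\<close>
  have "eventually (\<lambda>j. e j < g/8) sequentially" by (rule order_tendstoD(2)[OF e]) (use g in simp)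
  moreover have "eventually (\<lambda>j. nat \<lceil>1 / d\<rceil> + 1 \<le> n j) sequentially" using n(1) unfolding filterlim_at_top by blast
  ultimately have "eventually (\<lambda>j. norm (real (grid_argmax (n j) (y j)) / real (n j) - \<tau>) < r) sequentially"
  proof eventually_elim
    case (elim j)
    have "1 / d < real (n j)" using elim(2) by linarith
    then have nd: "1 / real (n j) < d" using d(1) n(2)[of j] by (simp add: field_simps)
    have cl: "\<bar>\<bar>y j t - t * y j 1\<bar> - b t\<bar> \<le> 2 * e j" if "t \<in> {0..1}" for t
    proof -
      have "\<bar>t * y j 1 - t * x 1\<bar> \<le> e j" using y[of 1 j] by (intro abs_scale_diff_le that) auto
      then show ?thesis using y[OF that, of j] unfolding b_def by linarith
    qed
    obtain k where k: "1 \<le> k" "k \<le> n j" "\<bar>real k / real (n j) - \<tau>\<bar> \<le> 1 / real (n j)"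
      using grid_point[of \<tau> "n j"] \<tau> n(2)[of j] by auto
    have k01: "real k / real (n j) \<in> {0..1}" using k by simp
    define s where "s = real (grid_argmax (n j) (y j)) / real (n j)"
    have s01: "s \<in> {0..1}" unfolding s_def by (rule argmax_ratio_in)
    have "\<bar>y j (real k / real (n j)) - real k / real (n j) * y j 1\<bar> \<le> \<bar>y j s - s * y j 1\<bar>"
      unfolding s_def by (rule grid_argmax(3)[OF n(2) k(1,2)])
    moreover have "\<bar>b (real k / real (n j)) - b \<tau>\<bar> < g/2" using k(3) nd by (intro d(2) k01) linarith
    ultimately have "b \<tau> - g < b s" using cl[OF s01] cl[OF k01] elim(1) by linarith
    then have "\<not> r \<le> \<bar>s - \<tau>\<bar>" using g(2)[OF s01] by linarith
    then show ?case unfolding s_def real_norm_def by simp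
  qed
  then show "\<exists>no. \<forall>j\<ge>no. norm (real (grid_argmax (n j) (y j)) / real (n j) - \<tau>) < r" unfolding eventually_sequentially .
qed

lemma n_real_at_top: "filterlim (\<lambda>j. real (n j)) at_top sequentially"
  using filterlim_compose[OF filterlim_real_sequentially n(1)] .

lemma argmax_at_top: "filterlim (\<lambda>j. grid_argmax (n j) (y j)) at_top sequentially"
proof -
  have "filterlim (\<lambda>j. real (grid_argmax (n j) (y j)) / real (n j) * real (n j)) at_top sequentially"
    by (rule filterlim_tendsto_pos_mult_at_top[OF argmax_ratio_converges \<tau>(1) n_real_at_top])
  moreover have "real (grid_argmax (n j) (y j)) / real (n j) * real (n j) = real (grid_argmax (n j) (y j))" for j
    using n(2)[of j] by simp
  ultimately show ?thesis by (simp add: filterlim_sequentially_iff_filterlim_real)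
qed

lemma argmax_co_at_top: "filterlim (\<lambda>j. n j - grid_argmax (n j) (y j)) at_top sequentially"
proof -
  have "filterlim (\<lambda>j. (1 - real (grid_argmax (n j) (y j)) / real (n j)) * real (n j)) at_top sequentially"
    by (rule filterlim_tendsto_pos_mult_at_top[OF tendsto_diff[OF tendsto_const argmax_ratio_converges] _ n_real_at_top])
       (use \<tau> in auto)
  moreover have "(1 - real (grid_argmax (n j) (y j)) / real (n j)) * real (n j) = real (n j - grid_argmax (n j) (y j))" for j
    using n(2)[of j] grid_argmax(2)[OF n(2), of j "y j"] by (simp add: left_diff_distrib)
  ultimately show ?thesis by (simp add: filterlim_sequentially_iff_filterlim_real)
qed

text \<open>At relative position \<open>u\<close> in the segment from 0 to \<open>s\<close> the
  bridge is \<open>x (s * u) - u * x s\<close>, jointly continuous in \<open>s\<close> and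
  \<open>u\<close>. The prefactor is \<open>1 / sqrt\<close> of the break ratio, which stays away
  from 0 in the limit.\<close>

lemma grid_left_converges:
  "(\<lambda>j. grid_left (n j) (y j) (grid_argmax (n j) (y j))) \<longlonglongrightarrow>
     1 / sqrt \<tau> * Sup ((\<lambda>t. \<bar>x t - t / \<tau> * x \<tau>\<bar>) ` {0..\<tau>})"
proof -
  define k where "k j = grid_argmax (n j) (y j)" for j
  define s where "s j = real (k j) / real (n j)" for j
  have k1: "1 \<le> k j" "k j \<le> n j" for j unfolding k_def using grid_argmax[OF n(2)] by auto
  have s01: "s j \<in> {0..1}" for j unfolding s_def k_def by (rule argmax_ratio_in)
  have slim: "s \<longlonglongrightarrow> \<tau>" unfolding s_def k_def by (rule argmax_ratio_converges)
  let ?\<Psi> = "\<lambda>(s, u). x (s * u) - u * x s"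
  let ?v = "\<lambda>j i. y j (real i / real (n j)) - real i / real (k j) * y j (s j)"
  have "continuous_on ({0..1} \<times> {0..1}) ?\<Psi>"
    unfolding split_beta by (intro continuous_intros continuous_on_compose2[OF x]) (auto intro: mult_le_one)
  then have M: "(\<lambda>j. Max ((\<lambda>i. \<bar>?v j i\<bar>) ` {1..k j})) \<longlonglongrightarrow> Sup ((\<lambda>u. \<bar>?\<Psi> (\<tau>, u)\<bar>) ` {0..1})"
  proof (rule grid_max_converges[OF _ slim s01 _ _ ])
    show "filterlim k at_top sequentially" unfolding k_def by (rule argmax_at_top)
    show "(\<lambda>j. 2 * e j) \<longlonglongrightarrow> 0" using tendsto_mult[OF tendsto_const e, of 2] by simp
    fix j i assume i: "1 \<le> i" "i \<le> k j"
    let ?u = "real i / real (k j)"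
    have u: "?u \<in> {0..1}" using i by simp
    have su: "s j * ?u = real i / real (n j)" unfolding s_def using k1[of j] by simp
    have su1: "s j * ?u \<in> {0..1}" unfolding su using i k1[of j] by simp
    have "\<bar>y j (s j * ?u) - x (s j * ?u)\<bar> \<le> e j" by (rule y[OF su1])
    moreover have "\<bar>?u * y j (s j) - ?u * x (s j)\<bar> \<le> e j" by (rule abs_scale_diff_le[OF u y[OF s01]])
    ultimately show "\<bar>?v j i - ?\<Psi> (s j, ?u)\<bar> \<le> 2 * e j"
      unfolding case_prod_conv su by (rule abs_diff_diff_le) simp
  qed (use \<tau> in auto)
  have img: "(\<lambda>u. \<bar>?\<Psi> (\<tau>, u)\<bar>) ` {0..1} = (\<lambda>t. \<bar>x t - t / \<tau> * x \<tau>\<bar>) ` {0..\<tau>}"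
  proof -
    have eq: "{0..\<tau>} = (\<lambda>u. \<tau> * u) ` {0..1}" using \<tau> by (simp add: image_mult_atLeastAtMost)
    show ?thesis unfolding eq image_image case_prod_conv by (intro image_cong refl) (use \<tau> in simp)
  qed
  have "(\<lambda>j. 1 / sqrt (s j)) \<longlonglongrightarrow> 1 / sqrt \<tau>" using \<tau> by (intro tendsto_intros slim) auto
  from tendsto_mult[OF this M] show ?thesis unfolding img grid_left_def k_def[symmetric] s_def
    by (simp add: real_sqrt_divide atLeastSucAtMost_greaterThanAtMost[symmetric])
qed

lemma grid_right_converges:
  "(\<lambda>j. grid_right (n j) (y j) (grid_argmax (n j) (y j))) \<longlonglongrightarrow>
     1 / sqrt (1 - \<tau>) * Sup ((\<lambda>t. \<bar>(x t - x \<tau>) - (t - \<tau>) / (1 - \<tau>) * (x 1 - x \<tau>)\<bar>) ` {\<tau>..1})"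
proof -
  define k where "k j = grid_argmax (n j) (y j)" for j
  define s where "s j = real (k j) / real (n j)" for j
  define m where "m j = n j - k j" for j
  have k1: "1 \<le> k j" "k j \<le> n j" for j unfolding k_def using grid_argmax[OF n(2)] by auto
  have s01: "s j \<in> {0..1}" for j unfolding s_def k_def by (rule argmax_ratio_in)
  have slim: "s \<longlonglongrightarrow> \<tau>" unfolding s_def k_def by (rule argmax_ratio_converges)
  let ?\<Psi> = "\<lambda>(s, u). x (s + u * (1 - s)) - x s - u * (x 1 - x s)"
  let ?v = "\<lambda>j i. y j (real (k j + i) / real (n j)) - y j (s j) - real i / real (m j) * (y j 1 - y j (s j))"
  have conv01: "a + u * (1 - a) \<in> {0..1}" if "a \<in> {0..1}" "u \<in> {0..1}" for a u :: real
  proof -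
    have "u * (1 - a) \<le> 1 * (1 - a)" using that by (intro mult_right_mono) auto
    then show ?thesis using that by simp
  qed
  have "continuous_on ({0..1} \<times> {0..1}) ?\<Psi>"
    unfolding split_beta by (intro continuous_intros continuous_on_compose2[OF x]) (use conv01 in auto)
  then have M: "(\<lambda>j. Max ((\<lambda>i. \<bar>?v j i\<bar>) ` {1..m j})) \<longlonglongrightarrow> Sup ((\<lambda>u. \<bar>?\<Psi> (\<tau>, u)\<bar>) ` {0..1})"
  proof (rule grid_max_converges[OF _ slim s01 _ _ ])
    show "filterlim m at_top sequentially" unfolding m_def k_def by (rule argmax_co_at_top)
    \<comment> \<open>One error for the value inside the segment, one for the value at the break,
      and two for the increment over the whole segment.\<close>
    show "(\<lambda>j. 4 * e j) \<longlonglongrightarrow> 0" using tendsto_mult[OF tendsto_const e, of 4] by simp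
    fix j i assume i: "1 \<le> i" "i \<le> m j"
    let ?u = "real i / real (m j)"
    have u: "?u \<in> {0..1}" using i by simp
    have m0: "0 < real (m j)" "real (m j) = real (n j) - real (k j)" using i k1[of j] by (auto simp: m_def)
    have su: "s j + ?u * (1 - s j) = real (k j + i) / real (n j)"
    proof -
      have n0: "0 < real (n j)" using n(2)[of j] by simp
      then have "1 - s j = real (m j) / real (n j)" unfolding s_def m0(2) by (simp add: diff_divide_distrib)
      then have "?u * (1 - s j) = real i / real (n j)" using m0(1) by simp
      then show ?thesis unfolding s_def by (simp add: add_divide_distrib)
    qed
    have "\<bar>y j (s j + ?u * (1 - s j)) - x (s j + ?u * (1 - s j))\<bar> \<le> e j" by (rule y[OF conv01[OF s01 u]])
    moreover have ys: "\<bar>y j (s j) - x (s j)\<bar> \<le> e j" by (rule y[OF s01])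
    moreover have "\<bar>?u * (y j 1 - y j (s j)) - ?u * (x 1 - x (s j))\<bar> \<le> 2 * e j"
    proof (rule abs_scale_diff_le[OF u])
      show "\<bar>y j 1 - y j (s j) - (x 1 - x (s j))\<bar> \<le> 2 * e j" using ys y[of 1 j] by auto
    qed
    ultimately show "\<bar>?v j i - ?\<Psi> (s j, ?u)\<bar> \<le> 4 * e j"
      unfolding case_prod_conv su[symmetric] by (intro abs_diff_diff_le[where e = "2 * e j" and f = "2 * e j"] abs_diff_diff_le[where e = "e j" and f = "e j"]) simp_all
  qed (use \<tau> in auto)
  have img: "(\<lambda>u. \<bar>?\<Psi> (\<tau>, u)\<bar>) ` {0..1} = (\<lambda>t. \<bar>(x t - x \<tau>) - (t - \<tau>) / (1 - \<tau>) * (x 1 - x \<tau>)\<bar>) ` {\<tau>..1}"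
  proof -
    have eq: "{\<tau>..1} = (\<lambda>u. \<tau> + u * (1 - \<tau>)) ` {0..1}"
    proof (intro set_eqI iffI)
      fix t assume "t \<in> {\<tau>..1}"
      then show "t \<in> (\<lambda>u. \<tau> + u * (1 - \<tau>)) ` {0..1}"
        using \<tau> by (intro image_eqI[of _ _ "(t - \<tau>) / (1 - \<tau>)"]) auto
    next
      fix t assume "t \<in> (\<lambda>u. \<tau> + u * (1 - \<tau>)) ` {0..1}"
      then show "t \<in> {\<tau>..1}" using conv01[of \<tau>] \<tau> by auto
    qed
    show ?thesis unfolding eq image_image case_prod_conv by (intro image_cong refl) (use \<tau> in simp)
  qed
  have mx: "(\<lambda>i. \<bar>?v j i\<bar>) ` {1..m j} = (\<lambda>i. \<bar>y j (real i / real (n j)) - y j (s j) - real (i - k j) / real (n j - k j) * (y j 1 - y j (s j))\<bar>) ` {k j<..n j}" for j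
  proof -
    have eq: "{k j<..n j} = (\<lambda>i. k j + i) ` {1..m j}"
    proof (intro set_eqI iffI)
      fix i assume "i \<in> {k j<..n j}"
      then show "i \<in> (\<lambda>i. k j + i) ` {1..m j}" unfolding m_def by (intro image_eqI[of _ _ "i - k j"]) auto
    qed (use k1 m_def in auto)
    show ?thesis unfolding eq image_image by (intro image_cong refl) (simp add: m_def)
  qed
  have "(\<lambda>j. 1 / sqrt (1 - s j)) \<longlonglongrightarrow> 1 / sqrt (1 - \<tau>)" using \<tau> by (intro tendsto_intros slim) auto
  moreover have "1 / sqrt (1 - s j) = sqrt (real (n j) / real (n j - k j))" for j
  proof -
    have "1 - s j = real (n j - k j) / real (n j)" unfolding s_def using k1[of j] n(2)[of j] by (simp add: diff_divide_distrib)
    then show ?thesis by (simp add: real_sqrt_divide)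
  qed
  ultimately have "(\<lambda>j. sqrt (real (n j) / real (n j - k j))) \<longlonglongrightarrow> 1 / sqrt (1 - \<tau>)" by simp
  from tendsto_mult[OF this M[unfolded img mx]] show ?thesis unfolding grid_right_def k_def[symmetric] s_def .
qed

end

text \<open>A failure for \<open>d = 1 / Suc j\<close> and \<open>m = Suc j\<close>, for every
  \<open>j\<close>, would give sample sizes tending to infinity and paths converging uniformly to
  \<open>x\<close>, against the sequential limits proved before.\<close>

lemma grid_functional_limit:
  fixes g :: "real \<times> real \<times> real \<Rightarrow> real"
  assumes g: "continuous_on UNIV g" and \<epsilon>: "0 < \<epsilon>"
  shows "\<exists>d>0. \<exists>m. \<forall>n\<ge>m. \<forall>y. (\<forall>t\<in>{0..1}. \<bar>y t - x t\<bar> < d) \<longrightarrow>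
    \<bar>g (real (grid_argmax n y) / real n, grid_left n y (grid_argmax n y), grid_right n y (grid_argmax n y))
     - g (\<tau>, 1 / sqrt \<tau> * Sup ((\<lambda>t. \<bar>x t - t / \<tau> * x \<tau>\<bar>) ` {0..\<tau>}),
          1 / sqrt (1 - \<tau>) * Sup ((\<lambda>t. \<bar>(x t - x \<tau>) - (t - \<tau>) / (1 - \<tau>) * (x 1 - x \<tau>)\<bar>) ` {\<tau>..1}))\<bar> < \<epsilon>"
    (is "\<exists>d>0. \<exists>m. \<forall>n\<ge>m. \<forall>y. _ \<longrightarrow> \<bar>g (?A n y) - g ?B\<bar> < \<epsilon>")
proof (rule ccontr)
  assume neg: "\<not> ?thesis"
  define A where "A = ?A"
  define B where "B = ?B"
  define P where "P j p \<longleftrightarrow> Suc j \<le> fst p \<and> (\<forall>t\<in>{0..1}. \<bar>snd p t - x t\<bar> < 1 / real (Suc j)) \<and> \<not> \<bar>g (A (fst p) (snd p)) - g B\<bar> < \<epsilon>"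
    for j and p :: "nat \<times> (real \<Rightarrow> real)"
  have "\<exists>p. P j p" for j
  proof (rule ccontr)
    assume no: "\<nexists>p. P j p"
    have "\<bar>g (A n y) - g B\<bar> < \<epsilon>" if "Suc j \<le> n" "\<forall>t\<in>{0..1}. \<bar>y t - x t\<bar> < 1 / real (Suc j)" for n y
    proof -
      have "\<not> P j (n, y)" using no by blast
      then show ?thesis using that unfolding P_def by simp
    qed
    then have "\<exists>d>0. \<exists>m. \<forall>n\<ge>m. \<forall>y. (\<forall>t\<in>{0..1}. \<bar>y t - x t\<bar> < d) \<longrightarrow> \<bar>g (A n y) - g B\<bar> < \<epsilon>"
      by (intro exI[of _ "1 / real (Suc j)"] exI[of _ "Suc j"] conjI) simp_all
    then show False using neg unfolding A_def B_def by (rule notE[rotated])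
  qed
  then obtain p where p: "\<And>j. P j (p j)" by metis
  define n where "n j = fst (p j)" for j
  define y where "y j = snd (p j)" for j
  have ny: "Suc j \<le> n j" "\<not> \<bar>g (A (n j) (y j)) - g B\<bar> < \<epsilon>" for j using p[of j] unfolding P_def n_def y_def by auto
  have ny2: "\<bar>y j t - x t\<bar> < 1 / real (Suc j)" if "t \<in> {0..1}" for j t using p[of j] that unfolding P_def y_def by blast
  have n: "filterlim n at_top sequentially" "\<And>j. 1 \<le> n j"
  proof -
    show "filterlim n at_top sequentially"
      by (rule filterlim_at_top_mono[OF filterlim_Suc]) (use ny(1) in auto)
    show "1 \<le> n j" for j using ny(1)[of j] by simp
  qed
  have e: "(\<lambda>j. 1 / real (Suc j)) \<longlonglongrightarrow> 0" by (rule LIMSEQ_Suc[OF lim_const_over_n[of 1]])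
  have y: "\<And>j t. t \<in> {0..1} \<Longrightarrow> \<bar>y j t - x t\<bar> \<le> 1 / real (Suc j)" using ny2 less_imp_le by blast
  have "(\<lambda>j. A (n j) (y j)) \<longlonglongrightarrow> B"
    unfolding A_def B_def by (intro tendsto_Pair argmax_ratio_converges[OF n e y] grid_left_converges[OF n e y] grid_right_converges[OF n e y])
  moreover have "isCont g B" using g continuous_on_eq_continuous_at[OF open_UNIV] by blast
  ultimately have "(\<lambda>j. g (A (n j) (y j))) \<longlonglongrightarrow> g B" by (rule isCont_tendsto_compose[rotated])
  from LIMSEQ_D[OF this \<epsilon>] show False using ny(2) by auto
qed

end

text \<open>The random time is rounded down to a grid, where the process takes one of finitely many
  measurable values; continuity of the paths removes the rounding.\<close>

lemma measurable_process_at: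
  fixes Z :: "real \<Rightarrow> 'c \<Rightarrow> real"
  assumes Z: "\<And>t. t \<in> {0..1} \<Longrightarrow> Z t \<in> borel_measurable M"
    and cont: "\<And>\<omega>. \<omega> \<in> space M \<Longrightarrow> continuous_on {0..1} (\<lambda>t. Z t \<omega>)"
    and T[measurable]: "T \<in> borel_measurable M" and T01: "\<And>\<omega>. \<omega> \<in> space M \<Longrightarrow> T \<omega> \<in> {0..1}"
  shows "(\<lambda>\<omega>. Z (T \<omega>) \<omega>) \<in> borel_measurable M"
proof (rule borel_measurable_LIMSEQ_real)
  define k where "k m \<omega> = nat \<lfloor>real (Suc m) * T \<omega>\<rfloor>" for m \<omega>
  have [measurable]: "k m \<in> measurable M (count_space UNIV)" for m unfolding k_def[abs_def] by measurable
  define F where "F m \<omega> = (\<Sum>i\<le>Suc m. if k m \<omega> = i then Z (real i / real (Suc m)) \<omega> else 0)" for m \<omega>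
  show "F m \<in> borel_measurable M" for m
    unfolding F_def[abs_def]
  proof (rule borel_measurable_sum)
    fix i assume "i \<in> {..Suc m}"
    then have [measurable]: "Z (real i / real (Suc m)) \<in> borel_measurable M" by (intro Z) auto
    show "(\<lambda>\<omega>. if k m \<omega> = i then Z (real i / real (Suc m)) \<omega> else 0) \<in> borel_measurable M" by measurable
  qed
  fix \<omega> assume w: "\<omega> \<in> space M"
  have T: "0 \<le> T \<omega>" "T \<omega> \<le> 1" using T01[OF w] by auto
  have k1: "real (k m \<omega>) \<le> real (Suc m) * T \<omega>" "real (Suc m) * T \<omega> < real (k m \<omega>) + 1" for m
  proof -
    have "0 \<le> real (Suc m) * T \<omega>" using T by (intro mult_nonneg_nonneg) auto
    then show "real (k m \<omega>) \<le> real (Suc m) * T \<omega>" "real (Suc m) * T \<omega> < real (k m \<omega>) + 1" unfolding k_def by linarith+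
  qed
  have km: "k m \<omega> \<le> Suc m" for m
  proof -
    have "real (Suc m) * T \<omega> \<le> real (Suc m) * 1" using T by (intro mult_left_mono) auto
    then have "real (k m \<omega>) \<le> real (Suc m)" using k1(1)[of m] by (metis mult.right_neutral order_trans)
    then show ?thesis by simp
  qed
  have F: "F m \<omega> = Z (real (k m \<omega>) / real (Suc m)) \<omega>" for m
    unfolding F_def using km[of m] by simp
  have near: "\<bar>real (k m \<omega>) / real (Suc m) - T \<omega>\<bar> \<le> 1 / real (Suc m)" for m
  proof -
    have "real (k m \<omega>) / real (Suc m) - T \<omega> = (real (k m \<omega>) - real (Suc m) * T \<omega>) / real (Suc m)" by (simp add: diff_divide_distrib)
    moreover have "\<bar>real (k m \<omega>) - real (Suc m) * T \<omega>\<bar> \<le> 1" using k1[of m] by linarith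
    ultimately show ?thesis by (simp add: abs_divide divide_right_mono)
  qed
  have "(\<lambda>m. real (k m \<omega>) / real (Suc m) - T \<omega>) \<longlonglongrightarrow> 0"
    by (rule tendsto_rabs_zero_cancel, rule tendsto_sandwich[OF _ _ tendsto_const LIMSEQ_Suc[OF lim_const_over_n[of 1]]])
       (use near in auto)
  then have "(\<lambda>m. real (k m \<omega>) / real (Suc m)) \<longlonglongrightarrow> T \<omega>" by (simp add: LIM_zero_iff)
  then show "(\<lambda>m. F m \<omega>) \<longlonglongrightarrow> Z (T \<omega>) \<omega>"
    unfolding F
  proof (rule continuous_on_tendsto_compose[OF cont[OF w]])
    have "real (k m \<omega>) / real (Suc m) \<in> {0..1}" for m using km[of m] by (simp add: divide_le_eq_1 del: of_nat_Suc)
    then show "eventually (\<lambda>m. real (k m \<omega>) / real (Suc m) \<in> {0..1}) sequentially" by (intro always_eventually allI)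
  qed (use T in simp)
qed

section \<open>Measurability and almost sure form of the limit vector\<close>

context fbm
begin

text \<open>The set in \<open>xi_arg\<close> is not confined to the unit interval, but it is closed,
  bounded below and contains a maximiser from that interval, so its infimum is attained and lies
  there too.\<close>

lemma xi_arg_props:
  assumes w: "\<omega> \<in> space N"
  shows "xi_arg W \<omega> \<in> {0..1}" "\<And>t. t \<in> {0..1} \<Longrightarrow> \<bar>br t \<omega>\<bar> \<le> \<bar>br (xi_arg W \<omega>) \<omega>\<bar>"
    "\<And>t. 0 \<le> t \<Longrightarrow> t < xi_arg W \<omega> \<Longrightarrow> \<bar>br t \<omega>\<bar> < \<bar>br (xi_arg W \<omega>) \<omega>\<bar>"
proof -
  define m where "m = Sup ((\<lambda>s. \<bar>br s \<omega>\<bar>) ` {0..1})"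
  define S where "S = {t. 0 \<le> t \<and> \<bar>br t \<omega>\<bar> = m}"
  have xi: "xi_arg W \<omega> = Inf S" unfolding xi_arg_def S_def m_def br_def ..
  have cont: "continuous_on {0..1} (\<lambda>t. \<bar>br t \<omega>\<bar>)" by (intro continuous_intros br_continuous w)
  have "\<exists>x\<in>{0..1}. \<forall>y\<in>{0..1}. \<bar>br y \<omega>\<bar> \<le> \<bar>br x \<omega>\<bar>" by (rule continuous_attains_sup[OF _ _ cont]) auto
  then obtain t0 where t0: "t0 \<in> {0..1}" "\<And>t. t \<in> {0..1} \<Longrightarrow> \<bar>br t \<omega>\<bar> \<le> \<bar>br t0 \<omega>\<bar>" by blast
  have m: "m = \<bar>br t0 \<omega>\<bar>" unfolding m_def by (rule cSup_eq_maximum) (use t0 in auto)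
  have t0S: "t0 \<in> S" using t0 m unfolding S_def by auto
  have bb: "bdd_below S" unfolding S_def by (rule bdd_belowI[of _ 0]) auto
  have "closed S"
  proof -
    have "continuous_on {0..} (\<lambda>t. \<bar>br t \<omega>\<bar>)" unfolding br_def by (intro continuous_intros W_continuous w)
    then have "closed {t \<in> {0..}. \<bar>br t \<omega>\<bar> = m}" by (intro continuous_closed_preimage_constant) auto
    then show ?thesis unfolding S_def by simp
  qed
  then have xS: "xi_arg W \<omega> \<in> S" unfolding xi using t0S bb by (intro closed_contains_Inf) auto
  have "xi_arg W \<omega> \<le> t0" unfolding xi using t0S bb by (rule cInf_lower)
  then show "xi_arg W \<omega> \<in> {0..1}" using xS t0 unfolding S_def by auto
  then show le: "\<bar>br t \<omega>\<bar> \<le> \<bar>br (xi_arg W \<omega>) \<omega>\<bar>" if "t \<in> {0..1}" for t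
    using xS t0(2)[OF that] m unfolding S_def by auto
  show "\<bar>br t \<omega>\<bar> < \<bar>br (xi_arg W \<omega>) \<omega>\<bar>" if "0 \<le> t" "t < xi_arg W \<omega>" for t
  proof -
    have "t \<notin> S" using that(2) bb cInf_lower[of t S] unfolding xi by auto
    moreover have "t \<in> {0..1}" using that \<open>xi_arg W \<omega> \<in> {0..1}\<close> by auto
    ultimately show ?thesis using le[of t] xS that unfolding S_def by auto
  qed
qed

lemma bdd_above_continuous:
  fixes f :: "real \<Rightarrow> real"
  assumes "continuous_on {0..1} f" "A \<subseteq> {0..1}"
  shows "bdd_above (f ` A)"
proof -
  have "bdd_above (f ` {0..1})"
    by (intro bounded_imp_bdd_above compact_imp_bounded compact_continuous_image assms compact_Icc)
  then show ?thesis by (rule bdd_above_mono) (use assms(2) in auto)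
qed

lemma rat_countable: "countable ({u..v} \<inter> \<rat> :: real set)"
  using countable_rat by auto

text \<open>The first maximiser is at most \<open>a\<close> exactly if the maximum over
  \<open>{0..a}\<close> already equals the maximum over \<open>{0..1}\<close>. The case
  \<open>a = 0\<close> stands apart because the rational supremum requires an interval of positive
  length.\<close>

lemma xi_arg_measurable[measurable]: "xi_arg W \<in> borel_measurable N"
proof (subst borel_measurable_iff_le, intro allI)
  fix a :: real
  define S where "S v \<omega> = (SUP t\<in>{0..v} \<inter> \<rat>. \<bar>br t \<omega>\<bar>)" for v \<omega>
  have Sm[measurable]: "S v \<in> borel_measurable N" if "v \<le> 1" for v
    unfolding S_def[abs_def]
  proof (rule borel_measurable_cSUP[OF rat_countable])
    fix t assume "t \<in> {0..v} \<inter> \<rat>"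
    then have [measurable]: "br t \<in> borel_measurable N" by (intro br_measurable) auto
    show "(\<lambda>\<omega>. \<bar>br t \<omega>\<bar>) \<in> borel_measurable N" by measurable
  next
    fix \<omega> assume "\<omega> \<in> space N"
    then show "bdd_above ((\<lambda>t. \<bar>br t \<omega>\<bar>) ` ({0..v} \<inter> \<rat>))"
      using that by (intro bdd_above_continuous continuous_intros br_continuous) auto
  qed
  have S1: "S 1 \<omega> = \<bar>br (xi_arg W \<omega>) \<omega>\<bar>" if w: "\<omega> \<in> space N" for \<omega>
    unfolding S_def
    by (rule cSUP_rational_interval) (use xi_arg_props[OF w] in \<open>auto intro!: continuous_intros br_continuous w\<close>)
  have [measurable]: "S 1 \<in> borel_measurable N" by (rule Sm) simp
  consider "a < 0" | "a = 0" | "0 < a" "a < 1" | "1 \<le> a" by linarith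
  then show "{\<omega> \<in> space N. xi_arg W \<omega> \<le> a} \<in> sets N"
  proof cases
    case 1
    then have "{\<omega> \<in> space N. xi_arg W \<omega> \<le> a} = {}" using xi_arg_props(1) by fastforce
    then show ?thesis by (simp only: sets.empty_sets)
  next
    case 2
    have [measurable]: "br 0 \<in> borel_measurable N" by (rule br_measurable) simp
    have "xi_arg W \<omega> \<le> a \<longleftrightarrow> \<bar>br 0 \<omega>\<bar> = S 1 \<omega>" if w: "\<omega> \<in> space N" for \<omega>
    proof (cases "xi_arg W \<omega> \<le> a")
      case True
      then have "xi_arg W \<omega> = 0" using 2 xi_arg_props(1)[OF w] by simp
      then show ?thesis using S1[OF w] 2 by simp
    next
      case False
      then show ?thesis using S1[OF w] xi_arg_props(3)[OF w, of 0] 2 by simp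
    qed
    then have "{\<omega> \<in> space N. xi_arg W \<omega> \<le> a} = {\<omega> \<in> space N. \<bar>br 0 \<omega>\<bar> = S 1 \<omega>}" by blast
    also have "\<dots> \<in> sets N" by measurable
    finally show ?thesis .
  next
    case 3
    have [measurable]: "S a \<in> borel_measurable N" by (rule Sm) (use 3 in simp)
    have "xi_arg W \<omega> \<le> a \<longleftrightarrow> S a \<omega> = S 1 \<omega>" if w: "\<omega> \<in> space N" for \<omega>
    proof (cases "xi_arg W \<omega> \<le> a")
      case True
      have "S a \<omega> = \<bar>br (xi_arg W \<omega>) \<omega>\<bar>"
        unfolding S_def
        by (rule cSUP_rational_interval)
           (use xi_arg_props[OF w] 3 True in \<open>auto intro!: continuous_intros continuous_on_subset[OF br_continuous[OF w]]\<close>)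
      then show ?thesis using S1[OF w] True by simp
    next
      case False
      have cont: "continuous_on {0..a} (\<lambda>t. \<bar>br t \<omega>\<bar>)"
        using 3 by (intro continuous_intros continuous_on_subset[OF br_continuous[OF w]]) auto
      have "\<exists>x\<in>{0..a}. \<forall>y\<in>{0..a}. \<bar>br y \<omega>\<bar> \<le> \<bar>br x \<omega>\<bar>" by (rule continuous_attains_sup[OF _ _ cont]) (use 3 in auto)
      then obtain t0 where t0: "t0 \<in> {0..a}" "\<And>t. t \<in> {0..a} \<Longrightarrow> \<bar>br t \<omega>\<bar> \<le> \<bar>br t0 \<omega>\<bar>" by blast
      have "S a \<omega> = \<bar>br t0 \<omega>\<bar>" unfolding S_def by (rule cSUP_rational_interval) (use t0 3 cont in auto)
      then show ?thesis using S1[OF w] xi_arg_props(3)[OF w, of t0] t0 False by auto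
    qed
    then have "{\<omega> \<in> space N. xi_arg W \<omega> \<le> a} = {\<omega> \<in> space N. S a \<omega> = S 1 \<omega>}" by blast
    also have "\<dots> \<in> sets N" by measurable
    finally show ?thesis .
  next
    case 4
    then have "{\<omega> \<in> space N. xi_arg W \<omega> \<le> a} = space N" using xi_arg_props(1) by fastforce
    then show ?thesis by simp
  qed
qed

lemma W_at_measurable:
  assumes "T \<in> borel_measurable N" "\<And>\<omega>. \<omega> \<in> space N \<Longrightarrow> T \<omega> \<in> {0..1}"
  shows "(\<lambda>\<omega>. W (T \<omega>) \<omega>) \<in> borel_measurable N"
  by (rule measurable_process_at[OF _ _ assms]) (auto intro!: W_measurable continuous_on_subset[OF W_continuous])

lemma measurable_SUP_unit:
  fixes Z :: "real \<Rightarrow> 'b \<Rightarrow> real"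
  assumes Z: "\<And>u. u \<in> {0..1} \<Longrightarrow> Z u \<in> borel_measurable N"
    and cont: "\<And>\<omega>. \<omega> \<in> space N \<Longrightarrow> continuous_on {0..1} (\<lambda>u. Z u \<omega>)"
  shows "(\<lambda>\<omega>. Sup ((\<lambda>u. Z u \<omega>) ` {0..1})) \<in> borel_measurable N"
proof -
  have "Sup ((\<lambda>u. Z u \<omega>) ` {0..1}) = (SUP u\<in>{0..1} \<inter> \<rat>. Z u \<omega>)" if w: "\<omega> \<in> space N" for \<omega>
  proof -
    have "\<exists>x\<in>{0..1}. \<forall>y\<in>{0..1}. Z y \<omega> \<le> Z x \<omega>" by (rule continuous_attains_sup[OF _ _ cont[OF w]]) auto
    then obtain u where u: "u \<in> {0..1}" "\<And>t. t \<in> {0..1} \<Longrightarrow> Z t \<omega> \<le> Z u \<omega>" by blast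
    have "Sup ((\<lambda>u. Z u \<omega>) ` {0..1}) = Z u \<omega>" by (rule cSup_eq_maximum) (use u in auto)
    moreover have "(SUP u\<in>{0..1} \<inter> \<rat>. Z u \<omega>) = Z u \<omega>" by (rule cSUP_rational_interval) (use u cont[OF w] in auto)
    ultimately show ?thesis by simp
  qed
  moreover have "(\<lambda>\<omega>. SUP u\<in>{0..1} \<inter> \<rat>. Z u \<omega>) \<in> borel_measurable N"
    by (rule borel_measurable_cSUP[OF rat_countable]) (use Z cont in \<open>auto intro!: bdd_above_continuous\<close>)
  ultimately show ?thesis by (simp cong: measurable_cong)
qed

text \<open>Moves the random interval to a fixed one, so that the supremum runs over a fixed
  countable set. For \<open>xi_arg W \<omega> = 0\<close> both sides are 0, since division by zero
  yields 0.\<close>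

lemma limit_vec_fst_eq:
  assumes w: "\<omega> \<in> space N"
  shows "fst (limit_vec W \<omega>) = 1 / sqrt (xi_arg W \<omega>) * Sup ((\<lambda>u. \<bar>W (u * xi_arg W \<omega>) \<omega> - u * W (xi_arg W \<omega>) \<omega>\<bar>) ` {0..1})"
proof (cases "xi_arg W \<omega> = 0")
  case True
  then show ?thesis by (simp add: limit_vec_def Let_def)
next
  case False
  define \<xi> where "\<xi> = xi_arg W \<omega>"
  have \<xi>: "0 < \<xi>" using xi_arg_props(1)[OF w] False unfolding \<xi>_def by auto
  have eq: "{0..\<xi>} = (\<lambda>u. u * \<xi>) ` {0..1}"
  proof (intro set_eqI iffI)
    fix t assume "t \<in> {0..\<xi>}"
    then show "t \<in> (\<lambda>u. u * \<xi>) ` {0..1}" using \<xi> by (intro image_eqI[of _ _ "t / \<xi>"]) auto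
  qed (use \<xi> in \<open>auto intro: mult_left_le_one_le\<close>)
  have "(\<lambda>t. \<bar>W t \<omega> - t / \<xi> * W \<xi> \<omega>\<bar>) ` {0..\<xi>} = (\<lambda>u. \<bar>W (u * \<xi>) \<omega> - u * W \<xi> \<omega>\<bar>) ` {0..1}"
    unfolding eq image_image by (intro image_cong refl) (use \<xi> in simp)
  then show ?thesis unfolding limit_vec_def Let_def \<xi>_def by simp
qed

lemma limit_vec_snd_eq:
  assumes w: "\<omega> \<in> space N"
  shows "snd (limit_vec W \<omega>) = 1 / sqrt (1 - xi_arg W \<omega>) *
    Sup ((\<lambda>u. \<bar>(W (xi_arg W \<omega> + u * (1 - xi_arg W \<omega>)) \<omega> - W (xi_arg W \<omega>) \<omega>) - u * (W 1 \<omega> - W (xi_arg W \<omega>) \<omega>)\<bar>) ` {0..1})"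
proof (cases "xi_arg W \<omega> = 1")
  case True
  then show ?thesis by (simp add: limit_vec_def Let_def)
next
  case False
  define \<xi> where "\<xi> = xi_arg W \<omega>"
  have \<xi>: "\<xi> < 1" using xi_arg_props(1)[OF w] False unfolding \<xi>_def by auto
  have eq: "{\<xi>..1} = (\<lambda>u. \<xi> + u * (1 - \<xi>)) ` {0..1}"
  proof (intro set_eqI iffI)
    fix t assume "t \<in> {\<xi>..1}"
    then show "t \<in> (\<lambda>u. \<xi> + u * (1 - \<xi>)) ` {0..1}" using \<xi> by (intro image_eqI[of _ _ "(t - \<xi>) / (1 - \<xi>)"]) auto
  next
    fix t assume "t \<in> (\<lambda>u. \<xi> + u * (1 - \<xi>)) ` {0..1}"
    then obtain u where u: "u \<in> {0..1}" "t = \<xi> + u * (1 - \<xi>)" by blast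
    have "u * (1 - \<xi>) \<le> 1 * (1 - \<xi>)" using u \<xi> by (intro mult_right_mono) auto
    then have "\<xi> + u * (1 - \<xi>) \<le> \<xi> + 1 * (1 - \<xi>)" by (rule add_left_mono)
    moreover have "0 \<le> u * (1 - \<xi>)" using u \<xi> by (intro mult_nonneg_nonneg) auto
    ultimately show "t \<in> {\<xi>..1}" unfolding u(2) atLeastAtMost_iff by (metis add_increasing2 diff_add_cancel add.commute mult_1 order_refl)
  qed
  have "(\<lambda>t. \<bar>(W t \<omega> - W \<xi> \<omega>) - (t - \<xi>) / (1 - \<xi>) * (W 1 \<omega> - W \<xi> \<omega>)\<bar>) ` {\<xi>..1}
    = (\<lambda>u. \<bar>(W (\<xi> + u * (1 - \<xi>)) \<omega> - W \<xi> \<omega>) - u * (W 1 \<omega> - W \<xi> \<omega>)\<bar>) ` {0..1}"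
    unfolding eq image_image by (intro image_cong refl) (use \<xi> in simp)
  then show ?thesis unfolding limit_vec_def Let_def \<xi>_def by simp
qed

lemma limit_vec_measurable:
  shows "(\<lambda>\<omega>. fst (limit_vec W \<omega>)) \<in> borel_measurable N" "(\<lambda>\<omega>. snd (limit_vec W \<omega>)) \<in> borel_measurable N"
proof -
  note xi = xi_arg_props(1)
  have conv01: "a + u * (1 - a) \<in> {0..1}" if "a \<in> {0..1}" "u \<in> {0..1}" for a u :: real
  proof -
    have "u * (1 - a) \<le> 1 * (1 - a)" using that by (intro mult_right_mono) auto
    then show ?thesis using that by simp
  qed
  have mul01: "u * a \<in> {0..1}" if "a \<in> {0..1}" "u \<in> {0..1}" for a u :: real using that by (auto intro: mult_le_one)
  have [measurable]: "(\<lambda>\<omega>. W (xi_arg W \<omega>) \<omega>) \<in> borel_measurable N" by (rule W_at_measurable) (use xi in auto)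
  have [measurable]: "W 1 \<in> borel_measurable N" by (rule W_measurable) simp
  have cW: "continuous_on {0..1} (\<lambda>u. W (f u) \<omega>)" if "\<omega> \<in> space N" "continuous_on {0..1} f" "\<And>u. u \<in> {0..1} \<Longrightarrow> f u \<in> {0..1}" for f \<omega>
    by (rule continuous_on_compose2[OF W_continuous[OF that(1)] that(2)]) (use that(3) in fastforce)
  have [measurable]: "(\<lambda>\<omega>. Sup ((\<lambda>u. \<bar>W (u * xi_arg W \<omega>) \<omega> - u * W (xi_arg W \<omega>) \<omega>\<bar>) ` {0..1})) \<in> borel_measurable N"
  proof (rule measurable_SUP_unit)
    fix u :: real assume u: "u \<in> {0..1}"
    have [measurable]: "(\<lambda>\<omega>. W (u * xi_arg W \<omega>) \<omega>) \<in> borel_measurable N"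
      by (rule W_at_measurable) (use mul01[OF xi u] in auto)
    show "(\<lambda>\<omega>. \<bar>W (u * xi_arg W \<omega>) \<omega> - u * W (xi_arg W \<omega>) \<omega>\<bar>) \<in> borel_measurable N" by measurable
  next
    fix \<omega> assume w: "\<omega> \<in> space N"
    show "continuous_on {0..1} (\<lambda>u. \<bar>W (u * xi_arg W \<omega>) \<omega> - u * W (xi_arg W \<omega>) \<omega>\<bar>)"
      by (intro continuous_intros cW w mul01 xi)
  qed
  have [measurable]: "(\<lambda>\<omega>. Sup ((\<lambda>u. \<bar>(W (xi_arg W \<omega> + u * (1 - xi_arg W \<omega>)) \<omega> - W (xi_arg W \<omega>) \<omega>) - u * (W 1 \<omega> - W (xi_arg W \<omega>) \<omega>)\<bar>) ` {0..1})) \<in> borel_measurable N"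
  proof (rule measurable_SUP_unit)
    fix u :: real assume u: "u \<in> {0..1}"
    have [measurable]: "(\<lambda>\<omega>. W (xi_arg W \<omega> + u * (1 - xi_arg W \<omega>)) \<omega>) \<in> borel_measurable N"
      by (rule W_at_measurable) (measurable, use conv01[OF xi u] in auto)
    show "(\<lambda>\<omega>. \<bar>(W (xi_arg W \<omega> + u * (1 - xi_arg W \<omega>)) \<omega> - W (xi_arg W \<omega>) \<omega>) - u * (W 1 \<omega> - W (xi_arg W \<omega>) \<omega>)\<bar>) \<in> borel_measurable N" by measurable
  next
    fix \<omega> assume w: "\<omega> \<in> space N"
    show "continuous_on {0..1} (\<lambda>u. \<bar>(W (xi_arg W \<omega> + u * (1 - xi_arg W \<omega>)) \<omega> - W (xi_arg W \<omega>) \<omega>) - u * (W 1 \<omega> - W (xi_arg W \<omega>) \<omega>)\<bar>)"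
      by (intro continuous_intros cW w conv01 xi)
  qed
  show "(\<lambda>\<omega>. fst (limit_vec W \<omega>)) \<in> borel_measurable N"
    by (subst measurable_cong[OF limit_vec_fst_eq]) auto
  show "(\<lambda>\<omega>. snd (limit_vec W \<omega>)) \<in> borel_measurable N"
    by (subst measurable_cong[OF limit_vec_snd_eq]) auto
qed

lemma xi_arg_unique_AE:
  "AE \<omega> in N. 0 < xi_arg W \<omega> \<and> xi_arg W \<omega> < 1 \<and>
     (\<forall>t\<in>{0..1}. t \<noteq> xi_arg W \<omega> \<longrightarrow> \<bar>W t \<omega> - t * W 1 \<omega>\<bar> < \<bar>W (xi_arg W \<omega>) \<omega> - xi_arg W \<omega> * W 1 \<omega>\<bar>)"
  using unique_argmax AE_space
proof eventually_elim
  case (elim \<omega>)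
  then obtain \<tau> where \<tau>: "0 < \<tau>" "\<tau> < 1" "\<forall>t\<in>{0..1}. t \<noteq> \<tau> \<longrightarrow> \<bar>br t \<omega>\<bar> < \<bar>br \<tau> \<omega>\<bar>" by blast
  have "xi_arg W \<omega> = \<tau>"
    using \<tau>(3) xi_arg_props(1,2)[OF elim(2)] \<tau>(1,2) by (meson atLeastAtMost_iff less_imp_le linorder_not_le)
  then show ?case using \<tau> unfolding br_def by blast
qed

end

section \<open>Moments of partial sums\<close>

context prob_space
begin

definition L2 :: "('a \<Rightarrow> real) set" where
  "L2 = {f. f \<in> borel_measurable M \<and> integrable M (\<lambda>\<omega>. (f \<omega>)\<^sup>2)}"

definition L4 :: "('a \<Rightarrow> real) set" where
  "L4 = {f. f \<in> borel_measurable M \<and> integrable M (\<lambda>\<omega>. f \<omega> ^ 4)}"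

lemma L4_measurable: "f \<in> L4 \<Longrightarrow> f \<in> borel_measurable M" by (simp add: L4_def)
lemma L2_integrable_square: "f \<in> L2 \<Longrightarrow> integrable M (\<lambda>\<omega>. (f \<omega>)\<^sup>2)" by (simp add: L2_def)
lemma L4_integrable_fourth: "f \<in> L4 \<Longrightarrow> integrable M (\<lambda>\<omega>. f \<omega> ^ 4)" by (simp add: L4_def)

lemma abs_mult_le_squares: "\<bar>u * v\<bar> \<le> u\<^sup>2 + v\<^sup>2" for u v :: real
proof -
  have "2 * (\<bar>u\<bar> * \<bar>v\<bar>) \<le> u\<^sup>2 + v\<^sup>2" using sum_squares_bound[of "\<bar>u\<bar>" "\<bar>v\<bar>"] by (simp add: mult.assoc)
  moreover have "0 \<le> \<bar>u\<bar> * \<bar>v\<bar>" by simp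
  ultimately show ?thesis unfolding abs_mult by linarith
qed

lemma L2_mult_integrable:
  assumes "f \<in> L2" "g \<in> L2"
  shows "integrable M (\<lambda>\<omega>. f \<omega> * g \<omega>)"
proof (rule Bochner_Integration.integrable_bound)
  show "integrable M (\<lambda>\<omega>. (f \<omega>)\<^sup>2 + (g \<omega>)\<^sup>2)" using assms by (simp add: L2_def)
  show "(\<lambda>\<omega>. f \<omega> * g \<omega>) \<in> borel_measurable M" using assms by (auto simp: L2_def)
  show "AE \<omega> in M. norm (f \<omega> * g \<omega>) \<le> norm ((f \<omega>)\<^sup>2 + (g \<omega>)\<^sup>2)"
    using abs_mult_le_squares by (intro AE_I2) (simp add: abs_mult)
qed

lemma const_L4: "(\<lambda>_. c) \<in> L4" by (simp add: L4_def)
lemma const_L2: "(\<lambda>_. c) \<in> L2" by (simp add: L2_def)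

lemma L2_integrable: "f \<in> L2 \<Longrightarrow> integrable M f"
  using L2_mult_integrable[of f "\<lambda>_. 1"] const_L2 by simp

lemma L4_mult_L2:
  assumes "f \<in> L4" "g \<in> L4"
  shows "(\<lambda>\<omega>. f \<omega> * g \<omega>) \<in> L2"
proof -
  have "integrable M (\<lambda>\<omega>. (f \<omega> * g \<omega>)\<^sup>2)"
  proof (rule Bochner_Integration.integrable_bound)
    show "integrable M (\<lambda>\<omega>. f \<omega> ^ 4 + g \<omega> ^ 4)" using assms by (simp add: L4_def)
    show "(\<lambda>\<omega>. (f \<omega> * g \<omega>)\<^sup>2) \<in> borel_measurable M" using assms by (auto simp: L4_def)
    have "(a * b)\<^sup>2 \<le> a ^ 4 + b ^ 4" for a b :: real
      using abs_mult_le_squares[of "a\<^sup>2" "b\<^sup>2"] by (simp add: power_mult_distrib abs_mult flip: power_mult)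
    then show "AE \<omega> in M. norm ((f \<omega> * g \<omega>)\<^sup>2) \<le> norm (f \<omega> ^ 4 + g \<omega> ^ 4)"
      by (intro AE_I2) simp
  qed
  then show ?thesis using assms by (auto simp: L2_def L4_def)
qed

lemma L4_L2: "f \<in> L4 \<Longrightarrow> f \<in> L2" using L4_mult_L2[OF _ const_L4[of 1]] by simp

lemma L4_mult4_integrable:
  assumes "a \<in> L4" "b \<in> L4" "c \<in> L4" "d \<in> L4"
  shows "integrable M (\<lambda>\<omega>. a \<omega> * b \<omega> * c \<omega> * d \<omega>)"
  using L2_mult_integrable[OF L4_mult_L2[OF assms(1,2)] L4_mult_L2[OF assms(3,4)]] by (simp add: mult.assoc)

lemma L4_prod_list_integrable:
  assumes "length fs \<le> 4" "set fs \<subseteq> L4"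
  shows "integrable M (\<lambda>\<omega>. prod_list (map (\<lambda>f. f \<omega>) fs))"
proof -
  consider "fs = []" | a where "fs = [a]" | a b where "fs = [a,b]" | a b c where "fs = [a,b,c]" | a b c d where "fs = [a,b,c,d]"
    using assms(1) by (cases fs rule: list.exhaust; simp) (metis (no_types, opaque_lifting) length_0_conv length_Suc_conv le_Suc_eq le_0_eq One_nat_def numeral_3_eq_3)
  then show ?thesis
  proof cases
    case 1 then show ?thesis by simp
  next
    case (2 a) then show ?thesis using assms L2_integrable[OF L4_L2, of a] by simp
  next
    case (3 a b) then show ?thesis using assms L2_integrable[OF L4_mult_L2, of a b] by simp
  next
    case (4 a b c)
    then show ?thesis using assms L4_mult4_integrable[of a b c "\<lambda>_. 1"] const_L4 by (simp add: mult.assoc)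
  next
    case (5 a b c d)
    then show ?thesis using assms L4_mult4_integrable[of a b c d] by (simp add: mult.assoc)
  qed
qed

lemma L4_add:
  assumes "f \<in> L4" "g \<in> L4"
  shows "(\<lambda>\<omega>. f \<omega> + g \<omega>) \<in> L4"
proof -
  have "integrable M (\<lambda>\<omega>. (f \<omega> + g \<omega>) ^ 4)"
  proof (rule Bochner_Integration.integrable_bound)
    show "integrable M (\<lambda>\<omega>. 8 * (f \<omega> ^ 4 + g \<omega> ^ 4))" using assms by (simp add: L4_def)
    show "(\<lambda>\<omega>. (f \<omega> + g \<omega>) ^ 4) \<in> borel_measurable M" using assms by (auto simp: L4_def)
    have "(a + b) ^ 4 \<le> 8 * (a ^ 4 + b ^ 4)" for a b :: real
    proof -
      have sq: "(a + b)\<^sup>2 \<le> 2 * (a\<^sup>2 + b\<^sup>2)" for a b :: real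
        using sum_squares_bound[of a b] by (simp add: power2_sum)
      have "(a + b) ^ 4 = ((a + b)\<^sup>2)\<^sup>2" by simp
      also have "\<dots> \<le> (2 * (a\<^sup>2 + b\<^sup>2))\<^sup>2" using sq[of a b] by (intro power_mono) auto
      also have "\<dots> = 4 * (a\<^sup>2 + b\<^sup>2)\<^sup>2" by (simp only: power_mult_distrib) simp
      also have "\<dots> \<le> 8 * (a ^ 4 + b ^ 4)" using sq[of "a\<^sup>2" "b\<^sup>2"] by simp
      finally show ?thesis .
    qed
    then show "AE \<omega> in M. norm ((f \<omega> + g \<omega>) ^ 4) \<le> norm (8 * (f \<omega> ^ 4 + g \<omega> ^ 4))" by (intro AE_I2) simp
  qed
  then show ?thesis using assms by (auto simp: L4_def)
qed

lemma L4_scale: "f \<in> L4 \<Longrightarrow> (\<lambda>\<omega>. c * f \<omega>) \<in> L4"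
  by (auto simp: L4_def power_mult_distrib)

lemma L4_diff: "f \<in> L4 \<Longrightarrow> g \<in> L4 \<Longrightarrow> (\<lambda>\<omega>. f \<omega> - g \<omega>) \<in> L4"
  using L4_add[of f "\<lambda>\<omega>. (-1) * g \<omega>"] L4_scale[of g "-1"] by simp

lemma L4_sum: "(\<And>i. i \<in> I \<Longrightarrow> f i \<in> L4) \<Longrightarrow> (\<lambda>\<omega>. \<Sum>i\<in>I. f i \<omega>) \<in> L4"
proof (induction I rule: infinite_finite_induct)
  case (infinite A)
  then show ?case using const_L4[of 0] by simp
next
  case empty
  then show ?case using const_L4[of 0] by simp
next
  case (insert x F)
  then show ?case using L4_add[of "f x" "\<lambda>\<omega>. \<Sum>i\<in>F. f i \<omega>"] by simp
qed

text \<open>Jensen's inequality in the form of a nonnegative variance, applied to the square and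
  then to the modulus.\<close>

lemma expectation_abs_le_root4:
  assumes f: "f \<in> L4" and b: "expectation (\<lambda>\<omega>. f \<omega> ^ 4) \<le> c ^ 4" "0 \<le> c"
  shows "expectation (\<lambda>\<omega>. \<bar>f \<omega>\<bar>) \<le> c" "expectation (\<lambda>\<omega>. (f \<omega>)\<^sup>2) \<le> c\<^sup>2"
proof -
  have sq: "(expectation g)\<^sup>2 \<le> expectation (\<lambda>\<omega>. (g \<omega>)\<^sup>2)" if "g \<in> L2" for g
  proof -
    have "0 \<le> variance g" by simp
    also have "variance g = expectation (\<lambda>\<omega>. (g \<omega>)\<^sup>2) - (expectation g)\<^sup>2"
      using that by (intro variance_eq L2_integrable L2_integrable_square)
    finally show ?thesis by simp
  qed
  have f2: "(\<lambda>\<omega>. (f \<omega>)\<^sup>2) \<in> L2" using L4_mult_L2[OF f f] by (simp add: power2_eq_square)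
  have "(expectation (\<lambda>\<omega>. (f \<omega>)\<^sup>2))\<^sup>2 \<le> (c\<^sup>2)\<^sup>2" using sq[OF f2] b by (simp flip: power_mult)
  then show 2: "expectation (\<lambda>\<omega>. (f \<omega>)\<^sup>2) \<le> c\<^sup>2" by (rule power2_le_imp_le) simp
  have "(\<lambda>\<omega>. \<bar>f \<omega>\<bar>) \<in> L2" using L4_L2[OF f] by (auto simp: L2_def)
  from sq[OF this] 2 have "(expectation (\<lambda>\<omega>. \<bar>f \<omega>\<bar>))\<^sup>2 \<le> c\<^sup>2" by simp
  then show "expectation (\<lambda>\<omega>. \<bar>f \<omega>\<bar>) \<le> c" using b(2) by (rule power2_le_imp_le)
qed

end

locale fos = prob_space M for M :: "'a measure" +
  fixes X :: "int \<Rightarrow> 'a \<Rightarrow> real"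
  assumes stat: "fourth_order_stationary M X"
begin

abbreviation "\<mu> \<equiv> mean_seq M X"
abbreviation "\<gamma> \<equiv> autocov M X"
abbreviation "\<kappa> \<equiv> cum4 M X"

definition Y :: "int \<Rightarrow> 'a \<Rightarrow> real" where "Y i \<omega> = X i \<omega> - \<mu>"

lemma X_L4: "X i \<in> L4" using stat by (simp add: fourth_order_stationary_def L4_def)
lemma Y_L4: "Y i \<in> L4" unfolding Y_def[abs_def] by (intro L4_diff X_L4 const_L4)
lemma X_measurable[measurable]: "X i \<in> borel_measurable M" by (rule L4_measurable[OF X_L4])
lemma Y_measurable[measurable]: "Y i \<in> borel_measurable M" by (rule L4_measurable[OF Y_L4])

text \<open>Stationarity is given for raw moments only. Centring one factor at a time expresses a
  product with one more centred factor through two products with fewer, so mixed products carry the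
  induction.\<close>

lemma mixed_moment_shift:
  assumes "length is + length js \<le> 4"
  shows "expectation (\<lambda>\<omega>. prod_list (map (\<lambda>i. X i \<omega>) is) * prod_list (map (\<lambda>i. Y i \<omega>) js))
    = expectation (\<lambda>\<omega>. prod_list (map (\<lambda>i. X (i + m) \<omega>) is) * prod_list (map (\<lambda>i. Y (i + m) \<omega>) js))"
  using assms
proof (induction js arbitrary: "is")
  case Nil
  then show ?case using stat by (simp add: fourth_order_stationary_def)
next
  case (Cons j js)
  have int: "integrable M (\<lambda>\<omega>. prod_list (map (\<lambda>i. X (i + s) \<omega>) is') * prod_list (map (\<lambda>i. Y (i + s) \<omega>) js'))"
    if "length is' + length js' \<le> 4" for s is' js'
  proof -
    have "integrable M (\<lambda>\<omega>. prod_list (map (\<lambda>f. f \<omega>) (map (\<lambda>i. X (i + s)) is' @ map (\<lambda>i. Y (i + s)) js')))"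
      by (rule L4_prod_list_integrable) (use that X_L4 Y_L4 in auto)
    then show ?thesis by (simp add: comp_def)
  qed
  have split: "expectation (\<lambda>\<omega>. prod_list (map (\<lambda>i. X (i + s) \<omega>) is) * prod_list (map (\<lambda>i. Y (i + s) \<omega>) (j # js)))
    = expectation (\<lambda>\<omega>. prod_list (map (\<lambda>i. X (i + s) \<omega>) (j # is)) * prod_list (map (\<lambda>i. Y (i + s) \<omega>) js))
      - \<mu> * expectation (\<lambda>\<omega>. prod_list (map (\<lambda>i. X (i + s) \<omega>) is) * prod_list (map (\<lambda>i. Y (i + s) \<omega>) js))" for s
  proof -
    have "expectation (\<lambda>\<omega>. prod_list (map (\<lambda>i. X (i + s) \<omega>) is) * prod_list (map (\<lambda>i. Y (i + s) \<omega>) (j # js)))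
      = expectation (\<lambda>\<omega>. prod_list (map (\<lambda>i. X (i + s) \<omega>) (j # is)) * prod_list (map (\<lambda>i. Y (i + s) \<omega>) js)
        - \<mu> * (prod_list (map (\<lambda>i. X (i + s) \<omega>) is) * prod_list (map (\<lambda>i. Y (i + s) \<omega>) js)))"
      by (intro Bochner_Integration.integral_cong refl) (simp add: Y_def algebra_simps)
    also have "\<dots> = expectation (\<lambda>\<omega>. prod_list (map (\<lambda>i. X (i + s) \<omega>) (j # is)) * prod_list (map (\<lambda>i. Y (i + s) \<omega>) js))
      - expectation (\<lambda>\<omega>. \<mu> * (prod_list (map (\<lambda>i. X (i + s) \<omega>) is) * prod_list (map (\<lambda>i. Y (i + s) \<omega>) js)))"
      by (rule Bochner_Integration.integral_diff) (use Cons.prems in \<open>auto intro!: integrable_mult_right int simp del: list.map prod_list.Cons\<close>)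
    finally show ?thesis by simp
  qed
  from split[of 0] split[of m] Cons.IH[of "j # is"] Cons.IH[of "is"] Cons.prems show ?case by simp
qed

lemma Y_cov: "expectation (\<lambda>\<omega>. Y i \<omega> * Y j \<omega>) = \<gamma> (j - i)"
proof -
  have "expectation (\<lambda>\<omega>. Y i \<omega> * Y j \<omega>) = expectation (\<lambda>\<omega>. Y 0 \<omega> * Y (j - i) \<omega>)"
    using mixed_moment_shift[of "[]" "[i, j]" "- i"] by simp
  then show ?thesis by (simp add: autocov_def Y_def)
qed

lemma autocov_minus: "\<gamma> (- j) = \<gamma> j"
proof -
  have "\<gamma> (- j) = expectation (\<lambda>\<omega>. Y 0 \<omega> * Y j \<omega>)" using Y_cov[of j 0] by (simp add: mult.commute)
  then show ?thesis using Y_cov[of 0 j] by simp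
qed

lemma autocov_abs: "\<gamma> \<bar>j\<bar> = \<gamma> j" using autocov_minus[of j] by (simp add: abs_if)

lemma Y_fourth: "expectation (\<lambda>\<omega>. Y a \<omega> * Y b \<omega> * Y c \<omega> * Y d \<omega>) =
   \<kappa> (b - a) (c - a) (d - a) + \<gamma> (b - a) * \<gamma> (c - d) + \<gamma> (c - a) * \<gamma> (b - d) + \<gamma> (d - a) * \<gamma> (b - c)"
proof -
  have "expectation (\<lambda>\<omega>. Y a \<omega> * Y b \<omega> * Y c \<omega> * Y d \<omega>) = expectation (\<lambda>\<omega>. Y 0 \<omega> * Y (b - a) \<omega> * Y (c - a) \<omega> * Y (d - a) \<omega>)"
    using mixed_moment_shift[of "[]" "[a, b, c, d]" "- a"] by (simp add: mult.assoc)
  then show ?thesis unfolding cum4_def by (simp add: Y_def)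
qed

definition YS :: "int set \<Rightarrow> 'a \<Rightarrow> real" where "YS A \<omega> = (\<Sum>a\<in>A. Y a \<omega>)"

lemma YS_L4: "YS A \<in> L4" unfolding YS_def[abs_def] by (intro L4_sum Y_L4)
lemma YS_measurable[measurable]: "YS A \<in> borel_measurable M" by (rule L4_measurable[OF YS_L4])

lemma YS_cov: "expectation (\<lambda>\<omega>. YS A \<omega> * YS B \<omega>) = (\<Sum>a\<in>A. \<Sum>b\<in>B. \<gamma> (b - a))"
proof -
  have "expectation (\<lambda>\<omega>. YS A \<omega> * YS B \<omega>) = expectation (\<lambda>\<omega>. \<Sum>a\<in>A. \<Sum>b\<in>B. Y a \<omega> * Y b \<omega>)"
    unfolding YS_def sum_product ..
  also have "\<dots> = (\<Sum>a\<in>A. \<Sum>b\<in>B. expectation (\<lambda>\<omega>. Y a \<omega> * Y b \<omega>))"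
    by (subst Bochner_Integration.integral_sum, intro Bochner_Integration.integrable_sum L2_mult_integrable L4_L2 Y_L4,
        intro sum.cong refl Bochner_Integration.integral_sum L2_mult_integrable L4_L2 Y_L4)
  finally show ?thesis by (simp add: Y_cov)
qed

text \<open>The moment-cumulant formula is multilinear: summed over four blocks, each pairing of
  covariances factors into two double sums.\<close>

lemma YS_fourth: "expectation (\<lambda>\<omega>. YS A \<omega> * YS B \<omega> * YS C \<omega> * YS D \<omega>) =
    (\<Sum>a\<in>A. \<Sum>b\<in>B. \<Sum>c\<in>C. \<Sum>d\<in>D. \<kappa> (b - a) (c - a) (d - a))
    + expectation (\<lambda>\<omega>. YS A \<omega> * YS B \<omega>) * expectation (\<lambda>\<omega>. YS C \<omega> * YS D \<omega>)
    + expectation (\<lambda>\<omega>. YS A \<omega> * YS C \<omega>) * expectation (\<lambda>\<omega>. YS B \<omega> * YS D \<omega>)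
    + expectation (\<lambda>\<omega>. YS A \<omega> * YS D \<omega>) * expectation (\<lambda>\<omega>. YS B \<omega> * YS C \<omega>)"
proof -
  have e: "YS A \<omega> * YS B \<omega> * YS C \<omega> * YS D \<omega> = (\<Sum>a\<in>A. \<Sum>b\<in>B. \<Sum>c\<in>C. \<Sum>d\<in>D. Y a \<omega> * Y b \<omega> * Y c \<omega> * Y d \<omega>)" for \<omega>
    unfolding YS_def by (simp only: mult.assoc sum_distrib_right, simp only: sum_distrib_left)
  \<comment> \<open>\<open>Y_fourth\<close> and \<open>YS_cov\<close> orient the lags differently;
    evenness of the autocovariance reconciles them.\<close>
  have s: "\<gamma> (b - a) = \<gamma> (a - b)" for a b using autocov_minus[of "b - a"] by simp
  have "expectation (\<lambda>\<omega>. YS A \<omega> * YS B \<omega> * YS C \<omega> * YS D \<omega>) = (\<Sum>a\<in>A. \<Sum>b\<in>B. \<Sum>c\<in>C. \<Sum>d\<in>D. expectation (\<lambda>\<omega>. Y a \<omega> * Y b \<omega> * Y c \<omega> * Y d \<omega>))"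
    unfolding e by (simp add: Bochner_Integration.integral_sum Bochner_Integration.integrable_sum L4_mult4_integrable Y_L4)
  also have "\<dots> = (\<Sum>a\<in>A. \<Sum>b\<in>B. \<Sum>c\<in>C. \<Sum>d\<in>D. \<kappa> (b - a) (c - a) (d - a))
    + (\<Sum>a\<in>A. \<Sum>b\<in>B. \<Sum>c\<in>C. \<Sum>d\<in>D. \<gamma> (b - a) * \<gamma> (d - c))
    + (\<Sum>a\<in>A. \<Sum>b\<in>B. \<Sum>c\<in>C. \<Sum>d\<in>D. \<gamma> (c - a) * \<gamma> (d - b))
    + (\<Sum>a\<in>A. \<Sum>b\<in>B. \<Sum>c\<in>C. \<Sum>d\<in>D. \<gamma> (d - a) * \<gamma> (c - b))"
    unfolding sum.distrib[symmetric] Y_fourth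
  proof (intro sum.cong refl)
    fix a b c d :: int
    show "\<kappa> (b - a) (c - a) (d - a) + \<gamma> (b - a) * \<gamma> (c - d) + \<gamma> (c - a) * \<gamma> (b - d) + \<gamma> (d - a) * \<gamma> (b - c)
      = \<kappa> (b - a) (c - a) (d - a) + \<gamma> (b - a) * \<gamma> (d - c) + \<gamma> (c - a) * \<gamma> (d - b) + \<gamma> (d - a) * \<gamma> (c - b)"
      by (simp only: s[of d c] s[of d b] s[of c b])
  qed
  also have "(\<Sum>a\<in>A. \<Sum>b\<in>B. \<Sum>c\<in>C. \<Sum>d\<in>D. \<gamma> (b - a) * \<gamma> (d - c)) = expectation (\<lambda>\<omega>. YS A \<omega> * YS B \<omega>) * expectation (\<lambda>\<omega>. YS C \<omega> * YS D \<omega>)"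
    unfolding YS_cov by (simp only: sum_distrib_right, simp only: sum_distrib_left)
  also have "(\<Sum>a\<in>A. \<Sum>b\<in>B. \<Sum>c\<in>C. \<Sum>d\<in>D. \<gamma> (c - a) * \<gamma> (d - b)) = expectation (\<lambda>\<omega>. YS A \<omega> * YS C \<omega>) * expectation (\<lambda>\<omega>. YS B \<omega> * YS D \<omega>)"
  proof -
    have sw: "(\<Sum>b\<in>B. \<Sum>c\<in>C. \<Sum>d\<in>D. \<gamma> (c - a) * \<gamma> (d - b)) = (\<Sum>c\<in>C. \<Sum>b\<in>B. \<Sum>d\<in>D. \<gamma> (c - a) * \<gamma> (d - b))" for a by (rule sum.swap)
    show ?thesis unfolding YS_cov sw by (simp only: sum_distrib_right, simp only: sum_distrib_left)
  qed
  also have "(\<Sum>a\<in>A. \<Sum>b\<in>B. \<Sum>c\<in>C. \<Sum>d\<in>D. \<gamma> (d - a) * \<gamma> (c - b)) = expectation (\<lambda>\<omega>. YS A \<omega> * YS D \<omega>) * expectation (\<lambda>\<omega>. YS B \<omega> * YS C \<omega>)"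
  proof -
    have sw: "(\<Sum>b\<in>B. \<Sum>c\<in>C. \<Sum>d\<in>D. \<gamma> (d - a) * \<gamma> (c - b)) = (\<Sum>d\<in>D. \<Sum>b\<in>B. \<Sum>c\<in>C. \<gamma> (d - a) * \<gamma> (c - b))" for a
    proof -
      have "(\<Sum>b\<in>B. \<Sum>c\<in>C. \<Sum>d\<in>D. \<gamma> (d - a) * \<gamma> (c - b)) = (\<Sum>b\<in>B. \<Sum>d\<in>D. \<Sum>c\<in>C. \<gamma> (d - a) * \<gamma> (c - b))"
        by (intro sum.cong refl sum.swap)
      also have "\<dots> = (\<Sum>d\<in>D. \<Sum>b\<in>B. \<Sum>c\<in>C. \<gamma> (d - a) * \<gamma> (c - b))" by (rule sum.swap)
      finally show ?thesis .
    qed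
    show ?thesis unfolding YS_cov sw by (simp only: sum_distrib_right, simp only: sum_distrib_left)
  qed
  finally show ?thesis .
qed

end

text \<open>Comparison with the integral, by telescoping: the mean value theorem bounds each term by
  an increment of \<open>x powr q / q\<close>. The first term is separate because the derivative is
  singular at 0.\<close>

lemma sum_powr_le:
  fixes q :: real
  assumes q: "0 < q" "q < 1"
  shows "(\<Sum>m<l. (1 + real m) powr (q - 1)) \<le> real l powr q / q"
proof (induction l)
  case 0
  then show ?case by simp
next
  case (Suc l)
  have "q * (1 + real l) powr (q - 1) \<le> (1 + real l) powr q - real l powr q"
  proof (cases "l = 0")
    case True then show ?thesis using q by simp
  next
    case False
    then have l: "0 < real l" by simp
    have "\<exists>z::real. z > real l \<and> z < 1 + real l \<and> (1 + real l) powr q - real l powr q = (1 + real l - real l) * (q * z powr (q - 1))"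
      by (rule MVT2) (use l in \<open>auto intro!: has_real_derivative_powr\<close>)
    then obtain z where z: "z > real l" "z < 1 + real l" "(1 + real l) powr q - real l powr q = q * z powr (q - 1)" by auto
    have "(1 + real l) powr (q - 1) \<le> z powr (q - 1)" using z l q by (intro powr_mono2') auto
    then show ?thesis using z(3) q by simp
  qed
  then have "(1 + real l) powr (q - 1) \<le> ((1 + real l) powr q - real l powr q) / q" using q by (simp add: field_simps)
  then show ?case using Suc by (simp add: diff_divide_distrib add.commute)
qed

text \<open>What matters is the factor 2 at \<open>y ^ 4\<close>. The threshold 6 achieves it
  because the fourth power of 7/6 is below 2; in the other case \<open>x + y \<le> 7 * x\<close>,
  and 2401 is the fourth power of 7.\<close>

lemma fourth_power_split: "(x + y) ^ 4 \<le> 2401 * x ^ 4 + 2 * y ^ 4" if "0 \<le> x" "0 \<le> y" for x y :: real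
proof (cases "6 * x \<le> y")
  case True
  have "(x + y) ^ 4 \<le> (7 / 6 * y) ^ 4" using that True by (intro power_mono) auto
  also have "\<dots> = (7 / 6) ^ 4 * y ^ 4" by (rule power_mult_distrib)
  also have "(7 / 6) ^ 4 * y ^ 4 = (2401 / 1296) * y ^ 4" by (simp add: power_divide)
  also have "\<dots> \<le> 2 * y ^ 4" by (intro mult_right_mono) auto
  finally show ?thesis using that by (smt (verit) zero_le_power)
next
  case False
  have "(x + y) ^ 4 \<le> (7 * x) ^ 4" using that False by (intro power_mono) auto
  also have "\<dots> = 2401 * x ^ 4" by (simp add: power_mult_distrib)
  finally show ?thesis using that by (smt (verit) zero_le_power)
qed

section \<open>Second and fourth moments of partial sums under long-range dependence\<close>

locale lrd = fos +
  fixes H Cg Cc :: real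
  assumes H: "1/2 < H" "H < 1"
    and gam: "\<And>j. \<bar>\<gamma> j\<bar> \<le> Cg * (1 + real_of_int \<bar>j\<bar>) powr (2*H - 2)"
    and cumb: "\<And>h l. 1 \<le> l \<Longrightarrow> (\<Sum>r\<in>{-int l..int l}. \<Sum>s\<in>{-int l..int l}. \<bar>\<kappa> h r s\<bar>) \<le> Cc * real l powr (2*H - 1)"
begin

lemma Cg0: "0 \<le> Cg" using gam[of 0] by simp
lemma Cc0: "0 \<le> Cc"
proof -
  have "0 \<le> (\<Sum>r\<in>{-int 1..int 1}. \<Sum>s\<in>{-int 1..int 1}. \<bar>\<kappa> 0 r s\<bar>)" by (intro sum_nonneg) auto
  then show ?thesis using cumb[of 1 0] by simp
qed

definition D :: "nat \<Rightarrow> nat \<Rightarrow> 'a \<Rightarrow> real" where "D i l = YS {int i<..int (i + l)}"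

lemma D_L4: "D i l \<in> L4" unfolding D_def by (rule YS_L4)
lemma D_measurable[measurable]: "D i l \<in> borel_measurable M" by (rule L4_measurable[OF D_L4])
lemma D_0[simp]: "D i 0 \<omega> = 0" by (simp add: D_def YS_def)

lemma D_add: "D i (l + r) \<omega> = D i l \<omega> + D (i + l) r \<omega>"
proof -
  have "{int i<..int (i + (l + r))} = {int i<..int (i + l)} \<union> {int (i + l)<..int (i + l + r)}" by auto
  then show ?thesis unfolding D_def YS_def by (simp add: sum.union_disjoint)
qed

definition Cv :: real where "Cv = 2 * Cg / (2*H - 1)"

text \<open>For fixed \<open>a\<close> the lags to the left and to the right run through distinct
  values below \<open>l\<close>, so the inner sum is at most twice the sum in
  \<open>sum_powr_le\<close>, of order \<open>l powr (2*H - 1)\<close>; the outer sum contributes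
  the factor \<open>l\<close>.\<close>

lemma D_second: "expectation (\<lambda>\<omega>. (D i l \<omega>)\<^sup>2) \<le> Cv * real l powr (2*H)"
proof -
  let ?A = "{int i<..int (i + l)}"
  let ?f = "\<lambda>m::nat. (1 + real m) powr (2*H - 2)"
  have "expectation (\<lambda>\<omega>. (D i l \<omega>)\<^sup>2) = (\<Sum>a\<in>?A. \<Sum>b\<in>?A. \<gamma> (b - a))"
    unfolding D_def power2_eq_square YS_cov ..
  also have "\<dots> \<le> (\<Sum>a\<in>?A. 2 * Cg / (2*H - 1) * real l powr (2*H - 1))"
  proof (rule sum_mono)
    fix a assume a: "a \<in> ?A"
    have "(\<Sum>b\<in>?A. \<gamma> (b - a)) \<le> (\<Sum>b\<in>?A. Cg * ?f (nat \<bar>b - a\<bar>))"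
    proof (rule sum_mono)
      fix b
      show "\<gamma> (b - a) \<le> Cg * ?f (nat \<bar>b - a\<bar>)" using gam[of "b - a"] by simp
    qed
    \<comment> \<open>The diagonal term is counted on both sides, which only enlarges the
      bound.\<close>
    also have "\<dots> \<le> (\<Sum>b\<in>{int i<..a}. Cg * ?f (nat \<bar>b - a\<bar>)) + (\<Sum>b\<in>{a..int (i + l)}. Cg * ?f (nat \<bar>b - a\<bar>))"
    proof -
      have "(\<Sum>b\<in>?A. Cg * ?f (nat \<bar>b - a\<bar>)) = (\<Sum>b\<in>{int i<..a} \<union> {a<..int (i + l)}. Cg * ?f (nat \<bar>b - a\<bar>))"
        using a by (intro sum.cong) auto
      also have "\<dots> = (\<Sum>b\<in>{int i<..a}. Cg * ?f (nat \<bar>b - a\<bar>)) + (\<Sum>b\<in>{a<..int (i + l)}. Cg * ?f (nat \<bar>b - a\<bar>))"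
        by (intro sum.union_disjoint) auto
      also have "(\<Sum>b\<in>{a<..int (i + l)}. Cg * ?f (nat \<bar>b - a\<bar>)) \<le> (\<Sum>b\<in>{a..int (i + l)}. Cg * ?f (nat \<bar>b - a\<bar>))"
        using Cg0 by (intro sum_mono2) auto
      finally show ?thesis by simp
    qed
    also have "(\<Sum>b\<in>{int i<..a}. Cg * ?f (nat \<bar>b - a\<bar>)) \<le> (\<Sum>m<l. Cg * ?f m)"
    proof -
      have "(\<Sum>b\<in>{int i<..a}. Cg * ?f (nat \<bar>b - a\<bar>)) = (\<Sum>m\<in>(\<lambda>b. nat \<bar>b - a\<bar>) ` {int i<..a}. Cg * ?f m)"
        by (subst sum.reindex) (auto simp: inj_on_def)
      also have "\<dots> \<le> (\<Sum>m<l. Cg * ?f m)" using a Cg0 by (intro sum_mono2) auto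
      finally show ?thesis .
    qed
    also have "(\<Sum>b\<in>{a..int (i + l)}. Cg * ?f (nat \<bar>b - a\<bar>)) \<le> (\<Sum>m<l. Cg * ?f m)"
    proof -
      have "(\<Sum>b\<in>{a..int (i + l)}. Cg * ?f (nat \<bar>b - a\<bar>)) = (\<Sum>m\<in>(\<lambda>b. nat \<bar>b - a\<bar>) ` {a..int (i + l)}. Cg * ?f m)"
        by (subst sum.reindex) (auto simp: inj_on_def)
      also have "\<dots> \<le> (\<Sum>m<l. Cg * ?f m)" using a Cg0 by (intro sum_mono2) auto
      finally show ?thesis .
    qed
    finally have "(\<Sum>b\<in>?A. \<gamma> (b - a)) \<le> 2 * Cg * (\<Sum>m<l. ?f m)" by (simp add: sum_distrib_left mult.assoc)
    also have "\<dots> \<le> 2 * Cg * (real l powr (2*H - 1) / (2*H - 1))"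
      using sum_powr_le[of "2*H - 1" l] H Cg0 by (intro mult_left_mono) auto
    finally show "(\<Sum>b\<in>?A. \<gamma> (b - a)) \<le> 2 * Cg / (2*H - 1) * real l powr (2*H - 1)" by simp
  qed
  also have "\<dots> = Cv * (real l * real l powr (2*H - 1))" by (simp add: Cv_def)
  also have "real l * real l powr (2*H - 1) = real l powr (2*H)"
    by (cases "l = 0") (use powr_add[of "real l" 1 "2*H - 1"] in auto)
  finally show ?thesis .
qed

lemma cum_window:
  assumes l: "1 \<le> l" and A: "A \<subseteq> {a - int l..a + int l}"
  shows "(\<Sum>c\<in>A. \<Sum>d\<in>A. \<bar>\<kappa> h (c - a) (d - a)\<bar>) \<le> Cc * real l powr (2*H - 1)"
proof -
  have fA: "finite A" using A by (rule finite_subset) simp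
  have sub: "(\<lambda>c. c - a) ` A \<subseteq> {-int l..int l}" using A by auto
  have re: "(\<Sum>c\<in>A. f (c - a)) = (\<Sum>r\<in>(\<lambda>c. c - a) ` A. f r)" for f :: "int \<Rightarrow> real"
    by (subst sum.reindex) (auto simp: inj_on_def)
  have "(\<Sum>c\<in>A. \<Sum>d\<in>A. \<bar>\<kappa> h (c - a) (d - a)\<bar>) = (\<Sum>r\<in>(\<lambda>c. c - a) ` A. \<Sum>s\<in>(\<lambda>c. c - a) ` A. \<bar>\<kappa> h r s\<bar>)"
    by (subst re[symmetric], subst re[symmetric]) (rule refl)
  also have "\<dots> \<le> (\<Sum>r\<in>{-int l..int l}. \<Sum>s\<in>(\<lambda>c. c - a) ` A. \<bar>\<kappa> h r s\<bar>)"
    using sub by (intro sum_mono2 sum_nonneg) auto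
  also have "\<dots> \<le> (\<Sum>r\<in>{-int l..int l}. \<Sum>s\<in>{-int l..int l}. \<bar>\<kappa> h r s\<bar>)"
    using sub by (intro sum_mono sum_mono2) auto
  also have "\<dots> \<le> Cc * real l powr (2*H - 1)" by (rule cumb[OF l])
  finally show ?thesis .
qed

definition C4 :: real where "C4 = 3 * Cv\<^sup>2 + Cc"

lemma C40: "0 \<le> C4" unfolding C4_def using Cc0 by simp

text \<open>The three pairings give \<open>3 * Cv\<^sup>2\<close>. The cumulants contribute order
  \<open>l powr (2*H + 1)\<close>, dominated by \<open>l powr (4*H)\<close> because
  \<open>H > 1/2\<close>.\<close>

lemma D_fourth: "expectation (\<lambda>\<omega>. D i l \<omega> ^ 4) \<le> C4 * real l powr (4*H)"
proof (cases "l = 0")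
  case True then show ?thesis by simp
next
  case False
  then have l: "1 \<le> l" by simp
  let ?A = "{int i<..int (i + l)}"
  have e2: "0 \<le> expectation (\<lambda>\<omega>. D i l \<omega> * D i l \<omega>)" by (intro Bochner_Integration.integral_nonneg) auto
  have "expectation (\<lambda>\<omega>. D i l \<omega> ^ 4) = expectation (\<lambda>\<omega>. D i l \<omega> * D i l \<omega> * D i l \<omega> * D i l \<omega>)"
    by (simp add: power4_eq_xxxx)
  also have "\<dots> = (\<Sum>a\<in>?A. \<Sum>b\<in>?A. \<Sum>c\<in>?A. \<Sum>d\<in>?A. \<kappa> (b - a) (c - a) (d - a)) + 3 * (expectation (\<lambda>\<omega>. D i l \<omega> * D i l \<omega>))\<^sup>2"
    unfolding D_def YS_fourth by (simp add: power2_eq_square)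
  also have "(\<Sum>a\<in>?A. \<Sum>b\<in>?A. \<Sum>c\<in>?A. \<Sum>d\<in>?A. \<kappa> (b - a) (c - a) (d - a)) \<le> (\<Sum>a\<in>?A. \<Sum>b\<in>?A. Cc * real l powr (2*H - 1))"
  proof (intro sum_mono)
    fix a b assume a: "a \<in> ?A"
    have "(\<Sum>c\<in>?A. \<Sum>d\<in>?A. \<kappa> (b - a) (c - a) (d - a)) \<le> (\<Sum>c\<in>?A. \<Sum>d\<in>?A. \<bar>\<kappa> (b - a) (c - a) (d - a)\<bar>)"
      by (intro sum_mono) auto
    also have "\<dots> \<le> Cc * real l powr (2*H - 1)" using a by (intro cum_window l) auto
    finally show "(\<Sum>c\<in>?A. \<Sum>d\<in>?A. \<kappa> (b - a) (c - a) (d - a)) \<le> Cc * real l powr (2*H - 1)" .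
  qed
  also have "(\<Sum>a\<in>?A. \<Sum>b\<in>?A. Cc * real l powr (2*H - 1)) = Cc * (real l powr 1 * (real l powr 1 * real l powr (2*H - 1)))"
    using l by simp
  also have "real l powr 1 * (real l powr 1 * real l powr (2*H - 1)) = real l powr (2*H + 1)"
    by (simp only: powr_add[symmetric]) (simp add: add.commute)
  also have "Cc * real l powr (2*H + 1) \<le> Cc * real l powr (4*H)"
    using l H Cc0 by (intro mult_left_mono powr_mono) auto
  also have "3 * (expectation (\<lambda>\<omega>. D i l \<omega> * D i l \<omega>))\<^sup>2 \<le> 3 * (Cv * real l powr (2*H))\<^sup>2"
    using D_second[of i l] e2 by (intro mult_left_mono power_mono) (auto simp: power2_eq_square)
  also have "(Cv * real l powr (2*H))\<^sup>2 = Cv\<^sup>2 * real l powr (4*H)"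
    by (simp add: power2_eq_square powr_add[symmetric])
  finally show ?thesis by (simp add: C4_def algebra_simps)
qed

definition Mx :: "nat \<Rightarrow> nat \<Rightarrow> 'a \<Rightarrow> real" where "Mx i R \<omega> = Max ((\<lambda>r. \<bar>D i r \<omega>\<bar>) ` {..R})"

lemma Mx_ge: "r \<le> R \<Longrightarrow> \<bar>D i r \<omega>\<bar> \<le> Mx i R \<omega>"
  unfolding Mx_def by (intro Max_ge) auto

lemma Mx_le: "(\<And>r. r \<le> R \<Longrightarrow> \<bar>D i r \<omega>\<bar> \<le> b) \<Longrightarrow> Mx i R \<omega> \<le> b"
  unfolding Mx_def by (intro Max.boundedI) auto

lemma Mx_nonneg: "0 \<le> Mx i R \<omega>" using Mx_ge[of 0 R i \<omega>] by simp

lemma Mx_mono: "R \<le> R' \<Longrightarrow> Mx i R \<omega> \<le> Mx i R' \<omega>"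
  by (rule Mx_le) (auto intro: Mx_ge)

lemma Mx_measurable[measurable]: "Mx i R \<in> borel_measurable M"
  unfolding Mx_def[abs_def] by (rule borel_measurable_Max) auto

lemma Mx_L4: "Mx i R \<in> L4"
proof -
  have "integrable M (\<lambda>\<omega>. Mx i R \<omega> ^ 4)"
  proof (rule Bochner_Integration.integrable_bound)
    show "integrable M (\<lambda>\<omega>. \<Sum>r\<le>R. D i r \<omega> ^ 4)" by (intro Bochner_Integration.integrable_sum L4_integrable_fourth D_L4)
    show "AE \<omega> in M. norm (Mx i R \<omega> ^ 4) \<le> norm (\<Sum>r\<le>R. D i r \<omega> ^ 4)"
    proof (intro AE_I2)
      fix \<omega>
      have "Mx i R \<omega> \<in> (\<lambda>r. \<bar>D i r \<omega>\<bar>) ` {..R}" unfolding Mx_def by (intro Max_in) auto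
      then obtain r where r: "r \<le> R" "Mx i R \<omega> = \<bar>D i r \<omega>\<bar>" by auto
      have "Mx i R \<omega> ^ 4 = D i r \<omega> ^ 4" using r by simp
      also have "\<dots> \<le> (\<Sum>r\<le>R. D i r \<omega> ^ 4)" using r by (intro member_le_sum) auto
      finally show "norm (Mx i R \<omega> ^ 4) \<le> norm (\<Sum>r\<le>R. D i r \<omega> ^ 4)" by (simp add: sum_nonneg)
    qed
  qed measurable
  then show ?thesis by (simp add: L4_def)
qed

text \<open>The first entry of the maximum starts the recursion of \<open>Mx_dyadic\<close>, and the
  second makes its step close. The factor 16 bounds \<open>2 powr (4*H)\<close>, the price of
  rounding a length up to a power of two.\<close>

definition Cm :: real where "Cm = 16 * max C4 (2401 * C4 / (2 powr (4*H) - 4))"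

lemma Cm0: "0 \<le> Cm" unfolding Cm_def using C40 by simp

lemma four_less: "4 < 2 powr (4*H)"
proof -
  have "2 powr 2 < 2 powr (4*H)" using H by (intro powr_less_mono) auto
  then show ?thesis by simp
qed

text \<open>Over a doubled block the maximum is at most the sum over the first half plus the larger
  of the two half maxima. In fourth powers the half maxima enter with total factor 4, less than
  \<open>2 powr (4*H)\<close>, so the recursion closes without a logarithmic loss.\<close>

lemma Mx_dyadic: "expectation (\<lambda>\<omega>. Mx i (2^J) \<omega> ^ 4) \<le> Cm / 16 * (2^J) powr (4*H)"
proof (induction J arbitrary: i)
  case 0
  have "Mx i (2^0) \<omega> = \<bar>D i 1 \<omega>\<bar>" for \<omega>
    by (rule antisym[OF Mx_le Mx_ge]) (auto simp: le_Suc_eq)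
  then have "expectation (\<lambda>\<omega>. Mx i (2^0) \<omega> ^ 4) \<le> C4" using D_fourth[of i 1] by simp
  then show ?case unfolding Cm_def by simp
next
  case (Suc J)
  let ?L = "2^J :: nat"
  have pt: "Mx i (2^Suc J) \<omega> ^ 4 \<le> 2401 * D i ?L \<omega> ^ 4 + 2 * (Mx i ?L \<omega> ^ 4 + Mx (i + ?L) ?L \<omega> ^ 4)" for \<omega>
  proof -
    define m where "m = max (Mx i ?L \<omega>) (Mx (i + ?L) ?L \<omega>)"
    have m0: "0 \<le> m" unfolding m_def using Mx_nonneg[of i ?L \<omega>] by simp
    have "Mx i (2^Suc J) \<omega> \<le> \<bar>D i ?L \<omega>\<bar> + m"
    proof (rule Mx_le)
      fix r :: nat assume r: "r \<le> 2^Suc J"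
      show "\<bar>D i r \<omega>\<bar> \<le> \<bar>D i ?L \<omega>\<bar> + m"
      proof (cases "r \<le> ?L")
        case True then show ?thesis using Mx_ge[OF True, of i \<omega>] unfolding m_def by linarith
      next
        case False
        define s where "s = r - ?L"
        have s: "r = ?L + s" "s \<le> ?L" using False r unfolding s_def by auto
        show ?thesis using Mx_ge[OF s(2), of "i + ?L" \<omega>] unfolding s(1) D_add m_def by linarith
      qed
    qed
    then have "Mx i (2^Suc J) \<omega> ^ 4 \<le> (\<bar>D i ?L \<omega>\<bar> + m) ^ 4" using Mx_nonneg by (intro power_mono) auto
    also have "\<dots> \<le> 2401 * \<bar>D i ?L \<omega>\<bar> ^ 4 + 2 * m ^ 4" using m0 by (intro fourth_power_split) auto
    also have "m ^ 4 \<le> Mx i ?L \<omega> ^ 4 + Mx (i + ?L) ?L \<omega> ^ 4" unfolding m_def max_def using Mx_nonneg by auto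
    finally show ?thesis by simp
  qed
  have i1: "integrable M (\<lambda>\<omega>. D i ?L \<omega> ^ 4)" by (rule L4_integrable_fourth[OF D_L4])
  have i2: "integrable M (\<lambda>\<omega>. Mx j R \<omega> ^ 4)" for j R by (rule L4_integrable_fourth[OF Mx_L4])
  have "expectation (\<lambda>\<omega>. Mx i (2^Suc J) \<omega> ^ 4) \<le> expectation (\<lambda>\<omega>. 2401 * D i ?L \<omega> ^ 4 + 2 * (Mx i ?L \<omega> ^ 4 + Mx (i + ?L) ?L \<omega> ^ 4))"
    using i1 i2 by (intro integral_mono pt) auto
  also have "\<dots> = 2401 * expectation (\<lambda>\<omega>. D i ?L \<omega> ^ 4) + 2 * (expectation (\<lambda>\<omega>. Mx i ?L \<omega> ^ 4) + expectation (\<lambda>\<omega>. Mx (i + ?L) ?L \<omega> ^ 4))"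
    using i1 i2 by simp
  also have "\<dots> \<le> 2401 * (C4 * real ?L powr (4*H)) + 2 * (Cm / 16 * (2^J) powr (4*H) + Cm / 16 * (2^J) powr (4*H))"
    by (intro add_mono mult_left_mono D_fourth Suc.IH) auto
  also have "\<dots> = (2401 * C4 + 4 * (Cm / 16)) * (2^J) powr (4*H)" by (simp add: algebra_simps)
  also have "\<dots> \<le> (Cm / 16 * 2 powr (4*H)) * (2^J) powr (4*H)"
  proof (rule mult_right_mono)
    have "2401 * C4 / (2 powr (4*H) - 4) \<le> Cm / 16" unfolding Cm_def by simp
    then show "2401 * C4 + 4 * (Cm / 16) \<le> Cm / 16 * 2 powr (4*H)" using four_less by (simp add: field_simps)
  qed simp
  also have "\<dots> = Cm / 16 * (2^Suc J) powr (4*H)" by (simp add: powr_mult)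
  finally show ?case .
qed

lemma Mx_fourth:
  assumes R: "1 \<le> R"
  shows "expectation (\<lambda>\<omega>. Mx i R \<omega> ^ 4) \<le> Cm * real R powr (4*H)"
proof -
  obtain J where J: "R \<le> 2^J" "2^J \<le> 2 * R"
  proof -
    define J where "J = (LEAST J. R \<le> 2^J)"
    have ex: "R \<le> 2^R" using less_exp[of R] by simp
    have 1: "R \<le> 2^J" unfolding J_def by (rule LeastI[of "\<lambda>J. R \<le> 2^J", OF ex])
    have 2: "2^J \<le> 2 * R"
    proof (cases J)
      case 0 then show ?thesis using R by simp
    next
      case (Suc K)
      then have "\<not> R \<le> 2^K" using not_less_Least[of K "\<lambda>J. R \<le> 2^J"] unfolding J_def by simp
      then show ?thesis using Suc by simp
    qed
    show thesis using that 1 2 by blast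
  qed
  have "expectation (\<lambda>\<omega>. Mx i R \<omega> ^ 4) \<le> expectation (\<lambda>\<omega>. Mx i (2^J) \<omega> ^ 4)"
    using Mx_mono[OF J(1)] Mx_nonneg by (intro integral_mono L4_integrable_fourth Mx_L4 power_mono) auto
  also have "\<dots> \<le> Cm / 16 * (2^J) powr (4*H)" by (rule Mx_dyadic)
  also have "\<dots> \<le> Cm / 16 * (16 * real R powr (4*H))"
  proof (intro mult_left_mono)
    have "(2^J :: real) \<le> 2 * real R" using J(2) by (metis of_nat_le_iff of_nat_mult of_nat_numeral of_nat_power)
    then have "(2^J) powr (4*H) \<le> (2 * real R) powr (4*H)" using H by (intro powr_mono2) auto
    also have "\<dots> = 2 powr (4*H) * real R powr (4*H)" by (simp add: powr_mult)
    also have "\<dots> \<le> 2 powr 4 * real R powr (4*H)" using H by (intro mult_right_mono powr_mono) auto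
    finally show "(2^J) powr (4*H) \<le> 16 * real R powr (4*H)" by simp
  qed (use Cm0 in auto)
  finally show ?thesis by simp
qed

text \<open>The break may lie anywhere, so overhanging pieces of windows have to be bounded for all
  starting points at once.\<close>

definition Gx :: "nat \<Rightarrow> nat \<Rightarrow> 'a \<Rightarrow> real" where
  "Gx n R \<omega> = Max ((\<lambda>(a, r). \<bar>D a r \<omega>\<bar>) ` ({..n} \<times> {..R}))"

lemma Gx_ge: "a \<le> n \<Longrightarrow> r \<le> R \<Longrightarrow> \<bar>D a r \<omega>\<bar> \<le> Gx n R \<omega>"
  unfolding Gx_def by (intro Max_ge) auto

lemma Gx_nonneg: "0 \<le> Gx n R \<omega>" using Gx_ge[of 0 n 0 R \<omega>] by simp

lemma Gx_measurable[measurable]: "Gx n R \<in> borel_measurable M"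
  unfolding Gx_def[abs_def] split_beta by (rule borel_measurable_Max) auto

text \<open>With the starting point in the block beginning at \<open>m * R\<close>, the increment is
  a difference of two partial sums from there of length at most \<open>2 * R\<close>. The factor 16
  is the fourth power of 2.\<close>

lemma Gx_pointwise:
  assumes R: "1 \<le> R"
  shows "Gx n R \<omega> ^ 4 \<le> 16 * (\<Sum>m\<le>n div R. Mx (m * R) (2 * R) \<omega> ^ 4)"
proof -
  have "Gx n R \<omega> \<in> (\<lambda>(a, r). \<bar>D a r \<omega>\<bar>) ` ({..n} \<times> {..R})" unfolding Gx_def by (intro Max_in) auto
  then obtain a r where ar: "a \<le> n" "r \<le> R" "Gx n R \<omega> = \<bar>D a r \<omega>\<bar>" by auto
  define m where "m = a div R"
  define s where "s = a mod R"
  have a: "a = m * R + s" "s < R" unfolding m_def s_def using R by auto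
  have "\<bar>D (m * R) (s + r) \<omega>\<bar> \<le> Mx (m * R) (2 * R) \<omega>" "\<bar>D (m * R) s \<omega>\<bar> \<le> Mx (m * R) (2 * R) \<omega>"
    using a ar by (auto intro!: Mx_ge)
  then have "\<bar>D a r \<omega>\<bar> \<le> 2 * Mx (m * R) (2 * R) \<omega>" unfolding D_add a(1) by linarith
  then have "Gx n R \<omega> ^ 4 \<le> (2 * Mx (m * R) (2 * R) \<omega>) ^ 4" unfolding ar(3) by (intro power_mono) auto
  also have "\<dots> = 16 * Mx (m * R) (2 * R) \<omega> ^ 4" by (simp add: power_mult_distrib)
  also have "\<dots> \<le> 16 * (\<Sum>m\<le>n div R. Mx (m * R) (2 * R) \<omega> ^ 4)"
    using ar(1) by (intro mult_left_mono member_le_sum) (auto simp: m_def div_le_mono)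
  finally show ?thesis .
qed

lemma Gx_L4: assumes R: "1 \<le> R" shows "Gx n R \<in> L4"
proof -
  have "integrable M (\<lambda>\<omega>. Gx n R \<omega> ^ 4)"
  proof (rule Bochner_Integration.integrable_bound)
    show "integrable M (\<lambda>\<omega>. 16 * (\<Sum>m\<le>n div R. Mx (m * R) (2 * R) \<omega> ^ 4))"
      by (intro integrable_mult_right Bochner_Integration.integrable_sum L4_integrable_fourth Mx_L4)
    show "AE \<omega> in M. norm (Gx n R \<omega> ^ 4) \<le> norm (16 * (\<Sum>m\<le>n div R. Mx (m * R) (2 * R) \<omega> ^ 4))"
      using Gx_pointwise[OF R] by (intro AE_I2) (simp add: sum_nonneg)
  qed measurable
  then show ?thesis by (simp add: L4_def)
qed

lemma Gx_fourth:
  assumes R: "1 \<le> R" "R \<le> n"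
  shows "expectation (\<lambda>\<omega>. Gx n R \<omega> ^ 4) \<le> 512 * Cm * (real n * real R powr (4*H - 1))"
proof -
  have i: "integrable M (\<lambda>\<omega>. Mx j R \<omega> ^ 4)" for j R by (rule L4_integrable_fourth[OF Mx_L4])
  have "expectation (\<lambda>\<omega>. Gx n R \<omega> ^ 4) \<le> expectation (\<lambda>\<omega>. 16 * (\<Sum>m\<le>n div R. Mx (m * R) (2 * R) \<omega> ^ 4))"
    using i by (intro integral_mono Gx_pointwise R(1) L4_integrable_fourth Gx_L4) auto
  also have "\<dots> = 16 * (\<Sum>m\<le>n div R. expectation (\<lambda>\<omega>. Mx (m * R) (2 * R) \<omega> ^ 4))" using i by simp
  also have "\<dots> \<le> 16 * (\<Sum>m\<le>n div R. Cm * real (2 * R) powr (4*H))"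
    using R by (intro mult_left_mono sum_mono Mx_fourth) auto
  also have "\<dots> = 16 * Cm * ((real (n div R) + 1) * real (2 * R) powr (4*H))" by (simp add: algebra_simps)
  \<comment> \<open>There are at most \<open>2 * n / R\<close> blocks. The constant 512 is 16 from
    the pointwise bound, times this 2, times 16 for the doubled length.\<close>
  also have "\<dots> \<le> 16 * Cm * ((2 * (real n / real R)) * (16 * real R powr (4*H)))"
  proof (intro mult_left_mono mult_mono)
    have "real (n div R) \<le> real n / real R" by (rule of_nat_div_le_of_nat)
    moreover have "1 \<le> real n / real R" using R by simp
    ultimately show "real (n div R) + 1 \<le> 2 * (real n / real R)" by linarith
    have "real (2 * R) powr (4*H) = 2 powr (4*H) * real R powr (4*H)" by (simp add: powr_mult)
    also have "\<dots> \<le> 2 powr 4 * real R powr (4*H)" using H by (intro mult_right_mono powr_mono) auto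
    finally show "real (2 * R) powr (4*H) \<le> 16 * real R powr (4*H)" by simp
  qed (use Cm0 in auto)
  also have "(2 * (real n / real R)) * (16 * real R powr (4*H)) = 32 * (real n * real R powr (4*H - 1))"
    using R by (simp add: powr_diff)
  finally show ?thesis by simp
qed

end

section \<open>Variance of sums of squared window sums\<close>

context lrd
begin

lemma D_cov_bound: "\<bar>expectation (\<lambda>\<omega>. D i l \<omega> * D j l \<omega>)\<bar> \<le> Cv * real l powr (2*H)"
proof -
  have L2: "D i l \<in> L2" for i by (rule L4_L2[OF D_L4])
  have "\<bar>expectation (\<lambda>\<omega>. D i l \<omega> * D j l \<omega>)\<bar> \<le> expectation (\<lambda>\<omega>. \<bar>D i l \<omega> * D j l \<omega>\<bar>)" by (rule integral_abs_bound)
  also have "\<dots> \<le> expectation (\<lambda>\<omega>. ((D i l \<omega>)\<^sup>2 + (D j l \<omega>)\<^sup>2) / 2)"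
  proof (rule integral_mono)
    show "integrable M (\<lambda>\<omega>. \<bar>D i l \<omega> * D j l \<omega>\<bar>)" using L2_mult_integrable[OF L2 L2] by simp
    show "integrable M (\<lambda>\<omega>. ((D i l \<omega>)\<^sup>2 + (D j l \<omega>)\<^sup>2) / 2)" using L2_integrable_square[OF L2] by simp
    show "\<bar>D i l \<omega> * D j l \<omega>\<bar> \<le> ((D i l \<omega>)\<^sup>2 + (D j l \<omega>)\<^sup>2) / 2" for \<omega>
      using sum_squares_bound[of "\<bar>D i l \<omega>\<bar>" "\<bar>D j l \<omega>\<bar>"] by (simp add: abs_mult)
  qed
  also have "\<dots> = (expectation (\<lambda>\<omega>. (D i l \<omega>)\<^sup>2) + expectation (\<lambda>\<omega>. (D j l \<omega>)\<^sup>2)) / 2"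
    using L2_integrable_square[OF L2] by simp
  also have "\<dots> \<le> Cv * real l powr (2*H)" using D_second[of i l] D_second[of j l] by simp
  finally show ?thesis .
qed

text \<open>Windows that start at distance \<open>m \<ge> 2 * l\<close> leave lags of at least
  \<open>m / 2\<close>. The factor 2 bounds \<open>2 powr (2 - 2*H)\<close>, which comes from this
  halving.\<close>

lemma D_cov_far:
  assumes l: "1 \<le> l" and m: "2 * l \<le> m" "int m \<le> \<bar>int i - int j\<bar>"
  shows "\<bar>expectation (\<lambda>\<omega>. D i l \<omega> * D j l \<omega>)\<bar> \<le> 2 * Cg * (real l / real m) powr (2 - 2*H) * real l powr (2*H)"
proof -
  let ?A = "{int i<..int (i + l)}" and ?B = "{int j<..int (j + l)}"
  have m0: "0 < real m" using l m by simp
  have g: "\<bar>\<gamma> (b - a)\<bar> \<le> Cg * (2 * real m powr (2*H - 2))" if "a \<in> ?A" "b \<in> ?B" for a b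
  proof -
    have lm: "2 * int l \<le> int m" using m(1) by linarith
    have ab: "int i < a" "a \<le> int i + int l" "int j < b" "b \<le> int j + int l" using that by auto
    have "int m \<le> 2 * \<bar>b - a\<bar>"
    proof (cases "i \<le> j")
      case True
      then have "int m \<le> int j - int i" using m(2) by simp
      then have "int m \<le> 2 * (b - a)" using ab lm by presburger
      then show ?thesis by presburger
    next
      case False
      then have "int m \<le> int i - int j" using m(2) by simp
      then have "int m \<le> 2 * (a - b)" using ab lm by presburger
      then show ?thesis by presburger
    qed
    then have "real_of_int (int m) \<le> real_of_int (2 * \<bar>b - a\<bar>)" by (simp only: of_int_le_iff)
    then have "real m / 2 \<le> real_of_int \<bar>b - a\<bar>" by simp
    then have le: "real m / 2 \<le> 1 + real_of_int \<bar>b - a\<bar>" by (rule order_trans) simp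
    have "\<bar>\<gamma> (b - a)\<bar> \<le> Cg * (1 + real_of_int \<bar>b - a\<bar>) powr (2*H - 2)" by (rule gam)
    also have "\<dots> \<le> Cg * (real m / 2) powr (2*H - 2)"
      using le m0 H Cg0 by (intro mult_left_mono powr_mono2') auto
    also have "(real m / 2) powr (2*H - 2) = real m powr (2*H - 2) * 2 powr (2 - 2*H)"
      using m0 by (simp add: powr_divide powr_minus_divide[symmetric] divide_powr_uminus)
    also have "Cg * (real m powr (2*H - 2) * 2 powr (2 - 2*H)) \<le> Cg * (real m powr (2*H - 2) * 2 powr 1)"
      using H Cg0 by (intro mult_left_mono powr_mono) auto
    finally show ?thesis by (simp add: mult.commute)
  qed
  have "\<bar>expectation (\<lambda>\<omega>. D i l \<omega> * D j l \<omega>)\<bar> = \<bar>\<Sum>a\<in>?A. \<Sum>b\<in>?B. \<gamma> (b - a)\<bar>"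
    unfolding D_def YS_cov ..
  also have "\<dots> \<le> (\<Sum>a\<in>?A. \<bar>\<Sum>b\<in>?B. \<gamma> (b - a)\<bar>)" by (rule sum_abs)
  also have "\<dots> \<le> (\<Sum>a\<in>?A. \<Sum>b\<in>?B. Cg * (2 * real m powr (2*H - 2)))"
    by (intro sum_mono order_trans[OF sum_abs] g)
  also have "\<dots> = 2 * Cg * (real l ^ 2 * real m powr (2*H - 2))" by (simp add: power2_eq_square)
  also have "real l ^ 2 * real m powr (2*H - 2) = (real l / real m) powr (2 - 2*H) * real l powr (2*H)"
  proof -
    have "real l ^ 2 = real l powr (2 - 2*H) * real l powr (2*H)" using l by (simp add: powr_add[symmetric])
    moreover have "real m powr (2*H - 2) = 1 / real m powr (2 - 2*H)" using powr_minus_divide[of "real m" "2 - 2*H"] by simp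
    ultimately show ?thesis by (simp add: powr_divide)
  qed
  finally show ?thesis by simp
qed

text \<open>With \<open>l\<close> the Bartlett window length, differences of \<open>F\<close> in
  \<open>k\<close> are, up to end effects and centring, the unnormalised estimator of a segment.
  Being cumulative in \<open>k\<close>, it handles all segments through one monotone
  function.\<close>

definition F :: "nat \<Rightarrow> nat \<Rightarrow> 'a \<Rightarrow> real" where "F l k \<omega> = (\<Sum>i<k. (D i l \<omega>)\<^sup>2)"

lemma D_square_L2: "(\<lambda>\<omega>. (D i l \<omega>)\<^sup>2) \<in> L2"
  using L4_mult_L2[OF D_L4 D_L4] by (simp add: power2_eq_square)

lemma L2_diff_const: "f \<in> L2 \<Longrightarrow> (\<lambda>\<omega>. f \<omega> - c) \<in> L2"
proof -
  assume f: "f \<in> L2"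
  have "integrable M (\<lambda>\<omega>. (f \<omega>)\<^sup>2 - 2 * c * f \<omega> + c\<^sup>2)" using f L2_integrable[OF f] by (simp add: L2_def)
  then show ?thesis using f by (auto simp: L2_def power2_diff algebra_simps)
qed

lemma F_measurable[measurable]: "F l k \<in> borel_measurable M"
  unfolding F_def[abs_def] by measurable

text \<open>A point \<open>c\<close> lies in at most \<open>l\<close> windows; the constraint on
  \<open>d\<close> is dropped.\<close>

lemma window_count:
  fixes g :: "int \<Rightarrow> int \<Rightarrow> real"
  assumes g: "\<And>c d. 0 \<le> g c d"
  shows "(\<Sum>j<k. \<Sum>c\<in>{int j<..int (j + l)}. \<Sum>d\<in>{int j<..int (j + l)}. g c d)
    \<le> real l * (\<Sum>c\<in>{0<..int (k + l)}. \<Sum>d\<in>{0<..int (k + l)}. g c d)"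
proof -
  let ?U = "{0<..int (k + l)}" and ?w = "\<lambda>j. {int j<..int (j + l)}"
  have "(\<Sum>j<k. \<Sum>c\<in>?w j. \<Sum>d\<in>?w j. g c d) \<le> (\<Sum>j<k. \<Sum>c\<in>?U. \<Sum>d\<in>?U. (if c \<in> ?w j then g c d else 0))"
  proof (rule sum_mono)
    fix j assume "j \<in> {..<k}"
    then have sub: "?w j \<subseteq> ?U" by auto
    have "(\<Sum>c\<in>?w j. \<Sum>d\<in>?w j. g c d) \<le> (\<Sum>c\<in>?w j. \<Sum>d\<in>?U. g c d)"
      using g sub by (intro sum_mono sum_mono2) auto
    also have "\<dots> = (\<Sum>c\<in>?w j. \<Sum>d\<in>?U. (if c \<in> ?w j then g c d else 0))" by (intro sum.cong refl) auto
    also have "\<dots> \<le> (\<Sum>c\<in>?U. \<Sum>d\<in>?U. (if c \<in> ?w j then g c d else 0))"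
      using g sub by (intro sum_mono2 sum_nonneg) auto
    finally show "(\<Sum>c\<in>?w j. \<Sum>d\<in>?w j. g c d) \<le> (\<Sum>c\<in>?U. \<Sum>d\<in>?U. (if c \<in> ?w j then g c d else 0))" .
  qed
  also have "\<dots> = (\<Sum>c\<in>?U. \<Sum>d\<in>?U. \<Sum>j<k. (if c \<in> ?w j then g c d else 0))"
    by (subst sum.swap) (intro sum.cong refl sum.swap)
  also have "\<dots> \<le> (\<Sum>c\<in>?U. \<Sum>d\<in>?U. real l * g c d)"
  proof (intro sum_mono)
    fix c d assume "c \<in> ?U"
    have "(\<Sum>j<k. (if c \<in> ?w j then g c d else 0)) = (\<Sum>j\<in>{j\<in>{..<k}. c \<in> ?w j}. g c d)" by (subst sum.inter_filter) auto
    also have "\<dots> = real (card {j\<in>{..<k}. c \<in> ?w j}) * g c d" by simp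
    also have "\<dots> \<le> real l * g c d"
    proof (rule mult_right_mono[OF _ g])
      have "{j\<in>{..<k}. c \<in> ?w j} \<subseteq> {nat (c - int l)..<nat c}" by auto
      then have "card {j\<in>{..<k}. c \<in> ?w j} \<le> card {nat (c - int l)..<nat c}" by (intro card_mono) auto
      also have "\<dots> \<le> l" by auto
      finally show "real (card {j\<in>{..<k}. c \<in> ?w j}) \<le> real l" by simp
    qed
    finally show "(\<Sum>j<k. (if c \<in> ?w j then g c d else 0)) \<le> real l * g c d" .
  qed
  finally show ?thesis by (simp only: sum_distrib_left)
qed

text \<open>The covariance of two squared window sums is twice the squared covariance plus a
  cumulant sum. At most \<open>2 * m\<close> windows near a given one take the crude covariance
  bound, all others the bound for far windows; the cumulants are handled by counting windows. The
  threshold \<open>m\<close> is left free, to become a small multiple of \<open>n\<close>.\<close>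

lemma F_variance:
  assumes l: "1 \<le> l" and ln: "l \<le> n" and k: "k \<le> 2 * n" and m: "2 * l \<le> m"
  shows "expectation (\<lambda>\<omega>. (F l k \<omega> - expectation (F l k))\<^sup>2) \<le> (real n * real l powr (2*H))\<^sup>2 *
    (8 * Cv\<^sup>2 * (real m / real n) + 32 * Cg\<^sup>2 * ((real l / real m) powr (2 - 2*H))\<^sup>2
      + 6 * Cc * (real l powr (3 - 4*H) * real n powr (2*H - 2)))"
proof -
  define P where "P = real l powr (2*H)"
  have P0: "0 < P" unfolding P_def using l by simp
  have n1: "1 \<le> n" using l ln by simp
  define e where "e i = expectation (\<lambda>\<omega>. (D i l \<omega>)\<^sup>2)" for i
  define g where "g i j = expectation (\<lambda>\<omega>. D i l \<omega> * D j l \<omega>)" for i j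
  let ?w = "\<lambda>j. {int j<..int (j + l)}"
  define Q where "Q i j = (\<Sum>a\<in>?w i. \<Sum>b\<in>?w i. \<Sum>c\<in>?w j. \<Sum>d\<in>?w j. \<kappa> (b - a) (c - a) (d - a))" for i j
  have L2G: "(\<lambda>\<omega>. (D i l \<omega>)\<^sup>2 - e i) \<in> L2" for i by (rule L2_diff_const[OF D_square_L2])
  have EF: "expectation (F l k) = (\<Sum>i<k. e i)"
    unfolding F_def[abs_def] e_def by (rule Bochner_Integration.integral_sum) (rule L2_integrable[OF D_square_L2])
  have cov: "expectation (\<lambda>\<omega>. ((D i l \<omega>)\<^sup>2 - e i) * ((D j l \<omega>)\<^sup>2 - e j)) = 2 * (g i j)\<^sup>2 + Q i j" for i j
  proof -
    have i1: "integrable M (\<lambda>\<omega>. (D i l \<omega>)\<^sup>2 * (D j l \<omega>)\<^sup>2)" by (rule L2_mult_integrable[OF D_square_L2 D_square_L2])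
    have i2: "integrable M (\<lambda>\<omega>. (D i l \<omega>)\<^sup>2)" for i by (rule L2_integrable[OF D_square_L2])
    have "expectation (\<lambda>\<omega>. ((D i l \<omega>)\<^sup>2 - e i) * ((D j l \<omega>)\<^sup>2 - e j))
      = expectation (\<lambda>\<omega>. (D i l \<omega>)\<^sup>2 * (D j l \<omega>)\<^sup>2 - e j * (D i l \<omega>)\<^sup>2 - e i * (D j l \<omega>)\<^sup>2 + e i * e j)"
      by (intro Bochner_Integration.integral_cong refl) (simp add: algebra_simps)
    also have "\<dots> = expectation (\<lambda>\<omega>. (D i l \<omega>)\<^sup>2 * (D j l \<omega>)\<^sup>2) - e j * e i - e i * e j + e i * e j"
      using i1 i2 by (simp add: prob_space e_def)
    also have "expectation (\<lambda>\<omega>. (D i l \<omega>)\<^sup>2 * (D j l \<omega>)\<^sup>2) = expectation (\<lambda>\<omega>. D i l \<omega> * D i l \<omega> * D j l \<omega> * D j l \<omega>)"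
      by (simp add: power2_eq_square mult.assoc)
    also have "\<dots> = Q i j + e i * e j + g i j * g i j + g i j * g i j"
      unfolding Q_def e_def g_def D_def YS_fourth by (simp add: power2_eq_square)
    finally show ?thesis by (simp add: power2_eq_square)
  qed
  have "expectation (\<lambda>\<omega>. (F l k \<omega> - expectation (F l k))\<^sup>2)
    = expectation (\<lambda>\<omega>. \<Sum>i<k. \<Sum>j<k. ((D i l \<omega>)\<^sup>2 - e i) * ((D j l \<omega>)\<^sup>2 - e j))"
    unfolding EF unfolding F_def sum_subtractf[symmetric] power2_eq_square sum_product ..
  also have "\<dots> = (\<Sum>i<k. \<Sum>j<k. expectation (\<lambda>\<omega>. ((D i l \<omega>)\<^sup>2 - e i) * ((D j l \<omega>)\<^sup>2 - e j)))"
    by (subst Bochner_Integration.integral_sum, intro Bochner_Integration.integrable_sum L2_mult_integrable L2G,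
        intro sum.cong refl Bochner_Integration.integral_sum L2_mult_integrable L2G)
  also have "\<dots> = 2 * (\<Sum>i<k. \<Sum>j<k. (g i j)\<^sup>2) + (\<Sum>i<k. \<Sum>j<k. Q i j)"
    unfolding cov by (simp add: sum.distrib sum_distrib_left)
  also have "(\<Sum>i<k. \<Sum>j<k. (g i j)\<^sup>2) \<le> real k * (real (2 * m) * (Cv * P)\<^sup>2 + real k * (2 * Cg * (real l / real m) powr (2 - 2*H) * P)\<^sup>2)"
  proof -
    have "(\<Sum>j<k. (g i j)\<^sup>2) \<le> real (2 * m) * (Cv * P)\<^sup>2 + real k * (2 * Cg * (real l / real m) powr (2 - 2*H) * P)\<^sup>2" for i
    proof -
      let ?N = "{j\<in>{..<k}. \<bar>int i - int j\<bar> < int m}"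
      have "(\<Sum>j<k. (g i j)\<^sup>2) = (\<Sum>j\<in>?N. (g i j)\<^sup>2) + (\<Sum>j\<in>{..<k} - ?N. (g i j)\<^sup>2)"
      proof -
        have "?N \<subseteq> {..<k}" by blast
        from sum.subset_diff[OF this finite_lessThan, of "\<lambda>j. (g i j)\<^sup>2"] show ?thesis by linarith
      qed
      also have "(\<Sum>j\<in>?N. (g i j)\<^sup>2) \<le> (\<Sum>j\<in>?N. (Cv * P)\<^sup>2)"
      proof (rule sum_mono)
        fix j
        have "\<bar>g i j\<bar> \<le> Cv * P" unfolding g_def P_def by (rule D_cov_bound)
        then show "(g i j)\<^sup>2 \<le> (Cv * P)\<^sup>2" by (metis abs_ge_zero power2_abs power_mono)
      qed
      also have "\<dots> = real (card ?N) * (Cv * P)\<^sup>2" by simp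
      also have "\<dots> \<le> real (2 * m) * (Cv * P)\<^sup>2"
      proof (rule mult_right_mono)
        have "?N \<subseteq> {i + 1 - m..<i + m}" by auto
        then have "card ?N \<le> card {i + 1 - m..<i + m}" by (intro card_mono) auto
        also have "\<dots> \<le> 2 * m" by auto
        finally show "real (card ?N) \<le> real (2 * m)" by simp
      qed simp
      also have "(\<Sum>j\<in>{..<k} - ?N. (g i j)\<^sup>2) \<le> (\<Sum>j\<in>{..<k} - ?N. (2 * Cg * (real l / real m) powr (2 - 2*H) * P)\<^sup>2)"
      proof (rule sum_mono)
        fix j assume "j \<in> {..<k} - ?N"
        then have "\<bar>g i j\<bar> \<le> 2 * Cg * (real l / real m) powr (2 - 2*H) * P"
          unfolding g_def P_def by (intro D_cov_far l m) auto
        then show "(g i j)\<^sup>2 \<le> (2 * Cg * (real l / real m) powr (2 - 2*H) * P)\<^sup>2" by (metis abs_ge_zero power2_abs power_mono)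
      qed
      also have "\<dots> \<le> (\<Sum>j\<in>{..<k}. (2 * Cg * (real l / real m) powr (2 - 2*H) * P)\<^sup>2)" by (intro sum_mono2) auto
      finally show ?thesis by simp
    qed
    then have "(\<Sum>i<k. \<Sum>j<k. (g i j)\<^sup>2) \<le> (\<Sum>i<k. real (2 * m) * (Cv * P)\<^sup>2 + real k * (2 * Cg * (real l / real m) powr (2 - 2*H) * P)\<^sup>2)"
      by (intro sum_mono)
    then show ?thesis by simp
  qed
  also have "(\<Sum>i<k. \<Sum>j<k. Q i j) \<le> real k * (real l * (real l * (real l * (Cc * real (3 * n) powr (2*H - 1)))))"
  proof -
    have "(\<Sum>j<k. Q i j) \<le> real l * (real l * (real l * (Cc * real (3 * n) powr (2*H - 1))))" if i: "i < k" for i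
    proof -
      have "(\<Sum>j<k. Q i j) = (\<Sum>a\<in>?w i. \<Sum>b\<in>?w i. \<Sum>j<k. \<Sum>c\<in>?w j. \<Sum>d\<in>?w j. \<kappa> (b - a) (c - a) (d - a))"
        unfolding Q_def by (subst sum.swap) (intro sum.cong refl sum.swap)
      also have "\<dots> \<le> (\<Sum>a\<in>?w i. \<Sum>b\<in>?w i. real l * (Cc * real (3 * n) powr (2*H - 1)))"
      proof (intro sum_mono)
        fix a b assume a: "a \<in> ?w i"
        have "(\<Sum>j<k. \<Sum>c\<in>?w j. \<Sum>d\<in>?w j. \<kappa> (b - a) (c - a) (d - a)) \<le> (\<Sum>j<k. \<Sum>c\<in>?w j. \<Sum>d\<in>?w j. \<bar>\<kappa> (b - a) (c - a) (d - a)\<bar>)"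
          by (intro sum_mono) auto
        also have "\<dots> \<le> real l * (\<Sum>c\<in>{0<..int (k + l)}. \<Sum>d\<in>{0<..int (k + l)}. \<bar>\<kappa> (b - a) (c - a) (d - a)\<bar>)"
          by (rule window_count) auto
        \<comment> \<open>All points involved lie in \<open>{0<..3 * n}\<close>, because
          \<open>k \<le> 2 * n\<close> and \<open>l \<le> n\<close>; hence \<open>c\<close> and
          \<open>d\<close> are within \<open>3 * n\<close> of \<open>a\<close>.\<close>
        also have "\<dots> \<le> real l * (Cc * real (3 * n) powr (2*H - 1))"
          using a i k ln n1 by (intro mult_left_mono cum_window) auto
        finally show "(\<Sum>j<k. \<Sum>c\<in>?w j. \<Sum>d\<in>?w j. \<kappa> (b - a) (c - a) (d - a)) \<le> real l * (Cc * real (3 * n) powr (2*H - 1))" .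
      qed
      also have "\<dots> = real l * (real l * (real l * (Cc * real (3 * n) powr (2*H - 1))))" by simp
      finally show ?thesis .
    qed
    then have "(\<Sum>i<k. \<Sum>j<k. Q i j) \<le> (\<Sum>i<k. real l * (real l * (real l * (Cc * real (3 * n) powr (2*H - 1)))))"
      by (intro sum_mono) auto
    then show ?thesis by simp
  qed
  finally have main: "expectation (\<lambda>\<omega>. (F l k \<omega> - expectation (F l k))\<^sup>2)
    \<le> 2 * (real k * (real (2 * m) * (Cv * P)\<^sup>2 + real k * (2 * Cg * (real l / real m) powr (2 - 2*H) * P)\<^sup>2))
      + real k * (real l * (real l * (real l * (Cc * real (3 * n) powr (2*H - 1)))))" by simp
  have kn: "real k \<le> 2 * real n" using k by simp
  have "2 * (real k * (real (2 * m) * (Cv * P)\<^sup>2 + real k * (2 * Cg * (real l / real m) powr (2 - 2*H) * P)\<^sup>2))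
    \<le> 2 * ((2 * real n) * (real (2 * m) * (Cv * P)\<^sup>2 + (2 * real n) * (2 * Cg * (real l / real m) powr (2 - 2*H) * P)\<^sup>2))"
    using kn by (intro mult_left_mono mult_mono add_mono add_nonneg_nonneg) auto
  also have "\<dots> = (real n * P)\<^sup>2 * (8 * Cv\<^sup>2 * (real m / real n) + 32 * Cg\<^sup>2 * ((real l / real m) powr (2 - 2*H))\<^sup>2)"
    using n1 by (simp add: power2_eq_square field_simps)
  finally have t1: "2 * (real k * (real (2 * m) * (Cv * P)\<^sup>2 + real k * (2 * Cg * (real l / real m) powr (2 - 2*H) * P)\<^sup>2))
    \<le> (real n * P)\<^sup>2 * (8 * Cv\<^sup>2 * (real m / real n) + 32 * Cg\<^sup>2 * ((real l / real m) powr (2 - 2*H))\<^sup>2)" .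
  have l3: "real l * (real l * real l) = P\<^sup>2 * real l powr (3 - 4*H)"
  proof -
    have "P\<^sup>2 * real l powr (3 - 4*H) = real l powr 3" unfolding P_def power2_eq_square by (simp add: powr_add[symmetric])
    also have "real l powr 3 = real l ^ 3" using l by simp
    finally show ?thesis by (simp add: power3_eq_cube)
  qed
  have n3: "real (3 * n) powr (2*H - 1) \<le> 3 * (real n powr (2*H - 2) * real n)"
  proof -
    have "real (3 * n) powr (2*H - 1) = 3 powr (2*H - 1) * real n powr (2*H - 1)" by (simp add: powr_mult)
    also have "\<dots> \<le> 3 powr 1 * real n powr (2*H - 1)" using H by (intro mult_right_mono powr_mono) auto
    also have "real n powr (2*H - 1) = real n powr (2*H - 2) * real n powr 1" using powr_add[of "real n" "2*H - 2" 1] by simp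
    finally show ?thesis using n1 by simp
  qed
  have "real k * (real l * (real l * (real l * (Cc * real (3 * n) powr (2*H - 1)))))
     = real k * (real l * (real l * real l) * Cc * real (3 * n) powr (2*H - 1))" by (simp add: algebra_simps)
  also have "\<dots> \<le> (2 * real n) * (real l * (real l * real l) * Cc * (3 * (real n powr (2*H - 2) * real n)))"
    using kn n3 Cc0 by (intro mult_mono mult_left_mono) auto
  also have "\<dots> = (real n * P)\<^sup>2 * (6 * Cc * (real l powr (3 - 4*H) * real n powr (2*H - 2)))"
    unfolding l3 by (simp add: power2_eq_square algebra_simps)
  finally have t2: "real k * (real l * (real l * (real l * (Cc * real (3 * n) powr (2*H - 1)))))
    \<le> (real n * P)\<^sup>2 * (6 * Cc * (real l powr (3 - 4*H) * real n powr (2*H - 2)))" .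
  show ?thesis using main t1 t2 unfolding P_def[symmetric] by (simp add: algebra_simps)
qed

lemma D_second_shift: "expectation (\<lambda>\<omega>. (D i l \<omega>)\<^sup>2) = expectation (\<lambda>\<omega>. (D 0 l \<omega>)\<^sup>2)"
proof -
  have re: "(\<Sum>a\<in>{int i<..int (i + l)}. f a) = (\<Sum>a\<in>{int 0<..int (0 + l)}. f (a + int i))" for f :: "int \<Rightarrow> real"
    by (rule sum.reindex_bij_witness[of _ "\<lambda>a. a + int i" "\<lambda>a. a - int i"]) auto
  have "(\<Sum>a\<in>{int i<..int (i + l)}. \<Sum>b\<in>{int i<..int (i + l)}. \<gamma> (b - a)) = (\<Sum>a\<in>{int 0<..int (0 + l)}. \<Sum>b\<in>{int 0<..int (0 + l)}. \<gamma> (b - a))"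
    unfolding re[of "\<lambda>a. \<Sum>b\<in>{int i<..int (i + l)}. \<gamma> (b - a)"]
  proof (rule sum.cong[OF refl])
    fix a
    show "(\<Sum>b\<in>{int i<..int (i + l)}. \<gamma> (b - (a + int i))) = (\<Sum>b\<in>{int 0<..int (0 + l)}. \<gamma> (b - a))"
      unfolding re[of "\<lambda>b. \<gamma> (b - (a + int i))"] by simp
  qed
  then show ?thesis unfolding D_def power2_eq_square YS_cov .
qed

lemma expectation_F: "expectation (F l k) = real k * expectation (\<lambda>\<omega>. (D 0 l \<omega>)\<^sup>2)"
proof -
  have "expectation (F l k) = (\<Sum>i<k. expectation (\<lambda>\<omega>. (D i l \<omega>)\<^sup>2))"
    unfolding F_def[abs_def] by (rule Bochner_Integration.integral_sum) (rule L2_integrable[OF D_square_L2])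
  also have "\<dots> = (\<Sum>i<k. expectation (\<lambda>\<omega>. (D 0 l \<omega>)\<^sup>2))" by (intro sum.cong refl D_second_shift)
  finally show ?thesis by simp
qed

lemma expectation_abs_le_sqrt:
  assumes "f \<in> L2"
  shows "expectation (\<lambda>\<omega>. \<bar>f \<omega>\<bar>) \<le> sqrt (expectation (\<lambda>\<omega>. (f \<omega>)\<^sup>2))"
proof -
  have a: "(\<lambda>\<omega>. \<bar>f \<omega>\<bar>) \<in> L2" using assms by (auto simp: L2_def)
  have "0 \<le> variance (\<lambda>\<omega>. \<bar>f \<omega>\<bar>)" by simp
  also have "variance (\<lambda>\<omega>. \<bar>f \<omega>\<bar>) = expectation (\<lambda>\<omega>. (\<bar>f \<omega>\<bar>)\<^sup>2) - (expectation (\<lambda>\<omega>. \<bar>f \<omega>\<bar>))\<^sup>2"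
    using a by (intro variance_eq L2_integrable L2_integrable_square)
  finally have "(expectation (\<lambda>\<omega>. \<bar>f \<omega>\<bar>))\<^sup>2 \<le> expectation (\<lambda>\<omega>. (f \<omega>)\<^sup>2)" by simp
  then show ?thesis by (rule real_le_rsqrt)
qed

lemma F_L2: "F l k \<in> L2"
proof -
  have "F l k \<in> borel_measurable M" by measurable
  moreover have "integrable M (\<lambda>\<omega>. (F l k \<omega>)\<^sup>2)"
    unfolding F_def power2_eq_square sum_product
    by (intro Bochner_Integration.integrable_sum L2_mult_integrable) (use D_square_L2 in \<open>simp_all add: power2_eq_square\<close>)
  ultimately show ?thesis by (simp add: L2_def)
qed

end

section \<open>The long-run variance estimator\<close>

locale lrd_var = lrd +
  fixes c :: real
  assumes c: "0 < c"
    and vlim: "(\<lambda>l. expectation (\<lambda>\<omega>. (D 0 l \<omega>)\<^sup>2) / real l powr (2*H)) \<longlonglongrightarrow> c\<^sup>2"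
begin

text \<open>The normalisation uses \<open>n\<close> rather than \<open>k\<close>: deviations at all
  endpoints are then on one scale and short initial pieces cause no trouble.\<close>

definition Dev :: "nat \<Rightarrow> nat \<Rightarrow> nat \<Rightarrow> 'a \<Rightarrow> real" where
  "Dev n l k \<omega> = \<bar>F l k \<omega> / (real n * real l powr (2*H)) - c\<^sup>2 * (real k / real n)\<bar>"

lemma Dev_measurable[measurable]: "Dev n l k \<in> borel_measurable M"
  unfolding Dev_def[abs_def] by measurable

lemma Dev_nonneg: "0 \<le> Dev n l k \<omega>" by (simp add: Dev_def)

lemma Dev_integrable: "integrable M (Dev n l k)"
  unfolding Dev_def[abs_def] using L2_integrable[OF F_L2, of l k] by simp

lemma Dev_expectation:
  assumes l: "1 \<le> l" and n: "1 \<le> n" and k: "k \<le> 2 * n"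
    and v: "expectation (\<lambda>\<omega>. (F l k \<omega> - expectation (F l k))\<^sup>2) \<le> (real n * real l powr (2*H))\<^sup>2 * \<beta>"
  shows "expectation (Dev n l k) \<le> sqrt \<beta> + 2 * \<bar>expectation (\<lambda>\<omega>. (D 0 l \<omega>)\<^sup>2) / real l powr (2*H) - c\<^sup>2\<bar>"
proof -
  define p where "p = real n * real l powr (2*H)"
  define e where "e = expectation (\<lambda>\<omega>. (D 0 l \<omega>)\<^sup>2)"
  have p: "0 < p" unfolding p_def using l n by simp
  have L2: "(\<lambda>\<omega>. F l k \<omega> - expectation (F l k)) \<in> L2" by (rule L2_diff_const[OF F_L2])
  have i: "integrable M (\<lambda>\<omega>. \<bar>F l k \<omega> - expectation (F l k)\<bar>)" using L2_integrable[OF L2] by simp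
  have pt: "Dev n l k \<omega> \<le> \<bar>F l k \<omega> - expectation (F l k)\<bar> / p + 2 * \<bar>e / real l powr (2*H) - c\<^sup>2\<bar>" for \<omega>
  proof -
    have e1: "F l k \<omega> / p - c\<^sup>2 * (real k / real n) = (F l k \<omega> - expectation (F l k)) / p + real k / real n * (e / real l powr (2*H) - c\<^sup>2)"
      unfolding expectation_F e_def[symmetric] p_def using l n by (simp add: field_simps)
    have "Dev n l k \<omega> \<le> \<bar>(F l k \<omega> - expectation (F l k)) / p\<bar> + \<bar>real k / real n * (e / real l powr (2*H) - c\<^sup>2)\<bar>"
      unfolding Dev_def p_def[symmetric] e1 by (rule abs_triangle_ineq)
    also have "\<bar>(F l k \<omega> - expectation (F l k)) / p\<bar> = \<bar>F l k \<omega> - expectation (F l k)\<bar> / p" using p by (simp add: abs_divide)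
    also have "\<bar>real k / real n * (e / real l powr (2*H) - c\<^sup>2)\<bar> \<le> 2 * \<bar>e / real l powr (2*H) - c\<^sup>2\<bar>"
      unfolding abs_mult using k n by (intro mult_right_mono) (auto simp: divide_le_eq)
    finally show ?thesis by simp
  qed
  have "expectation (Dev n l k) \<le> expectation (\<lambda>\<omega>. \<bar>F l k \<omega> - expectation (F l k)\<bar> / p + 2 * \<bar>e / real l powr (2*H) - c\<^sup>2\<bar>)"
    using i by (intro integral_mono Dev_integrable pt) auto
  also have "\<dots> = expectation (\<lambda>\<omega>. \<bar>F l k \<omega> - expectation (F l k)\<bar>) / p + 2 * \<bar>e / real l powr (2*H) - c\<^sup>2\<bar>"
    using i by (simp add: prob_space)
  also have "expectation (\<lambda>\<omega>. \<bar>F l k \<omega> - expectation (F l k)\<bar>) / p \<le> sqrt \<beta>"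
  proof -
    have "expectation (\<lambda>\<omega>. \<bar>F l k \<omega> - expectation (F l k)\<bar>) \<le> sqrt (expectation (\<lambda>\<omega>. (F l k \<omega> - expectation (F l k))\<^sup>2))"
      by (rule expectation_abs_le_sqrt[OF L2])
    also have "\<dots> \<le> sqrt (p\<^sup>2 * \<beta>)" using v unfolding p_def by simp
    also have "\<dots> = p * sqrt \<beta>" using p by (simp add: real_sqrt_mult)
    finally show ?thesis using p by (simp add: divide_le_eq mult.commute)
  qed
  finally show ?thesis unfolding e_def by simp
qed

lemma F_mono: "k \<le> k' \<Longrightarrow> F L k \<omega> \<le> F L k' \<omega>"
  unfolding F_def by (intro sum_mono2) auto

text \<open>As in Polya's theorem on uniform convergence of monotone functions: \<open>F\<close>
  increases in \<open>k\<close> and its limit is linear, so the two neighbouring grid points control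
  any \<open>k\<close> up to the increment of the limit. The term \<open>1 / real n\<close> comes
  from integer division.\<close>

lemma Dev_grid:
  assumes K: "1 \<le> K" and n: "1 \<le> n" and L: "1 \<le> L" and k: "k \<le> n"
  shows "Dev n L k \<omega> \<le> (\<Sum>j\<le>K + 1. Dev n L (j * n div K) \<omega>) + c\<^sup>2 * (1 / real K + 1 / real n)"
proof -
  define p where "p = real n * real L powr (2*H)"
  have p: "0 < p" unfolding p_def using L n by simp
  define j where "j = k * K div n"
  define k0 where "k0 = j * n div K"
  define k1 where "k1 = (j + 1) * n div K"
  have jn: "j * n \<le> k * K" unfolding j_def by simp
  have jn1: "k * K < (j + 1) * n" unfolding j_def using n by (metis Suc_eq_plus1 dividend_less_div_times mult.commute mult_Suc add.commute less_le_trans zero_less_one le_refl One_nat_def)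
  have jK: "j \<le> K"
  proof -
    have "k * K div n \<le> n * K div n" using k by (intro div_le_mono) simp
    then show ?thesis unfolding j_def using n by simp
  qed
  have k0k: "k0 \<le> k"
  proof -
    have "j * n div K \<le> k * K div K" using jn by (rule div_le_mono)
    then show ?thesis unfolding k0_def using K by simp
  qed
  have kk1: "k \<le> k1"
  proof -
    have "k * K div K \<le> (j + 1) * n div K" using jn1 by (intro div_le_mono) simp
    then show ?thesis unfolding k1_def using K by simp
  qed
  have r0: "real k \<le> real k0 + real n / real K + 1" and r1: "real k1 \<le> real k + real n / real K + 1"
  proof -
    have a: "real k < (real j + 1) * real n / real K"
      using jn1 K by (simp add: field_simps) (metis of_nat_less_iff of_nat_mult of_nat_add mult.commute)
    have b: "real j * real n / real K < real k0 + 1"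
    proof -
      have "j * n < (k0 + 1) * K" unfolding k0_def using K by (metis Suc_eq_plus1 dividend_less_div_times mult.commute mult_Suc add.commute less_le_trans zero_less_one le_refl One_nat_def)
      then have "real (j * n) < real ((k0 + 1) * K)" by (simp only: of_nat_less_iff)
      then have "real j * real n < (real k0 + 1) * real K" by (simp add: algebra_simps)
      then show ?thesis using K by (simp add: pos_divide_less_eq)
    qed
    have e: "(real j + 1) * real n / real K = real j * real n / real K + real n / real K" by (simp add: add_divide_distrib distrib_right)
    show "real k \<le> real k0 + real n / real K + 1" using a b e by linarith
    have "real k1 \<le> real ((j + 1) * n) / real K" unfolding k1_def by (rule of_nat_div_le_of_nat)
    moreover have "real ((j + 1) * n) / real K = real j * real n / real K + real n / real K" by (simp add: add_divide_distrib distrib_right)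
    moreover have "real j * real n / real K \<le> real k"
    proof -
      have "real (j * n) \<le> real (k * K)" using jn by (simp only: of_nat_le_iff)
      then show ?thesis using K by (simp add: divide_le_eq)
    qed
    ultimately show "real k1 \<le> real k + real n / real K + 1" by linarith
  qed
  have S0: "Dev n L k0 \<omega> \<le> (\<Sum>j\<le>K + 1. Dev n L (j * n div K) \<omega>)" unfolding k0_def using jK Dev_nonneg
    by (intro member_le_sum[of j "{..K + 1}" "\<lambda>j. Dev n L (j * n div K) \<omega>"]) auto
  have S1: "Dev n L k1 \<omega> \<le> (\<Sum>j\<le>K + 1. Dev n L (j * n div K) \<omega>)" unfolding k1_def using jK Dev_nonneg
    by (intro member_le_sum[of "j + 1" "{..K + 1}" "\<lambda>j. Dev n L (j * n div K) \<omega>"]) auto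
  have f: "F L k0 \<omega> / p \<le> F L k \<omega> / p" "F L k \<omega> / p \<le> F L k1 \<omega> / p"
    using F_mono[OF k0k] F_mono[OF kk1] p by (auto intro!: divide_right_mono)
  have q: "c\<^sup>2 * (x / real n) \<le> c\<^sup>2 * (y / real n) + c\<^sup>2 * (1 / real K + 1 / real n)" if "x \<le> y + real n / real K + 1" for x y :: real
  proof -
    have "x / real n \<le> (y + real n / real K + 1) / real n" using that by (intro divide_right_mono) auto
    also have "\<dots> = y / real n + (1 / real K + 1 / real n)" using n by (simp add: add_divide_distrib)
    finally have "c\<^sup>2 * (x / real n) \<le> c\<^sup>2 * (y / real n + (1 / real K + 1 / real n))" by (rule mult_left_mono) simp
    then show ?thesis unfolding distrib_left[of "c\<^sup>2" "y / real n"] .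
  qed
  show ?thesis using S0 S1 f q[OF r0] q[OF r1] unfolding Dev_def p_def[symmetric] by linarith
qed

definition DevM :: "nat \<Rightarrow> nat \<Rightarrow> 'a \<Rightarrow> real" where "DevM n L \<omega> = Max ((\<lambda>k. Dev n L k \<omega>) ` {..n})"

lemma DevM_ge: "k \<le> n \<Longrightarrow> Dev n L k \<omega> \<le> DevM n L \<omega>"
  unfolding DevM_def by (intro Max_ge) auto

lemma DevM_nonneg: "0 \<le> DevM n L \<omega>" using DevM_ge[of 0 n L \<omega>] Dev_nonneg[of n L 0 \<omega>] by simp

lemma DevM_measurable[measurable]: "DevM n L \<in> borel_measurable M"
  unfolding DevM_def[abs_def] by (rule borel_measurable_Max) auto

lemma DevM_integrable: "integrable M (DevM n L)"
proof (rule Bochner_Integration.integrable_bound)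
  show "integrable M (\<lambda>\<omega>. \<Sum>k\<le>n. Dev n L k \<omega>)" by (intro Bochner_Integration.integrable_sum Dev_integrable)
  show "AE \<omega> in M. norm (DevM n L \<omega>) \<le> norm (\<Sum>k\<le>n. Dev n L k \<omega>)"
  proof (intro AE_I2)
    fix \<omega>
    have "DevM n L \<omega> \<le> (\<Sum>k\<le>n. Dev n L k \<omega>)" unfolding DevM_def
      by (intro Max.boundedI) (auto intro!: member_le_sum Dev_nonneg)
    then show "norm (DevM n L \<omega>) \<le> norm (\<Sum>k\<le>n. Dev n L k \<omega>)" using DevM_nonneg[of n L \<omega>] by simp
  qed
qed measurable

context
  fixes l :: "nat \<Rightarrow> nat"
  assumes l_top: "filterlim l at_top sequentially" and l_small: "(\<lambda>n. real (l n) / real n) \<longlonglongrightarrow> 0"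
begin

text \<open>With separation threshold of order \<open>e * n\<close>, near windows contribute order
  \<open>e\<close>, and the other terms vanish because \<open>l\<close> is of smaller order than
  \<open>n\<close>. The second claim is the separation required for far windows.\<close>

lemma variance_factor_converges:
  assumes e: "0 < e"
  shows "(\<lambda>n. 8 * Cv\<^sup>2 * (real (nat \<lceil>e * real n\<rceil>) / real n)
      + 32 * Cg\<^sup>2 * ((real (l n) / real (nat \<lceil>e * real n\<rceil>)) powr (2 - 2*H))\<^sup>2
      + 6 * Cc * (real (l n) powr (3 - 4*H) * real n powr (2*H - 2))) \<longlonglongrightarrow> 8 * Cv\<^sup>2 * e"
    and "eventually (\<lambda>n. 2 * l n \<le> nat \<lceil>e * real n\<rceil>) sequentially"
proof -
  define m where "m n = nat \<lceil>e * real n\<rceil>" for n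
  have mn: "(\<lambda>n. real (m n) / real n) \<longlonglongrightarrow> e"
  proof (rule tendsto_sandwich)
    have b: "e * real n \<le> real (m n)" "real (m n) \<le> e * real n + 1" for n
    proof -
      have "0 \<le> e * real n" using e by simp
      then show "e * real n \<le> real (m n)" "real (m n) \<le> e * real n + 1" unfolding m_def by linarith+
    qed
    show "eventually (\<lambda>n. e \<le> real (m n) / real n) sequentially"
      using eventually_gt_at_top[of 0] by eventually_elim (use b in \<open>simp add: field_simps\<close>)
    show "eventually (\<lambda>n. real (m n) / real n \<le> e + 1 / real n) sequentially"
      using eventually_gt_at_top[of 0] by eventually_elim (use b in \<open>simp add: field_simps\<close>)
    show "(\<lambda>n. e + 1 / real n) \<longlonglongrightarrow> e" using tendsto_add[OF tendsto_const[of e] lim_const_over_n[of 1]] by simp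
  qed simp
  have "(\<lambda>n. (real (l n) / real n) / (real (m n) / real n)) \<longlonglongrightarrow> 0 / e"
    by (intro tendsto_divide l_small mn) (use e in simp)
  then have "(\<lambda>n. (real (l n) / real n) / (real (m n) / real n)) \<longlonglongrightarrow> 0" by (simp only: div_0)
  moreover have "eventually (\<lambda>n. (real (l n) / real n) / (real (m n) / real n) = real (l n) / real (m n)) sequentially"
    using eventually_gt_at_top[of 0] by eventually_elim simp
  ultimately have lm: "(\<lambda>n. real (l n) / real (m n)) \<longlonglongrightarrow> 0" by (rule Lim_transform_eventually)
  have lmp: "(\<lambda>n. (real (l n) / real (m n)) powr (2 - 2*H)) \<longlonglongrightarrow> 0"
  proof -
    have "(\<lambda>n. (real (l n) / real (m n)) powr (2 - 2*H)) \<longlonglongrightarrow> 0 powr (2 - 2*H)"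
      by (rule tendsto_powr'[OF lm tendsto_const]) (use H in auto)
    then show ?thesis by simp
  qed
  have small: "(\<lambda>n. real (l n) powr (3 - 4*H) * real n powr (2*H - 2)) \<longlonglongrightarrow> 0"
  \<comment> \<open>The exponent \<open>3 - 4*H\<close> changes sign at \<open>H = 3/4\<close>; the
    sum of both possible bounds avoids a case distinction in the limit.\<close>
  proof (rule tendsto_sandwich[where f = "\<lambda>_. 0" and h = "\<lambda>n. real n powr (2*H - 2) + real n powr (1 - 2*H)"])
    have neg: "(\<lambda>n. real n powr s) \<longlonglongrightarrow> 0" if "s < 0" for s :: real
      using tendsto_neg_powr[OF that filterlim_real_sequentially] .
    show "(\<lambda>n. real n powr (2*H - 2) + real n powr (1 - 2*H)) \<longlonglongrightarrow> 0"
      using tendsto_add[OF neg[of "2*H - 2"] neg[of "1 - 2*H"]] H by simp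
    have l1: "eventually (\<lambda>n. 1 \<le> l n) sequentially" using l_top unfolding filterlim_at_top by blast
    have ln: "eventually (\<lambda>n. real (l n) / real n < 1) sequentially" using order_tendstoD(2)[OF l_small, of 1] by simp
    show "eventually (\<lambda>n. real (l n) powr (3 - 4*H) * real n powr (2*H - 2) \<le> real n powr (2*H - 2) + real n powr (1 - 2*H)) sequentially"
      using l1 ln eventually_gt_at_top[of 0]
    proof eventually_elim
      case (elim n)
      have le: "1 \<le> real (l n)" "real (l n) \<le> real n" using elim by (auto simp: divide_less_eq)
      have "real (l n) powr (3 - 4*H) \<le> 1 + real n powr (3 - 4*H)"
      proof (cases "0 \<le> 3 - 4*H")
        case True
        then have "real (l n) powr (3 - 4*H) \<le> real n powr (3 - 4*H)" using le by (intro powr_mono2) auto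
        then show ?thesis by simp
      next
        case False
        then have "real (l n) powr (3 - 4*H) \<le> real (l n) powr 0" using le by (intro powr_mono) auto
        then show ?thesis using le by (smt (verit) powr_ge_zero powr_zero_eq_one)
      qed
      then have "real (l n) powr (3 - 4*H) * real n powr (2*H - 2) \<le> (1 + real n powr (3 - 4*H)) * real n powr (2*H - 2)"
        by (intro mult_right_mono) auto
      also have "\<dots> = real n powr (2*H - 2) + real n powr (1 - 2*H)"
        using elim by (simp add: distrib_right powr_add[symmetric])
      finally show ?case .
    qed
  qed auto
  have "(\<lambda>n. 8 * Cv\<^sup>2 * (real (m n) / real n) + 32 * Cg\<^sup>2 * ((real (l n) / real (m n)) powr (2 - 2*H))\<^sup>2
      + 6 * Cc * (real (l n) powr (3 - 4*H) * real n powr (2*H - 2))) \<longlonglongrightarrow> 8 * Cv\<^sup>2 * e + 32 * Cg\<^sup>2 * 0\<^sup>2 + 6 * Cc * 0"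
    by (intro tendsto_intros mn lmp small)
  then show "(\<lambda>n. 8 * Cv\<^sup>2 * (real (nat \<lceil>e * real n\<rceil>) / real n)
      + 32 * Cg\<^sup>2 * ((real (l n) / real (nat \<lceil>e * real n\<rceil>)) powr (2 - 2*H))\<^sup>2
      + 6 * Cc * (real (l n) powr (3 - 4*H) * real n powr (2*H - 2))) \<longlonglongrightarrow> 8 * Cv\<^sup>2 * e"
    unfolding m_def by simp
  have "eventually (\<lambda>n. real (l n) / real (m n) < 1/2) sequentially" using order_tendstoD(2)[OF lm, of "1/2"] by simp
  moreover have "eventually (\<lambda>n. 0 < real (m n) / real n) sequentially" using order_tendstoD(1)[OF mn e] .
  ultimately have "eventually (\<lambda>n. 2 * l n \<le> m n) sequentially"
  proof eventually_elim
    case (elim n)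
    then have "0 < m n" by (cases "m n = 0") auto
    then have "2 * real (l n) < real (m n)" using elim(1) by (simp add: field_simps)
    then show ?case by linarith
  qed
  then show "eventually (\<lambda>n. 2 * l n \<le> nat \<lceil>e * real n\<rceil>) sequentially" unfolding m_def .
qed

lemma Dev_small:
  assumes \<eta>: "0 < \<eta>"
  shows "eventually (\<lambda>n. \<forall>k\<le>2 * n. expectation (Dev n (l n) k) \<le> \<eta>) sequentially"
proof -
  \<comment> \<open>Chosen so that the variance factor falls below a quarter of
    \<open>\<eta>\<^sup>2\<close> and its root below \<open>\<eta> / 2\<close>. The added 1 guards
    against \<open>Cv = 0\<close>.\<close>
  define e where "e = \<eta>\<^sup>2 / (64 * (Cv\<^sup>2 + 1))"
  have C1: "0 < Cv\<^sup>2 + 1" by (simp add: add_nonneg_pos)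
  have e: "0 < e" unfolding e_def using \<eta> C1 by simp
  have "8 * Cv\<^sup>2 * e \<le> 8 * (Cv\<^sup>2 + 1) * e" using e by (intro mult_right_mono mult_left_mono) auto
  also have "\<dots> = \<eta>\<^sup>2 / 8" unfolding e_def using C1 by (simp add: field_simps)
  also have "\<dots> < \<eta>\<^sup>2 / 4" using \<eta> by simp
  finally have lt: "8 * Cv\<^sup>2 * e < \<eta>\<^sup>2 / 4" .
  have l1: "eventually (\<lambda>n. 1 \<le> l n) sequentially" using l_top unfolding filterlim_at_top by blast
  have ln: "eventually (\<lambda>n. real (l n) / real n < 1) sequentially" using order_tendstoD(2)[OF l_small, of 1] by simp
  have "(\<lambda>n. expectation (\<lambda>\<omega>. (D 0 (l n) \<omega>)\<^sup>2) / real (l n) powr (2*H)) \<longlonglongrightarrow> c\<^sup>2"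
    using filterlim_compose[OF vlim l_top] .
  then have v: "eventually (\<lambda>n. \<bar>expectation (\<lambda>\<omega>. (D 0 (l n) \<omega>)\<^sup>2) / real (l n) powr (2*H) - c\<^sup>2\<bar> < \<eta> / 4) sequentially"
    using tendstoD[of _ "c\<^sup>2" sequentially "\<eta>/4"] \<eta> unfolding dist_real_def by simp
  show ?thesis
    using l1 ln v variance_factor_converges(2)[OF e] order_tendstoD(2)[OF variance_factor_converges(1)[OF e] lt] eventually_gt_at_top[of 0]
  proof eventually_elim
    case (elim n)
    have lln: "l n \<le> n" using elim(2,6) by (simp add: divide_less_eq)
    show ?case
    proof (intro allI impI)
      fix k assume k: "k \<le> 2 * n"
      let ?b = "8 * Cv\<^sup>2 * (real (nat \<lceil>e * real n\<rceil>) / real n)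
      + 32 * Cg\<^sup>2 * ((real (l n) / real (nat \<lceil>e * real n\<rceil>)) powr (2 - 2*H))\<^sup>2
      + 6 * Cc * (real (l n) powr (3 - 4*H) * real n powr (2*H - 2))"
      define v where "v = \<bar>expectation (\<lambda>\<omega>. (D 0 (l n) \<omega>)\<^sup>2) / real (l n) powr (2*H) - c\<^sup>2\<bar>"
      define s where "s = sqrt ?b"
      have a: "expectation (Dev n (l n) k) \<le> s + 2 * v"
        unfolding s_def v_def using elim by (intro Dev_expectation F_variance k lln) auto
      have "?b \<le> (\<eta> / 2)\<^sup>2" using elim(5) by (simp add: power_divide)
      then have "sqrt ?b \<le> sqrt ((\<eta> / 2)\<^sup>2)" by (rule real_sqrt_le_mono)
      also have "sqrt ((\<eta> / 2)\<^sup>2) = \<eta> / 2" using \<eta> by simp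
      finally have "s \<le> \<eta> / 2" unfolding s_def .
      moreover have "v < \<eta> / 4" using elim(3) unfolding v_def .
      ultimately show "expectation (Dev n (l n) k) \<le> \<eta>" using a by linarith
    qed
  qed
qed

lemma DevM_converges: "(\<lambda>n. expectation (DevM n (l n))) \<longlonglongrightarrow> 0"
proof (rule LIMSEQ_I)
  fix r :: real assume r: "0 < r"
  obtain K :: nat where K0: "4 * c\<^sup>2 / r < real K" using reals_Archimedean2 by blast
  have "0 \<le> 4 * c\<^sup>2 / r" using r by simp
  then have K: "1 \<le> K" using K0 by (cases K) auto
  have Kr: "c\<^sup>2 * (2 / real K) < r / 2" using K0 K r by (simp add: field_simps)
  \<comment> \<open>The number of grid points, \<open>K + 2\<close>, is fixed by the mesh error
    before \<open>n\<close> grows; together they then contribute \<open>r / 4\<close>.\<close>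
  define \<eta> where "\<eta> = r / (4 * (real K + 2))"
  have \<eta>: "0 < \<eta>" unfolding \<eta>_def using r by simp
  have l1: "eventually (\<lambda>n. 1 \<le> l n) sequentially" using l_top unfolding filterlim_at_top by blast
  have "eventually (\<lambda>n. norm (expectation (DevM n (l n)) - 0) < r) sequentially"
    using Dev_small[OF \<eta>] l1 eventually_ge_at_top[of K]
  proof eventually_elim
    case (elim n)
    have n1: "1 \<le> n" using elim K by simp
    have "expectation (DevM n (l n)) \<le> expectation (\<lambda>\<omega>. (\<Sum>j\<le>K + 1. Dev n (l n) (j * n div K) \<omega>) + c\<^sup>2 * (1 / real K + 1 / real n))"
    proof (rule integral_mono[OF DevM_integrable])
      show "integrable M (\<lambda>\<omega>. (\<Sum>j\<le>K + 1. Dev n (l n) (j * n div K) \<omega>) + c\<^sup>2 * (1 / real K + 1 / real n))"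
        by (intro Bochner_Integration.integrable_add Bochner_Integration.integrable_sum Dev_integrable) simp
      show "DevM n (l n) \<omega> \<le> (\<Sum>j\<le>K + 1. Dev n (l n) (j * n div K) \<omega>) + c\<^sup>2 * (1 / real K + 1 / real n)" for \<omega>
        unfolding DevM_def using Dev_grid[OF K n1 elim(2)] by (intro Max.boundedI) auto
    qed
    also have "\<dots> = (\<Sum>j\<le>K + 1. expectation (Dev n (l n) (j * n div K))) + c\<^sup>2 * (1 / real K + 1 / real n)"
      using Dev_integrable by (simp add: prob_space)
    also have "(\<Sum>j\<le>K + 1. expectation (Dev n (l n) (j * n div K))) \<le> (\<Sum>j\<le>K + 1. \<eta>)"
    proof (rule sum_mono)
      fix j assume "j \<in> {..K + 1}"
      \<comment> \<open>Since \<open>K \<ge> 1\<close>, the overshooting index satisfies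
        \<open>K + 1 \<le> K + K\<close>; here the range up to \<open>2 * n\<close> is used.\<close>
      then have "j * n div K \<le> (K + K) * n div K" using K by (intro div_le_mono mult_le_mono1) auto
      also have "(K + K) * n div K = 2 * n"
      proof -
        have "(K + K) * n = (2 * n) * K" by simp
        then show ?thesis using K by (metis One_nat_def not_one_le_zero nonzero_mult_div_cancel_right)
      qed
      finally show "expectation (Dev n (l n) (j * n div K)) \<le> \<eta>" using elim(1) by blast
    qed
    also have "(\<Sum>j\<le>K + 1. \<eta>) = (real K + 2) * \<eta>" by simp
    also have "\<dots> = r / 4"
    proof -
      have "0 < real K + 2" by simp
      then show ?thesis unfolding \<eta>_def by (simp add: field_simps)
    qed
    also have "c\<^sup>2 * (1 / real K + 1 / real n) \<le> c\<^sup>2 * (2 / real K)"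
    proof (rule mult_left_mono)
      have "1 / real n \<le> 1 / real K" using elim K by (intro divide_left_mono) auto
      then show "1 / real K + 1 / real n \<le> 2 / real K" by simp
    qed simp
    finally have "expectation (DevM n (l n)) < r" using Kr r by linarith
    moreover have "0 \<le> expectation (DevM n (l n))" using DevM_nonneg by (intro Bochner_Integration.integral_nonneg) auto
    ultimately show ?case by simp
  qed
  then show "\<exists>no. \<forall>n\<ge>no. norm (expectation (DevM n (l n)) - 0) < r" unfolding eventually_sequentially .
qed

end

end

text \<open>The source of the triangular weights: a window of length \<open>p\<close> contains both
  points exactly if it starts before the smaller one and reaches the larger one. \<open>nat\<close>
  yields 0 when they are too far apart.\<close>

lemma card_common_windows:
  fixes s t lo hi :: int
  assumes "lo \<le> max s t - int p" "min s t \<le> hi + 1"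
  shows "card {i\<in>{lo..hi}. i < s \<and> s \<le> i + int p \<and> i < t \<and> t \<le> i + int p} = nat (int p - \<bar>s - t\<bar>)"
proof -
  define u where "u = max s t"
  define v where "v = min s t"
  have eq: "i < s \<and> s \<le> i + int p \<and> i < t \<and> t \<le> i + int p \<longleftrightarrow> i < v \<and> u \<le> i + int p" for i
    unfolding u_def v_def by auto
  have "{i\<in>{lo..hi}. i < s \<and> s \<le> i + int p \<and> i < t \<and> t \<le> i + int p} = {u - int p..<v}"
    unfolding eq using assms unfolding u_def[symmetric] v_def[symmetric] by (intro set_eqI) (simp, linarith)
  moreover have "v - (u - int p) = int p - \<bar>s - t\<bar>" unfolding u_def v_def by linarith
  ultimately show ?thesis by (simp only: card_atLeastLessThan_int)
qed

text \<open>Pairs below the diagonal mirror those above it, and lags from \<open>p\<close> on carry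
  weight 0.\<close>

lemma sum_pairs_by_lag:
  fixes z :: "nat \<Rightarrow> real" and w :: "nat \<Rightarrow> real"
  assumes w: "\<And>j. p \<le> j \<Longrightarrow> w j = 0" and p: "1 \<le> p"
  shows "(\<Sum>s\<in>{a<..b}. \<Sum>t\<in>{a<..b}. z s * z t * w (nat \<bar>int s - int t\<bar>))
    = w 0 * (\<Sum>s\<in>{a<..b}. (z s)\<^sup>2) + 2 * (\<Sum>j\<in>{1..p - 1}. w j * (\<Sum>i\<in>{a<..b - j}. z i * z (i + j)))"
proof -
  let ?A = "{a<..b}"
  let ?f = "\<lambda>s t. z s * z t * w (nat \<bar>int s - int t\<bar>)"
  have pairs: "(\<Sum>s\<in>?A. \<Sum>t\<in>{s<..b}. ?f s t) = (\<Sum>j\<in>{1..p - 1}. w j * (\<Sum>i\<in>{a<..b - j}. z i * z (i + j)))"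
  proof -
    have "(\<Sum>s\<in>?A. \<Sum>t\<in>{s<..b}. ?f s t) = (\<Sum>(s,t)\<in>Sigma ?A (\<lambda>s. {s<..b}). ?f s t)" by (rule sum.Sigma) auto
    also have "\<dots> = (\<Sum>(s,t)\<in>{(s,t)\<in>Sigma ?A (\<lambda>s. {s<..b}). t - s \<le> p - 1}. ?f s t)"
    proof (rule sum.mono_neutral_right)
      show "finite (Sigma ?A (\<lambda>s. {s<..b}))" by (intro finite_SigmaI) simp_all
      show "{(s,t)\<in>Sigma ?A (\<lambda>s. {s<..b}). t - s \<le> p - 1} \<subseteq> Sigma ?A (\<lambda>s. {s<..b})" by blast
      show "\<forall>x\<in>Sigma ?A (\<lambda>s. {s<..b}) - {(s,t)\<in>Sigma ?A (\<lambda>s. {s<..b}). t - s \<le> p - 1}. (case x of (s,t) \<Rightarrow> ?f s t) = 0"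
      proof
        fix x assume x: "x \<in> Sigma ?A (\<lambda>s. {s<..b}) - {(s,t)\<in>Sigma ?A (\<lambda>s. {s<..b}). t - s \<le> p - 1}"
        obtain s t where st: "x = (s, t)" by (cases x)
        have "s < t" "\<not> t - s \<le> p - 1" using x unfolding st by auto
        then have "p \<le> nat \<bar>int s - int t\<bar>" using p by linarith
        then show "(case x of (s,t) \<Rightarrow> ?f s t) = 0" unfolding st using w by simp
      qed
    qed
    also have "\<dots> = (\<Sum>(j,i)\<in>Sigma {1..p - 1} (\<lambda>j. {a<..b - j}). w j * (z i * z (i + j)))"
    proof (rule sum.reindex_bij_witness[of _ "\<lambda>(j,i). (i, i + j)" "\<lambda>(s,t). (t - s, s)"], goal_cases)
      case (5 x)
      obtain s t where st: "x = (s, t)" by (cases x)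
      have "s < t" using 5 unfolding st by auto
      then have "nat \<bar>int s - int t\<bar> = t - s" by simp
      then show ?case unfolding st using \<open>s < t\<close> by simp
    qed (use p in auto)
    also have "\<dots> = (\<Sum>j\<in>{1..p - 1}. \<Sum>i\<in>{a<..b - j}. w j * (z i * z (i + j)))" by (rule sum.Sigma[symmetric]) auto
    finally show ?thesis by (simp add: sum_distrib_left)
  qed
  have low: "(\<Sum>s\<in>?A. \<Sum>t\<in>{a<..<s}. ?f s t) = (\<Sum>s\<in>?A. \<Sum>t\<in>{s<..b}. ?f s t)"
  proof -
    have "(\<Sum>s\<in>?A. \<Sum>t\<in>{a<..<s}. ?f s t) = (\<Sum>(s,t)\<in>Sigma ?A (\<lambda>s. {a<..<s}). ?f s t)" by (rule sum.Sigma) auto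
    also have "\<dots> = (\<Sum>(s,t)\<in>Sigma ?A (\<lambda>s. {s<..b}). ?f s t)"
      by (rule sum.reindex_bij_witness[of _ "\<lambda>(s,t). (t,s)" "\<lambda>(s,t). (t,s)"]) (auto simp: abs_minus_commute mult_ac)
    also have "\<dots> = (\<Sum>s\<in>?A. \<Sum>t\<in>{s<..b}. ?f s t)" by (rule sum.Sigma[symmetric]) auto
    finally show ?thesis .
  qed
  have "(\<Sum>t\<in>?A. ?f s t) = (\<Sum>t\<in>{a<..<s}. ?f s t) + (z s)\<^sup>2 * w 0 + (\<Sum>t\<in>{s<..b}. ?f s t)" if "s \<in> ?A" for s
  proof -
    have A: "?A = insert s ({a<..<s} \<union> {s<..b})" using that by auto
    have "(\<Sum>t\<in>?A. ?f s t) = ?f s s + (\<Sum>t\<in>{a<..<s} \<union> {s<..b}. ?f s t)" unfolding A by (rule sum.insert) auto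
    also have "(\<Sum>t\<in>{a<..<s} \<union> {s<..b}. ?f s t) = (\<Sum>t\<in>{a<..<s}. ?f s t) + (\<Sum>t\<in>{s<..b}. ?f s t)" by (rule sum.union_disjoint) auto
    finally show ?thesis by (simp add: power2_eq_square)
  qed
  then have "(\<Sum>s\<in>?A. \<Sum>t\<in>?A. ?f s t) = (\<Sum>s\<in>?A. (\<Sum>t\<in>{a<..<s}. ?f s t) + (z s)\<^sup>2 * w 0 + (\<Sum>t\<in>{s<..b}. ?f s t))"
    by (intro sum.cong refl)
  also have "\<dots> = (\<Sum>s\<in>?A. \<Sum>t\<in>{a<..<s}. ?f s t) + (\<Sum>s\<in>?A. (z s)\<^sup>2 * w 0) + (\<Sum>s\<in>?A. \<Sum>t\<in>{s<..b}. ?f s t)"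
    by (simp only: sum.distrib)
  also have "\<dots> = w 0 * (\<Sum>s\<in>?A. (z s)\<^sup>2) + 2 * (\<Sum>s\<in>?A. \<Sum>t\<in>{s<..b}. ?f s t)"
    unfolding low by (simp add: sum_distrib_left mult.commute)
  finally show ?thesis unfolding pairs .
qed

text \<open>The Bartlett weights make the estimator a sum of squared sums over all windows of length
  \<open>q + 1\<close>, the centred observations being extended by zero outside \<open>{a<..b}\<close>.\<close>

lemma bartlett_as_squares:
  fixes z :: "nat \<Rightarrow> real"
  shows "(\<Sum>s\<in>{a<..b}. (z s)\<^sup>2) + 2 * (\<Sum>j\<in>{1..q}. bartlett q j * (\<Sum>i\<in>{a<..b - j}. z i * z (i + j)))
    = (\<Sum>i\<in>{int a - int (q + 1)..int b}. (\<Sum>t | t \<in> {a<..b} \<and> i < int t \<and> int t \<le> i + int (q + 1). z t)\<^sup>2) / real (q + 1)"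
proof -
  define p where "p = q + 1"
  let ?A = "{a<..b}" and ?I = "{int a - int p..int b}"
  \<comment> \<open>The number of windows shared at lag \<open>j\<close>; truncation by
    \<open>nat\<close> makes it vanish from \<open>p\<close> on, and up to lag \<open>q\<close> it
    is \<open>p\<close> times the Bartlett weight.\<close>
  define w where "w j = real (nat (int p - int j))" for j
  have "(\<Sum>i\<in>?I. (\<Sum>t | t \<in> ?A \<and> i < int t \<and> int t \<le> i + int p. z t)\<^sup>2)
    = (\<Sum>i\<in>?I. \<Sum>s\<in>?A. \<Sum>t\<in>?A. (if i < int s \<and> int s \<le> i + int p \<and> i < int t \<and> int t \<le> i + int p then z s * z t else 0))"
  proof (rule sum.cong[OF refl])
    fix i
    have "(\<Sum>t | t \<in> ?A \<and> i < int t \<and> int t \<le> i + int p. z t) = (\<Sum>t\<in>?A. if i < int t \<and> int t \<le> i + int p then z t else 0)"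
      by (subst sum.inter_filter[symmetric]) auto
    then have "(\<Sum>t | t \<in> ?A \<and> i < int t \<and> int t \<le> i + int p. z t)\<^sup>2
      = (\<Sum>s\<in>?A. \<Sum>t\<in>?A. (if i < int s \<and> int s \<le> i + int p then z s else 0) * (if i < int t \<and> int t \<le> i + int p then z t else 0))"
      by (simp only: power2_eq_square sum_product)
    also have "\<dots> = (\<Sum>s\<in>?A. \<Sum>t\<in>?A. (if i < int s \<and> int s \<le> i + int p \<and> i < int t \<and> int t \<le> i + int p then z s * z t else 0))"
      by (intro sum.cong refl) auto
    finally show "(\<Sum>t | t \<in> ?A \<and> i < int t \<and> int t \<le> i + int p. z t)\<^sup>2
      = (\<Sum>s\<in>?A. \<Sum>t\<in>?A. (if i < int s \<and> int s \<le> i + int p \<and> i < int t \<and> int t \<le> i + int p then z s * z t else 0))" .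
  qed
  also have "\<dots> = (\<Sum>s\<in>?A. \<Sum>t\<in>?A. \<Sum>i\<in>?I. (if i < int s \<and> int s \<le> i + int p \<and> i < int t \<and> int t \<le> i + int p then z s * z t else 0))"
    by (subst sum.swap) (intro sum.cong refl sum.swap)
  also have "\<dots> = (\<Sum>s\<in>?A. \<Sum>t\<in>?A. z s * z t * w (nat \<bar>int s - int t\<bar>))"
  proof (intro sum.cong refl)
    fix s t assume st: "s \<in> ?A" "t \<in> ?A"
    have "(\<Sum>i\<in>?I. (if i < int s \<and> int s \<le> i + int p \<and> i < int t \<and> int t \<le> i + int p then z s * z t else 0))
      = (\<Sum>i\<in>{i\<in>?I. i < int s \<and> int s \<le> i + int p \<and> i < int t \<and> int t \<le> i + int p}. z s * z t)"
      by (subst sum.inter_filter) auto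
    also have "\<dots> = real (card {i\<in>?I. i < int s \<and> int s \<le> i + int p \<and> i < int t \<and> int t \<le> i + int p}) * (z s * z t)" by simp
    also have "card {i\<in>?I. i < int s \<and> int s \<le> i + int p \<and> i < int t \<and> int t \<le> i + int p} = nat (int p - \<bar>int s - int t\<bar>)"
      by (rule card_common_windows) (use st in auto)
    finally show "(\<Sum>i\<in>?I. (if i < int s \<and> int s \<le> i + int p \<and> i < int t \<and> int t \<le> i + int p then z s * z t else 0))
      = z s * z t * w (nat \<bar>int s - int t\<bar>)" unfolding w_def by simp
  qed
  also have "\<dots> = w 0 * (\<Sum>s\<in>?A. (z s)\<^sup>2) + 2 * (\<Sum>j\<in>{1..p - 1}. w j * (\<Sum>i\<in>{a<..b - j}. z i * z (i + j)))"
    by (rule sum_pairs_by_lag) (auto simp: w_def p_def)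
  also have "\<dots> = real p * (\<Sum>s\<in>?A. (z s)\<^sup>2) + 2 * (\<Sum>j\<in>{1..q}. real p * (bartlett q j * (\<Sum>i\<in>{a<..b - j}. z i * z (i + j))))"
  proof -
    have "w j = real p * bartlett q j" if "j \<in> {1..q}" for j
    proof -
      have "w j = real p - real j" 
      proof -
        have "nat (int p - int j) = p - j" by simp
        then show ?thesis using that unfolding w_def p_def by (simp add: of_nat_diff)
      qed
      also have "\<dots> = real p * bartlett q j" unfolding bartlett_def p_def by (simp add: field_simps)
      finally show ?thesis .
    qed
    then have "(\<Sum>j\<in>{1..p - 1}. w j * (\<Sum>i\<in>{a<..b - j}. z i * z (i + j))) = (\<Sum>j\<in>{1..q}. real p * (bartlett q j * (\<Sum>i\<in>{a<..b - j}. z i * z (i + j))))"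
      by (intro sum.cong) (auto simp: p_def)
    moreover have "w 0 = real p" by (simp add: w_def)
    ultimately show ?thesis by simp
  qed
  also have "\<dots> = real p * ((\<Sum>s\<in>?A. (z s)\<^sup>2) + 2 * (\<Sum>j\<in>{1..q}. bartlett q j * (\<Sum>i\<in>{a<..b - j}. z i * z (i + j))))"
    by (simp add: sum_distrib_left algebra_simps)
  finally show ?thesis unfolding p_def[symmetric] by (simp add: p_def)
qed

section \<open>The estimator in terms of window sums of the centred process\<close>

context lrd
begin

lemma D_eq_sum: "D i l \<omega> = (\<Sum>t\<in>{i<..i + l}. Y (int t) \<omega>)"
proof -
  have "{int i<..int (i + l)} = {int (Suc i)..int (i + l)}" by auto
  also have "\<dots> = int ` {Suc i..i + l}" by (rule image_int_atLeastAtMost[symmetric])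
  also have "{Suc i..i + l} = {i<..i + l}" by auto
  finally show ?thesis unfolding D_def YS_def by (simp add: sum.reindex)
qed

lemma psum_eq: "a \<le> b \<Longrightarrow> psum X \<omega> a b = D a (b - a) \<omega> + real (b - a) * \<mu>"
  unfolding psum_def D_eq_sum Y_def by (simp add: sum_subtractf)

text \<open>Only windows overhanging an end differ from uncut ones starting inside the segment. On
  the left the truncated window is itself a partial sum from \<open>a\<close>; on the right the
  discrepancy is the overhang beyond \<open>b\<close>.\<close>

lemma window_sum:
  assumes ab: "a < b" and p: "1 \<le> p" "p \<le> b - a" and i: "i \<in> {int a - int p..int b}"
  shows "\<bar>(\<Sum>t | t \<in> {a<..b} \<and> i < int t \<and> int t \<le> i + int p. Y (int t) \<omega>)
      - (if int a \<le> i \<and> i < int b then D (nat i) p \<omega> else 0)\<bar>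
    \<le> (if i < int a \<or> int b - int p < i then (max (Mx a p \<omega>) (Mx b p \<omega>)) else 0)"
proof -
  let ?S = "\<lambda>i. {t. t \<in> {a<..b} \<and> i < int t \<and> int t \<le> i + int p}"
  have ib: "int a - int p \<le> i" "i \<le> int b" using i by auto
  have pb: "int p \<le> int b - int a" using p ab by linarith
  consider "i < int a" | "int a \<le> i" "i \<le> int b - int p" | "int a \<le> i" "int b - int p < i" "i < int b" | "i = int b"
    using ib by linarith
  then show ?thesis
  proof cases
    case 1
    define r where "r = nat (i + int p - int a)"
    have r: "int r = i + int p - int a" unfolding r_def using ib by simp
    have S: "?S i = {a<..a + r}" using 1 r pb by (intro set_eqI) (simp, linarith)
    have "r \<le> p" using r 1 by linarith
    then have "\<bar>D a r \<omega>\<bar> \<le> Mx a p \<omega>" by (rule Mx_ge)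
    then show ?thesis unfolding S D_eq_sum[symmetric] using 1 by (simp add: le_max_iff_disj)
  next
    case 2
    define k where "k = nat i"
    have k: "i = int k" unfolding k_def using 2 by simp
    have S: "?S i = {k<..k + p}" using 2 k by (intro set_eqI) (simp, linarith)
    have "\<not> (i < int a \<or> int b - int p < i)" "int a \<le> i \<and> i < int b" using 2 p by linarith+
    then show ?thesis unfolding S D_eq_sum[symmetric] k_def[symmetric] by simp
  next
    case 3
    define k where "k = nat i"
    have k: "i = int k" unfolding k_def using 3 by simp
    define r where "r = k + p - b"
    have kb: "k < b" "k + p = b + r" using 3 k unfolding r_def by linarith+
    have S: "?S i = {k<..k + (b - k)}" using 3 k by (intro set_eqI) (simp, linarith)
    have "D k ((b - k) + r) \<omega> = D k (b - k) \<omega> + D (k + (b - k)) r \<omega>" by (rule D_add)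
    moreover have "(b - k) + r = p" "k + (b - k) = b" using kb by linarith+
    ultimately have "D k p \<omega> = D k (b - k) \<omega> + D b r \<omega>" by simp
    moreover have "r \<le> p" using kb by linarith
    then have "\<bar>D b r \<omega>\<bar> \<le> Mx b p \<omega>" by (rule Mx_ge)
    ultimately show ?thesis unfolding S D_eq_sum[symmetric] k_def[symmetric] using 3 by (simp add: le_max_iff_disj)
  next
    case 4
    have S: "?S i = {}" using 4 by auto
    show ?thesis unfolding S using 4 ab p Mx_nonneg[of a p \<omega>] by (simp add: le_max_iff_disj)
  qed
qed

end

lemma L2_set_diff_le: "\<bar>L2_set f A - L2_set g A\<bar> \<le> L2_set (\<lambda>i. f i - g i) A"
proof -
  have "L2_set f A \<le> L2_set (\<lambda>i. f i - g i) A + L2_set g A"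
    using L2_set_triangle_ineq[of "\<lambda>i. f i - g i" g A] by simp
  moreover have "L2_set g A \<le> L2_set (\<lambda>i. f i - g i) A + L2_set f A"
  proof -
    have "L2_set (\<lambda>i. g i - f i) A = L2_set (\<lambda>i. f i - g i) A" unfolding L2_set_def by (simp add: power2_commute)
    then show ?thesis using L2_set_triangle_ineq[of "\<lambda>i. g i - f i" f A] by simp
  qed
  ultimately show ?thesis by linarith
qed

lemma L2_set_le_card:
  assumes "finite A" "\<And>i. i \<in> A \<Longrightarrow> \<bar>f i\<bar> \<le> e" "0 \<le> e" "\<And>i. i \<in> A - B \<Longrightarrow> f i = 0" "B \<subseteq> A"
  shows "L2_set f A \<le> sqrt (real (card B)) * e"
proof -
  have "(\<Sum>i\<in>A. (f i)\<^sup>2) = (\<Sum>i\<in>B. (f i)\<^sup>2)"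
    using assms by (intro sum.mono_neutral_right) auto
  also have "\<dots> \<le> (\<Sum>i\<in>B. e\<^sup>2)"
  proof (rule sum_mono)
    fix i assume "i \<in> B"
    then have "\<bar>f i\<bar> \<le> e" using assms by blast
    then show "(f i)\<^sup>2 \<le> e\<^sup>2" by (metis abs_ge_zero power2_abs power_mono)
  qed
  also have "\<dots> = real (card B) * e\<^sup>2" by simp
  finally have "L2_set f A \<le> sqrt (real (card B) * e\<^sup>2)" unfolding L2_set_def by simp
  then show ?thesis using assms(3) by (simp add: real_sqrt_mult)
qed

context lrd
begin

text \<open>Makes the square root of the estimator an \<open>l\<^sup>2\<close> norm, so that each
  later modification of the windows costs only the norm of the change.\<close>

lemma lrv_est_squares:
  assumes ab: "a < b"
  shows "lrv_est X q a b \<omega> * (real (b - a) * real (q (b - a) + 1)) =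
    (L2_set (\<lambda>i. \<Sum>t | t \<in> {a<..b} \<and> i < int t \<and> int t \<le> i + int (q (b - a) + 1). Y (int t) \<omega> - D a (b - a) \<omega> / real (b - a))
      {int a - int (q (b - a) + 1)..int b})\<^sup>2"
proof -
  define L where "L = b - a"
  have L: "0 < real L" using ab unfolding L_def by simp
  define z where "z t = Y (int t) \<omega> - D a L \<omega> / real L" for t :: nat
  have z: "X (int t) \<omega> - psum X \<omega> a b / real L = z t" for t
    using psum_eq[of a b \<omega>] ab L unfolding z_def Y_def L_def[symmetric] by (simp add: add_divide_distrib)
  have "lrv_est X q a b \<omega> = (1 / real L) * ((\<Sum>s\<in>{a<..b}. (z s)\<^sup>2) + 2 * (\<Sum>j\<in>{1..q L}. bartlett (q L) j * (\<Sum>i\<in>{a<..b - j}. z i * z (i + j))))"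
    unfolding lrv_est_def Let_def L_def[symmetric] z by (simp add: sum_distrib_left algebra_simps)
  also have "\<dots> = (1 / real L) * ((\<Sum>i\<in>{int a - int (q L + 1)..int b}. (\<Sum>t | t \<in> {a<..b} \<and> i < int t \<and> int t \<le> i + int (q L + 1). z t)\<^sup>2) / real (q L + 1))"
    unfolding bartlett_as_squares ..
  finally have "lrv_est X q a b \<omega> * (real L * real (q L + 1)) = (\<Sum>i\<in>{int a - int (q L + 1)..int b}. (\<Sum>t | t \<in> {a<..b} \<and> i < int t \<and> int t \<le> i + int (q L + 1). z t)\<^sup>2)"
    using L by simp
  then show ?thesis unfolding L_def[symmetric] z_def[symmetric] L2_set_def
    by (simp add: sum_nonneg)
qed

lemma lrv_est_nonneg:
  assumes "a < b"
  shows "0 \<le> lrv_est X q a b \<omega>"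
proof -
  have "0 \<le> lrv_est X q a b \<omega> * (real (b - a) * real (q (b - a) + 1))" unfolding lrv_est_squares[OF assms] by simp
  moreover have "0 < real (b - a) * real (q (b - a) + 1)" using assms by simp
  ultimately show ?thesis by (metis mult_neg_pos not_le)
qed

lemma F_diff: "a \<le> b \<Longrightarrow> F l b \<omega> - F l a \<omega> = (\<Sum>i\<in>{a..<b}. (D i l \<omega>)\<^sup>2)"
proof -
  assume "a \<le> b"
  then have eq: "{..<b} = {..<a} \<union> {a..<b}" by auto
  have "F l b \<omega> = F l a \<omega> + (\<Sum>i\<in>{a..<b}. (D i l \<omega>)\<^sup>2)"
    unfolding F_def eq by (rule sum.union_disjoint) auto
  then show ?thesis by simp
qed

text \<open>Three changes in succession: from \<open>v\<close> to \<open>w\<close> the centring by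
  the segment mean is undone, from \<open>w\<close> to \<open>u k\<close> overhanging windows are
  replaced by uncut ones started inside, from \<open>u k\<close> to \<open>u l\<close> the window is
  shortened to a grid length. The random quantities in the bound depend on neither endpoint.\<close>

lemma lrv_est_approx:
  fixes q :: "nat \<Rightarrow> nat"
  defines "L \<equiv> \<lambda>a b :: nat. b - a" and "p \<equiv> \<lambda>a b :: nat. q (b - a) + 1"
  assumes ab: "a < b" "b \<le> n" and p: "p a b \<le> L a b" "p a b \<le> Q" and l: "l \<le> p a b" "p a b - l \<le> R"
  shows "\<bar>sqrt (lrv_est X q a b \<omega> * (real (L a b) * real (p a b))) - sqrt (F l b \<omega> - F l a \<omega>)\<bar>
    \<le> sqrt (2 * real (p a b)) * Gx n Q \<omega> + sqrt (3 * real (L a b)) * (real (p a b) * (2 * Mx 0 n \<omega> / real (L a b)))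
      + sqrt (\<Sum>i<n + Q. (Mx i R \<omega>)\<^sup>2)"
proof -
  define k where "k = p a b"
  define m where "m = D a (b - a) \<omega> / real (b - a)"
  let ?I = "{int a - int k..int b}"
  let ?S = "\<lambda>i. {t. t \<in> {a<..b} \<and> i < int t \<and> int t \<le> i + int k}"
  have k1: "1 \<le> k" unfolding k_def p_def by simp
  have kL: "k \<le> b - a" using p(1) unfolding k_def L_def .
  have L0: "0 < real (b - a)" using ab by simp
  define v where "v i = (\<Sum>t\<in>?S i. Y (int t) \<omega> - m)" for i
  define w where "w i = (\<Sum>t\<in>?S i. Y (int t) \<omega>)" for i
  define u where "u r i = (if int a \<le> i \<and> i < int b then D (nat i) r \<omega> else 0)" for r i
  have e0: "lrv_est X q a b \<omega> * (real (L a b) * real (p a b)) = (L2_set v ?I)\<^sup>2"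
    using lrv_est_squares[OF ab(1), of q \<omega>] unfolding L_def v_def k_def p_def m_def .
  have vw: "v i - w i = - real (card (?S i)) * m" for i unfolding v_def w_def by (simp add: sum_subtractf)
  have cardS: "card (?S i) \<le> k" for i
  proof -
    have "?S i \<subseteq> {nat (i + 1)..<nat (i + 1) + k}" by auto
    then have "card (?S i) \<le> card {nat (i + 1)..<nat (i + 1) + k}" by (intro card_mono) auto
    then show ?thesis by simp
  qed
  have mb: "\<bar>m\<bar> \<le> 2 * Mx 0 n \<omega> / real (b - a)"
  proof -
    have "D 0 (a + (b - a)) \<omega> = D 0 a \<omega> + D (0 + a) (b - a) \<omega>" by (rule D_add)
    moreover have "\<bar>D 0 (a + (b - a)) \<omega>\<bar> \<le> Mx 0 n \<omega>" "\<bar>D 0 a \<omega>\<bar> \<le> Mx 0 n \<omega>" using ab by (auto intro!: Mx_ge)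
    ultimately have "\<bar>D a (b - a) \<omega>\<bar> \<le> 2 * Mx 0 n \<omega>" by simp
    then show ?thesis unfolding m_def abs_divide using L0 by (simp add: divide_right_mono)
  qed
  have A: "L2_set (\<lambda>i. w i - u k i) ?I \<le> sqrt (2 * real k) * Gx n Q \<omega>"
  proof -
    let ?B = "{int a - int k..<int a} \<union> {int b - int k<..int b}"
    have MG: "max (Mx a k \<omega>) (Mx b k \<omega>) \<le> Gx n Q \<omega>"
      using ab p(2) by (auto intro!: Mx_le Gx_ge simp: k_def)
    have ws: "\<bar>w i - u k i\<bar> \<le> (if i < int a \<or> int b - int k < i then max (Mx a k \<omega>) (Mx b k \<omega>) else 0)" if "i \<in> ?I" for i
      unfolding w_def u_def using window_sum[OF ab(1) k1 kL that] .
    have "L2_set (\<lambda>i. w i - u k i) ?I \<le> sqrt (real (card ?B)) * Gx n Q \<omega>"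
    proof (rule L2_set_le_card)
      fix i assume "i \<in> ?I"
      from ws[OF this] show "\<bar>w i - u k i\<bar> \<le> Gx n Q \<omega>" using MG Gx_nonneg[of n Q \<omega>] by (auto split: if_splits)
    next
      fix i assume i: "i \<in> ?I - ?B"
      then have "\<not> (i < int a \<or> int b - int k < i)" by auto
      then show "w i - u k i = 0" using ws[of i] i by auto
    next
      show "?B \<subseteq> ?I" using kL ab by auto
    qed (auto simp: Gx_nonneg)
    also have "card ?B \<le> 2 * k"
      using card_Un_le[of "{int a - int k..<int a}" "{int b - int k<..int b}"] by simp
    then have "sqrt (real (card ?B)) * Gx n Q \<omega> \<le> sqrt (2 * real k) * Gx n Q \<omega>"
      by (intro mult_right_mono real_sqrt_le_mono Gx_nonneg) simp
    finally show ?thesis .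
  qed
  have B: "L2_set (\<lambda>i. v i - w i) ?I \<le> sqrt (3 * real (b - a)) * (real k * (2 * Mx 0 n \<omega> / real (b - a)))"
  proof -
    have nn: "0 \<le> real k * (2 * Mx 0 n \<omega> / real (b - a))" using Mx_nonneg[of 0 n \<omega>] L0 by simp
    have "L2_set (\<lambda>i. v i - w i) ?I \<le> sqrt (real (card ?I)) * (real k * (2 * Mx 0 n \<omega> / real (b - a)))"
    proof (rule L2_set_le_card)
      fix i
      show "\<bar>v i - w i\<bar> \<le> real k * (2 * Mx 0 n \<omega> / real (b - a))"
        unfolding vw abs_mult using cardS[of i] mb by (intro mult_mono) auto
    qed (use nn in auto)
    also have "\<dots> \<le> sqrt (3 * real (b - a)) * (real k * (2 * Mx 0 n \<omega> / real (b - a)))"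
    proof (intro mult_right_mono real_sqrt_le_mono nn)
      \<comment> \<open>The index interval has \<open>b - a + k + 1\<close> elements, with
        \<open>1 \<le> k \<le> b - a\<close>.\<close>
      have "card ?I = nat (int b - (int a - int k) + 1)" by simp
      also have "\<dots> \<le> 3 * (b - a)" using kL ab k1 by linarith
      finally have "real (card ?I) \<le> real (3 * (b - a))" by (simp only: of_nat_le_iff)
      then show "real (card ?I) \<le> 3 * real (b - a)" by simp
    qed
    finally show ?thesis .
  qed
  \<comment> \<open>\<open>g\<close> receives the indicator of the admissible starting points as a
    number, so that one reindexing serves both for the difference \<open>u k - u l\<close> and for
    \<open>u l\<close> alone.\<close>
  have sumu: "(\<Sum>i\<in>?I. (g (nat i) (if int a \<le> i \<and> i < int b then 1 else 0 :: real))\<^sup>2) = (\<Sum>i\<in>{a..<b}. (g i 1)\<^sup>2)"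
    if g0: "\<And>i. g i 0 = 0" for g :: "nat \<Rightarrow> real \<Rightarrow> real"
  proof -
    have "(\<Sum>i\<in>?I. (g (nat i) (if int a \<le> i \<and> i < int b then 1 else 0))\<^sup>2) = (\<Sum>i\<in>{int a..<int b}. (g (nat i) (if int a \<le> i \<and> i < int b then 1 else 0))\<^sup>2)"
      by (rule sum.mono_neutral_right) (auto simp: g0)
    also have "{int a..<int b} = int ` {a..<b}" by (simp add: image_int_atLeastLessThan)
    also have "(\<Sum>i\<in>int ` {a..<b}. (g (nat i) (if int a \<le> i \<and> i < int b then 1 else 0))\<^sup>2) = (\<Sum>i\<in>{a..<b}. (g i 1)\<^sup>2)"
      by (subst sum.reindex) (auto intro!: sum.cong)
    finally show ?thesis .
  qed
  have ur: "u r i = (if int a \<le> i \<and> i < int b then 1 else 0) * D (nat i) r \<omega>" for r i unfolding u_def by simp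
  have C: "L2_set (\<lambda>i. u k i - u l i) ?I \<le> sqrt (\<Sum>i<n + Q. (Mx i R \<omega>)\<^sup>2)"
  proof -
    have "(\<Sum>i\<in>?I. (u k i - u l i)\<^sup>2) = (\<Sum>i\<in>{a..<b}. (D i k \<omega> - D i l \<omega>)\<^sup>2)"
      unfolding ur left_diff_distrib[symmetric] right_diff_distrib[symmetric]
      using sumu[of "\<lambda>i x. x * (D i k \<omega> - D i l \<omega>)"] by simp
    also have "\<dots> = (\<Sum>i\<in>{a..<b}. (D (i + l) (k - l) \<omega>)\<^sup>2)"
    proof (intro sum.cong refl)
      fix i
      have "D i (l + (k - l)) \<omega> = D i l \<omega> + D (i + l) (k - l) \<omega>" by (rule D_add)
      then show "(D i k \<omega> - D i l \<omega>)\<^sup>2 = (D (i + l) (k - l) \<omega>)\<^sup>2" using l(1) unfolding k_def by simp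
    qed
    also have "\<dots> \<le> (\<Sum>i\<in>{a..<b}. (Mx (i + l) R \<omega>)\<^sup>2)"
    proof (rule sum_mono)
      fix i
      have "\<bar>D (i + l) (k - l) \<omega>\<bar> \<le> Mx (i + l) R \<omega>" using l(2) unfolding k_def by (rule Mx_ge)
      then show "(D (i + l) (k - l) \<omega>)\<^sup>2 \<le> (Mx (i + l) R \<omega>)\<^sup>2" by (metis abs_ge_zero power2_abs power_mono)
    qed
    also have "\<dots> = (\<Sum>i\<in>(\<lambda>i. i + l) ` {a..<b}. (Mx i R \<omega>)\<^sup>2)" by (subst sum.reindex) (auto simp: inj_on_def)
    \<comment> \<open>Shifting by \<open>l \<le> Q\<close> moves the starting points to at most
      \<open>n + Q\<close>; enlarging the range removes the dependence on the segment and on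
      \<open>l\<close>.\<close>
    also have "\<dots> \<le> (\<Sum>i<n + Q. (Mx i R \<omega>)\<^sup>2)" using ab l p by (intro sum_mono2) auto
    finally show ?thesis unfolding L2_set_def by simp
  qed
  have E: "L2_set (u l) ?I = sqrt (F l b \<omega> - F l a \<omega>)"
  proof -
    have "(\<Sum>i\<in>?I. (u l i)\<^sup>2) = (\<Sum>i\<in>{a..<b}. (D i l \<omega>)\<^sup>2)"
      unfolding ur using sumu[of "\<lambda>i x. x * D i l \<omega>"] by simp
    then show ?thesis unfolding L2_set_def F_diff[OF less_imp_le[OF ab(1)]] by simp
  qed
  have "\<bar>L2_set v ?I - L2_set (u l) ?I\<bar> \<le> L2_set (\<lambda>i. v i - w i) ?I + L2_set (\<lambda>i. w i - u k i) ?I + L2_set (\<lambda>i. u k i - u l i) ?I"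
    using L2_set_diff_le[of v ?I w] L2_set_diff_le[of w ?I "u k"] L2_set_diff_le[of "u k" ?I "u l"] by linarith
  also have "\<dots> \<le> sqrt (2 * real k) * Gx n Q \<omega> + sqrt (3 * real (b - a)) * (real k * (2 * Mx 0 n \<omega> / real (b - a))) + sqrt (\<Sum>i<n + Q. (Mx i R \<omega>)\<^sup>2)"
  proof -
    have "L2_set (\<lambda>i. v i - w i) ?I + L2_set (\<lambda>i. w i - u k i) ?I \<le> sqrt (2 * real k) * Gx n Q \<omega> + sqrt (3 * real (b - a)) * (real k * (2 * Mx 0 n \<omega> / real (b - a)))"
      using add_mono[OF A B] by (simp only: add.commute)
    then show ?thesis by (rule add_mono[OF _ C])
  qed
  finally have fin: "\<bar>L2_set v ?I - sqrt (F l b \<omega> - F l a \<omega>)\<bar> \<le> sqrt (2 * real k) * Gx n Q \<omega>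
    + sqrt (3 * real (b - a)) * (real k * (2 * Mx 0 n \<omega> / real (b - a))) + sqrt (\<Sum>i<n + Q. (Mx i R \<omega>)\<^sup>2)" unfolding E .
  have se: "sqrt (lrv_est X q a b \<omega> * (real (L a b) * real (p a b))) = L2_set v ?I" unfolding e0 by (simp add: L2_set_nonneg)
  show ?thesis unfolding se using fin unfolding k_def L_def .
qed

end

lemma powr_quarter_power: "0 \<le> x \<Longrightarrow> (x powr (1/4)) ^ 4 = x" for x :: real
  by (cases "x = 0") (simp_all add: powr_power)

lemma powr_lower: "x \<le> x powr H" if "0 \<le> x" "x \<le> 1" "H \<le> 1" "0 < H" for x H :: real
proof (cases "x = 0")
  case False
  then have "x powr 1 \<le> x powr H" using that by (intro powr_mono') auto
  then show ?thesis using that False by simp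
qed simp

context lrd
begin

lemma Gx_expectation:
  assumes R: "1 \<le> R" "R \<le> n"
  shows "expectation (Gx n R) \<le> (512 * Cm) powr (1/4) * (real n powr (1/4) * real R powr (H - 1/4))"
proof -
  have C: "0 \<le> 512 * Cm * (real n * real R powr (4*H - 1))" using Cm0 by simp
  have "expectation (\<lambda>\<omega>. \<bar>Gx n R \<omega>\<bar>) \<le> (512 * Cm * (real n * real R powr (4*H - 1))) powr (1/4)"
    using Gx_fourth[OF R] powr_quarter_power[OF C] by (intro expectation_abs_le_root4(1)[OF Gx_L4[OF R(1)]]) auto
  also have "\<dots> = (512 * Cm) powr (1/4) * (real n powr (1/4) * (real R powr (4*H - 1)) powr (1/4))"
    using Cm0 by (simp add: powr_mult)
  also have "(real R powr (4*H - 1)) powr (1/4) = real R powr (H - 1/4)" by (simp add: powr_powr algebra_simps diff_divide_distrib)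
  finally show ?thesis using Gx_nonneg by simp
qed

lemma Mx_expectation:
  assumes R: "1 \<le> R"
  shows "expectation (Mx i R) \<le> Cm powr (1/4) * real R powr H"
    and "expectation (\<lambda>\<omega>. (Mx i R \<omega>)\<^sup>2) \<le> (Cm powr (1/4) * real R powr H)\<^sup>2"
proof -
  have e: "(Cm powr (1/4) * real R powr H) ^ 4 = Cm * real R powr (4*H)"
  proof -
    have "(Cm powr (1/4) * real R powr H) ^ 4 = (Cm powr (1/4)) ^ 4 * (real R powr H) ^ 4" by (rule power_mult_distrib)
    also have "(real R powr H) ^ 4 = real R powr (4*H)" using R by (simp add: powr_power mult.commute)
    finally show ?thesis using powr_quarter_power[OF Cm0] by simp
  qed
  have n: "0 \<le> Cm powr (1/4) * real R powr H" by simp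
  have b: "expectation (\<lambda>\<omega>. Mx i R \<omega> ^ 4) \<le> (Cm powr (1/4) * real R powr H) ^ 4" unfolding e by (rule Mx_fourth[OF R])
  show "expectation (Mx i R) \<le> Cm powr (1/4) * real R powr H"
    using expectation_abs_le_root4(1)[OF Mx_L4 b n] Mx_nonneg by simp
  show "expectation (\<lambda>\<omega>. (Mx i R \<omega>)\<^sup>2) \<le> (Cm powr (1/4) * real R powr H)\<^sup>2"
    by (rule expectation_abs_le_root4(2)[OF Mx_L4 b n])
qed

text \<open>The error of shortening windows is an \<open>l\<^sup>2\<close> norm over starting
  points. Its second moment is additive, so a maximal inequality is required only over the short
  remainder \<open>R\<close>.\<close>

definition Sx :: "nat \<Rightarrow> nat \<Rightarrow> 'a \<Rightarrow> real" where "Sx n R \<omega> = sqrt (\<Sum>i<n. (Mx i R \<omega>)\<^sup>2)"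

lemma Sx_measurable[measurable]: "Sx n R \<in> borel_measurable M" unfolding Sx_def[abs_def] by measurable

lemma Sx_nonneg: "0 \<le> Sx n R \<omega>" unfolding Sx_def by (simp add: sum_nonneg)

lemma Sx_L2: "Sx n R \<in> L2"
proof -
  have "(Sx n R \<omega>)\<^sup>2 = (\<Sum>i<n. (Mx i R \<omega>)\<^sup>2)" for \<omega> unfolding Sx_def by (simp add: sum_nonneg)
  moreover have "integrable M (\<lambda>\<omega>. \<Sum>i<n. (Mx i R \<omega>)\<^sup>2)"
    by (intro Bochner_Integration.integrable_sum L2_integrable_square L4_L2 Mx_L4)
  moreover have "Sx n R \<in> borel_measurable M" by measurable
  ultimately show ?thesis by (simp add: L2_def)
qed

lemma Sx_expectation:
  assumes R: "1 \<le> R"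
  shows "expectation (Sx n R) \<le> sqrt (real n) * (Cm powr (1/4) * real R powr H)"
proof -
  have "(Sx n R \<omega>)\<^sup>2 = (\<Sum>i<n. (Mx i R \<omega>)\<^sup>2)" for \<omega> unfolding Sx_def by (simp add: sum_nonneg)
  then have "expectation (\<lambda>\<omega>. (Sx n R \<omega>)\<^sup>2) = (\<Sum>i<n. expectation (\<lambda>\<omega>. (Mx i R \<omega>)\<^sup>2))"
    by (simp add: Bochner_Integration.integral_sum L2_integrable_square L4_L2 Mx_L4)
  also have "\<dots> \<le> (\<Sum>i<n. (Cm powr (1/4) * real R powr H)\<^sup>2)" by (intro sum_mono Mx_expectation(2) R)
  also have "\<dots> = real n * (Cm powr (1/4) * real R powr H)\<^sup>2" by simp
  finally have "sqrt (expectation (\<lambda>\<omega>. (Sx n R \<omega>)\<^sup>2)) \<le> sqrt (real n * (Cm powr (1/4) * real R powr H)\<^sup>2)" by (rule real_sqrt_le_mono)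
  also have "\<dots> = sqrt (real n) * (Cm powr (1/4) * real R powr H)" by (simp add: real_sqrt_mult)
  finally show ?thesis using expectation_abs_le_sqrt[OF Sx_L2, of n R] Sx_nonneg by simp
qed

end

context lrd_var
begin

text \<open>The increment of \<open>F\<close> is compared with \<open>c\<^sup>2\<close> times the
  segment length, at the cost of dividing by the length fraction \<open>\<delta>\<close>. The root
  is taken through \<open>\<bar>y - c\<bar> * c \<le> \<bar>y\<^sup>2 - c\<^sup>2\<bar>\<close>, and
  normalising by \<open>p\<close> instead of \<open>l\<close> costs
  \<open>1 - (l / p) powr H\<close>, at most \<open>(p - l) / p\<close>.\<close>

lemma main_term:
  assumes ab: "a < b" "b \<le> n" "\<delta> * real n \<le> real (b - a)" and \<delta>: "0 < \<delta>" and l: "1 \<le> l" "l \<le> p"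
  shows "\<bar>sqrt (F l b \<omega> - F l a \<omega>) / (sqrt (real (b - a)) * real p powr H) - c\<bar>
    \<le> 2 / (\<delta> * c) * DevM n l \<omega> + c * (real (p - l) / real p)"
proof -
  define L where "L = real (b - a)"
  have n: "0 < real n" using ab by simp
  have L: "0 < L" unfolding L_def using ab by simp
  have lp: "0 < real l" "0 < real p" using l by auto
  define y where "y = sqrt (F l b \<omega> - F l a \<omega>) / (sqrt L * real l powr H)"
  have y0: "0 \<le> y" unfolding y_def using L by (simp add: F_diff[OF less_imp_le[OF ab(1)]] sum_nonneg)
  have y2: "y\<^sup>2 = (F l b \<omega> - F l a \<omega>) / (L * real l powr (2*H))"
  proof -
    have "0 \<le> F l b \<omega> - F l a \<omega>" unfolding F_diff[OF less_imp_le[OF ab(1)]] by (simp add: sum_nonneg)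
    moreover have "(real l powr H)\<^sup>2 = real l powr (2*H)" using lp by (simp add: powr_power mult.commute)
    ultimately show ?thesis unfolding y_def using L by (simp add: power_divide power_mult_distrib)
  qed
  have d: "\<bar>y\<^sup>2 - c\<^sup>2\<bar> \<le> 2 / \<delta> * DevM n l \<omega>"
  proof -
    define P where "P = real n * real l powr (2*H)"
    have P: "0 < P" unfolding P_def using n lp by simp
    have Lab: "L = real b - real a" unfolding L_def using ab by simp
    have eqd: "(y\<^sup>2 - c\<^sup>2) * (L / real n) = (F l b \<omega> / P - c\<^sup>2 * (real b / real n)) - (F l a \<omega> / P - c\<^sup>2 * (real a / real n))"
    proof -
      have "y\<^sup>2 * (L / real n) = (F l b \<omega> - F l a \<omega>) / P" unfolding y2 P_def using L n by simp
      then have "y\<^sup>2 * (L / real n) = F l b \<omega> / P - F l a \<omega> / P" by (simp only: diff_divide_distrib)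
      moreover have "c\<^sup>2 * (L / real n) = c\<^sup>2 * (real b / real n) - c\<^sup>2 * (real a / real n)" unfolding Lab by (simp add: diff_divide_distrib right_diff_distrib)
      ultimately have "(y\<^sup>2 - c\<^sup>2) * (L / real n) = (F l b \<omega> / P - F l a \<omega> / P) - (c\<^sup>2 * (real b / real n) - c\<^sup>2 * (real a / real n))"
        by (simp only: left_diff_distrib)
      then show ?thesis by linarith
    qed
    have "\<bar>(y\<^sup>2 - c\<^sup>2) * (L / real n)\<bar> \<le> Dev n l b \<omega> + Dev n l a \<omega>"
      unfolding eqd Dev_def P_def[symmetric] by (rule abs_triangle_ineq4)
    also have "\<dots> \<le> 2 * DevM n l \<omega>" using DevM_ge[of b n l \<omega>] DevM_ge[of a n l \<omega>] ab by simp
    finally have "\<bar>y\<^sup>2 - c\<^sup>2\<bar> * (L / real n) \<le> 2 * DevM n l \<omega>" using L n by (simp add: abs_mult abs_divide)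
    moreover have "\<delta> \<le> L / real n" using ab(3) n unfolding L_def[symmetric] by (simp add: pos_le_divide_eq)
    then have "\<bar>y\<^sup>2 - c\<^sup>2\<bar> * \<delta> \<le> \<bar>y\<^sup>2 - c\<^sup>2\<bar> * (L / real n)" by (intro mult_left_mono) auto
    ultimately have "\<bar>y\<^sup>2 - c\<^sup>2\<bar> * \<delta> \<le> 2 * DevM n l \<omega>" by linarith
    then show ?thesis using \<delta> by (simp add: field_simps)
  qed
  have yc: "\<bar>y - c\<bar> \<le> 2 / (\<delta> * c) * DevM n l \<omega>"
  proof -
    have "\<bar>y - c\<bar> * c \<le> \<bar>y - c\<bar> * (y + c)" using y0 by (intro mult_left_mono) auto
    also have "\<dots> = \<bar>y\<^sup>2 - c\<^sup>2\<bar>"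
    proof -
      have "y\<^sup>2 - c\<^sup>2 = (y - c) * (y + c)" by (simp add: power2_eq_square algebra_simps)
      then show ?thesis using y0 c by (simp add: abs_mult)
    qed
    finally have "\<bar>y - c\<bar> * c \<le> 2 / \<delta> * DevM n l \<omega>" using d by linarith
    then show ?thesis using c \<delta> by (simp add: field_simps)
  qed
  define r where "r = (real l / real p) powr H"
  have lp1: "real l / real p \<le> 1" using l lp by simp
  have r1: "r \<le> 1" unfolding r_def using lp lp1 H by (intro powr_le1) auto
  have r0: "0 \<le> r" unfolding r_def by simp
  have rl: "real l / real p \<le> r" unfolding r_def using lp lp1 H by (intro powr_lower) auto
  have eq: "sqrt (F l b \<omega> - F l a \<omega>) / (sqrt L * real p powr H) = y * r"
    unfolding y_def r_def using lp by (simp add: powr_divide)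
  have "\<bar>y * r - c\<bar> \<le> \<bar>y - c\<bar> * r + c * (1 - r)"
  proof -
    have "y * r - c = (y - c) * r - c * (1 - r)" by (simp add: algebra_simps)
    then have "\<bar>y * r - c\<bar> \<le> \<bar>(y - c) * r\<bar> + \<bar>c * (1 - r)\<bar>" by linarith
    then show ?thesis using r0 r1 c by (simp add: abs_mult)
  qed
  also have "\<dots> \<le> \<bar>y - c\<bar> * 1 + c * (real (p - l) / real p)"
  proof (intro add_mono mult_left_mono)
    have "real (p - l) / real p = 1 - real l / real p" using l lp by (simp add: of_nat_diff diff_divide_distrib)
    then show "1 - r \<le> real (p - l) / real p" using rl by linarith
  qed (use r1 c in auto)
  also have "\<dots> \<le> 2 / (\<delta> * c) * DevM n l \<omega> + c * (real (p - l) / real p)"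
    using yc by (intro add_right_mono) simp
  finally show ?thesis unfolding L_def[symmetric] eq .
qed

text \<open>Trades the segment-dependent \<open>p\<close> for \<open>Q\<close> through
  \<open>c0 * Q \<le> p \<le> Q\<close>, the side depending on the sign of the exponent. On the
  right only the grid length \<open>l\<close> still depends on the segment.\<close>

lemma lrv_normalized_bound:
  fixes q :: "nat \<Rightarrow> nat"
  assumes ab: "a < b" "b \<le> n" "\<delta> * real n \<le> real (b - a)" and \<delta>: "0 < \<delta>" "\<delta> \<le> 1"
    and p: "p = q (b - a) + 1" "p \<le> b - a" "p \<le> Q" "c0 * real Q \<le> real p" "0 < c0"
    and l: "1 \<le> l" "l \<le> p" "p - l \<le> R"
  shows "\<bar>sqrt (lrv_est X q a b \<omega>) * real p powr (1/2 - H) - c\<bar> \<le>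
      2 / sqrt \<delta> * (c0 * real Q) powr (1/2 - H) / sqrt (real n) * Gx n Q \<omega>
      + 4 / \<delta> * real Q powr (1 - H) / real n * Mx 0 n \<omega>
      + 1 / (sqrt \<delta> * sqrt (real n) * (c0 * real Q) powr H) * Sx (n + Q) R \<omega>
      + 2 / (\<delta> * c) * DevM n l \<omega> + c * (real R / (c0 * real Q))"
proof -
  define L where "L = real (b - a)"
  have n: "0 < real n" using ab by simp
  have L: "0 < L" unfolding L_def using ab by simp
  have p1: "0 < real p" "1 \<le> real p" using p(1) by auto
  have Q: "0 < real Q" using p(1,3) by simp
  have cQ: "0 < c0 * real Q" using Q p by simp
  define s where "s = sqrt L * real p powr H"
  have s: "0 < s" unfolding s_def using L p1 by simp
  have \<delta>n: "0 < \<delta> * real n" using \<delta> n by simp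
  have sL: "sqrt \<delta> * sqrt (real n) \<le> sqrt L" using ab(3) unfolding L_def by (simp flip: real_sqrt_mult)
  have sLp: "0 < sqrt \<delta> * sqrt (real n)" using \<delta> n by simp
  have nn: "0 \<le> lrv_est X q a b \<omega>" by (rule lrv_est_nonneg[OF ab(1)])
  have z: "sqrt (lrv_est X q a b \<omega> * (L * real p)) / s = sqrt (lrv_est X q a b \<omega>) * real p powr (1/2 - H)"
  proof -
    have "real p powr (1/2 - H) = sqrt (real p) / real p powr H" using p1 by (simp add: powr_diff powr_half_sqrt)
    then show ?thesis unfolding s_def using L by (simp add: real_sqrt_mult)
  qed
  have "\<bar>sqrt (lrv_est X q a b \<omega> * (L * real p)) - sqrt (F l b \<omega> - F l a \<omega>)\<bar>
    \<le> sqrt (2 * real p) * Gx n Q \<omega> + sqrt (3 * L) * (real p * (2 * Mx 0 n \<omega> / L)) + Sx (n + Q) R \<omega>"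
    unfolding Sx_def L_def p(1) using lrv_est_approx[of a b n q Q l R \<omega>] ab p l by simp
  then have "\<bar>sqrt (lrv_est X q a b \<omega> * (L * real p)) - sqrt (F l b \<omega> - F l a \<omega>)\<bar> / s
    \<le> (sqrt (2 * real p) * Gx n Q \<omega> + sqrt (3 * L) * (real p * (2 * Mx 0 n \<omega> / L)) + Sx (n + Q) R \<omega>) / s"
    using s by (intro divide_right_mono) auto
  then have t0: "\<bar>sqrt (lrv_est X q a b \<omega>) * real p powr (1/2 - H) - sqrt (F l b \<omega> - F l a \<omega>) / s\<bar>
    \<le> sqrt (2 * real p) / s * Gx n Q \<omega> + sqrt (3 * L) * (real p * 2 / L) / s * Mx 0 n \<omega> + 1 / s * Sx (n + Q) R \<omega>"
    unfolding z[symmetric] using s by (simp add: add_divide_distrib diff_divide_distrib[symmetric] abs_divide mult_ac)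
  have t1: "sqrt (2 * real p) / s * Gx n Q \<omega> \<le> 2 / sqrt \<delta> * (c0 * real Q) powr (1/2 - H) / sqrt (real n) * Gx n Q \<omega>"
  proof (rule mult_right_mono[OF _ Gx_nonneg])
    have "sqrt (2 * real p) / s = sqrt 2 * real p powr (1/2 - H) / sqrt L"
      unfolding s_def using p1 by (simp add: powr_diff powr_half_sqrt real_sqrt_mult)
    also have "\<dots> \<le> 2 * (c0 * real Q) powr (1/2 - H) / (sqrt \<delta> * sqrt (real n))"
    proof (rule frac_le)
      have "sqrt 2 \<le> (2::real)" by (rule real_le_lsqrt) auto
      moreover have "real p powr (1/2 - H) \<le> (c0 * real Q) powr (1/2 - H)" using p cQ H by (intro powr_mono2') auto
      ultimately show "sqrt 2 * real p powr (1/2 - H) \<le> 2 * (c0 * real Q) powr (1/2 - H)" by (intro mult_mono) auto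
    qed (use sL sLp in auto)
    finally show "sqrt (2 * real p) / s \<le> 2 / sqrt \<delta> * (c0 * real Q) powr (1/2 - H) / sqrt (real n)" by simp
  qed
  have t2: "sqrt (3 * L) * (real p * 2 / L) / s * Mx 0 n \<omega> \<le> 4 / \<delta> * real Q powr (1 - H) / real n * Mx 0 n \<omega>"
  proof (rule mult_right_mono[OF _ Mx_nonneg])
    have "sqrt (3 * L) * (real p * 2 / L) / s = 2 * sqrt 3 * real p powr (1 - H) / L"
      unfolding s_def using p1 L by (simp add: powr_diff real_sqrt_mult mult_ac)
    also have "\<dots> \<le> 4 * real Q powr (1 - H) / (\<delta> * real n)"
    proof (rule frac_le)
      have "sqrt 3 \<le> (2::real)" by (rule real_le_lsqrt) auto
      moreover have "real p powr (1 - H) \<le> real Q powr (1 - H)" using p p1 H by (intro powr_mono2) auto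
      ultimately show "2 * sqrt 3 * real p powr (1 - H) \<le> 4 * real Q powr (1 - H)" by (intro mult_mono) auto
    qed (use \<delta>n ab(3) L_def in auto)
    finally show "sqrt (3 * L) * (real p * 2 / L) / s \<le> 4 / \<delta> * real Q powr (1 - H) / real n" by simp
  qed
  have t3: "1 / s * Sx (n + Q) R \<omega> \<le> 1 / (sqrt \<delta> * sqrt (real n) * (c0 * real Q) powr H) * Sx (n + Q) R \<omega>"
  proof (rule mult_right_mono[OF _ Sx_nonneg])
    have "sqrt \<delta> * sqrt (real n) * (c0 * real Q) powr H \<le> s"
      unfolding s_def using sL p cQ H L by (intro mult_mono powr_mono2) auto
    moreover have "0 < sqrt \<delta> * sqrt (real n) * (c0 * real Q) powr H" by (rule mult_pos_pos[OF sLp]) (use p(5) Q in simp)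
    ultimately show "1 / s \<le> 1 / (sqrt \<delta> * sqrt (real n) * (c0 * real Q) powr H)" using s by (intro divide_left_mono mult_pos_pos[OF s]) auto
  qed
  have t4: "\<bar>sqrt (F l b \<omega> - F l a \<omega>) / s - c\<bar> \<le> 2 / (\<delta> * c) * DevM n l \<omega> + c * (real (p - l) / real p)"
    unfolding s_def L_def by (rule main_term[OF ab \<delta>(1) l(1,2)])
  have t5: "c * (real (p - l) / real p) \<le> c * (real R / (c0 * real Q))"
    using c l p cQ by (intro mult_left_mono frac_le) auto
  show ?thesis using t0 t1 t2 t3 t4 t5 by linarith
qed

end

text \<open>From the largest power of two below \<open>L\<close>, boundedly many doublings reach
  \<open>n\<close>, because \<open>n \<le> L / \<delta>\<close>; each multiplies \<open>q\<close> by
  at most a constant.\<close>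

lemma doubling_compare:
  fixes q :: "nat \<Rightarrow> nat"
  assumes mono: "mono_on {1..} q" and dbl: "\<exists>C. \<forall>k. real (q (2^(k+1))) \<le> C * real (q (2^k))" and \<delta>: "0 < \<delta>"
  obtains c0 where "0 < c0" "c0 \<le> 1" "\<And>n L. 1 \<le> L \<Longrightarrow> L \<le> n \<Longrightarrow> \<delta> * real n \<le> real L \<Longrightarrow> c0 * real (q n + 1) \<le> real (q L + 1)"
proof -
  obtain C where C: "\<And>k. real (q (2^(k+1))) \<le> C * real (q (2^k))" using dbl by blast
  \<comment> \<open>At least 1, so that its powers are at least 1 and also cover the summand 1 in
    \<open>q n + 1\<close>.\<close>
  define C1 where "C1 = max 1 C"
  have C1: "1 \<le> C1" "\<And>k. real (q (2^(k+1))) \<le> C1 * real (q (2^k))"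
  proof -
    show "real (q (2^(k+1))) \<le> C1 * real (q (2^k))" for k
      using C[of k] mult_right_mono[of C C1 "real (q (2^k))"] unfolding C1_def by simp
  qed (simp add: C1_def)
  have it: "real (q (2^(k+s))) \<le> C1 ^ s * real (q (2^k))" for k s
  proof (induction s)
    case (Suc s)
    have "real (q (2^(k+Suc s))) \<le> C1 * real (q (2^(k+s)))" using C1(2)[of "k+s"] by simp
    also have "\<dots> \<le> C1 * (C1 ^ s * real (q (2^k)))" using Suc C1(1) by (intro mult_left_mono) auto
    finally show ?case by simp
  qed simp
  obtain s where s: "1 / \<delta> < 2 ^ s" using real_arch_pow[of 2 "1/\<delta>"] by auto
  define c0 where "c0 = 1 / C1 ^ (s + 1)"
  have Cs: "1 \<le> C1 ^ (s + 1)" using C1(1) by (rule one_le_power)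
  show ?thesis
  proof (rule that[of c0])
    show "0 < c0" "c0 \<le> 1" unfolding c0_def using Cs by auto
    fix n L :: nat assume L: "1 \<le> L" "L \<le> n" "\<delta> * real n \<le> real L"
    define k where "k = floor_log L"
    have k: "2^k \<le> L" "L < 2^(k+1)" unfolding k_def using L floor_log_exp2_le[of L] floor_log_exp2_gt[of L] by auto
    have "real n \<le> real L * (1 / \<delta>)" using L(3) \<delta> by (simp add: field_simps)
    also have "\<dots> \<le> 2^(k+1) * 2^s"
    proof (rule mult_mono)
      have "real L \<le> real (2^(k+1))" using k(2) by (simp only: of_nat_le_iff less_imp_le)
      then show "real L \<le> 2^(k+1)" by simp
    qed (use s \<delta> in auto)
    also have "\<dots> = real (2^(k+(s+1)))" by (simp add: power_add)
    finally have "n \<le> 2^(k+(s+1))" by (simp only: of_nat_le_iff)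
    then have "q n \<le> q (2^(k+(s+1)))" using L by (intro mono_onD[OF mono]) auto
    then have "real (q n) \<le> real (q (2^(k+(s+1))))" by simp
    also have "\<dots> \<le> C1 ^ (s + 1) * real (q (2^k))" by (rule it)
    also have "\<dots> \<le> C1 ^ (s + 1) * real (q L)" using mono_onD[OF mono, of "2^k" L] k L Cs by (intro mult_left_mono) auto
    finally have "real (q n + 1) \<le> C1 ^ (s + 1) * real (q L + 1)" using Cs by (simp add: algebra_simps)
    then show "c0 * real (q n + 1) \<le> real (q L + 1)" unfolding c0_def using Cs by (simp add: field_simps)
  qed
qed

text \<open>Rounds a segment-dependent length down to one of \<open>J\<close> lengths that depend on
  \<open>Q\<close> and \<open>J\<close> only. The condition \<open>Q \<le> p * J\<close> keeps the
  index positive, and the summand 2 covers the integer divisions.\<close>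

lemma lag_grid:
  fixes p Q J :: nat
  assumes J: "1 \<le> J" "J \<le> Q" and p: "p \<le> Q" "Q \<le> p * J"
  obtains j where "1 \<le> j" "j \<le> J" "1 \<le> j * Q div J" "j * Q div J \<le> p" "p - j * Q div J \<le> Q div J + 2"
proof
  define j where "j = p * J div Q"
  have Q: "0 < Q" using J by simp
  have "Q div Q \<le> p * J div Q" using p(2) by (rule div_le_mono)
  then show j1: "1 \<le> j" unfolding j_def using Q by simp
  have "p * J div Q \<le> Q * J div Q" using p(1) by (intro div_le_mono) simp
  then show "j \<le> J" unfolding j_def using Q by simp
  have "Q div J \<le> j * Q div J" using j1 by (intro div_le_mono) simp
  moreover have "1 \<le> Q div J" using J div_le_mono[OF J(2), of J] by simp
  ultimately show "1 \<le> j * Q div J" by linarith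
  have jQ: "j * Q \<le> p * J" unfolding j_def by simp
  have "j * Q div J \<le> p * J div J" using jQ by (rule div_le_mono)
  then show "j * Q div J \<le> p" using J by simp
  have m: "x < (x div y + 1) * y" if "0 < y" for x y :: nat
    using that by (metis Suc_eq_plus1 dividend_less_div_times mult.commute mult_Suc add.commute)
  define l where "l = j * Q div J"
  define d where "d = Q div J"
  have a: "p * J < (j + 1) * Q" unfolding j_def by (rule m[OF Q])
  have b: "j * Q < (l + 1) * J" unfolding l_def using J by (intro m) simp
  have e: "Q < (d + 1) * J" unfolding d_def using J by (intro m) simp
  have "p * J < j * Q + Q" using a by simp
  also have "\<dots> < (l + 1) * J + (d + 1) * J" using b e by linarith
  also have "\<dots> = (l + d + 2) * J" by (simp add: algebra_simps)
  finally have "p < l + d + 2" by (simp only: mult_less_cancel2)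
  then show "p - j * Q div J \<le> Q div J + 2" unfolding l_def d_def by linarith
qed

context lrd_var
begin

text \<open>The number \<open>J\<close> of window lengths is fixed first, so that shortening costs
  less than \<open>\<eta> / 2\<close>. Then \<open>n\<close> grows: end effects and centring carry
  positive powers of \<open>Q / n\<close>, and the deviations of the finitely many lengths vanish. A
  single \<open>T\<close> for all segments is what a random break calls for.\<close>

theorem lrv_est_uniform:
  fixes q :: "nat \<Rightarrow> nat"
  assumes mono: "mono_on {1..} q" and dbl: "\<exists>C. \<forall>k. real (q (2^(k+1))) \<le> C * real (q (2^k))"
    and qtop: "filterlim q at_top sequentially" and qn: "(\<lambda>n. real (q n) / real n) \<longlonglongrightarrow> 0"
    and \<delta>: "0 < \<delta>" "\<delta> \<le> 1" and \<eta>: "0 < \<eta>"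
  shows "eventually (\<lambda>n. \<exists>T. integrable M T \<and> expectation T \<le> \<eta> \<and>
    (\<forall>\<omega> a b. a < b \<longrightarrow> b \<le> n \<longrightarrow> \<delta> * real n \<le> real (b - a) \<longrightarrow>
      \<bar>sqrt (lrv_est X q a b \<omega>) * real (q (b - a) + 1) powr (1/2 - H) - c\<bar> \<le> T \<omega>)) sequentially"
proof -
  obtain c0 where c0: "0 < c0" "c0 \<le> 1" "\<And>n L. 1 \<le> L \<Longrightarrow> L \<le> n \<Longrightarrow> \<delta> * real n \<le> real L \<Longrightarrow> c0 * real (q n + 1) \<le> real (q L + 1)"
    using doubling_compare[OF mono dbl \<delta>(1)] by metis
  define Q where "Q n = q n + 1" for n
  define k1 where "k1 = 2 / sqrt \<delta> * c0 powr (1/2 - H) * (512 * Cm) powr (1/4)"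
  define k2 where "k2 = 4 / \<delta> * Cm powr (1/4)"
  define k3 where "k3 = sqrt 2 * Cm powr (1/4) / (sqrt \<delta> * c0 powr H)"
  define k4 where "k4 = 2 / (\<delta> * c)"
  have k0: "0 \<le> k3" "0 < k4" unfolding k3_def k4_def using \<delta> c by auto
  have "(\<lambda>J. k3 * (3 / real J) powr H + c / c0 * (3 / real J)) \<longlonglongrightarrow> k3 * 0 powr H + c / c0 * 0"
    using H by (intro tendsto_intros lim_const_over_n tendsto_powr') auto
  then have "(\<lambda>J. k3 * (3 / real J) powr H + c / c0 * (3 / real J)) \<longlonglongrightarrow> 0" by simp
  then have "eventually (\<lambda>J. k3 * (3 / real J) powr H + c / c0 * (3 / real J) < \<eta>/2) sequentially"
    using \<eta> by (intro order_tendstoD(2)) auto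
  \<comment> \<open>Exceeding \<open>1 / c0\<close> gives \<open>Q n \<le> p * J\<close> later, so
    that \<open>lag_grid\<close> applies.\<close>
  then have "eventually (\<lambda>J. k3 * (3 / real J) powr H + c / c0 * (3 / real J) < \<eta>/2 \<and> nat \<lceil>1 / c0\<rceil> + 1 \<le> J) sequentially"
    using eventually_ge_at_top[of "nat \<lceil>1 / c0\<rceil> + 1"] by (rule eventually_conj)
  then obtain J where J: "k3 * (3 / real J) powr H + c / c0 * (3 / real J) < \<eta>/2" "nat \<lceil>1 / c0\<rceil> + 1 \<le> J"
    using eventually_happens'[OF sequentially_bot] by blast
  have J1: "1 \<le> J" using J(2) by simp
  have cJ: "1 \<le> c0 * real J"
  proof -
    have "1 / c0 \<le> real J" using J(2) by linarith
    then show ?thesis using c0(1) by (simp add: field_simps)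
  qed
  define l where "l j n = j * Q n div J" for j n
  define R where "R n = Q n div J + 2" for n
  define \<rho> where "\<rho> n = real (Q n) / real n" for n
  have \<rho>: "\<rho> \<longlonglongrightarrow> 0"
  proof -
    have "(\<lambda>n. real (q n) / real n + 1 / real n) \<longlonglongrightarrow> 0 + 0" by (intro tendsto_add qn lim_const_over_n)
    then show ?thesis unfolding \<rho>_def Q_def by (simp add: add_divide_distrib add.commute)
  qed
  have Qtop: "filterlim Q at_top sequentially"
    by (rule filterlim_at_top_mono[OF qtop]) (simp add: Q_def)
  have ltop: "filterlim (l j) at_top sequentially" if "1 \<le> j" for j
    unfolding filterlim_at_top
  proof
    fix Z :: nat
    have "eventually (\<lambda>n. Z * J \<le> Q n) sequentially" using Qtop unfolding filterlim_at_top by blast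
    then show "eventually (\<lambda>n. Z \<le> l j n) sequentially"
    proof eventually_elim
      case (elim n)
      have "1 * (Z * J) \<le> j * Q n" by (rule mult_le_mono[OF that elim])
      then have "Z * J \<le> j * Q n" by simp
      then have "Z * J div J \<le> j * Q n div J" by (rule div_le_mono)
      then show ?case unfolding l_def using J1 by simp
    qed
  qed
  have lsmall: "(\<lambda>n. real (l j n) / real n) \<longlonglongrightarrow> 0" for j
  proof (rule tendsto_sandwich[where f = "\<lambda>_. 0" and h = "\<lambda>n. real j * \<rho> n"])
    show "(\<lambda>n. real j * \<rho> n) \<longlonglongrightarrow> 0" using tendsto_mult[OF tendsto_const \<rho>, of "real j"] by simp
    have "l j n \<le> j * Q n" for n unfolding l_def by simp
    then have "real (l j n) \<le> real j * real (Q n)" for n by (metis of_nat_le_iff of_nat_mult)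
    then show "eventually (\<lambda>n. real (l j n) / real n \<le> real j * \<rho> n) sequentially"
      unfolding \<rho>_def by (intro always_eventually allI) (simp add: divide_right_mono)
  qed auto
  have DS: "(\<lambda>n. \<Sum>j\<in>{1..J}. k4 * expectation (DevM n (l j n))) \<longlonglongrightarrow> (\<Sum>j\<in>{1..J}. k4 * 0)"
    by (intro tendsto_sum tendsto_mult tendsto_const DevM_converges ltop lsmall) auto
  have "(\<lambda>n. k1 * \<rho> n powr (1/4) + k2 * \<rho> n powr (1 - H) + (\<Sum>j\<in>{1..J}. k4 * expectation (DevM n (l j n))))
    \<longlonglongrightarrow> k1 * 0 powr (1/4) + k2 * 0 powr (1 - H) + (\<Sum>j\<in>{1..J}. k4 * 0)"
    using H by (intro tendsto_intros DS tendsto_powr'[OF \<rho>]) (auto simp: \<rho>_def)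
  then have "(\<lambda>n. k1 * \<rho> n powr (1/4) + k2 * \<rho> n powr (1 - H) + (\<Sum>j\<in>{1..J}. k4 * expectation (DevM n (l j n)))) \<longlonglongrightarrow> 0" by simp
  then have ev1: "eventually (\<lambda>n. k1 * \<rho> n powr (1/4) + k2 * \<rho> n powr (1 - H) + (\<Sum>j\<in>{1..J}. k4 * expectation (DevM n (l j n))) < \<eta>/2) sequentially"
    using \<eta> by (intro order_tendstoD(2)) auto
  have ev2: "eventually (\<lambda>n. \<rho> n < \<delta>) sequentially" using order_tendstoD(2)[OF \<rho> \<delta>(1)] .
  have ev3: "eventually (\<lambda>n. J \<le> Q n) sequentially" using Qtop unfolding filterlim_at_top by blast
  show ?thesis
    using ev1 ev2 ev3 eventually_gt_at_top[of 0]
  proof eventually_elim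
    case (elim n)
    have n: "0 < real n" using elim by simp
    have Q1: "1 \<le> Q n" "0 < real (Q n)" unfolding Q_def by auto
    have Qd: "real (Q n) < \<delta> * real n" using elim(2) n unfolding \<rho>_def by (simp add: pos_divide_less_eq)
    also have "\<dots> \<le> real n" using \<delta> by (simp add: mult_left_le_one_le)
    finally have Qn: "Q n \<le> n" by simp
    have cQ: "0 < c0 * real (Q n)" using c0 Q1 by simp
    define A1 where "A1 = 2 / sqrt \<delta> * (c0 * real (Q n)) powr (1/2 - H) / sqrt (real n)"
    define A2 where "A2 = 4 / \<delta> * real (Q n) powr (1 - H) / real n"
    define A3 where "A3 = 1 / (sqrt \<delta> * sqrt (real n) * (c0 * real (Q n)) powr H)"
    define A5 where "A5 = c * (real (R n) / (c0 * real (Q n)))"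
    have A0: "0 \<le> A1" "0 \<le> A2" "0 \<le> A3" unfolding A1_def A2_def A3_def using \<delta> by auto
    define T where "T \<omega> = A1 * Gx n (Q n) \<omega> + A2 * Mx 0 n \<omega> + A3 * Sx (n + Q n) (R n) \<omega>
      + (\<Sum>j\<in>{1..J}. k4 * DevM n (l j n) \<omega>) + A5" for \<omega>
    have iG: "integrable M (Gx n (Q n))" by (rule L2_integrable[OF L4_L2[OF Gx_L4[OF Q1(1)]]])
    have iM: "integrable M (Mx 0 n)" by (rule L2_integrable[OF L4_L2[OF Mx_L4]])
    have iS: "integrable M (Sx (n + Q n) (R n))" by (rule L2_integrable[OF Sx_L2])
    have iD: "integrable M (\<lambda>\<omega>. \<Sum>j\<in>{1..J}. k4 * DevM n (l j n) \<omega>)"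
      by (intro Bochner_Integration.integrable_sum integrable_mult_right DevM_integrable)
    have iT: "integrable M T" unfolding T_def[abs_def] using iG iM iS iD by simp
    \<comment> \<open>One third comes from the grid step, two thirds from the rounding summand 2,
      using \<open>J \<le> Q n\<close>.\<close>
    have RQ: "real (R n) / real (Q n) \<le> 3 / real J"
    proof -
      have "real (R n) \<le> real (Q n) / real J + 2" unfolding R_def using of_nat_div_le_of_nat[of "Q n" J] by simp
      then have "real (R n) / real (Q n) \<le> (real (Q n) / real J + 2) / real (Q n)" by (intro divide_right_mono) auto
      also have "\<dots> = 1 / real J + 2 / real (Q n)" using Q1 by (simp add: add_divide_distrib)
      also have "2 / real (Q n) \<le> 2 / real J" using elim(3) J1 by (intro divide_left_mono) auto
      finally show ?thesis by simp
    qed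
    \<comment> \<open>The exponents of \<open>Q n\<close> add up to 1/4, the same power as remains
      of \<open>n\<close> in the denominator.\<close>
    have e1: "A1 * expectation (Gx n (Q n)) \<le> k1 * \<rho> n powr (1/4)"
    proof -
      have "A1 * expectation (Gx n (Q n)) \<le> A1 * ((512 * Cm) powr (1/4) * (real n powr (1/4) * real (Q n) powr (H - 1/4)))"
        by (rule mult_left_mono[OF Gx_expectation[OF Q1(1) Qn] A0(1)])
      also have "\<dots> = k1 * ((real (Q n) powr (1/2 - H) * real (Q n) powr (H - 1/4)) * (real n powr (1/4) / real n powr (1/2)))"
        unfolding A1_def k1_def using n c0 Q1 by (simp add: powr_mult powr_half_sqrt)
      also have "real (Q n) powr (1/2 - H) * real (Q n) powr (H - 1/4) = real (Q n) powr (1/4)"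
        by (simp add: powr_add[symmetric])
      also have "real n powr (1/4) / real n powr (1/2) = 1 / real n powr (1/4)"
        using n by (simp add: powr_diff[symmetric] powr_minus_divide[symmetric])
      finally show ?thesis unfolding \<rho>_def using n by (simp add: powr_divide)
    qed
    have e2: "A2 * expectation (Mx 0 n) \<le> k2 * \<rho> n powr (1 - H)"
    proof -
      have "A2 * expectation (Mx 0 n) \<le> A2 * (Cm powr (1/4) * real n powr H)"
        using elim by (intro mult_left_mono[OF Mx_expectation(1) A0(2)]) auto
      also have "\<dots> = k2 * (real (Q n) powr (1 - H) * (real n powr H / real n powr 1))"
        unfolding A2_def k2_def using n by simp
      also have "real n powr H / real n powr 1 = 1 / real n powr (1 - H)"
        using n by (simp only: powr_diff[symmetric] powr_minus_divide[symmetric]) simp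
      finally show ?thesis unfolding \<rho>_def using n by (simp add: powr_divide)
    qed
    \<comment> \<open>Here the powers of \<open>n\<close> cancel, so this error does not vanish with
      \<open>n\<close>; it is small only through the choice of \<open>J\<close>.\<close>
    have e3: "A3 * expectation (Sx (n + Q n) (R n)) \<le> k3 * (3 / real J) powr H"
    proof -
      have "A3 * expectation (Sx (n + Q n) (R n)) \<le> A3 * (sqrt (real (n + Q n)) * (Cm powr (1/4) * real (R n) powr H))"
        by (intro mult_left_mono[OF Sx_expectation A0(3)]) (simp add: R_def)
      also have "\<dots> \<le> A3 * (sqrt (2 * real n) * (Cm powr (1/4) * real (R n) powr H))"
        using A0 Qn by (intro mult_left_mono mult_right_mono real_sqrt_le_mono) auto
      also have "\<dots> = k3 * (real (R n) powr H / real (Q n) powr H)"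
        unfolding A3_def k3_def using n c0 Q1 by (simp add: powr_mult real_sqrt_mult)
      also have "real (R n) powr H / real (Q n) powr H = (real (R n) / real (Q n)) powr H" by (simp add: powr_divide)
      also have "k3 * (real (R n) / real (Q n)) powr H \<le> k3 * (3 / real J) powr H"
        using RQ k0 H by (intro mult_left_mono powr_mono2) auto
      finally show ?thesis .
    qed
    have e5: "A5 \<le> c / c0 * (3 / real J)"
    proof -
      have "A5 = c / c0 * (real (R n) / real (Q n))" unfolding A5_def by simp
      also have "\<dots> \<le> c / c0 * (3 / real J)" using RQ c c0 by (intro mult_left_mono) auto
      finally show ?thesis .
    qed
    have "expectation T = A1 * expectation (Gx n (Q n)) + A2 * expectation (Mx 0 n) + A3 * expectation (Sx (n + Q n) (R n))
      + (\<Sum>j\<in>{1..J}. k4 * expectation (DevM n (l j n))) + A5"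
    proof -
      have s: "expectation (\<lambda>\<omega>. \<Sum>j\<in>{1..J}. k4 * DevM n (l j n) \<omega>) = (\<Sum>j\<in>{1..J}. k4 * expectation (DevM n (l j n)))"
        by (subst Bochner_Integration.integral_sum) (auto intro!: integrable_mult_right DevM_integrable)
      show ?thesis unfolding T_def[abs_def] s[symmetric] using iG iM iS iD by (simp add: prob_space)
    qed
    then have ET: "expectation T \<le> \<eta>" using e1 e2 e3 e5 elim(1) J(1) by linarith
    have bd: "\<bar>sqrt (lrv_est X q a b \<omega>) * real (q (b - a) + 1) powr (1/2 - H) - c\<bar> \<le> T \<omega>"
      if ab: "a < b" "b \<le> n" "\<delta> * real n \<le> real (b - a)" for \<omega> a b
    proof -
      define p where "p = q (b - a) + 1"
      have pQ: "p \<le> Q n" unfolding p_def Q_def using mono_onD[OF mono, of "b - a" n] ab by simp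
      have "real p < real (b - a)" using pQ Qd ab(3) by linarith
      then have pL: "p \<le> b - a" by simp
      have pc: "c0 * real (Q n) \<le> real p" unfolding p_def Q_def using c0(3)[of "b - a" n] ab by simp
      have "real (Q n) \<le> c0 * real J * real (Q n)" using mult_right_mono[OF cJ, of "real (Q n)"] Q1 by simp
      also have "\<dots> \<le> real p * real J" using mult_right_mono[OF pc, of "real J"] by (simp add: mult_ac)
      finally have "real (Q n) \<le> real (p * J)" by simp
      then have QpJ: "Q n \<le> p * J" by (simp only: of_nat_le_iff)
      obtain j where j: "1 \<le> j" "j \<le> J" "1 \<le> l j n" "l j n \<le> p" "p - l j n \<le> R n"
        using lag_grid[OF J1 elim(3) pQ QpJ] unfolding l_def R_def by metis
      \<comment> \<open>The index \<open>j\<close> depends on the segment; the sum over all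
        \<open>j\<close> does not.\<close>
      have "k4 * DevM n (l j n) \<omega> \<le> (\<Sum>j\<in>{1..J}. k4 * DevM n (l j n) \<omega>)"
        using j k0 DevM_nonneg by (intro member_le_sum[of j "{1..J}" "\<lambda>j. k4 * DevM n (l j n) \<omega>"]) auto
      moreover have "\<bar>sqrt (lrv_est X q a b \<omega>) * real p powr (1/2 - H) - c\<bar> \<le>
          A1 * Gx n (Q n) \<omega> + A2 * Mx 0 n \<omega> + A3 * Sx (n + Q n) (R n) \<omega> + k4 * DevM n (l j n) \<omega> + A5"
        unfolding A1_def A2_def A3_def A5_def k4_def
        by (rule lrv_normalized_bound[where q = q, OF ab \<delta> p_def pL pQ pc c0(1) j(3,4,5)])
      ultimately show ?thesis unfolding T_def p_def by linarith
    qed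
    show ?case using iT ET bd by blast
  qed
qed

end

section \<open>Convergence of the statistics\<close>

lemma Max_scale:
  fixes f :: "'i \<Rightarrow> real"
  assumes "0 \<le> s" "finite A" "A \<noteq> {}"
  shows "Max ((\<lambda>i. s * f i) ` A) = s * Max (f ` A)"
proof -
  have "mono (\<lambda>x::real. s * x)" using assms(1) by (intro monoI mult_left_mono)
  from mono_Max_commute[OF this, of "f ` A"] show ?thesis using assms by (simp add: image_image)
qed

text \<open>A convergent ratio is bounded. Replacing \<open>j\<close> by \<open>1 + j\<close> costs
  at most the factor 2, lag 0 is absorbed into the constant, and negative lags follow by
  evenness.\<close>

lemma autocov_bound:
  assumes f: "fos M X" and c0: "0 < c0" and H: "1/2 < H" "H < 1"
    and lim: "(\<lambda>j::nat. autocov M X (int j) / (c0 * real j powr (2*H - 2))) \<longlonglongrightarrow> 1"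
  shows "\<exists>Cg. \<forall>j. \<bar>autocov M X j\<bar> \<le> Cg * (1 + real_of_int \<bar>j\<bar>) powr (2*H - 2)"
proof -
  interpret fos M X by (rule f)
  from lim have "Bseq (\<lambda>j::nat. \<gamma> (int j) / (c0 * real j powr (2*H - 2)))"
    by (intro convergent_imp_Bseq) (auto simp: convergent_def)
  then obtain K where K: "0 < K" "\<And>j::nat. \<bar>\<gamma> (int j) / (c0 * real j powr (2*H - 2))\<bar> \<le> K"
    unfolding Bseq_def by auto
  define Cg where "Cg = max \<bar>\<gamma> 0\<bar> (2 * (K * c0))"
  have nat: "\<bar>\<gamma> (int j)\<bar> \<le> Cg * (1 + real j) powr (2*H - 2)" for j :: nat
  proof (cases "j = 0")
    case True
    then show ?thesis by (simp add: Cg_def)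
  next
    case False
    then have j: "1 \<le> real j" by simp
    have "\<bar>\<gamma> (int j)\<bar> \<le> K * (c0 * real j powr (2*H - 2))"
      using K(2)[of j] c0 j by (simp add: abs_divide abs_mult divide_le_eq)
    also have "real j powr (2*H - 2) \<le> 2 * (1 + real j) powr (2*H - 2)"
    proof -
      have "real j powr (2*H - 2) = 2 powr (2 - 2*H) * (2 * real j) powr (2*H - 2)"
        using j by (simp add: powr_mult powr_add[symmetric] mult.assoc[symmetric])
      also have "\<dots> \<le> 2 powr 1 * (1 + real j) powr (2*H - 2)"
        using j H by (intro mult_mono powr_mono powr_mono2') auto
      finally show ?thesis by simp
    qed
    then have "K * (c0 * real j powr (2*H - 2)) \<le> K * (c0 * (2 * (1 + real j) powr (2*H - 2)))"
      using K(1) c0 by (intro mult_left_mono) auto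
    finally have "\<bar>\<gamma> (int j)\<bar> \<le> 2 * (K * c0) * (1 + real j) powr (2*H - 2)" by (simp add: mult_ac)
    also have "\<dots> \<le> Cg * (1 + real j) powr (2*H - 2)" by (intro mult_right_mono) (auto simp: Cg_def)
    finally show ?thesis .
  qed
  have "\<bar>\<gamma> j\<bar> \<le> Cg * (1 + real_of_int \<bar>j\<bar>) powr (2*H - 2)" for j :: int
  proof -
    have "int (nat \<bar>j\<bar>) = \<bar>j\<bar>" by simp
    then show ?thesis using nat[of "nat \<bar>j\<bar>"] autocov_abs[of j] by simp
  qed
  then show ?thesis by blast
qed

text \<open>Extends an eventual bound to all lengths: short windows are enlarged to
  \<open>n1\<close>, and \<open>max l n1 \<le> n1 * l\<close> moves the excess into the
  constant.\<close>

lemma cumulant_bound: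
  fixes k :: "int \<Rightarrow> int \<Rightarrow> int \<Rightarrow> real"
  assumes H: "1/2 < H"
    and c: "\<exists>C n0. \<forall>n\<ge>n0. \<forall>h. (\<Sum>r\<in>{-int n..int n}. \<Sum>s\<in>{-int n..int n}. \<bar>k h r s\<bar>) \<le> C * real n powr (2*H - 1)"
  shows "\<exists>Cc. \<forall>h. \<forall>l\<ge>1. (\<Sum>r\<in>{-int l..int l}. \<Sum>s\<in>{-int l..int l}. \<bar>k h r s\<bar>) \<le> Cc * real l powr (2*H - 1)"
proof -
  obtain C n0 where C: "\<And>n h. n \<ge> n0 \<Longrightarrow> (\<Sum>r\<in>{-int n..int n}. \<Sum>s\<in>{-int n..int n}. \<bar>k h r s\<bar>) \<le> C * real n powr (2*H - 1)"
    using c by blast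
  define n1 where "n1 = max 1 n0"
  have n1: "1 \<le> real n1" unfolding n1_def by simp
  have p1: "1 \<le> real n1 powr (2*H - 1)" using n1 H by (intro ge_one_powr_ge_zero) auto
  show ?thesis
  proof (intro exI[of _ "\<bar>C\<bar> * real n1 powr (2*H - 1)"] allI impI)
    fix h :: int and l :: nat assume l: "1 \<le> l"
    define m where "m = max l n1"
    have "(\<Sum>r\<in>{-int l..int l}. \<Sum>s\<in>{-int l..int l}. \<bar>k h r s\<bar>) \<le> (\<Sum>r\<in>{-int m..int m}. \<Sum>s\<in>{-int l..int l}. \<bar>k h r s\<bar>)"
      unfolding m_def by (intro sum_mono2 sum_nonneg) auto
    also have "\<dots> \<le> (\<Sum>r\<in>{-int m..int m}. \<Sum>s\<in>{-int m..int m}. \<bar>k h r s\<bar>)"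
      unfolding m_def by (intro sum_mono sum_mono2) auto
    also have "\<dots> \<le> C * real m powr (2*H - 1)" by (rule C) (simp add: m_def n1_def)
    also have "\<dots> \<le> \<bar>C\<bar> * (real n1 * real l) powr (2*H - 1)"
    proof (intro mult_mono powr_mono2)
      have "real l \<le> real n1 * real l" using n1 mult_right_mono[of 1 "real n1" "real l"] by simp
      moreover have "real n1 \<le> real n1 * real l" using l n1 mult_left_mono[of 1 "real l" "real n1"] by simp
      ultimately show "real m \<le> real n1 * real l" unfolding m_def by (auto simp: max_def)
    qed (use H in auto)
    finally show "(\<Sum>r\<in>{-int l..int l}. \<Sum>s\<in>{-int l..int l}. \<bar>k h r s\<bar>) \<le> \<bar>C\<bar> * real n1 powr (2*H - 1) * real l powr (2*H - 1)"
      by (simp add: powr_mult)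
  qed
qed

section \<open>The rescaled partial-sum path and the statistics as its functionals\<close>

locale lrd_limit = lrd M X H Cg Cc + lim: fbm N H W
  for M :: "'a measure" and X :: "int \<Rightarrow> 'a \<Rightarrow> real" and H Cg Cc :: real and N :: "'b measure" and W :: "real \<Rightarrow> 'b \<Rightarrow> real" +
  fixes c_H :: real
  assumes cH: "0 < c_H"
    and conv: "conv_distr_D M
         (\<lambda>n \<omega> t. real n powr (-H) * (\<Sum>j\<in>{1..nat \<lfloor>real n * t\<rfloor>}. (X (int j) \<omega> - mean_seq M X)))
         N (\<lambda>\<omega> t. c_H * W t \<omega>)"
begin

definition cc :: "nat \<Rightarrow> nat \<Rightarrow> 'a \<Rightarrow> real" where
  "cc n k \<omega> = real n powr (-H) * (\<Sum>j\<in>{1..k}. (X (int j) \<omega> - mean_seq M X))"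

lemma cc_D: "cc n k \<omega> = real n powr (-H) * D 0 k \<omega>"
proof -
  have "{0<..k} = {1..k}" by auto
  then show ?thesis unfolding cc_def D_eq_sum Y_def by simp
qed

lemma cc_measurable[measurable]: "cc n k \<in> borel_measurable M"
  unfolding cc_def[abs_def] by measurable

lemma conv_cc: "conv_distr_D M (\<lambda>n \<omega> t. cc n (nat \<lfloor>real n * t\<rfloor>) \<omega>) N (\<lambda>\<omega> t. c_H * W t \<omega>)"
  using conv unfolding cc_def .

text \<open>Truncation makes the squared value at time 1 a bounded functional, continuous at every
  limit path.\<close>

lemma truncated_second_moment:
  fixes K :: real
  assumes K: "0 \<le> K"
  shows "(\<lambda>n. expectation (\<lambda>\<omega>. min ((cc n n \<omega>)\<^sup>2) K)) \<longlonglongrightarrow> lim.expectation (\<lambda>\<omega>. min ((c_H * W 1 \<omega>)\<^sup>2) K)"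
proof -
  have W1[measurable]: "W 1 \<in> borel_measurable N" by (rule lim.W_measurable) simp
  have "(\<lambda>n. \<integral>\<omega>. (\<lambda>n y. min ((y 1)\<^sup>2) K) n (\<lambda>t. cc n (nat \<lfloor>real n * t\<rfloor>) \<omega>) \<partial>M) \<longlonglongrightarrow> (\<integral>\<omega>. min ((c_H * W 1 \<omega>)\<^sup>2) K \<partial>N)"
  proof (rule extended_continuous_mapping[OF prob_space_axioms lim.prob_space_axioms conv_cc, where B = K])
    show "(\<lambda>\<omega>. c_H * W t \<omega>) \<in> borel_measurable N" if "t \<in> {0..1}" for t
    proof -
      have [measurable]: "W t \<in> borel_measurable N" using that by (intro lim.W_measurable) auto
      show ?thesis by measurable
    qed
    show "continuous_on {0..1} (\<lambda>t. c_H * W t \<omega>)" if "\<omega> \<in> space N" for \<omega>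
      by (intro continuous_intros continuous_on_subset[OF lim.W_continuous[OF that]]) auto
    show "AE \<omega> in N. \<forall>e>0. \<exists>d>0. \<exists>m. \<forall>n\<ge>m. \<forall>y. (\<forall>t\<in>{0..1}. \<bar>y t - c_H * W t \<omega>\<bar> < d) \<longrightarrow>
        \<bar>min ((y 1)\<^sup>2) K - min ((c_H * W 1 \<omega>)\<^sup>2) K\<bar> < e"
    proof (intro AE_I2 allI impI)
      fix \<omega> and e :: real assume "0 < e"
      have "isCont (\<lambda>x::real. min (x\<^sup>2) K) (c_H * W 1 \<omega>)" by (intro continuous_intros)
      then obtain d where d: "0 < d" "\<And>x. \<bar>x - c_H * W 1 \<omega>\<bar> < d \<Longrightarrow> \<bar>min (x\<^sup>2) K - min ((c_H * W 1 \<omega>)\<^sup>2) K\<bar> < e"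
        using \<open>0 < e\<close> unfolding continuous_at_eps_delta dist_real_def by metis
      then show "\<exists>d>0. \<exists>m. \<forall>n\<ge>m. \<forall>y. (\<forall>t\<in>{0..1}. \<bar>y t - c_H * W t \<omega>\<bar> < d) \<longrightarrow>
        \<bar>min ((y 1)\<^sup>2) K - min ((c_H * W 1 \<omega>)\<^sup>2) K\<bar> < e" by (intro exI[of _ d]) auto
    qed
  qed (use K in \<open>auto simp: abs_le_iff min_def\<close>)
  then show ?thesis by simp
qed

text \<open>The limiting variance is identified with \<open>c_H\<^sup>2\<close> by uniform integrability: bounded fourth
  moments allow passing to the limit in the second moments.\<close>

lemma variance_limit: "(\<lambda>l. expectation (\<lambda>\<omega>. (D 0 l \<omega>)\<^sup>2) / real l powr (2*H)) \<longlonglongrightarrow> c_H\<^sup>2"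
proof (rule LIMSEQ_I)
  fix r :: real assume r: "0 < r"
  have W1[measurable]: "W 1 \<in> borel_measurable N" by (rule lim.W_measurable) simp
  have gW: "(\<lambda>\<omega>. c_H * W 1 \<omega>) \<in> lim.gspace" by (intro lim.gspace_scale lim.gspace_W) simp
  have iW: "integrable N (\<lambda>\<omega>. (c_H * W 1 \<omega>)\<^sup>2)" by (rule lim.gspace_square_integrable[OF gW])
  have EW: "lim.expectation (\<lambda>\<omega>. (c_H * W 1 \<omega>)\<^sup>2) = c_H\<^sup>2"
    using lim.W_cov[of 1 1] by (simp add: power_mult_distrib power2_eq_square[of "W 1 _"] lim.cv_def)
  have "(\<lambda>K::nat. lim.expectation (\<lambda>\<omega>. min ((c_H * W 1 \<omega>)\<^sup>2) (real K))) \<longlonglongrightarrow> lim.expectation (\<lambda>\<omega>. (c_H * W 1 \<omega>)\<^sup>2)"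
  proof (rule integral_dominated_convergence[OF _ _ iW])
    show "AE \<omega> in N. (\<lambda>K::nat. min ((c_H * W 1 \<omega>)\<^sup>2) (real K)) \<longlonglongrightarrow> (c_H * W 1 \<omega>)\<^sup>2"
    proof (intro AE_I2)
      fix \<omega>
      obtain K0 :: nat where K0: "(c_H * W 1 \<omega>)\<^sup>2 < real K0" using reals_Archimedean2 by blast
      have "eventually (\<lambda>K::nat. min ((c_H * W 1 \<omega>)\<^sup>2) (real K) = (c_H * W 1 \<omega>)\<^sup>2) sequentially"
        using eventually_ge_at_top[of K0]
      proof eventually_elim
        case (elim K)
        then have "real K0 \<le> real K" by simp
        then show ?case using K0 by (simp add: min_def)
      qed
      then show "(\<lambda>K::nat. min ((c_H * W 1 \<omega>)\<^sup>2) (real K)) \<longlonglongrightarrow> (c_H * W 1 \<omega>)\<^sup>2" by (rule tendsto_eventually)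
    qed
  qed auto
  then have "eventually (\<lambda>K::nat. dist (lim.expectation (\<lambda>\<omega>. min ((c_H * W 1 \<omega>)\<^sup>2) (real K))) (c_H\<^sup>2) < r/3) sequentially"
    unfolding EW using r by (intro tendstoD) auto
  moreover have "eventually (\<lambda>K::nat. C4 / real K < r/3) sequentially"
    using r by (intro order_tendstoD(2)[OF lim_const_over_n]) auto
  ultimately have "eventually (\<lambda>K::nat. dist (lim.expectation (\<lambda>\<omega>. min ((c_H * W 1 \<omega>)\<^sup>2) (real K))) (c_H\<^sup>2) < r/3
      \<and> C4 / real K < r/3 \<and> 1 \<le> K) sequentially" using eventually_ge_at_top[of 1] by eventually_elim simp
  then obtain K :: nat where K: "\<bar>lim.expectation (\<lambda>\<omega>. min ((c_H * W 1 \<omega>)\<^sup>2) (real K)) - c_H\<^sup>2\<bar> < r/3" "C4 / real K < r/3" "1 \<le> K"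
    using eventually_happens'[OF sequentially_bot] unfolding dist_real_def by blast
  have K0: "0 < real K" using K by simp
  have "eventually (\<lambda>n. \<bar>expectation (\<lambda>\<omega>. min ((cc n n \<omega>)\<^sup>2) (real K)) - lim.expectation (\<lambda>\<omega>. min ((c_H * W 1 \<omega>)\<^sup>2) (real K))\<bar> < r/3) sequentially"
    using tendstoD[OF truncated_second_moment[of "real K"], of "r/3"] r by (simp add: dist_real_def)
  then have "eventually (\<lambda>l. norm (expectation (\<lambda>\<omega>. (D 0 l \<omega>)\<^sup>2) / real l powr (2*H) - c_H\<^sup>2) < r) sequentially"
    using eventually_gt_at_top[of 0]
  proof eventually_elim
    case (elim n)
    have n: "0 < real n" using elim by simp
    have inv: "real n powr (-H) = 1 / real n powr H" by (rule powr_minus_divide)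
    have p2: "real n powr (2*H) = (real n powr H)\<^sup>2" using powr_add[of "real n" H H] by (simp add: power2_eq_square)
    have p4': "real n powr (4*H) = (real n powr H) ^ 4" using powr_add[of "real n" "2*H" "2*H"] by (simp add: p2 flip: power_add)
    have L4: "cc n n \<in> L4" unfolding cc_D[abs_def] by (intro L4_scale D_L4)
    have i2: "integrable M (\<lambda>\<omega>. (cc n n \<omega>)\<^sup>2)" by (rule L2_integrable_square[OF L4_L2[OF L4]])
    have i4: "integrable M (\<lambda>\<omega>. cc n n \<omega> ^ 4)" by (rule L4_integrable_fourth[OF L4])
    have im: "integrable M (\<lambda>\<omega>. min ((cc n n \<omega>)\<^sup>2) (real K))"
      by (rule Bochner_Integration.integrable_bound[OF i2]) auto
    have e2: "expectation (\<lambda>\<omega>. (cc n n \<omega>)\<^sup>2) = expectation (\<lambda>\<omega>. (D 0 n \<omega>)\<^sup>2) / real n powr (2*H)"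
    proof -
      have "(real n powr (-H))\<^sup>2 = 1 / real n powr (2*H)" unfolding inv p2 by (simp add: power_divide)
      then show ?thesis unfolding cc_D power_mult_distrib by simp
    qed
    have e4: "expectation (\<lambda>\<omega>. cc n n \<omega> ^ 4) \<le> C4"
    proof -
      have p4: "(real n powr (-H)) ^ 4 * real n powr (4*H) = 1"
        unfolding inv p4' using n by (simp add: power_divide)
      have "expectation (\<lambda>\<omega>. cc n n \<omega> ^ 4) = (real n powr (-H)) ^ 4 * expectation (\<lambda>\<omega>. D 0 n \<omega> ^ 4)"
        unfolding cc_D power_mult_distrib by simp
      also have "\<dots> \<le> (real n powr (-H)) ^ 4 * (C4 * real n powr (4*H))" by (intro mult_left_mono D_fourth) simp
      also have "\<dots> = C4 * ((real n powr (-H)) ^ 4 * real n powr (4*H))" by (simp only: mult_ac)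
      finally show ?thesis unfolding p4 by simp
    qed
    \<comment> \<open>The part of the square above \<open>K\<close> is at most the fourth power over
      \<open>K\<close>, hence small in mean uniformly in \<open>n\<close>.\<close>
    have pt: "x\<^sup>2 \<le> min (x\<^sup>2) (real K) + x ^ 4 / real K" for x :: real
    proof (cases "x\<^sup>2 \<le> real K")
      case False
      have "x\<^sup>2 * real K \<le> x\<^sup>2 * x\<^sup>2" using False by (intro mult_left_mono) auto
      then have "x\<^sup>2 \<le> x ^ 4 / real K" using K0 by (simp add: pos_le_divide_eq flip: power_add)
      then show ?thesis using K0 by (simp add: min_def)
    qed (use K0 in \<open>simp add: min_def\<close>)
    have "expectation (\<lambda>\<omega>. (cc n n \<omega>)\<^sup>2) \<le> expectation (\<lambda>\<omega>. min ((cc n n \<omega>)\<^sup>2) (real K) + cc n n \<omega> ^ 4 / real K)"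
      using i2 im i4 by (intro integral_mono pt) auto
    also have "\<dots> = expectation (\<lambda>\<omega>. min ((cc n n \<omega>)\<^sup>2) (real K)) + expectation (\<lambda>\<omega>. cc n n \<omega> ^ 4) / real K"
      using im i4 by simp
    also have "\<dots> \<le> expectation (\<lambda>\<omega>. min ((cc n n \<omega>)\<^sup>2) (real K)) + C4 / real K"
      using e4 K0 by (intro add_left_mono divide_right_mono) auto
    finally have up: "expectation (\<lambda>\<omega>. (cc n n \<omega>)\<^sup>2) \<le> expectation (\<lambda>\<omega>. min ((cc n n \<omega>)\<^sup>2) (real K)) + C4 / real K" .
    have lo: "expectation (\<lambda>\<omega>. min ((cc n n \<omega>)\<^sup>2) (real K)) \<le> expectation (\<lambda>\<omega>. (cc n n \<omega>)\<^sup>2)"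
      using i2 im by (intro integral_mono) auto
    show ?case unfolding e2[symmetric] real_norm_def using up lo K(1,2) elim(1) by linarith
  qed
  then show "\<exists>no. \<forall>l\<ge>no. norm (expectation (\<lambda>\<omega>. (D 0 l \<omega>)\<^sup>2) / real l powr (2*H) - c_H\<^sup>2) < r"
    unfolding eventually_sequentially .
qed

text \<open>The limit of the normalised variance is the square of the very constant that scales the
  limit path; this is why the constant cancels in the studentised statistics.\<close>

sublocale lrd_var M X H Cg Cc c_H
  by unfold_locales (rule cH, rule variance_limit)

definition path :: "nat \<Rightarrow> 'a \<Rightarrow> real \<Rightarrow> real" where
  "path n \<omega> t = cc n (nat \<lfloor>real n * t\<rfloor>) \<omega> / c_H"

lemma path_grid: "1 \<le> n \<Longrightarrow> path n \<omega> (real k / real n) = real n powr (-H) / c_H * D 0 k \<omega>"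
  unfolding path_def cc_D by simp

lemma path_one: "path n \<omega> 1 = real n powr (-H) / c_H * D 0 n \<omega>"
  unfolding path_def cc_D by simp

lemma path_measurable[measurable]: "(\<lambda>\<omega>. path n \<omega> t) \<in> borel_measurable M"
  unfolding path_def by measurable

text \<open>The mean drops out of the bridge, since it enters only as a linear drift, and the
  positive scaling leaves the argmax unchanged.\<close>

lemma khat_grid:
  assumes n: "1 \<le> n"
  shows "khat X n \<omega> = grid_argmax n (path n \<omega>)"
proof -
  define s where "s = real n powr (-H) / c_H"
  have s: "0 < s" unfolding s_def using n cH by simp
  have e: "\<bar>path n \<omega> (real k / real n) - real k / real n * path n \<omega> 1\<bar> = s * \<bar>psum X \<omega> 0 k - real k / real n * psum X \<omega> 0 n\<bar>" for k
  proof -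
    have "path n \<omega> (real k / real n) - real k / real n * path n \<omega> 1 = s * (psum X \<omega> 0 k - real k / real n * psum X \<omega> 0 n)"
      unfolding path_grid[OF n] path_one s_def[symmetric] using n psum_eq[of 0 k \<omega>] psum_eq[of 0 n \<omega>] by (simp add: algebra_simps)
    then show ?thesis using s by (simp add: abs_mult)
  qed
  have m: "Max ((\<lambda>i. s * \<bar>psum X \<omega> 0 i - real i / real n * psum X \<omega> 0 n\<bar>) ` {1..n}) = s * Max ((\<lambda>i. \<bar>psum X \<omega> 0 i - real i / real n * psum X \<omega> 0 n\<bar>) ` {1..n})"
    using s n by (intro Max_scale) auto
  show ?thesis unfolding khat_def grid_argmax_def e m using s by simp
qed

text \<open>The ratio of true to estimated scale, tending to 1 in probability uniformly over long
  segments. It uses \<open>q\<close>, as the statistics do, whereas the estimator is naturally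
  scaled by \<open>q + 1\<close>.\<close>

definition rho :: "(nat \<Rightarrow> nat) \<Rightarrow> nat \<Rightarrow> nat \<Rightarrow> 'a \<Rightarrow> real" where
  "rho q a b \<omega> = c_H * real (q (b - a)) powr (H - 1/2) / sqrt (lrv_est X q a b \<omega>)"

text \<open>Separates the path functional from the scale: \<open>n powr (-H)\<close> times the root
  of \<open>n\<close> is the power \<open>n powr (1/2 - H)\<close> of the normalisation, and the
  power of \<open>q\<close> goes into \<open>rho\<close>.\<close>

lemma left_statistic:
  assumes n: "1 \<le> n" and k: "1 \<le> k"
  shows "(real (q k) / real n) powr (H - 1/2) * cusum_T X q 0 k \<omega> = grid_left n (path n \<omega>) k * rho q 0 k \<omega>"
proof -
  define s where "s = real n powr (-H) / c_H"
  have s: "0 < s" unfolding s_def using n cH by simp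
  define m where "m = Max ((\<lambda>i. \<bar>psum X \<omega> 0 i - real i / real k * psum X \<omega> 0 k\<bar>) ` {0<..k})"
  have "\<bar>path n \<omega> (real i / real n) - real i / real k * path n \<omega> (real k / real n)\<bar> = s * \<bar>psum X \<omega> 0 i - real i / real k * psum X \<omega> 0 k\<bar>" for i
  proof -
    have "path n \<omega> (real i / real n) - real i / real k * path n \<omega> (real k / real n) = s * (psum X \<omega> 0 i - real i / real k * psum X \<omega> 0 k)"
      unfolding path_grid[OF n] s_def[symmetric] using k psum_eq[of 0 k \<omega>] psum_eq[of 0 i \<omega>] by (simp add: algebra_simps)
    then show ?thesis using s by (simp add: abs_mult)
  qed
  then have g: "grid_left n (path n \<omega>) k = sqrt (real n / real k) * (s * m)"
    unfolding grid_left_def m_def using s k by (simp add: Max_scale)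
  have t: "cusum_T X q 0 k \<omega> = 1 / sqrt (lrv_est X q 0 k \<omega>) * (1 / sqrt (real k)) * m"
    unfolding cusum_T_def m_def by simp
  have "sqrt (real n / real k) * s * c_H = 1 / real n powr (H - 1/2) * (1 / sqrt (real k))"
    unfolding s_def using n cH by (simp add: real_sqrt_divide powr_minus_divide powr_diff powr_half_sqrt)
  then have "(sqrt (real n / real k) * s * c_H) * (m * real (q k) powr (H - 1/2) / sqrt (lrv_est X q 0 k \<omega>))
    = (1 / real n powr (H - 1/2) * (1 / sqrt (real k))) * (m * real (q k) powr (H - 1/2) / sqrt (lrv_est X q 0 k \<omega>))" by (simp only:)
  then show ?thesis unfolding g t rho_def by (simp add: powr_divide mult_ac)
qed

lemma right_statistic:
  assumes n: "1 \<le> n" and k: "1 \<le> k" "k < n"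
  shows "(real (q (n - k)) / real n) powr (H - 1/2) * cusum_T X q k n \<omega> = grid_right n (path n \<omega>) k * rho q k n \<omega>"
proof -
  define s where "s = real n powr (-H) / c_H"
  have s: "0 < s" unfolding s_def using n cH by simp
  let ?f = "\<lambda>i. \<bar>psum X \<omega> k i - real (i - k) / real (n - k) * psum X \<omega> k n\<bar>"
  define m where "m = Max (?f ` {k<..n})"
  have e: "\<bar>path n \<omega> (real i / real n) - path n \<omega> (real k / real n) - real (i - k) / real (n - k) * (path n \<omega> 1 - path n \<omega> (real k / real n))\<bar> = s * ?f i"
    if i: "i \<in> {k<..n}" for i
  proof -
    have "D 0 (k + (i - k)) \<omega> = D 0 k \<omega> + D (0 + k) (i - k) \<omega>" "D 0 (k + (n - k)) \<omega> = D 0 k \<omega> + D (0 + k) (n - k) \<omega>" by (rule D_add)+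
    then have D: "D 0 i \<omega> = D 0 k \<omega> + D k (i - k) \<omega>" "D 0 n \<omega> = D 0 k \<omega> + D k (n - k) \<omega>" using i k by auto
    have nk: "real (n - k) \<noteq> 0" using k by simp
    have "path n \<omega> (real i / real n) - path n \<omega> (real k / real n) - real (i - k) / real (n - k) * (path n \<omega> 1 - path n \<omega> (real k / real n))
      = s * (D k (i - k) \<omega> - real (i - k) / real (n - k) * D k (n - k) \<omega>)"
      unfolding path_grid[OF n] path_one s_def[symmetric] D by (simp add: algebra_simps)
    also have "D k (i - k) \<omega> - real (i - k) / real (n - k) * D k (n - k) \<omega> = psum X \<omega> k i - real (i - k) / real (n - k) * psum X \<omega> k n"
      using psum_eq[of k i \<omega>] psum_eq[of k n \<omega>] i k nk by (simp add: distrib_left)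
    finally show ?thesis using s by (simp add: abs_mult)
  qed
  have "(\<lambda>i. \<bar>path n \<omega> (real i / real n) - path n \<omega> (real k / real n) - real (i - k) / real (n - k) * (path n \<omega> 1 - path n \<omega> (real k / real n))\<bar>) ` {k<..n}
    = (\<lambda>i. s * ?f i) ` {k<..n}" by (intro image_cong refl e)
  then have g: "grid_right n (path n \<omega>) k = sqrt (real n / real (n - k)) * (s * m)"
    unfolding grid_right_def m_def using s k by (simp add: Max_scale)
  have t: "cusum_T X q k n \<omega> = 1 / sqrt (lrv_est X q k n \<omega>) * (1 / sqrt (real (n - k))) * m"
    unfolding cusum_T_def m_def by simp
  have "sqrt (real n / real (n - k)) * s * c_H = 1 / real n powr (H - 1/2) * (1 / sqrt (real (n - k)))"
    unfolding s_def using n cH by (simp add: real_sqrt_divide powr_minus_divide powr_diff powr_half_sqrt)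
  then have "(sqrt (real n / real (n - k)) * s * c_H) * (m * real (q (n - k)) powr (H - 1/2) / sqrt (lrv_est X q k n \<omega>))
    = (1 / real n powr (H - 1/2) * (1 / sqrt (real (n - k)))) * (m * real (q (n - k)) powr (H - 1/2) / sqrt (lrv_est X q k n \<omega>))" by (simp only:)
  then show ?thesis unfolding g t rho_def by (simp add: powr_divide mult_ac)
qed

lemma grid_argmax_measurable:
  assumes [measurable]: "\<And>t. (\<lambda>\<omega>. P \<omega> t) \<in> borel_measurable M"
  shows "(\<lambda>\<omega>. grid_argmax n (P \<omega>)) \<in> measurable M (count_space UNIV)"
  unfolding grid_argmax_def by measurable

lemma grid_left_measurable:
  assumes [measurable]: "\<And>t. (\<lambda>\<omega>. P \<omega> t) \<in> borel_measurable M"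
  shows "(\<lambda>\<omega>. grid_left n (P \<omega>) k) \<in> borel_measurable M"
  unfolding grid_left_def by measurable

lemma grid_right_measurable:
  assumes [measurable]: "\<And>t. (\<lambda>\<omega>. P \<omega> t) \<in> borel_measurable M"
  shows "(\<lambda>\<omega>. grid_right n (P \<omega>) k) \<in> borel_measurable M"
  unfolding grid_right_def by measurable

text \<open>The break ratio is carried along so that a continuous cutoff can exclude breaks close to
  the ends.\<close>

definition stats :: "nat \<Rightarrow> 'a \<Rightarrow> real \<times> real \<times> real" where
  "stats n \<omega> = (real (grid_argmax n (path n \<omega>)) / real n, grid_left n (path n \<omega>) (grid_argmax n (path n \<omega>)),
     grid_right n (path n \<omega>) (grid_argmax n (path n \<omega>)))"

lemma stats_measurable[measurable]: "stats n \<in> borel_measurable M"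
proof -
  note k = grid_argmax_measurable[OF path_measurable]
  have "(\<lambda>\<omega>. grid_left n (path n \<omega>) (grid_argmax n (path n \<omega>))) \<in> borel_measurable M"
    by (rule measurable_compose_countable[OF grid_left_measurable[OF path_measurable] k])
  moreover have "(\<lambda>\<omega>. grid_right n (path n \<omega>) (grid_argmax n (path n \<omega>))) \<in> borel_measurable M"
    by (rule measurable_compose_countable[OF grid_right_measurable[OF path_measurable] k])
  moreover have "(\<lambda>\<omega>. real (grid_argmax n (path n \<omega>)) / real n) \<in> borel_measurable M"
    using measurable_compose[OF k, of "\<lambda>k. real k / real n" borel] by simp
  ultimately show ?thesis unfolding stats_def[abs_def] by (intro borel_measurable_Pair)
qed

lemma stats_converge:
  fixes G :: "real \<times> real \<times> real \<Rightarrow> real"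
  assumes G: "continuous_on UNIV G" and GB: "\<And>x. \<bar>G x\<bar> \<le> B"
  shows "(\<lambda>n. expectation (\<lambda>\<omega>. G (stats n \<omega>))) \<longlonglongrightarrow> lim.expectation (\<lambda>\<omega>. G (xi_arg W \<omega>, limit_vec W \<omega>))"
proof -
  define h where "h n y = G (real (grid_argmax n (\<lambda>t. y t / c_H)) / real n, grid_left n (\<lambda>t. y t / c_H) (grid_argmax n (\<lambda>t. y t / c_H)),
     grid_right n (\<lambda>t. y t / c_H) (grid_argmax n (\<lambda>t. y t / c_H)))" for n and y :: "real \<Rightarrow> real"
  have hs: "h n (\<lambda>t. cc n (nat \<lfloor>real n * t\<rfloor>) \<omega>) = G (stats n \<omega>)" for n \<omega>
    unfolding h_def stats_def path_def[abs_def] ..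
  have Gm[measurable]: "G \<in> borel_measurable borel" by (rule borel_measurable_continuous_onI[OF G])
  have lm[measurable]: "(\<lambda>\<omega>. (xi_arg W \<omega>, limit_vec W \<omega>)) \<in> borel_measurable N"
  proof -
    have "limit_vec W \<omega> = (fst (limit_vec W \<omega>), snd (limit_vec W \<omega>))" for \<omega> by simp
    then have "limit_vec W = (\<lambda>\<omega>. (fst (limit_vec W \<omega>), snd (limit_vec W \<omega>)))" by blast
    moreover have "(\<lambda>\<omega>. (fst (limit_vec W \<omega>), snd (limit_vec W \<omega>))) \<in> borel_measurable N"
      by (intro borel_measurable_Pair lim.limit_vec_measurable)
    ultimately have "limit_vec W \<in> borel_measurable N" by simp
    then show ?thesis by (intro borel_measurable_Pair lim.xi_arg_measurable)
  qed
  have "(\<lambda>n. \<integral>\<omega>. h n (\<lambda>t. cc n (nat \<lfloor>real n * t\<rfloor>) \<omega>) \<partial>M) \<longlonglongrightarrow> (\<integral>\<omega>. G (xi_arg W \<omega>, limit_vec W \<omega>) \<partial>N)"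
  proof (rule extended_continuous_mapping[OF prob_space_axioms lim.prob_space_axioms conv_cc cc_measurable, where B = B])
    show "(\<lambda>\<omega>. c_H * W t \<omega>) \<in> borel_measurable N" if "t \<in> {0..1}" for t
    proof -
      have [measurable]: "W t \<in> borel_measurable N" using that by (intro lim.W_measurable) auto
      show ?thesis by measurable
    qed
    show "continuous_on {0..1} (\<lambda>t. c_H * W t \<omega>)" if "\<omega> \<in> space N" for \<omega>
      by (intro continuous_intros continuous_on_subset[OF lim.W_continuous[OF that]]) auto
    show "\<bar>h n y\<bar> \<le> B" for n y unfolding h_def by (rule GB)
    show "(\<lambda>\<omega>. h n (\<lambda>t. cc n (nat \<lfloor>real n * t\<rfloor>) \<omega>)) \<in> borel_measurable M" for n unfolding hs by measurable
    show "(\<lambda>\<omega>. G (xi_arg W \<omega>, limit_vec W \<omega>)) \<in> borel_measurable N" by measurable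
    show "\<bar>G (xi_arg W \<omega>, limit_vec W \<omega>)\<bar> \<le> B" for \<omega> by (rule GB)
    show "AE \<omega> in N. \<forall>e>0. \<exists>d>0. \<exists>m. \<forall>n\<ge>m. \<forall>y. (\<forall>t\<in>{0..1}. \<bar>y t - c_H * W t \<omega>\<bar> < d) \<longrightarrow>
      \<bar>h n y - G (xi_arg W \<omega>, limit_vec W \<omega>)\<bar> < e"
      using lim.xi_arg_unique_AE AE_space
    proof eventually_elim
      case (elim \<omega>)
      have cW: "continuous_on {0..1} (\<lambda>t. W t \<omega>)" by (rule continuous_on_subset[OF lim.W_continuous[OF elim(2)]]) auto
      have lv: "(xi_arg W \<omega>, limit_vec W \<omega>) = (xi_arg W \<omega>, 1 / sqrt (xi_arg W \<omega>) * Sup ((\<lambda>t. \<bar>W t \<omega> - t / xi_arg W \<omega> * W (xi_arg W \<omega>) \<omega>\<bar>) ` {0..xi_arg W \<omega>}),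
          1 / sqrt (1 - xi_arg W \<omega>) * Sup ((\<lambda>t. \<bar>(W t \<omega> - W (xi_arg W \<omega>) \<omega>) - (t - xi_arg W \<omega>) / (1 - xi_arg W \<omega>) * (W 1 \<omega> - W (xi_arg W \<omega>) \<omega>)\<bar>) ` {xi_arg W \<omega>..1}))"
        unfolding limit_vec_def Let_def ..
      show ?case
      proof (intro allI impI)
        fix e :: real assume "0 < e"
        have "\<exists>d>0. \<exists>m. \<forall>n\<ge>m. \<forall>y. (\<forall>t\<in>{0..1}. \<bar>y t - W t \<omega>\<bar> < d) \<longrightarrow>
          \<bar>G (real (grid_argmax n y) / real n, grid_left n y (grid_argmax n y), grid_right n y (grid_argmax n y)) - G (xi_arg W \<omega>, limit_vec W \<omega>)\<bar> < e"
          unfolding lv by (rule grid_functional_limit[OF cW _ _ _ G \<open>0 < e\<close>]) (use elim(1) in auto)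
        then obtain d m where d: "0 < d" "\<forall>n\<ge>m. \<forall>y. (\<forall>t\<in>{0..1}. \<bar>y t - W t \<omega>\<bar> < d) \<longrightarrow>
          \<bar>G (real (grid_argmax n y) / real n, grid_left n y (grid_argmax n y), grid_right n y (grid_argmax n y)) - G (xi_arg W \<omega>, limit_vec W \<omega>)\<bar> < e"
          by (elim exE conjE) (rule that)
        show "\<exists>d>0. \<exists>m. \<forall>n\<ge>m. \<forall>y. (\<forall>t\<in>{0..1}. \<bar>y t - c_H * W t \<omega>\<bar> < d) \<longrightarrow> \<bar>h n y - G (xi_arg W \<omega>, limit_vec W \<omega>)\<bar> < e"
        \<comment> \<open>The continuous mapping works with paths near \<open>c_H * W\<close>, while
          the grid functionals see the path divided by \<open>c_H\<close>.\<close>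
        proof (rule exI[of _ "d * c_H"], rule conjI, use d cH in simp, rule exI[of _ m], intro allI impI)
          fix n y assume n: "m \<le> n" and y: "\<forall>t\<in>{0..1}. \<bar>y t - c_H * W t \<omega>\<bar> < d * c_H"
          have "\<forall>t\<in>{0..1}. \<bar>y t / c_H - W t \<omega>\<bar> < d"
          proof
            fix t :: real assume "t \<in> {0..1}"
            with y have "\<bar>y t - c_H * W t \<omega>\<bar> < d * c_H" by blast
            moreover have "y t / c_H - W t \<omega> = (y t - c_H * W t \<omega>) / c_H" using cH by (simp add: diff_divide_distrib)
            ultimately show "\<bar>y t / c_H - W t \<omega>\<bar> < d" using cH by (simp add: abs_divide pos_divide_less_eq)
          qed
          then show "\<bar>h n y - G (xi_arg W \<omega>, limit_vec W \<omega>)\<bar> < e" unfolding h_def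
            by (rule d(2)[THEN spec, THEN mp, OF n, THEN spec, THEN mp])
        qed
      qed
    qed
  qed
  then show ?thesis unfolding hs .
qed

end

section \<open>Cutoff near the ends and replacement of the estimated scale\<close>

definition clip :: "real \<Rightarrow> real" where "clip u = max 0 (min 1 u)"

lemma clip_bounds: "0 \<le> clip u" "clip u \<le> 1" by (auto simp: clip_def)
lemma clip_pos: "0 < clip u \<Longrightarrow> 0 < u" by (auto simp: clip_def max_def min_def split: if_splits)
lemma clip_one: "1 \<le> u \<Longrightarrow> clip u = 1" by (auto simp: clip_def)

text \<open>A continuous stand-in for the indicator that both segments are longer than
  \<open>n / m\<close> and both maxima below \<open>m\<close>. Continuity lets
  \<open>stats_converge\<close> give the limit of its expectation.\<close>

definition cutoff :: "nat \<Rightarrow> real \<times> real \<times> real \<Rightarrow> real" where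
  "cutoff m z = clip (real m * fst z - 1) * clip (real m * (1 - fst z) - 1) *
     clip (real m - \<bar>fst (snd z)\<bar>) * clip (real m - \<bar>snd (snd z)\<bar>)"

lemma cutoff_bounds: "0 \<le> cutoff m z" "cutoff m z \<le> 1"
  unfolding cutoff_def by (auto intro!: mult_nonneg_nonneg mult_le_one clip_bounds)

lemma cutoff_pos:
  assumes "0 < cutoff m z"
  shows "1 < real m * fst z" "1 < real m * (1 - fst z)" "\<bar>fst (snd z)\<bar> < real m" "\<bar>snd (snd z)\<bar> < real m"
proof -
  have "clip (real m * fst z - 1) \<noteq> 0" "clip (real m * (1 - fst z) - 1) \<noteq> 0"
     "clip (real m - \<bar>fst (snd z)\<bar>) \<noteq> 0" "clip (real m - \<bar>snd (snd z)\<bar>) \<noteq> 0"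
    using assms unfolding cutoff_def by auto
  then have "0 < clip (real m * fst z - 1)" "0 < clip (real m * (1 - fst z) - 1)"
     "0 < clip (real m - \<bar>fst (snd z)\<bar>)" "0 < clip (real m - \<bar>snd (snd z)\<bar>)"
    using clip_bounds(1) by (simp_all add: less_le)
  then show "1 < real m * fst z" "1 < real m * (1 - fst z)" "\<bar>fst (snd z)\<bar> < real m" "\<bar>snd (snd z)\<bar> < real m"
    by (auto dest: clip_pos)
qed

lemma cutoff_continuous: "continuous_on UNIV (cutoff m)"
  unfolding cutoff_def[abs_def] clip_def by (intro continuous_intros)

lemma cutoff_limit:
  assumes "0 < fst z" "fst z < 1"
  shows "(\<lambda>m. cutoff m z) \<longlonglongrightarrow> 1"
proof (rule tendsto_eventually)
  obtain N :: nat where N: "max (max (2 / fst z) (2 / (1 - fst z))) (max (\<bar>fst (snd z)\<bar> + 1) (\<bar>snd (snd z)\<bar> + 1)) < real N"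
    using reals_Archimedean2 by blast
  show "eventually (\<lambda>m. cutoff m z = 1) sequentially"
    using eventually_ge_at_top[of N]
  proof eventually_elim
    case (elim m)
    then have Nm: "real N \<le> real m" by simp
    have "2 / fst z \<le> real m" "2 / (1 - fst z) \<le> real m" using N Nm by auto
    then have "1 \<le> real m * fst z - 1" "1 \<le> real m * (1 - fst z) - 1" using assms by (auto simp: pos_divide_le_eq)
    moreover have "1 \<le> real m - \<bar>fst (snd z)\<bar>" "1 \<le> real m - \<bar>snd (snd z)\<bar>" using N Nm by auto
    ultimately show ?case unfolding cutoff_def by (simp add: clip_one)
  qed
qed

context lrd_limit
begin

text \<open>Two factors: \<open>c_H / w\<close>, close to 1 because \<open>w\<close> stays above
  \<open>c_H / 2\<close>, and a power of \<open>q / (q + 1)\<close> with exponent in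
  \<open>{0..1}\<close>, which lies between that ratio and 1.\<close>

lemma rho_close:
  assumes ab: "a < b" and q1: "1 \<le> q (b - a)" and e: "e \<le> c_H / 2"
    and z: "\<bar>sqrt (lrv_est X q a b \<omega>) * real (q (b - a) + 1) powr (1/2 - H) - c_H\<bar> \<le> e"
  shows "\<bar>rho q a b \<omega> - 1\<bar> \<le> 2 * e / c_H + 1 / real (q (b - a))"
proof -
  define p where "p = real (q (b - a) + 1)"
  define k where "k = real (q (b - a))"
  define w where "w = sqrt (lrv_est X q a b \<omega>) * p powr (1/2 - H)"
  have k: "1 \<le> k" "p = k + 1" unfolding k_def p_def using q1 by auto
  have zz: "\<bar>w - c_H\<bar> \<le> e" using z unfolding w_def p_def .
  have w: "c_H / 2 \<le> w" using zz e cH by linarith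
  have w0: "0 < w" using w cH by linarith
  define r where "r = (k / p) powr (H - 1/2)"
  have kp: "0 < k / p" "k / p \<le> 1" using k by auto
  have r1: "r \<le> 1" unfolding r_def using kp H by (intro powr_le1) auto
  have r2: "k / p \<le> r" unfolding r_def using kp H by (intro powr_lower) auto
  have "p powr (1/2 - H) = 1 / p powr (H - 1/2)" using powr_minus_divide[of p "H - 1/2"] by simp
  then have sl: "sqrt (lrv_est X q a b \<omega>) = w * p powr (H - 1/2)" unfolding w_def using k by simp
  have rho: "rho q a b \<omega> = c_H / w * r"
    unfolding rho_def sl r_def k_def[symmetric] using k by (simp add: powr_divide)
  have cw1: "c_H / w - 1 = (c_H - w) / w" using w0 by (simp add: diff_divide_distrib)
  have "\<bar>c_H / w - 1\<bar> = \<bar>c_H - w\<bar> / w" unfolding cw1 abs_divide using w0 by simp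
  also have "\<dots> \<le> e / (c_H / 2)"
    using zz w w0 cH by (intro frac_le) (auto simp: abs_minus_commute)
  finally have cw: "\<bar>c_H / w - 1\<bar> \<le> 2 * e / c_H" by (simp add: mult.commute)
  have "\<bar>c_H / w * r - 1\<bar> \<le> \<bar>c_H / w - 1\<bar> * r + (1 - r)"
  proof -
    have r0: "0 \<le> r" unfolding r_def by simp
    have "c_H / w * r - 1 = (c_H / w - 1) * r - (1 - r)" by (simp add: algebra_simps)
    then have "\<bar>c_H / w * r - 1\<bar> \<le> \<bar>(c_H / w - 1) * r\<bar> + \<bar>1 - r\<bar>" by (simp only: abs_triangle_ineq4)
    then show ?thesis using r0 r1 by (simp add: abs_mult)
  qed
  also have "\<dots> \<le> \<bar>c_H / w - 1\<bar> * 1 + 1 / k"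
  proof (intro add_mono mult_left_mono r1)
    have "1 - r \<le> 1 - k / p" using r2 by simp
    also have "\<dots> = 1 / p" using k by (simp add: field_simps)
    also have "\<dots> \<le> 1 / k" using k by (intro divide_left_mono) auto
    finally show "1 - r \<le> 1 / k" .
  qed simp
  also have "\<dots> \<le> 2 * e / c_H + 1 / k" using cw by simp
  finally show ?thesis unfolding rho k_def .
qed

lemma psum_measurable[measurable]: "(\<lambda>\<omega>. psum X \<omega> a b) \<in> borel_measurable M"
  unfolding psum_def by measurable

lemma lrv_est_measurable[measurable]: "(\<lambda>\<omega>. lrv_est X q a b \<omega>) \<in> borel_measurable M"
  unfolding lrv_est_def Let_def by measurable

lemma cusum_T_measurable[measurable]: "(\<lambda>\<omega>. cusum_T X q a b \<omega>) \<in> borel_measurable M"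
  unfolding cusum_T_def by measurable

lemma khat_measurable: "khat X n \<in> measurable M (count_space UNIV)"
  unfolding khat_def[abs_def] by measurable

lemma stat_vec_measurable[measurable]: "stat_vec X q H n \<in> borel_measurable M"
proof -
  have "(\<lambda>\<omega>. ((real (q k) / real n) powr (H - 1/2) * cusum_T X q 0 k \<omega>,
        (real (q (n - k)) / real n) powr (H - 1/2) * cusum_T X q k n \<omega>)) \<in> borel_measurable M" for k
    by (intro borel_measurable_Pair) measurable
  from measurable_compose_countable[OF this khat_measurable] show ?thesis
    unfolding stat_vec_def[abs_def] Let_def .
qed

text \<open>A Slutsky argument in expectation. Where the cutoff is positive and \<open>T\<close>
  small, the vectors differ by factors near 1 inside a compact box and uniform continuity of
  \<open>g\<close> applies. Elsewhere the trivial bound \<open>2 * B\<close> is paid for by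
  \<open>1 - th\<close> or, in the manner of Markov, by \<open>T / e\<close>.\<close>

lemma stat_vec_close:
  fixes q :: "nat \<Rightarrow> nat" and g :: "real \<times> real \<Rightarrow> real"
  assumes q: "mono_on {1..} q" "\<exists>C. \<forall>k. real (q (2^(k+1))) \<le> C * real (q (2^k))"
      "filterlim q at_top sequentially" "(\<lambda>n. real (q n) / real n) \<longlonglongrightarrow> 0"
    and g: "continuous_on UNIV g" and gB: "\<And>x. \<bar>g x\<bar> \<le> B" and B: "0 < B" and r: "0 < r"
  shows "eventually (\<lambda>n. \<bar>expectation (\<lambda>\<omega>. g (stat_vec X q H n \<omega>)) - expectation (\<lambda>\<omega>. g (snd (stats n \<omega>)))\<bar> < r) sequentially"
proof -
  define \<theta> where "\<theta> m = lim.expectation (\<lambda>\<omega>. cutoff m (xi_arg W \<omega>, limit_vec W \<omega>))" for m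
  have th: "(\<lambda>n. expectation (\<lambda>\<omega>. cutoff m (stats n \<omega>))) \<longlonglongrightarrow> \<theta> m" for m
    unfolding \<theta>_def by (rule stats_converge[OF cutoff_continuous, of _ 1]) (use cutoff_bounds in \<open>simp add: abs_le_iff order_trans[of _ 0]\<close>)
  have lmm: "(\<lambda>\<omega>. (xi_arg W \<omega>, limit_vec W \<omega>)) \<in> borel_measurable N"
  proof -
    have "(\<lambda>\<omega>. (fst (limit_vec W \<omega>), snd (limit_vec W \<omega>))) \<in> borel_measurable N"
      by (intro borel_measurable_Pair lim.limit_vec_measurable)
    then show ?thesis by (intro borel_measurable_Pair lim.xi_arg_measurable) simp
  qed
  have "\<theta> \<longlonglongrightarrow> lim.expectation (\<lambda>\<omega>. 1)"
    unfolding \<theta>_def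
  proof (rule integral_dominated_convergence[where w = "\<lambda>_. 1"])
    show "(\<lambda>\<omega>. cutoff m (xi_arg W \<omega>, limit_vec W \<omega>)) \<in> borel_measurable N" for m
      by (rule measurable_compose[OF lmm borel_measurable_continuous_onI[OF cutoff_continuous]])
    show "AE \<omega> in N. (\<lambda>m. cutoff m (xi_arg W \<omega>, limit_vec W \<omega>)) \<longlonglongrightarrow> 1"
      using lim.xi_arg_unique_AE by eventually_elim (intro cutoff_limit, auto)
    show "AE \<omega> in N. norm (cutoff m (xi_arg W \<omega>, limit_vec W \<omega>)) \<le> 1" for m
      using cutoff_bounds by (intro AE_I2) auto
  qed auto
  then have "\<theta> \<longlonglongrightarrow> 1" by (simp add: lim.prob_space)
  then have "eventually (\<lambda>m. 1 - r / (8 * B) < \<theta> m) sequentially" using r B by (intro order_tendstoD(1)) auto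
  then have "eventually (\<lambda>m. 1 - r / (8 * B) < \<theta> m \<and> 1 \<le> m) sequentially" using eventually_ge_at_top[of 1] by (rule eventually_conj)
  then obtain m where m: "1 - r / (8 * B) < \<theta> m" "1 \<le> m" using eventually_happens'[OF sequentially_bot] by blast
  have m0: "1 \<le> real m" using m by simp
  \<comment> \<open>The factors \<open>rho\<close> are at most 2 on the good event, so doubled
    bounds contain both vectors.\<close>
  let ?box = "{- 2 * real m..2 * real m} \<times> {- 2 * real m..2 * real m}"
  have "uniformly_continuous_on ?box g"
    by (rule compact_uniformly_continuous[OF continuous_on_subset[OF g]]) (auto intro!: compact_Times)
  then obtain d where d: "0 < d" "\<And>x y. x \<in> ?box \<Longrightarrow> y \<in> ?box \<Longrightarrow> dist x y < d \<Longrightarrow> dist (g x) (g y) < r / 4"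
    unfolding uniformly_continuous_on_def using r by (metis divide_pos_pos zero_less_numeral)
  \<comment> \<open>Each coordinate moves by at most \<open>m * \<eta>\<close>, so the distance
    stays below \<open>d\<close>; the bound 1 keeps \<open>rho\<close> below 2.\<close>
  define \<eta> where "\<eta> = min 1 (d / (4 * real m))"
  have \<eta>: "0 < \<eta>" "\<eta> \<le> 1" "2 * real m * \<eta> < d"
  proof -
    show "0 < \<eta>" "\<eta> \<le> 1" unfolding \<eta>_def using d m0 by auto
    have "2 * real m * \<eta> \<le> 2 * real m * (d / (4 * real m))" unfolding \<eta>_def using m0 by (intro mult_left_mono) auto
    also have "\<dots> = d / 2" using m0 by simp
    finally show "2 * real m * \<eta> < d" using d(1) by simp
  qed
  define e where "e = min (c_H / 2) (\<eta> * c_H / 4)"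
  have e: "0 < e" "e \<le> c_H / 2" "2 * e / c_H \<le> \<eta> / 2"
  proof -
    show "0 < e" "e \<le> c_H / 2" unfolding e_def using cH \<eta> by auto
    have "2 * e / c_H \<le> 2 * (\<eta> * c_H / 4) / c_H" unfolding e_def using cH by (intro divide_right_mono mult_left_mono) auto
    then show "2 * e / c_H \<le> \<eta> / 2" using cH by simp
  qed
  \<comment> \<open>Where the cutoff is positive, both segments have at least this fraction of the
    sample.\<close>
  define \<delta> where "\<delta> = 1 / real m"
  have \<delta>: "0 < \<delta>" "\<delta> \<le> 1" unfolding \<delta>_def using m0 by auto
  \<comment> \<open>With this bound on the expectation of \<open>T\<close> the Markov term is at
    most \<open>r / 8\<close>; uniform continuity and the cutoff contribute at most
    \<open>r / 4\<close> each.\<close>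
  have \<tau>: "0 < r * e / (16 * B)" using r e B by simp
  obtain L0 where L0: "\<And>L. L \<ge> L0 \<Longrightarrow> nat \<lceil>2 / \<eta>\<rceil> + 1 \<le> q L"
    using q(3) unfolding filterlim_at_top eventually_sequentially by blast
  have evq: "eventually (\<lambda>n. real L0 \<le> \<delta> * real n) sequentially"
  proof -
    have "filterlim (\<lambda>n. \<delta> * real n) at_top sequentially"
      by (rule filterlim_tendsto_pos_mult_at_top[OF tendsto_const \<delta>(1) filterlim_real_sequentially])
    then show ?thesis unfolding filterlim_at_top by blast
  qed
  show ?thesis
    using lrv_est_uniform[OF q \<delta> \<tau>] order_tendstoD(1)[OF th m(1)] evq eventually_gt_at_top[of 0]
  proof eventually_elim
    case (elim n)
    have n: "1 \<le> n" "0 < real n" using elim by auto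
    obtain T where T: "integrable M T" "expectation T \<le> r * e / (16 * B)"
      "\<And>\<omega> a b. a < b \<Longrightarrow> b \<le> n \<Longrightarrow> \<delta> * real n \<le> real (b - a) \<Longrightarrow>
        \<bar>sqrt (lrv_est X q a b \<omega>) * real (q (b - a) + 1) powr (1/2 - H) - c_H\<bar> \<le> T \<omega>"
      using elim(1) by blast
    \<comment> \<open>\<open>T\<close> dominates an absolute value already for the segment
      consisting of the whole sample.\<close>
    have T0: "0 \<le> T \<omega>" for \<omega>
    proof -
      have "\<delta> * real n \<le> real (n - 0)" using \<delta> n by (simp add: mult_left_le_one_le)
      then have "\<bar>sqrt (lrv_est X q 0 n \<omega>) * real (q (n - 0) + 1) powr (1/2 - H) - c_H\<bar> \<le> T \<omega>" using n by (intro T(3)) auto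
      then show ?thesis by linarith
    qed
    have rc: "\<bar>rho q a b \<omega> - 1\<bar> \<le> \<eta>" if ab: "a < b" "b \<le> n" "\<delta> * real n \<le> real (b - a)" and Te: "T \<omega> \<le> e" for a b \<omega>
    proof -
      have "real L0 \<le> real (b - a)" using elim(3) ab(3) by linarith
      then have qq: "nat \<lceil>2 / \<eta>\<rceil> + 1 \<le> q (b - a)" by (intro L0) simp
      then have q1: "1 \<le> q (b - a)" by simp
      have "2 / \<eta> \<le> real (q (b - a))" using qq by linarith
      then have "1 / real (q (b - a)) \<le> \<eta> / 2" using \<eta> q1 by (simp add: field_simps)
      moreover have "\<bar>rho q a b \<omega> - 1\<bar> \<le> 2 * e / c_H + 1 / real (q (b - a))"
        by (rule rho_close[OF ab(1) q1 e(2) order_trans[OF T(3)[OF ab] Te]])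
      ultimately show ?thesis using e(3) by linarith
    qed
    define th where "th \<omega> = cutoff m (stats n \<omega>)" for \<omega>
    have pt: "\<bar>g (stat_vec X q H n \<omega>) - g (snd (stats n \<omega>))\<bar> \<le> r / 4 + 2 * B / e * T \<omega> + 2 * B * (1 - th \<omega>)" for \<omega>
    proof -
      have nn: "0 \<le> 2 * B / e * T \<omega>" "0 \<le> 2 * B * (1 - th \<omega>)" using B e T0[of \<omega>] cutoff_bounds(2) unfolding th_def by auto
      have g2: "\<bar>g (stat_vec X q H n \<omega>) - g (snd (stats n \<omega>))\<bar> \<le> 2 * B"
        using gB[of "stat_vec X q H n \<omega>"] gB[of "snd (stats n \<omega>)"] by linarith
      consider "th \<omega> = 0" | "e < T \<omega>" | "0 < th \<omega>" "T \<omega> \<le> e" using cutoff_bounds(1)[of m "stats n \<omega>"] unfolding th_def by linarith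
      then show ?thesis
      proof cases
        case 1
        then have "2 * B * (1 - th \<omega>) = 2 * B" by simp
        then show ?thesis using g2 nn(1) r by linarith
      next
        case 2
        have "2 * B * 1 \<le> 2 * B * (T \<omega> / e)" using 2 e B by (intro mult_left_mono) auto
        then have "2 * B \<le> 2 * B / e * T \<omega>" by simp
        then show ?thesis using g2 nn(2) r by linarith
      next
        case 3
        define k where "k = grid_argmax n (path n \<omega>)"
        define x where "x = grid_left n (path n \<omega>) k"
        define y where "y = grid_right n (path n \<omega>) k"
        have st: "stats n \<omega> = (real k / real n, x, y)" unfolding stats_def k_def x_def y_def ..
        have cp: "1 < real m * (real k / real n)" "1 < real m * (1 - real k / real n)" "\<bar>x\<bar> < real m" "\<bar>y\<bar> < real m"
          using cutoff_pos[of m "stats n \<omega>"] 3(1) unfolding th_def st by auto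
        have k1: "1 \<le> k" "k \<le> n" unfolding k_def using grid_argmax[OF n(1)] by auto
        have kd: "\<delta> * real n \<le> real k"
          using cp(1) m0 n unfolding \<delta>_def by (simp add: field_simps)
        have kd2: "\<delta> * real n \<le> real n - real k"
          using cp(2) m0 n unfolding \<delta>_def by (simp add: field_simps)
        have "0 < \<delta> * real n" using \<delta> n by simp
        then have kn: "k < n" using kd2 by simp
        have V: "stat_vec X q H n \<omega> = (x * rho q 0 k \<omega>, y * rho q k n \<omega>)"
          unfolding stat_vec_def Let_def khat_grid[OF n(1)] k_def[symmetric]
          using left_statistic[OF n(1) k1(1), of q \<omega>] right_statistic[OF n(1) k1(1) kn, of q \<omega>] unfolding x_def y_def by simp
        have r1: "\<bar>rho q 0 k \<omega> - 1\<bar> \<le> \<eta>" using k1 kd 3(2) by (intro rc) auto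
        have r2: "\<bar>rho q k n \<omega> - 1\<bar> \<le> \<eta>" using kn kd2 3(2) by (intro rc) auto
        have dif: "\<bar>u * s - u\<bar> \<le> real m * \<eta>" if "\<bar>u\<bar> < real m" "\<bar>s - 1\<bar> \<le> \<eta>" for u s :: real
        proof -
          have "u * s - u = u * (s - 1)" by (simp add: algebra_simps)
          then have "\<bar>u * s - u\<bar> = \<bar>u\<bar> * \<bar>s - 1\<bar>" by (simp add: abs_mult)
          also have "\<dots> \<le> real m * \<eta>" using that by (intro mult_mono) auto
          finally show ?thesis .
        qed
        have "real m * \<eta> \<le> real m * 1" using \<eta> by (intro mult_left_mono) auto
        then have me: "real m * \<eta> \<le> real m" by simp
        have xb: "\<bar>x * rho q 0 k \<omega> - x\<bar> \<le> real m * \<eta>" "\<bar>y * rho q k n \<omega> - y\<bar> \<le> real m * \<eta>"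
          using dif[OF cp(3) r1] dif[OF cp(4) r2] by auto
        have in1: "(x, y) \<in> ?box" using cp(3,4) by auto
        have in2: "(x * rho q 0 k \<omega>, y * rho q k n \<omega>) \<in> ?box"
        proof -
          have "\<bar>x * rho q 0 k \<omega>\<bar> \<le> 2 * real m" "\<bar>y * rho q k n \<omega>\<bar> \<le> 2 * real m" using xb me cp(3,4) by linarith+
          then show ?thesis by (auto simp: abs_le_iff)
        qed
        have "dist (x * rho q 0 k \<omega>, y * rho q k n \<omega>) (x, y) \<le> dist (x * rho q 0 k \<omega>) x + dist (y * rho q k n \<omega>) y"
          unfolding dist_prod_def by (simp add: sqrt_sum_squares_le_sum)
        also have "\<dots> \<le> real m * \<eta> + real m * \<eta>" using xb unfolding dist_real_def by (rule add_mono)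
        also have "\<dots> < d" using \<eta>(3) by (simp add: mult_ac)
        finally have "dist (g (x * rho q 0 k \<omega>, y * rho q k n \<omega>)) (g (x, y)) < r / 4" by (rule d(2)[OF in2 in1])
        then have "\<bar>g (stat_vec X q H n \<omega>) - g (snd (stats n \<omega>))\<bar> < r / 4" unfolding V st dist_real_def by simp
        then show ?thesis using nn by linarith
      qed
    qed
    have gm[measurable]: "g \<in> borel_measurable borel" by (rule borel_measurable_continuous_onI[OF g])
    have cm[measurable]: "cutoff m \<in> borel_measurable borel" by (rule borel_measurable_continuous_onI[OF cutoff_continuous])
    have i1: "integrable M (\<lambda>\<omega>. g (stat_vec X q H n \<omega>))"
      by (rule integrable_const_bound[where B = B]) (use gB in auto)
    have sm: "(\<lambda>\<omega>. snd (stats n \<omega>)) \<in> borel_measurable M"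
      by (rule measurable_compose[OF stats_measurable borel_measurable_continuous_onI]) (intro continuous_intros)
    have i2: "integrable M (\<lambda>\<omega>. g (snd (stats n \<omega>)))"
      by (rule integrable_const_bound[where B = B]) (use gB measurable_compose[OF sm gm] in auto)
    have i3: "integrable M th"
      unfolding th_def[abs_def] by (rule integrable_const_bound[where B = 1]) (use cutoff_bounds in auto)
    have i4: "integrable M (\<lambda>\<omega>. g (stat_vec X q H n \<omega>) - g (snd (stats n \<omega>)))" using i1 i2 by simp
    have "\<bar>expectation (\<lambda>\<omega>. g (stat_vec X q H n \<omega>)) - expectation (\<lambda>\<omega>. g (snd (stats n \<omega>)))\<bar>
      = \<bar>expectation (\<lambda>\<omega>. g (stat_vec X q H n \<omega>) - g (snd (stats n \<omega>)))\<bar>" using i1 i2 by simp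
    also have "\<dots> \<le> expectation (\<lambda>\<omega>. \<bar>g (stat_vec X q H n \<omega>) - g (snd (stats n \<omega>))\<bar>)" by (rule integral_abs_bound)
    also have "\<dots> \<le> expectation (\<lambda>\<omega>. r / 4 + 2 * B / e * T \<omega> + 2 * B * (1 - th \<omega>))"
      by (rule integral_mono[OF _ _ pt]) (use i4 i3 T(1) in \<open>auto intro!: Bochner_Integration.integrable_add Bochner_Integration.integrable_diff integrable_mult_right integrable_abs\<close>)
    also have "\<dots> = r / 4 + 2 * B / e * expectation T + 2 * B * (1 - expectation th)"
      using T(1) i3 by (simp add: prob_space)
    also have "\<dots> < r"
    proof -
      have "2 * B / e * expectation T \<le> 2 * B / e * (r * e / (16 * B))" using T(2) B e by (intro mult_left_mono) auto
      also have "\<dots> = r / 8" using B e by simp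
      finally have a: "2 * B / e * expectation T \<le> r / 8" .
      have "1 - expectation th < r / (8 * B)" using elim(2) unfolding th_def[abs_def] by linarith
      then have "2 * B * (1 - expectation th) < 2 * B * (r / (8 * B))" using B by (intro mult_strict_left_mono) auto
      also have "\<dots> = r / 4" using B by simp
      finally show ?thesis using a r by linarith
    qed
    finally show ?case .
  qed
qed

theorem stat_vec_converges:
  fixes q :: "nat \<Rightarrow> nat"
  assumes q: "mono_on {1..} q" "\<exists>C. \<forall>k. real (q (2^(k+1))) \<le> C * real (q (2^k))"
      "filterlim q at_top sequentially" "(\<lambda>n. real (q n) / real n) \<longlonglongrightarrow> 0"
  shows "conv_distr_R2 M (stat_vec X q H) N (limit_vec W)"
  unfolding conv_distr_R2_def
proof (intro allI impI)
  fix g :: "real \<times> real \<Rightarrow> real"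
  assume "continuous_on UNIV g \<and> bounded (range g)"
  then have g: "continuous_on UNIV g" and "bounded (range g)" by auto
  then obtain B0 where B0: "\<And>x. \<bar>g x\<bar> \<le> B0" unfolding bounded_iff by auto
  define B where "B = max 1 B0"
  have B: "0 < B" "\<And>x. \<bar>g x\<bar> \<le> B" unfolding B_def using B0 by (auto simp: le_max_iff_disj)
  have 1: "(\<lambda>n. expectation (\<lambda>\<omega>. g (snd (stats n \<omega>)))) \<longlonglongrightarrow> lim.expectation (\<lambda>\<omega>. g (limit_vec W \<omega>))"
  proof -
    have "continuous_on UNIV (\<lambda>z::real \<times> real \<times> real. g (snd z))"
      by (rule continuous_on_compose2[OF g]) (auto intro: continuous_intros)
    from stats_converge[OF this, of B] B(2) show ?thesis by simp
  qed
  have 2: "(\<lambda>n. expectation (\<lambda>\<omega>. g (stat_vec X q H n \<omega>)) - expectation (\<lambda>\<omega>. g (snd (stats n \<omega>)))) \<longlonglongrightarrow> 0"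
  proof (rule tendstoI)
    fix r :: real assume "0 < r"
    from stat_vec_close[OF q g B(2) B(1) this]
    show "eventually (\<lambda>n. dist (expectation (\<lambda>\<omega>. g (stat_vec X q H n \<omega>)) - expectation (\<lambda>\<omega>. g (snd (stats n \<omega>)))) 0 < r) sequentially"
      by (simp add: dist_real_def)
  qed
  from tendsto_add[OF 2 1]
  show "(\<lambda>n. \<integral>\<omega>. g (stat_vec X q H n \<omega>) \<partial>M) \<longlonglongrightarrow> (\<integral>\<omega>. g (limit_vec W \<omega>) \<partial>N)" by simp
qed

end

text \<open>Since \<open>H < 1\<close>, the logarithm carries a negative power, so the bound on
  \<open>q n / n\<close> tends to 0.\<close>

lemma bandwidth_small:
  fixes q :: "nat \<Rightarrow> nat"
  assumes H: "H < 1" and q: "\<exists>C n0. \<forall>n\<ge>n0. real (q n) \<le> C * real n * ln (real n) powr (- 7 / (4 - 4*H))"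
  shows "(\<lambda>n. real (q n) / real n) \<longlonglongrightarrow> 0"
proof -
  obtain C n0 where C: "\<And>n. n \<ge> n0 \<Longrightarrow> real (q n) \<le> C * real n * ln (real n) powr (- 7 / (4 - 4*H))" using q by blast
  have "filterlim (\<lambda>n. ln (real n)) at_top sequentially"
    by (rule filterlim_compose[OF ln_at_top filterlim_real_sequentially])
  then have "(\<lambda>n. ln (real n) powr (- 7 / (4 - 4*H))) \<longlonglongrightarrow> 0"
    using H by (intro tendsto_neg_powr) auto
  from tendsto_mult[OF tendsto_const this, of C]
  have lim: "(\<lambda>n. C * ln (real n) powr (- 7 / (4 - 4*H))) \<longlonglongrightarrow> 0" by simp
  show ?thesis
  proof (rule tendsto_sandwich[OF _ _ tendsto_const lim])
    show "eventually (\<lambda>n. real (q n) / real n \<le> C * ln (real n) powr (- 7 / (4 - 4*H))) sequentially"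
      using eventually_ge_at_top[of n0] eventually_gt_at_top[of 0]
    proof eventually_elim
      case (elim n)
      then show ?case using C[OF elim(1)] by (simp add: pos_divide_le_eq mult_ac)
    qed
  qed auto
qed

theorem theorem2p2:
  fixes M :: "'a measure" and X :: "int \<Rightarrow> 'a \<Rightarrow> real"
    and N :: "'b measure" and W :: "real \<Rightarrow> 'b \<Rightarrow> real"
    and H c_H c0 :: real and q :: "nat \<Rightarrow> nat"
  assumes M: "prob_space M"
    and stat: "fourth_order_stationary M X"
    and H: "1/2 < H" "H < 1"
    and W: "fBm N H W"
    and a: "0 < c_H"
      "conv_distr_D M
         (\<lambda>n \<omega> t. real n powr (-H) * (\<Sum>j\<in>{1..nat \<lfloor>real n * t\<rfloor>}. (X (int j) \<omega> - mean_seq M X)))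
         N (\<lambda>\<omega> t. c_H * W t \<omega>)"
    and b: "0 < c0"
      "(\<lambda>j::nat. autocov M X (int j) / (c0 * real j powr (2*H - 2))) \<longlonglongrightarrow> 1"
    and c: "\<exists>C n0. \<forall>n\<ge>n0. \<forall>h. (\<Sum>r\<in>{-int n..int n}. \<Sum>s\<in>{-int n..int n}. \<bar>cum4 M X h r s\<bar>)
               \<le> C * real n powr (2*H - 1)"
    and q_pos: "\<forall>n\<ge>1. 0 < q n"
    and q_mono: "mono_on {1..} q"
    and q_doubling: "\<exists>C. \<forall>k. real (q (2^(k+1))) \<le> C * real (q (2^k))"
    and q_infty: "filterlim q at_top sequentially"
    and q_bound: "\<exists>C n0. \<forall>n\<ge>n0. real (q n) \<le> C * real n * ln (real n) powr (- 7 / (4 - 4*H))"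
  shows "conv_distr_R2 M (stat_vec X q H) N (limit_vec W)"
proof -
  have f: "fos M X" using M stat by (simp add: fos_def fos_axioms_def)
  obtain Cg where Cg: "\<And>j. \<bar>autocov M X j\<bar> \<le> Cg * (1 + real_of_int \<bar>j\<bar>) powr (2*H - 2)"
    using autocov_bound[OF f b(1) H b(2)] by blast
  obtain Cc where Cc: "\<And>h l. 1 \<le> l \<Longrightarrow> (\<Sum>r\<in>{-int l..int l}. \<Sum>s\<in>{-int l..int l}. \<bar>cum4 M X h r s\<bar>) \<le> Cc * real l powr (2*H - 1)"
    using cumulant_bound[OF H(1) c] by blast
  interpret lrd_limit M X H Cg Cc N W c_H
  proof -
    interpret fos M X by (rule f)
    show "lrd_limit M X H Cg Cc N W c_H"
      by unfold_locales (use H Cg Cc W a in auto)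
  qed
  show ?thesis by (rule stat_vec_converges[OF q_mono q_doubling q_infty bandwidth_small[OF H(2) q_bound]])
qed

end
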